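(* Let $m=m(n)\ge1$ be integers and put $$G^2_{n,m}=\sum_{k=0}^{n-1}(nS_{k,m})^2,\qquad M_{n,m}=\sum_{k=0}^{n-1}\ln(nS_{k,m}),\qquad H_{n,m}=\sum_{k=0}^{n-1}(nS_{k,m})\ln(nS_{k,m}).$$ (i) If $m=o(n)$, then as $n\to\infty$ $$\frac{\sqrt3\,\big(G^2_{n,m}-nm(m+1)\big)}{\sqrt{2m(m+1)(2m+1)n}}\xrightarrow{d}\mathcal N(0,1).$$ (ii) If $m=o(n^{1/3})$, then as $n\to\infty$ $$\frac{M_{n,m}-n\psi(m)}{\sqrt{n\big((2m^2-2m+1)\zeta(2,m)-2m+1\big)}}\xrightarrow{d}\mathcal N(0,1)$$ and $$\frac{H_{n,m}-nm\psi(m+1)}{\sqrt{n\big(2(m(m+1))^2\zeta(2,m+2)-m(m+1)(2m-1)\big)/4}}\xrightarrow{d}\mathcal N(0,1).$$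
   Context: Spacings: let $0\le U_1\le U_2\le\dots\le U_{n-1}\le 1$ be the order statistics of a sample of size $n-1$ from the uniform distribution on $[0,1]$. Put $U_0=0$, $U_n=1$, and $U_k=1+U_{k-n}$ for $k\ge n$. The overlapping spacings of order $m$ are $S_{k,m}=U_{k+m}-U_k$, $k=0,\dots,n-1$. Digamma and Hurwitz zeta at integers: $\psi(m)=\sum_{k=1}^{m-1}\frac1k-\gamma$, where $\gamma=0.5772\ldots$ is Euler's constant, and $\zeta(k,m)=\sum_{j=m}^\infty j^{-k}$. The convention $0\ln0=0$ is used. $\xrightarrow{d}$ is convergence in distribution; $\mathcal N(0,1)$ is the standard normal law. *)

theory Defs
  imports "HOL-Probability.Probability" "HOL-Library.Landau_Symbols"
begin

definition uniform_sample :: "'a measure \<Rightarrow> nat \<Rightarrow> (nat \<Rightarrow> 'a \<Rightarrow> real) \<Rightarrow> bool" where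
  "uniform_sample P N X \<longleftrightarrow>
     prob_space P \<and>
     prob_space.indep_vars P (\<lambda>_. borel) X {..<N} \<and>
     (\<forall>i<N. distr P borel (X i) = uniform_measure lborel {0..1})"

definition order_stat :: "nat \<Rightarrow> (nat \<Rightarrow> real) \<Rightarrow> nat \<Rightarrow> real" where
  "order_stat N x k = sort (map x [0..<N]) ! (k - 1)"

text \<open>The points \<open>U\<^sub>k\<close> built from the realisation \<open>x 0, \<dots>, x (n - 2)\<close> of a sample of size
  \<open>n - 1\<close>. The last branch includes \<open>U\<^sub>n = 1 + U\<^sub>0 = 1\<close>. The value for \<open>n = 0\<close> is a dummy that
  makes the recursion terminate.\<close>

fun spacing_point :: "nat \<Rightarrow> (nat \<Rightarrow> real) \<Rightarrow> nat \<Rightarrow> real" where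
  "spacing_point n x k =
     (if n = 0 \<or> k = 0 then 0
      else if k < n then order_stat (n - 1) x k
      else 1 + spacing_point n x (k - n))"

declare spacing_point.simps [simp del]

definition spacing :: "nat \<Rightarrow> nat \<Rightarrow> (nat \<Rightarrow> real) \<Rightarrow> nat \<Rightarrow> real" where
  "spacing n m x k = spacing_point n x (k + m) - spacing_point n x k"

definition greenwood_stat :: "nat \<Rightarrow> nat \<Rightarrow> (nat \<Rightarrow> real) \<Rightarrow> real" where
  "greenwood_stat n m x = (\<Sum>k<n. (real n * spacing n m x k)\<^sup>2)"

text \<open>The library has \<open>ln 0 = 0\<close>. This gives the convention \<open>0 ln 0 = 0\<close> in \<open>entropy_stat\<close>;
  in \<open>log_stat\<close> it only fixes the value on the null event that some spacing vanishes.\<close>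

definition log_stat :: "nat \<Rightarrow> nat \<Rightarrow> (nat \<Rightarrow> real) \<Rightarrow> real" where
  "log_stat n m x = (\<Sum>k<n. ln (real n * spacing n m x k))"

definition entropy_stat :: "nat \<Rightarrow> nat \<Rightarrow> (nat \<Rightarrow> real) \<Rightarrow> real" where
  "entropy_stat n m x =
     (\<Sum>k<n. (real n * spacing n m x k) * ln (real n * spacing n m x k))"

text \<open>\<open>\<zeta>(s, a) = \<Sum>\<^bsub>j \<ge> a\<^esub> j\<^sup>-\<^sup>s\<close>, with the sum reindexed to start at \<open>0\<close>.\<close>

definition hurwitz_zeta_nat :: "nat \<Rightarrow> nat \<Rightarrow> real" where
  "hurwitz_zeta_nat s a = (\<Sum>j. 1 / real (a + j) ^ s)"

lemma Digamma_nat_eq: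
  assumes "m \<ge> 1"
  shows "Digamma (real m) = (\<Sum>k=1..m-1. 1 / real k) - euler_mascheroni"
proof -
  obtain l where "m = Suc l"
    using assms by (cases m) auto
  then show ?thesis
    using Digamma_of_nat[of l, where 'a = real] by (simp add: harm_def inverse_eq_divide)
qed

end

theory Submission
  imports Defs "HOL-Real_Asymp.Real_Asymp"
begin

text \<open>The spacings of a uniform sample are distributed like \<open>E\<^sub>k/(E\<^sub>0 + \<dots> + E\<^sub>n\<^sub>-\<^sub>1)\<close> with independent standard exponential
  \<open>E\<^sub>k\<close>, so each statistic is a sum of a function \<open>g\<close> of \<open>T\<^sub>k/r\<close>, where \<open>T\<^sub>k\<close> is a cyclic window sum of length \<open>m\<close> and \<open>r\<close> the mean of
  the \<open>E\<^sub>k\<close>. Subtracting from \<open>g\<close> its mean and a multiple of \<open>T\<^sub>k - m\<close> leaves a kernel \<open>h\<close> for which the effect of \<open>r\<close>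
  is of order \<open>(r - 1)\<^sup>2\<close>, with \<open>E(r - 1)\<^sup>2 = 1/n\<close>, and this is negligible as soon as \<open>m/n \<rightarrow> 0\<close>. The sum of the
  \<open>h(T\<^sub>k)\<close> is \<open>m\<close>-dependent; splitting it into long independent blocks separated by gaps of length \<open>m\<close> gives its
  asymptotic normality. Its variance is found from \<open>E h(S\<^sub>d) h(S'\<^sub>d) - E h(S\<^sub>d\<^sub>+\<^sub>1) h(S'\<^sub>d\<^sub>+\<^sub>1) = E h'h'\<close>, with windows \<open>S\<^sub>d\<close>,
  \<open>S'\<^sub>d\<close> at distance \<open>d\<close>, a covariance identity for a single shared exponential variable: it reduces the overlap moments of \<open>h\<close> to those of \<open>h'\<close>, and
  for the logarithm and the entropy to those of \<open>1/x\<close>.\<close>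

section \<open>Exponential sequences and gamma laws\<close>

text \<open>Since m may grow with n, every estimate has to be uniform in m. Each kernel h gets a
  scale v, namely m^2 for the squares, 1/m^2 for the logarithm and 1 for the entropy, with E h^4 <=
  C v^2 and a variance per window of at least c m v. The series that give the variances have
  nonnegative terms, so their first terms also give this lower bound for the logarithm and the
  entropy. The linear coefficient in the kernel of g is E T g'(T) / m = E g'(T'), where T and T'
  have gamma laws with parameters m and m + 1. Hence h' is again centred, at window length m + 1.
  The covariance identity passes from length m to length m + 1, so it can be applied to h' once
  more. This second use settles the squares (h'' is constant) and the entropy (h'' = 1/x). The
  effect of r splits into a multiple |r - 1| of the kernel sum, of relative size n^(-1/2), and a
  deterministic error n m sqrt(v) (r - 1)^2, which is of order sqrt(m/n) after division by sqrt(n m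
  v).\<close>

definition exp_law :: "real measure" where
  "exp_law = density lborel (exponential_density 1)"

text \<open>One infinite product serves all n at once, and shifting the coordinates by any amount
  preserves it.\<close>

definition exp_seq :: "(nat \<Rightarrow> real) measure" where
  "exp_seq = Pi\<^sub>M UNIV (\<lambda>_. exp_law)"

text \<open>The point mass at parameter 0 is the law of the empty sum. It lets the sum formula below
  hold for all finite index sets, including the empty private parts of two coinciding
  windows.\<close>

definition gamma_law :: "nat \<Rightarrow> real measure" where
  "gamma_law k = (if k = 0 then return borel 0 else density lborel (erlang_density (k - 1) 1))"

lemma sets_exp_law [measurable_cong, simp]: "sets exp_law = sets borel"
  and space_exp_law [simp]: "space exp_law = UNIV"
  by (simp_all add: exp_law_def)

lemma sets_gamma_law [measurable_cong, simp]: "sets (gamma_law k) = sets borel"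
  and space_gamma_law [simp]: "space (gamma_law k) = UNIV"
  by (simp_all add: gamma_law_def)

lemma gamma_law_1 [simp]: "gamma_law (Suc 0) = exp_law"
  by (simp add: gamma_law_def exp_law_def)

lemma gamma_law_Suc: "gamma_law (Suc k) = density lborel (erlang_density k 1)"
  by (simp add: gamma_law_def)

lemma prob_space_gamma_law: "prob_space (gamma_law k)"
  by (simp add: gamma_law_def prob_space_erlang_density prob_space_return)

lemma prob_space_exp_law: "prob_space exp_law"
  using prob_space_gamma_law[of 1] by simp

lemma sets_exp_seq [measurable_cong, simp]: "sets exp_seq = sets (Pi\<^sub>M UNIV (\<lambda>_. borel))"
  unfolding exp_seq_def by (intro sets_PiM_cong) auto

lemma space_exp_seq [simp]: "space exp_seq = UNIV"
  by (simp add: exp_seq_def space_PiM)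

interpretation exp_seq: prob_space exp_seq
  unfolding exp_seq_def by (intro prob_space_PiM prob_space_exp_law)

lemma measurable_coord: "(\<lambda>\<omega>. \<omega> i) \<in> borel_measurable exp_seq"
  by measurable

lemma distr_coord: "distr exp_seq borel (\<lambda>\<omega>. \<omega> i) = exp_law"
proof -
  have "distr exp_seq borel (\<lambda>\<omega>. \<omega> i) = distr exp_seq exp_law (\<lambda>\<omega>. \<omega> i)"
    by (intro distr_cong) auto
  also have "\<dots> = exp_law"
    unfolding exp_seq_def by (rule distr_PiM_component) (auto intro: prob_space_exp_law)
  finally show ?thesis .
qed

lemma indep_coord: "exp_seq.indep_vars (\<lambda>_. borel) (\<lambda>i \<omega>. \<omega> i) UNIV"
proof (subst exp_seq.indep_vars_iff_distr_eq_PiM')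
  have "distr exp_seq (Pi\<^sub>M UNIV (\<lambda>_. borel)) (\<lambda>x. \<lambda>i\<in>UNIV. x i) = distr exp_seq exp_seq (\<lambda>x. x)"
    by (intro distr_cong) auto
  also have "\<dots> = Pi\<^sub>M UNIV (\<lambda>i. distr exp_seq borel (\<lambda>\<omega>. \<omega> i))"
    unfolding distr_coord by (simp add: exp_seq_def)
  finally show "distr exp_seq (Pi\<^sub>M UNIV (\<lambda>_. borel)) (\<lambda>x. \<lambda>i\<in>UNIV. x i)
    = Pi\<^sub>M UNIV (\<lambda>i. distr exp_seq borel (\<lambda>\<omega>. \<omega> i))" .
qed auto

text \<open>Independence in the form of a product measure, so that one group of coordinates can be
  integrated out by Fubini while the other is held fixed.\<close>

lemma distr_pair_disjoint:
  assumes "A \<inter> B = {}"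
    and [measurable]: "f \<in> Pi\<^sub>M A (\<lambda>_. borel) \<rightarrow>\<^sub>M N1" "g \<in> Pi\<^sub>M B (\<lambda>_. borel) \<rightarrow>\<^sub>M N2"
  shows "distr exp_seq (N1 \<Otimes>\<^sub>M N2) (\<lambda>\<omega>. (f (restrict \<omega> A), g (restrict \<omega> B)))
    = distr exp_seq N1 (\<lambda>\<omega>. f (restrict \<omega> A)) \<Otimes>\<^sub>M distr exp_seq N2 (\<lambda>\<omega>. g (restrict \<omega> B))"
proof -
  let ?A = "distr exp_seq (Pi\<^sub>M A (\<lambda>_. borel)) (\<lambda>\<omega>. restrict \<omega> A)"
  let ?B = "distr exp_seq (Pi\<^sub>M B (\<lambda>_. borel)) (\<lambda>\<omega>. restrict \<omega> B)"
  have [measurable]: "(\<lambda>\<omega>. restrict \<omega> S) \<in> exp_seq \<rightarrow>\<^sub>M Pi\<^sub>M S (\<lambda>_. borel)" for S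
    by (intro measurable_restrict) auto
  have "exp_seq.indep_var (Pi\<^sub>M A (\<lambda>_. borel)) (\<lambda>\<omega>. restrict \<omega> A) (Pi\<^sub>M B (\<lambda>_. borel)) (\<lambda>\<omega>. restrict \<omega> B)"
    using exp_seq.indep_var_restrict[OF indep_coord assms(1)] by simp
  then have *: "?A \<Otimes>\<^sub>M ?B = distr exp_seq (Pi\<^sub>M A (\<lambda>_. borel) \<Otimes>\<^sub>M Pi\<^sub>M B (\<lambda>_. borel)) (\<lambda>\<omega>. (restrict \<omega> A, restrict \<omega> B))"
    by (simp add: exp_seq.indep_var_distribution_eq)
  interpret B: prob_space "distr ?B N2 g"
    by (intro prob_space.prob_space_distr exp_seq.prob_space_distr) auto
  have "distr ?A N1 f \<Otimes>\<^sub>M distr ?B N2 g = distr (?A \<Otimes>\<^sub>M ?B) (N1 \<Otimes>\<^sub>M N2) (\<lambda>(x, y). (f x, g y))"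
    by (intro pair_measure_distr) (auto intro: B.sigma_finite_measure_axioms)
  also have "\<dots> = distr exp_seq (N1 \<Otimes>\<^sub>M N2) (\<lambda>\<omega>. (f (restrict \<omega> A), g (restrict \<omega> B)))"
    unfolding * by (subst distr_distr) (auto simp: comp_def)
  finally show ?thesis by (simp add: distr_distr comp_def)
qed

lemma distributed_coord: "distributed exp_seq lborel (\<lambda>\<omega>. \<omega> i) (exponential_density 1)"
proof -
  have "distr exp_seq lborel (\<lambda>\<omega>. \<omega> i) = distr exp_seq borel (\<lambda>\<omega>. \<omega> i)"
    by (intro distr_cong) auto
  then show ?thesis
    by (simp add: distributed_def distr_coord exp_law_def)
qed

lemma distr_sum_coord:
  assumes "finite S"
  shows "distr exp_seq borel (\<lambda>\<omega>. \<Sum>i\<in>S. \<omega> i) = gamma_law (card S)"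
proof (cases "S = {}")
  case True
  then show ?thesis by (simp add: gamma_law_def exp_seq.distr_const)
next
  case False
  then have c: "card S > 0" using assms by (simp add: card_gt_0_iff)
  have "distributed exp_seq lborel (\<lambda>\<omega>. \<Sum>i\<in>S. \<omega> i) (erlang_density (card S - 1) 1)"
    using assms False exp_seq.indep_vars_subset[OF indep_coord]
    by (intro exp_seq.exponential_distributed_sum distributed_coord) auto
  then have "distr exp_seq lborel (\<lambda>\<omega>. \<Sum>i\<in>S. \<omega> i) = density lborel (erlang_density (card S - 1) 1)"
    by (simp add: distributed_def)
  moreover have "distr exp_seq lborel (\<lambda>\<omega>. \<Sum>i\<in>S. \<omega> i) = distr exp_seq borel (\<lambda>\<omega>. \<Sum>i\<in>S. \<omega> i)"
    by (intro distr_cong) auto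
  ultimately show ?thesis using c by (simp add: gamma_law_def)
qed

lemma AE_exp_law_pos: "AE x in exp_law. x > 0"
proof -
  have "AE x in lborel. x \<noteq> (0::real)" by (rule AE_lborel_singleton)
  then show ?thesis
    unfolding exp_law_def by (subst AE_density) (auto simp: exponential_density_def elim!: eventually_mono)
qed

lemma AE_exp_seq_pos: "AE \<omega> in exp_seq. \<forall>i. \<omega> i > 0"
proof (subst AE_all_countable, intro allI)
  fix i
  have "AE x in distr exp_seq borel (\<lambda>\<omega>. \<omega> i). x > 0"
    unfolding distr_coord by (rule AE_exp_law_pos)
  then show "AE \<omega> in exp_seq. \<omega> i > 0" by (subst (asm) AE_distr_iff) auto
qed

lemma AE_gamma_law_pos: "k \<ge> 1 \<Longrightarrow> AE x in gamma_law k. x > 0"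
proof -
  assume k: "k \<ge> 1"
  have "AE x in lborel. x \<noteq> (0::real)" by (rule AE_lborel_singleton)
  then show ?thesis using k
    unfolding gamma_law_def by (auto simp: AE_density erlang_density_def elim!: eventually_mono)
qed

lemma distr_three_sums:
  assumes "finite I" "finite J" "finite K" "I \<inter> J = {}" "I \<inter> K = {}" "J \<inter> K = {}"
  shows "distr exp_seq (borel \<Otimes>\<^sub>M (borel \<Otimes>\<^sub>M borel)) (\<lambda>\<omega>. (sum \<omega> I, sum \<omega> J, sum \<omega> K))
    = gamma_law (card I) \<Otimes>\<^sub>M (gamma_law (card J) \<Otimes>\<^sub>M gamma_law (card K))"
proof -
  have r: "sum (restrict \<omega> A) B = sum \<omega> B" if "B \<subseteq> A" for \<omega> :: "nat \<Rightarrow> real" and A B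
    using that by (intro sum.cong) auto
  have m: "(\<lambda>x. sum x B :: real) \<in> borel_measurable (Pi\<^sub>M A (\<lambda>_. borel))" if "B \<subseteq> A" for A B :: "nat set"
    using that by (intro borel_measurable_sum measurable_component_singleton) auto
  have "distr exp_seq (borel \<Otimes>\<^sub>M (borel \<Otimes>\<^sub>M borel))
      (\<lambda>\<omega>. (sum (restrict \<omega> I) I, (sum (restrict \<omega> (J \<union> K)) J, sum (restrict \<omega> (J \<union> K)) K)))
    = distr exp_seq borel (\<lambda>\<omega>. sum (restrict \<omega> I) I) \<Otimes>\<^sub>M
      distr exp_seq (borel \<Otimes>\<^sub>M borel) (\<lambda>\<omega>. (sum (restrict \<omega> (J \<union> K)) J, sum (restrict \<omega> (J \<union> K)) K))"
    using assms by (intro distr_pair_disjoint measurable_Pair m) auto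
  moreover have "distr exp_seq (borel \<Otimes>\<^sub>M borel) (\<lambda>\<omega>. (sum (restrict \<omega> J) J, sum (restrict \<omega> K) K))
    = distr exp_seq borel (\<lambda>\<omega>. sum (restrict \<omega> J) J) \<Otimes>\<^sub>M distr exp_seq borel (\<lambda>\<omega>. sum (restrict \<omega> K) K)"
    using assms by (intro distr_pair_disjoint m) auto
  ultimately show ?thesis
    using assms by (simp add: r distr_sum_coord)
qed

text \<open>The joint law of two overlapping sums depends on the index sets only through cardinalities.\<close>

lemma distr_overlap_sums:
  assumes "finite I" "finite J" "finite K" "I \<inter> J = {}" "I \<inter> K = {}" "J \<inter> K = {}"
    and "finite I'" "finite J'" "finite K'" "I' \<inter> J' = {}" "I' \<inter> K' = {}" "J' \<inter> K' = {}"
    and "card I = card I'" "card J = card J'" "card K = card K'"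
    and [measurable]: "case_prod F \<in> borel \<Otimes>\<^sub>M borel \<rightarrow>\<^sub>M N"
  shows "distr exp_seq N (\<lambda>\<omega>. F (sum \<omega> (I \<union> J)) (sum \<omega> (J \<union> K)))
    = distr exp_seq N (\<lambda>\<omega>. F (sum \<omega> (I' \<union> J')) (sum \<omega> (J' \<union> K')))"
proof -
  have [measurable]: "(\<lambda>(a, b, c). F (a + b) (b + c)) \<in> borel \<Otimes>\<^sub>M (borel \<Otimes>\<^sub>M borel) \<rightarrow>\<^sub>M N"
    by measurable
  have *: "distr exp_seq N (\<lambda>\<omega>. F (sum \<omega> (I \<union> J)) (sum \<omega> (J \<union> K)))
     = distr (gamma_law (card I) \<Otimes>\<^sub>M (gamma_law (card J) \<Otimes>\<^sub>M gamma_law (card K))) N (\<lambda>(a, b, c). F (a + b) (b + c))"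
    if "finite I" "finite J" "finite K" "I \<inter> J = {}" "I \<inter> K = {}" "J \<inter> K = {}" for I J K
    using that
    by (subst distr_three_sums[symmetric]) (auto simp: distr_distr comp_def sum.union_disjoint split_beta')
  show ?thesis using assms by (simp add: *)
qed

section \<open>A covariance formula for the exponential law\<close>

lemma set_integral_FTC_Ioi:
  fixes F f :: "real \<Rightarrow> real"
  assumes "\<And>x. x > a \<Longrightarrow> (F has_real_derivative f x) (at x)" "continuous_on {a<..} f"
    "set_integrable lborel {a<..} f" "(F \<longlongrightarrow> A) (at_right a)" "(F \<longlongrightarrow> B) at_top"
  shows "(LBINT x:{a<..}. f x) = B - A"
proof -
  have "(LBINT x=ereal a..\<infinity>. f x) = B - A"
  proof (rule interval_integral_FTC_integrable[where F = F])
    show "(F has_vector_derivative f x) (at x)" if "ereal a < ereal x" for x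
      using assms(1)[of x] that by (simp add: has_real_derivative_iff_has_vector_derivative)
    show "isCont f x" if "ereal a < ereal x" for x
      using assms(2) that by (simp add: continuous_on_eq_continuous_at)
    show "set_integrable lborel (einterval (ereal a) \<infinity>) f"
      using assms(3) by simp
    show "((F \<circ> real_of_ereal) \<longlongrightarrow> A) (at_right (ereal a))"
      using assms(4) by (simp add: ereal_tendsto_simps)
    show "((F \<circ> real_of_ereal) \<longlongrightarrow> B) (at_left \<infinity>)"
      using assms(5) by (simp add: ereal_tendsto_simps)
  qed auto
  then show ?thesis by (simp add: interval_integral_to_infinity_eq)
qed

lemma integrable_exp_law_iff:
  fixes f :: "real \<Rightarrow> real"
  assumes [measurable]: "f \<in> borel_measurable borel"
  shows "integrable exp_law f \<longleftrightarrow> set_integrable lborel {0<..} (\<lambda>x. f x * exp (- x))"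
    and "integral\<^sup>L exp_law f = (LBINT x:{0<..}. f x * exp (- x))"
proof -
  have ae: "AE x in lborel. x \<noteq> (0::real)" by (rule AE_lborel_singleton)
  have "integrable exp_law f \<longleftrightarrow> integrable lborel (\<lambda>x. exponential_density 1 x *\<^sub>R f x)"
    unfolding exp_law_def by (rule integrable_density) auto
  also have "\<dots> \<longleftrightarrow> set_integrable lborel {0<..} (\<lambda>x. f x * exp (- x))"
    unfolding set_integrable_def using ae
    by (intro integrable_cong_AE) (auto simp: exponential_density_def elim!: eventually_mono split: split_indicator)
  finally show "integrable exp_law f \<longleftrightarrow> set_integrable lborel {0<..} (\<lambda>x. f x * exp (- x))" .
  have "integral\<^sup>L exp_law f = (LBINT x. exponential_density 1 x *\<^sub>R f x)"
    unfolding exp_law_def by (rule integral_density) auto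
  also have "\<dots> = (LBINT x:{0<..}. f x * exp (- x))"
    unfolding set_lebesgue_integral_def using ae
    by (intro integral_cong_AE) (auto simp: exponential_density_def elim!: eventually_mono split: split_indicator)
  finally show "integral\<^sup>L exp_law f = (LBINT x:{0<..}. f x * exp (- x))" .
qed

lemma set_integrable_Ioi_shift:
  fixes f :: "real \<Rightarrow> real"
  shows "set_integrable lborel {x<..} f \<longleftrightarrow> set_integrable lborel {0<..} (\<lambda>e. f (x + e))"
    and "(LBINT y:{x<..}. f y) = (LBINT e:{0<..}. f (x + e))"
proof -
  have *: "indicator {x<..} (x + e) = (indicator {0<..} e :: real)" for e by (auto split: split_indicator)
  show "set_integrable lborel {x<..} f \<longleftrightarrow> set_integrable lborel {0<..} (\<lambda>e. f (x + e))"
    unfolding set_integrable_def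
    using lborel_integrable_real_affine_iff[of 1 "\<lambda>y. indicat_real {x<..} y *\<^sub>R f y" x] by (simp add: *)
  show "(LBINT y:{x<..}. f y) = (LBINT e:{0<..}. f (x + e))"
    unfolding set_lebesgue_integral_def
    using lborel_integral_real_affine[of 1 "\<lambda>y. indicat_real {x<..} y *\<^sub>R f y" x] by (simp add: *)
qed

lemma has_derivative_tail_integral:
  fixes w :: "real \<Rightarrow> real"
  assumes w: "set_integrable lborel {0<..} w" "continuous_on {0<..} w" and x: "x > 0"
  shows "((\<lambda>x. LBINT y:{x<..}. w y) has_real_derivative - w x) (at x)"
proof -
  \<comment> \<open>A cut strictly between 0 and x: the part of the integral that varies with x then
    runs over a compact interval on which w is continuous.\<close>
  define c where "c = x / 2"
  have c: "0 < c" "c < x" using x by (auto simp: c_def)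
  have sub: "set_integrable lborel A w" if "A \<subseteq> {0<..}" "A \<in> sets borel" for A
    using w(1) that by (auto intro: set_integrable_subset)
  have eq: "(LBINT y:{z<..}. w y) = (LBINT y:{c<..}. w y) - (LBINT y=c..z. w y)" if "z > c" for z
  proof -
    have "{c<..} = {c<..z} \<union> {z<..}" using that by auto
    moreover have "(LBINT y:{c<..z} \<union> {z<..}. w y) = (LBINT y:{c<..z}. w y) + (LBINT y:{z<..}. w y)"
      using that c by (intro set_integral_Un sub) auto
    moreover have "(LBINT y=c..z. w y) = (LBINT y:{c<..z}. w y)"
      using that by (subst interval_integral_Ioc) auto
    ultimately show ?thesis by simp
  qed
  have "((\<lambda>u. LBINT y=c..u. w y) has_vector_derivative w x) (at x within {c..x+1})"
    using w(2) c by (intro interval_integral_FTC2) (auto intro: continuous_on_subset)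
  then have "((\<lambda>u. LBINT y=c..u. w y) has_vector_derivative w x) (at x)"
    using c by (subst (asm) at_within_interior) (auto simp: interior_atLeastAtMost_real)
  then have "((\<lambda>u. (LBINT y:{c<..}. w y) - (LBINT y=c..u. w y)) has_real_derivative - w x) (at x)"
    by (auto simp: has_real_derivative_iff_has_vector_derivative[symmetric] intro!: derivative_eq_intros)
  then show ?thesis
  proof (rule DERIV_cong_ev[THEN iffD1, OF refl _ refl, rotated])
    have "eventually (\<lambda>z. z > c) (nhds x)" using c by (intro eventually_nhds_in_open[of "{c<..}", simplified]) auto
    then show "\<forall>\<^sub>F z in nhds x. (LBINT y:{c<..}. w y) - (LBINT y=c..z. w y) = (LBINT y:{z<..}. w y)"
      by eventually_elim (simp add: eq)
  qed
qed

lemma tail_integral_at_right_0: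
  fixes w :: "real \<Rightarrow> real"
  assumes w: "set_integrable lborel {0<..} w"
  shows "((\<lambda>x. LBINT y:{x<..}. w y) \<longlongrightarrow> (LBINT y:{0<..}. w y)) (at_right 0)"
  unfolding set_lebesgue_integral_def
proof (rule tendsto_at_right_sequentially[of 0 1], simp)
  fix S :: "nat \<Rightarrow> real" assume S: "\<And>n. 0 < S n" "\<And>n. S n < 1" "decseq S" "S \<longlonglongrightarrow> 0"
  show "(\<lambda>n. LBINT y. indicat_real {S n<..} y *\<^sub>R w y) \<longlonglongrightarrow> (LBINT y. indicat_real {0<..} y *\<^sub>R w y)"
  proof (rule integral_dominated_convergence[where w = "\<lambda>y. norm (indicat_real {0<..} y *\<^sub>R w y)"])
    show "(\<lambda>y. indicat_real {0<..} y *\<^sub>R w y) \<in> borel_measurable lborel"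
      using w unfolding set_integrable_def by auto
    show "(\<lambda>y. indicat_real {S n<..} y *\<^sub>R w y) \<in> borel_measurable lborel" for n
    proof -
      have "set_integrable lborel {S n<..} w"
        by (rule set_integrable_subset[OF w]) (use S(1)[of n] in auto)
      then show ?thesis unfolding set_integrable_def by auto
    qed
    show "integrable lborel (\<lambda>y. norm (indicat_real {0<..} y *\<^sub>R w y))"
      using w unfolding set_integrable_def by (rule integrable_norm)
    show "AE y in lborel. (\<lambda>n. indicat_real {S n<..} y *\<^sub>R w y) \<longlonglongrightarrow> indicat_real {0<..} y *\<^sub>R w y"
    proof (intro AE_I2)
      fix y :: real
      show "(\<lambda>n. indicat_real {S n<..} y *\<^sub>R w y) \<longlonglongrightarrow> indicat_real {0<..} y *\<^sub>R w y"
      proof (cases "y > 0")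
        case True
        have "eventually (\<lambda>n. S n < y) sequentially" using S(4) True by (rule order_tendstoD)
        then have "eventually (\<lambda>n. indicat_real {0<..} y *\<^sub>R w y = indicat_real {S n<..} y *\<^sub>R w y) sequentially"
          by eventually_elim (use True in auto)
        then show ?thesis by (rule Lim_transform_eventually[OF tendsto_const])
      next
        case False
        then have "indicat_real {S n<..} y = 0" for n using S(1)[of n] by (auto simp: indicator_def)
        then show ?thesis using False by simp
      qed
    qed
    show "AE y in lborel. norm (indicat_real {S n<..} y *\<^sub>R w y) \<le> norm (indicat_real {0<..} y *\<^sub>R w y)" for n
      using S(1)[of n] by (intro AE_I2) (auto split: split_indicator)
  qed
qed

lemma has_integral_exp_tail:
  fixes c x :: real assumes "c > 0"
  shows "set_integrable lborel {x<..} (\<lambda>y. exp (- c * y))" "(LBINT y:{x<..}. exp (- c * y)) = exp (- c * x) / c"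
proof -
  have l: "((\<lambda>x. - exp (- c * x) / c) \<longlongrightarrow> 0) at_top"
    using assms by real_asymp
  have d: "((\<lambda>x. - exp (- c * x) / c) has_real_derivative exp (- c * y)) (at y)" for y
    using assms by (auto intro!: derivative_eq_intros)
  have nn: "(\<integral>\<^sup>+ y. ennreal (exp (- c * y)) * indicator {x..} y \<partial>lborel) = ennreal (0 - (- exp (- c * x) / c))"
    by (rule nn_integral_FTC_atLeast[where F = "\<lambda>x. - exp (- c * x) / c"]) (use l d in auto)
  have "(\<integral>\<^sup>+ y. ennreal (norm (indicat_real {x<..} y *\<^sub>R exp (- c * y))) \<partial>lborel)
     \<le> (\<integral>\<^sup>+ y. ennreal (exp (- c * y)) * indicator {x..} y \<partial>lborel)"
    by (intro nn_integral_mono) (auto split: split_indicator)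
  also have "\<dots> < \<infinity>" unfolding nn by simp
  finally show i: "set_integrable lborel {x<..} (\<lambda>y. exp (- c * y))"
    unfolding set_integrable_def by (intro integrableI_bounded) auto
  have "((\<lambda>y. - exp (- c * y) / c) \<longlongrightarrow> - exp (- c * x) / c) (at_right x)"
    using assms by (intro tendsto_intros) auto
  from set_integral_FTC_Ioi[OF d _ i this l] show "(LBINT y:{x<..}. exp (- c * y)) = exp (- c * x) / c"
    by (simp add: continuous_intros)
qed

text \<open>Writing \<open>P x = \<integral>\<^sub>x\<^sup>\<infinity> u(y) e\<^sup>-\<^sup>y dy\<close> and \<open>Q\<close> for the same integral of \<open>v\<close>, both sides
  are boundary terms of \<open>e\<^sup>x P Q\<close>.\<close>

lemma exp_law_covariance:
  fixes u v u' v' :: "real \<Rightarrow> real"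
  assumes [measurable]: "u \<in> borel_measurable borel" "v \<in> borel_measurable borel"
      "u' \<in> borel_measurable borel" "v' \<in> borel_measurable borel"
    and du: "\<And>x. x > 0 \<Longrightarrow> (u has_real_derivative u' x) (at x)" "continuous_on {0<..} u'"
    and dv: "\<And>x. x > 0 \<Longrightarrow> (v has_real_derivative v' x) (at x)" "continuous_on {0<..} v'"
    and iu: "integrable exp_law u" and iv: "integrable exp_law v" and iuv: "integrable exp_law (\<lambda>x. u x * v x)"
    and iu': "\<And>x. x > 0 \<Longrightarrow> integrable exp_law (\<lambda>e. u' (x + e))"
    and iv': "\<And>x. x > 0 \<Longrightarrow> integrable exp_law (\<lambda>e. v' (x + e))"
    and gu: "\<And>x. x \<ge> 1 \<Longrightarrow> \<bar>u x\<bar> \<le> K * exp (x / 4)" and gv: "\<And>x. x \<ge> 1 \<Longrightarrow> \<bar>v x\<bar> \<le> K * exp (x / 4)"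
    and iuv': "integrable exp_law (\<lambda>x. (\<integral>e. u' (x + e) \<partial>exp_law) * (\<integral>e. v' (x + e) \<partial>exp_law))"
  shows "(\<integral>x. u x * v x \<partial>exp_law) - (\<integral>x. u x \<partial>exp_law) * (\<integral>x. v x \<partial>exp_law)
    = (\<integral>x. (\<integral>e. u' (x + e) \<partial>exp_law) * (\<integral>e. v' (x + e) \<partial>exp_law) \<partial>exp_law)"
proof -
  define P where "P = (\<lambda>f x. LBINT y:{x<..}. f y * exp (- y) :: real)"
  have K: "K \<ge> 0" using order_trans[OF abs_ge_zero gu[of 1]] by (simp add: zero_le_mult_iff)
  have sint: "set_integrable lborel {x<..} (\<lambda>y. f y * exp (- y))"
    if "x \<ge> 0" "f \<in> borel_measurable borel" "integrable exp_law f" for f x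
  proof (rule set_integrable_subset)
    show "set_integrable lborel {0<..} (\<lambda>y. f y * exp (- y))"
      using that(3) unfolding integrable_exp_law_iff(1)[OF that(2)] .
  qed (use that in auto)
  \<comment> \<open>Integration by parts: (f(y) e^(-y))' = f'(y) e^(-y) - f(y) e^(-y), integrated
    over (x, \<infinity>) and multiplied by e^x.\<close>
  have key: "(\<integral>e. f' (x + e) \<partial>exp_law) = exp x * P f x - f x"
    if "x > 0" and m[measurable]: "f \<in> borel_measurable borel" "f' \<in> borel_measurable borel"
      and d: "\<And>x. x > 0 \<Longrightarrow> (f has_real_derivative f' x) (at x)" "continuous_on {0<..} f'"
      and i: "integrable exp_law f" "integrable exp_law (\<lambda>e. f' (x + e))"
      and g: "\<And>x. x \<ge> 1 \<Longrightarrow> \<bar>f x\<bar> \<le> K * exp (x / 4)" for f f' x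
  proof -
    have cf: "continuous_on {0<..} f"
      using d(1) by (intro continuous_at_imp_continuous_on) (auto intro: DERIV_isCont)
    have i1: "set_integrable lborel {x<..} (\<lambda>y. f y * exp (- y))"
      using \<open>x > 0\<close> i(1) by (intro sint) auto
    have "set_integrable lborel {0<..} (\<lambda>e. exp (- x) * (f' (x + e) * exp (- e)))"
      using i(2) by (subst (asm) integrable_exp_law_iff) auto
    then have i2: "set_integrable lborel {x<..} (\<lambda>y. f' y * exp (- y))"
      by (subst set_integrable_Ioi_shift) (simp add: exp_add exp_diff exp_minus field_simps)
    have "(LBINT y:{x<..}. f' y * exp (- y) - f y * exp (- y)) = 0 - f x * exp (- x)"
    proof (rule set_integral_FTC_Ioi[where F = "\<lambda>y. f y * exp (- y)"])
      show "((\<lambda>y. f y * exp (- y)) has_real_derivative f' y * exp (- y) - f y * exp (- y)) (at y)" if "x < y" for y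
        using d(1)[of y] that \<open>x > 0\<close> by (auto intro!: derivative_eq_intros)
      show "continuous_on {x<..} (\<lambda>y. f' y * exp (- y) - f y * exp (- y))"
        using d(2) cf \<open>x > 0\<close> by (intro continuous_intros) (auto elim!: continuous_on_subset)
      show "set_integrable lborel {x<..} (\<lambda>y. f' y * exp (- y) - f y * exp (- y))" using i1 i2 by simp
      have "isCont f x" using d(1)[OF \<open>x > 0\<close>] by (rule DERIV_isCont)
      then show "((\<lambda>y. f y * exp (- y)) \<longlongrightarrow> f x * exp (- x)) (at_right x)"
        by (intro tendsto_intros) (auto simp: isCont_def filterlim_at_split)
      show "((\<lambda>y. f y * exp (- y)) \<longlongrightarrow> 0) at_top"
      proof (rule Lim_null_comparison)
        show "\<forall>\<^sub>F y in at_top. norm (f y * exp (- y)) \<le> K * exp (y / 4) * exp (- y)"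
          using eventually_ge_at_top[of 1] by eventually_elim (use g in \<open>auto simp: abs_mult\<close>)
        show "((\<lambda>y. K * exp (y / 4) * exp (- y)) \<longlongrightarrow> 0) at_top"
          using tendsto_mult[OF tendsto_const[of K at_top], of "\<lambda>y. exp (y/4) * exp (- y)" 0]
          by (simp add: mult.assoc) (rule tendsto_mult_right_zero, real_asymp)
      qed
    qed
    then have "(LBINT y:{x<..}. f' y * exp (- y)) = P f x - f x * exp (- x)"
      using i1 i2 by (simp add: P_def)
    moreover have "(\<integral>e. f' (x + e) \<partial>exp_law) = exp x * (LBINT y:{x<..}. f' y * exp (- y))"
    proof -
      have *: "f' (x + e) * exp (- e) = exp x * (f' (x + e) * exp (- (x + e)))" for e
        by (simp add: exp_add exp_diff exp_minus field_simps)
      have "(\<integral>e. f' (x + e) \<partial>exp_law) = (LBINT e:{0<..}. exp x * (f' (x + e) * exp (- (x + e))))"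
        by (subst integrable_exp_law_iff(2)) (simp_all only: *, measurable)
      also have "\<dots> = exp x * (LBINT y:{x<..}. f' y * exp (- y))"
        unfolding set_integrable_Ioi_shift(2)[of x "\<lambda>y. f' y * exp (- y)"] by (rule set_integral_mult_right)
      finally show ?thesis .
    qed
    ultimately have "(\<integral>e. f' (x + e) \<partial>exp_law) = exp x * P f x - f x * (exp x * exp (- x))"
      by (simp only: right_diff_distrib mult.left_commute)
    also have "exp x * exp (- x) = 1" by (simp flip: exp_add)
    finally show ?thesis by simp
  qed
  \<comment> \<open>Growth e^(x/4) of f leaves decay e^(-3x/4) for the tail, so e^x P Q is of order
    e^(-x/2) and its boundary term at infinity vanishes.\<close>
  have Pbound: "\<bar>P f x\<bar> \<le> K * exp (- (3/4) * x) / (3/4)"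
    if "x \<ge> 1" and m[measurable]: "f \<in> borel_measurable borel" and "integrable exp_law f"
      and g: "\<And>x. x \<ge> 1 \<Longrightarrow> \<bar>f x\<bar> \<le> K * exp (x / 4)" for f x
  proof -
    note e = has_integral_exp_tail[of "3/4" x]
    have "\<bar>P f x\<bar> \<le> (LBINT y:{x<..}. \<bar>f y * exp (- y)\<bar>)"
      unfolding P_def set_lebesgue_integral_def using integral_abs_bound by (rule order_trans) (simp add: abs_mult)
    also have "\<dots> \<le> (LBINT y:{x<..}. K * exp (- (3/4) * y))"
    proof (rule set_integral_mono)
      show "set_integrable lborel {x<..} (\<lambda>y. \<bar>f y * exp (- y)\<bar>)"
        using that by (intro set_integrable_abs sint) auto
      show "set_integrable lborel {x<..} (\<lambda>y. K * exp (- (3/4) * y))" using e(1) by simp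
      fix y assume "y \<in> {x<..}"
      then have "\<bar>f y * exp (- y)\<bar> \<le> K * exp (y / 4) * exp (- y)" using g[of y] that by (auto simp: abs_mult)
      also have "\<dots> = K * exp (- (3/4) * y)" by (simp add: mult.assoc flip: exp_add)
      finally show "\<bar>f y * exp (- y)\<bar> \<le> K * exp (- (3/4) * y)" .
    qed
    also have "\<dots> = K * exp (- (3/4) * x) / (3/4)" using e(2) by simp
    finally show ?thesis .
  qed
  let ?U = "\<lambda>x. exp x * P u x - u x" and ?V = "\<lambda>x. exp x * P v x - v x"
  have cu: "continuous_on {0<..} u" and cv: "continuous_on {0<..} v"
    using du(1) dv(1) by (auto intro!: continuous_at_imp_continuous_on intro: DERIV_isCont)
  have dP: "(P f has_real_derivative - (f x * exp (- x))) (at x)"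
    if "x > 0" "integrable exp_law f" "f \<in> borel_measurable borel" "continuous_on {0<..} f" for f x
    unfolding P_def using that sint[of 0 f] by (intro has_derivative_tail_integral) (auto intro!: continuous_intros)
  have cP: "continuous_on {0<..} (P f)"
    if "integrable exp_law f" "f \<in> borel_measurable borel" "continuous_on {0<..} f" for f
    using dP that by (intro continuous_at_imp_continuous_on) (auto intro: DERIV_isCont)
  have ae: "AE x in exp_law. (\<integral>e. u' (x + e) \<partial>exp_law) * (\<integral>e. v' (x + e) \<partial>exp_law) = ?U x * ?V x"
    using AE_exp_law_pos
  proof eventually_elim
    case (elim x)
    show ?case
      using key[OF elim _ _ du(1) du(2) iu iu'[OF elim] gu] key[OF elim _ _ dv(1) dv(2) iv iv'[OF elim] gv] by simp
  qed
  have mP: "P f \<in> borel_measurable borel" if m: "f \<in> borel_measurable borel" for f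
  proof -
    note m [measurable]
    have "(\<lambda>(x, y). (if x < y then 1 else 0) *\<^sub>R (f y * exp (- y))) \<in> borel_measurable (borel \<Otimes>\<^sub>M (lborel :: real measure))"
      by measurable
    then show ?thesis
      unfolding P_def set_lebesgue_integral_def indicator_def greaterThan_iff of_bool_def
      by (intro lborel.borel_measurable_lebesgue_integral) (simp add: split_beta')
  qed
  have mUV [measurable]: "(\<lambda>x. ?U x * ?V x) \<in> borel_measurable borel"
    using assms(1,2) by (intro borel_measurable_times borel_measurable_diff borel_measurable_exp mP) auto
  have [measurable]: "(\<lambda>x. (\<integral>e. u' (x + e) \<partial>exp_law) * (\<integral>e. v' (x + e) \<partial>exp_law)) \<in> borel_measurable exp_law"
    using iuv' by auto
  have mUV': "(\<lambda>x. ?U x * ?V x) \<in> borel_measurable exp_law"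
    unfolding measurable_cong_sets[OF sets_exp_law refl] by (rule mUV)
  have iUV: "integrable exp_law (\<lambda>x. ?U x * ?V x)"
    using iuv' integrable_cong_AE[OF _ mUV' ae] by auto
  have UV: "(\<integral>x. (\<integral>e. u' (x + e) \<partial>exp_law) * (\<integral>e. v' (x + e) \<partial>exp_law) \<partial>exp_law) = (\<integral>x. ?U x * ?V x \<partial>exp_law)"
    using integral_cong_AE[OF _ mUV' ae] by auto
  have i1: "set_integrable lborel {0<..} (\<lambda>x. u x * v x * exp (- x))"
    using iuv by (simp add: integrable_exp_law_iff)
  have i2: "set_integrable lborel {0<..} (\<lambda>x. ?U x * ?V x * exp (- x))"
    using iUV unfolding integrable_exp_law_iff(1)[OF mUV] .
  \<comment> \<open>The right side is the derivative of -e^x P(x) Q(x), because P' = -u e^(-x) and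
    Q' = -v e^(-x).\<close>
  have eq: "u x * v x * exp (- x) - ?U x * ?V x * exp (- x) = - (exp x * P u x * P v x) + P u x * v x + u x * P v x" for x
    by (simp add: field_simps exp_minus)
  have "(LBINT x:{0<..}. u x * v x * exp (- x) - ?U x * ?V x * exp (- x)) = 0 - (- (exp 0 * P u 0 * P v 0))"
  proof (rule set_integral_FTC_Ioi[where F = "\<lambda>x. - (exp x * P u x * P v x)"])
    show "((\<lambda>x. - (exp x * P u x * P v x)) has_real_derivative u x * v x * exp (- x) - ?U x * ?V x * exp (- x)) (at x)"
      if "0 < x" for x
      unfolding eq using dP[OF that iu] dP[OF that iv] cu cv
      by (auto intro!: derivative_eq_intros simp: field_simps exp_minus)
    show "continuous_on {0<..} (\<lambda>x. u x * v x * exp (- x) - ?U x * ?V x * exp (- x))"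
      unfolding eq using cu cv iu iv by (intro continuous_intros cP) auto
    show "set_integrable lborel {0<..} (\<lambda>x. u x * v x * exp (- x) - ?U x * ?V x * exp (- x))"
      using i1 i2 by simp
    have "(P u \<longlongrightarrow> P u 0) (at_right 0)" "(P v \<longlongrightarrow> P v 0) (at_right 0)"
      unfolding P_def using iu iv by (auto intro!: tail_integral_at_right_0 sint)
    then show "((\<lambda>x. - (exp x * P u x * P v x)) \<longlongrightarrow> - (exp 0 * P u 0 * P v 0)) (at_right 0)"
      by (intro tendsto_intros) auto
    show "((\<lambda>x. - (exp x * P u x * P v x)) \<longlongrightarrow> 0) at_top"
    proof (rule Lim_null_comparison)
      show "\<forall>\<^sub>F x in at_top. norm (- (exp x * P u x * P v x))
         \<le> exp x * (K * exp (- (3/4) * x) / (3/4)) * (K * exp (- (3/4) * x) / (3/4))"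
        using eventually_ge_at_top[of 1]
      proof eventually_elim
        case (elim x)
        let ?b = "K * exp (- (3/4) * x) / (3/4)"
        have "\<bar>P u x\<bar> * \<bar>P v x\<bar> \<le> ?b * ?b"
          using Pbound[OF elim _ iu gu] Pbound[OF elim _ iv gv] K by (intro mult_mono) auto
        then have "exp x * (\<bar>P u x\<bar> * \<bar>P v x\<bar>) \<le> exp x * (?b * ?b)" by (intro mult_left_mono) auto
        then show ?case by (simp only: mult.assoc norm_minus_cancel abs_minus_cancel real_norm_def abs_mult abs_exp_cancel)
      qed
      have "((\<lambda>x. (K / (3/4)) ^ 2 * (exp x * exp (- (3/4) * x) * exp (- (3/4) * x))) \<longlongrightarrow> 0) at_top"
        by (rule tendsto_mult_right_zero) real_asymp
      then show "((\<lambda>x. exp x * (K * exp (- (3/4) * x) / (3/4)) * (K * exp (- (3/4) * x) / (3/4))) \<longlongrightarrow> 0) at_top"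
        by (simp add: power2_eq_square algebra_simps)
    qed
  qed
  then have "(LBINT x:{0<..}. u x * v x * exp (- x)) - (LBINT x:{0<..}. ?U x * ?V x * exp (- x)) = P u 0 * P v 0"
    using i1 i2 by simp
  then show ?thesis
    unfolding UV integrable_exp_law_iff(2)[OF mUV] by (simp add: integrable_exp_law_iff P_def)
qed

section \<open>Integrability under gamma laws and the class of admissible functions\<close>

text \<open>The substitution t = (1 - c) x turns the integrand of \<open>Gamma (1 - p)\<close> into
  x^(-p) e^(c x) e^(-x), up to a constant factor.\<close>

lemma integrable_exp_law_powr:
  assumes "p < 1" "c < 1"
  shows "integrable exp_law (\<lambda>x. x powr (- p) * exp (c * x))"
proof (subst integrable_exp_law_iff)
  define f where "f = (\<lambda>t::real. indicator {0..} t * t powr ((1 - p) - 1) / exp t)"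
  have [measurable]: "f \<in> borel_measurable borel" unfolding f_def by measurable
  have "(\<integral>\<^sup>+ t. ennreal (norm (f t)) \<partial>lborel) = ennreal (Gamma (1 - p))"
    using Gamma_conv_nn_integral_real[of "1 - p"] assms
    by (simp add: f_def abs_mult abs_divide)
  then have "integrable lborel f" by (intro integrableI_bounded) auto
  then have i: "integrable lborel (\<lambda>x. (1 - c) powr p * f (0 + (1 - c) * x))"
    using assms by (intro integrable_mult_right) (subst lborel_integrable_real_affine_iff, auto)
  have eq: "indicat_real {0<..} x *\<^sub>R (x powr - p * exp (c * x) * exp (- x)) = (1 - c) powr p * f (0 + (1 - c) * x)"
    if "x \<noteq> 0" for x
  proof (cases "x > 0")
    case True
    then have "f (0 + (1 - c) * x) = (1 - c) powr (- p) * x powr (- p) / exp ((1 - c) * x)"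
      using assms by (simp add: f_def powr_mult)
    then show ?thesis
      using True assms by (simp add: exp_minus powr_minus exp_diff algebra_simps) (simp add: field_simps)
  next
    case False
    then have "(1 - c) * x < 0" using assms that by (simp add: mult_less_0_iff)
    then show ?thesis using False by (simp add: f_def)
  qed
  have ae: "AE x in lborel. (1 - c) powr p * f (0 + (1 - c) * x) = indicat_real {0<..} x *\<^sub>R (x powr - p * exp (c * x) * exp (- x))"
    using AE_lborel_singleton[of 0] by eventually_elim (rule eq[symmetric])
  show "set_integrable lborel {0<..} (\<lambda>x. x powr (- p) * exp (c * x) * exp (- x))"
    unfolding set_integrable_def by (rule integrable_cong_AE_imp[OF i _ ae]) measurable
qed measurable

text \<open>A single term of the exponential series bounds the polynomial factor of the gamma
  density: x^(k-1) / (k-1)! <= e^(c x) / c^(k-1).\<close>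

lemma integrable_gamma_law_of_exp_law:
  fixes f :: "real \<Rightarrow> real"
  assumes [measurable]: "f \<in> borel_measurable borel" and k: "k \<ge> 1" and c: "0 < c"
    and i: "integrable exp_law (\<lambda>x. f x * exp (c * x))"
  shows "integrable (gamma_law k) f"
proof -
  define C where "C = 1 / c ^ (k - 1)"
  have "integrable lborel (\<lambda>x. exponential_density 1 x *\<^sub>R (C * (f x * exp (c * x))))"
    using i unfolding exp_law_def by (subst integrable_density[symmetric]) auto
  then have "integrable lborel (\<lambda>x. erlang_density (k - 1) 1 x *\<^sub>R f x)"
  proof (rule Bochner_Integration.integrable_bound)
    have "norm (erlang_density (k - 1) 1 x *\<^sub>R f x) \<le> norm (exponential_density 1 x *\<^sub>R (C * (f x * exp (c * x))))" for x
    proof (cases "x < 0")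
      case False
      then have x: "x \<ge> 0" by simp
      have "(c * x) ^ (k - 1) / fact (k - 1) \<le> exp (c * x)"
      proof -
        have "(\<Sum>n\<in>{k-1}. inverse (fact n) * (c * x) ^ n) \<le> (\<Sum>n. inverse (fact n) * (c * x) ^ n)"
          using x c summable_exp[of "c * x"] by (intro sum_le_suminf) auto
        then show ?thesis by (simp add: exp_def field_simps)
      qed
      then have "x ^ (k - 1) / fact (k - 1) \<le> C * exp (c * x)"
        using c by (simp add: C_def field_simps power_mult_distrib)
      from mult_right_mono[OF this, of "\<bar>f x\<bar> * exp (- x)"] show ?thesis
        using x c by (simp add: erlang_density_def abs_mult C_def field_simps)
    qed (simp add: erlang_density_def)
    then show "AE x in lborel. norm (erlang_density (k - 1) 1 x *\<^sub>R f x) \<le> norm (exponential_density 1 x *\<^sub>R (C * (f x * exp (c * x))))"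
      by simp
  qed simp
  then show ?thesis
    using k by (simp add: gamma_law_def integrable_density)
qed

lemma integrable_gamma_law_powr:
  assumes "k \<ge> 1" "p < 1" "c < 1"
  shows "integrable (gamma_law k) (\<lambda>x. x powr (- p) * exp (c * x))"
proof (rule integrable_gamma_law_of_exp_law[where c = "(1 - c) / 2"])
  have "c + (1 - c) / 2 < 1" using assms by (simp add: field_simps)
  from integrable_exp_law_powr[OF assms(2) this]
  show "integrable exp_law (\<lambda>x. x powr - p * exp (c * x) * exp ((1 - c) / 2 * x))"
    by (simp add: mult.assoc distrib_right flip: exp_add)
qed (use assms in auto)

lemma integrable_gamma_law_exp:
  assumes "k \<ge> 1" "c < 1"
  shows "integrable (gamma_law k) (\<lambda>x. exp (c * x))"
proof -
  have "integrable (gamma_law k) (\<lambda>x. exp (c * x)) \<longleftrightarrow> integrable (gamma_law k) (\<lambda>x. x powr (- 0) * exp (c * x))"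
    using AE_gamma_law_pos[OF assms(1)] by (intro integrable_cong_AE) (auto elim!: eventually_mono)
  then show ?thesis using integrable_gamma_law_powr[OF assms(1), of 0 c] assms(2) by simp
qed

lemma (in pair_sigma_finite) integral_product_mult:
  fixes f :: "'a \<Rightarrow> real" and g :: "'b \<Rightarrow> real"
  assumes f: "integrable M1 f" and g: "integrable M2 g"
  shows "integrable (M1 \<Otimes>\<^sub>M M2) (\<lambda>(x, y). f x * g y)"
    and "integral\<^sup>L (M1 \<Otimes>\<^sub>M M2) (\<lambda>(x, y). f x * g y) = integral\<^sup>L M1 f * integral\<^sup>L M2 g"
proof -
  have [measurable]: "f \<in> borel_measurable M1" "g \<in> borel_measurable M2" using f g by auto
  show i: "integrable (M1 \<Otimes>\<^sub>M M2) (\<lambda>(x, y). f x * g y)"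
    using f g by (intro Fubini_integrable) (auto simp: abs_mult)
  show "integral\<^sup>L (M1 \<Otimes>\<^sub>M M2) (\<lambda>(x, y). f x * g y) = integral\<^sup>L M1 f * integral\<^sup>L M2 g"
    using integral_fst[OF i] by simp
qed

lemma (in prob_space) integrable_square_of_power4:
  fixes f :: "'a \<Rightarrow> real"
  assumes [measurable]: "f \<in> borel_measurable M" and i: "integrable M (\<lambda>x. f x ^ 4)"
  shows "integrable M (\<lambda>x. (f x)\<^sup>2)"
proof (rule Bochner_Integration.integrable_bound)
  show "integrable M (\<lambda>x. 1 + f x ^ 4)" using i by simp
  have "(f x)\<^sup>2 \<le> 1 + f x ^ 4" for x
  proof -
    have "0 \<le> ((f x)\<^sup>2 - 1)\<^sup>2 + (f x)\<^sup>2 * (f x)\<^sup>2 + 1" by simp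
    then show ?thesis by (simp add: power2_diff power2_eq_square power4_eq_xxxx algebra_simps)
  qed
  then show "AE x in M. norm ((f x)\<^sup>2) \<le> norm (1 + f x ^ 4)" by simp
qed measurable

text \<open>The exponents \<open>1/8\<close> and \<open>1/16\<close> are small enough for \<open>h\<^sup>4\<close> to be integrable under every gamma law.\<close>

locale tame =
  fixes h h' :: "real \<Rightarrow> real" and K :: real
  assumes h_measurable [measurable]: "h \<in> borel_measurable borel" "h' \<in> borel_measurable borel"
    and deriv: "\<And>x. x > 0 \<Longrightarrow> (h has_real_derivative h' x) (at x)"
    and cont: "continuous_on {0<..} h'"
    and growth: "\<And>x. x > 0 \<Longrightarrow> \<bar>h x\<bar> \<le> K * (x powr (- (1/8)) + exp (x / 16))"
    and growth': "\<And>x. x > 0 \<Longrightarrow> \<bar>h' x\<bar> \<le> K * (1 / x + exp (x / 16))"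
begin

lemma K_nonneg: "K \<ge> 0"
proof -
  have "0 \<le> K * (1 + exp (1 / 16))" using order_trans[OF abs_ge_zero growth[of 1]] by simp
  moreover have "0 < 1 + exp (1 / 16 :: real)" by (simp add: add_pos_pos)
  ultimately show ?thesis by (auto simp: zero_le_mult_iff)
qed

text \<open>Once all coordinates but a few are fixed, a window sum is a + x with a nonnegative; the
  class has to be stable under this conditioning.\<close>

lemma tame_translate: "a \<ge> 0 \<Longrightarrow> tame (\<lambda>x. h (a + x)) (\<lambda>x. h' (a + x)) (K * exp (a / 16))"
proof
  assume a: "a \<ge> 0"
  have e: "1 \<le> exp (a / 16)" using a by simp
  show "((\<lambda>x. h (a + x)) has_real_derivative h' (a + x)) (at x)" if "x > 0" for x
    using DERIV_shift[of h "h' (a + x)" x a] deriv[of "a + x"] a that by (simp add: add.commute)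
  show "continuous_on {0<..} (\<lambda>x. h' (a + x))"
    using a by (intro continuous_on_compose2[OF cont]) (auto intro!: continuous_intros)
  fix x :: real assume x: "x > 0"
  have "(a + x) powr (- (1/8)) \<le> x powr (- (1/8))" using a x by (intro powr_mono2') auto
  also have "\<dots> \<le> exp (a / 16) * x powr (- (1/8))" using e mult_right_mono[OF e, of "x powr (- (1/8))"] by simp
  finally have "K * ((a + x) powr (- (1/8)) + exp ((a + x) / 16)) \<le> K * (exp (a / 16) * x powr (- (1/8)) + exp (a / 16) * exp (x / 16))"
    using K_nonneg by (intro mult_left_mono) (auto simp: exp_add[symmetric] add_divide_distrib)
  then show "\<bar>h (a + x)\<bar> \<le> K * exp (a / 16) * (x powr (- (1/8)) + exp (x / 16))"
    using growth[of "a + x"] a x by (simp add: algebra_simps)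
  have "1 / (a + x) \<le> 1 / x" using a x by (simp add: frac_le)
  also have "\<dots> \<le> exp (a / 16) * (1 / x)" using e x mult_right_mono[OF e, of "1 / x"] by simp
  finally have "K * (1 / (a + x) + exp ((a + x) / 16)) \<le> K * (exp (a / 16) * (1 / x) + exp (a / 16) * exp (x / 16))"
    using K_nonneg by (intro mult_left_mono) (auto simp: exp_add[symmetric] add_divide_distrib)
  then show "\<bar>h' (a + x)\<bar> \<le> K * exp (a / 16) * (1 / x + exp (x / 16))"
    using growth'[of "a + x"] a x by (simp add: algebra_simps)
qed measurable

lemma integrable_h4:
  assumes "k \<ge> 1"
  shows "integrable (gamma_law k) (\<lambda>x. h x ^ 4)"
proof (rule Bochner_Integration.integrable_bound)
  show "integrable (gamma_law k) (\<lambda>x. 8 * K ^ 4 * (x powr (- (1/2)) * exp (0 * x) + exp (1/4 * x)))"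
    using assms by (intro integrable_mult_right Bochner_Integration.integrable_add integrable_gamma_law_powr integrable_gamma_law_exp) auto
  show "AE x in gamma_law k. norm (h x ^ 4) \<le> norm (8 * K ^ 4 * (x powr (- (1/2)) * exp (0 * x) + exp (1/4 * x)))"
    using AE_gamma_law_pos[OF assms]
  proof eventually_elim
    case (elim x)
    let ?a = "x powr (- (1/8))" and ?b = "exp (x / 16)"
    have "\<bar>h x\<bar> ^ 4 \<le> (K * (?a + ?b)) ^ 4" using growth[OF elim] by (intro power_mono) auto
    also have "\<dots> = K ^ 4 * (?a + ?b) ^ 4" by (simp add: power_mult_distrib)
    also have "\<dots> \<le> K ^ 4 * (8 * (?a ^ 4 + ?b ^ 4))"
    proof (intro mult_left_mono)
      have "(?a + ?b)^2 \<le> 2 * (?a^2 + ?b^2)" using sum_squares_bound[of ?a ?b] by (simp add: power2_sum)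
      then have "((?a + ?b)^2)^2 \<le> (2 * (?a^2 + ?b^2))^2" by (intro power_mono) auto
      also have "\<dots> \<le> 8 * (?a ^ 4 + ?b ^ 4)"
        using sum_squares_bound[of "?a^2" "?b^2"] by (simp add: power2_eq_square power4_eq_xxxx algebra_simps)
      finally show "(?a + ?b) ^ 4 \<le> 8 * (?a ^ 4 + ?b ^ 4)" by simp
    qed (use K_nonneg in auto)
    also have "?a ^ 4 = x powr (- (1/2))" using elim by (simp add: powr_power)
    also have "?b ^ 4 = exp (1/4 * x)" by (simp flip: exp_of_nat_mult)
    finally show ?case using K_nonneg by (simp add: algebra_simps)
  qed
qed measurable

lemma integrable_h2:
  assumes "k \<ge> 1"
  shows "integrable (gamma_law k) (\<lambda>x. (h x)\<^sup>2)"
  by (rule prob_space.integrable_square_of_power4[OF prob_space_gamma_law _ integrable_h4[OF assms]]) measurable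

lemma integrable_h:
  assumes "k \<ge> 1"
  shows "integrable (gamma_law k) h"
proof -
  interpret prob_space "gamma_law k" by (rule prob_space_gamma_law)
  show ?thesis using integrable_h2[OF assms] by (rule square_integrable_imp_integrable[rotated]) measurable
qed

text \<open>The bound allows h' a singularity 1/x, which is not integrable against the exponential
  density near 0. A positive shift x removes it.\<close>

lemma integrable_deriv_shift:
  assumes x: "x > 0"
  shows "integrable exp_law (\<lambda>e. h' (x + e))"
proof (rule Bochner_Integration.integrable_bound)
  interpret prob_space exp_law by (rule prob_space_exp_law)
  have "integrable exp_law (\<lambda>e. exp (1/16 * e))"
    using integrable_gamma_law_exp[of 1 "1/16"] by simp
  then show "integrable exp_law (\<lambda>e. K * (1 / x + exp (x / 16) * exp (1/16 * e)))" by simp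
  show "AE e in exp_law. norm (h' (x + e)) \<le> norm (K * (1 / x + exp (x / 16) * exp (1/16 * e)))"
    using AE_exp_law_pos
  proof eventually_elim
    case (elim e)
    have "\<bar>h' (x + e)\<bar> \<le> K * (1 / (x + e) + exp ((x + e) / 16))" using x elim by (intro growth') auto
    also have "\<dots> \<le> K * (1 / x + exp (x / 16) * exp (1/16 * e))"
      using x elim K_nonneg by (intro mult_left_mono add_mono) (auto simp: frac_le add_divide_distrib simp flip: exp_add)
    finally show ?case using K_nonneg x by simp
  qed
qed measurable

lemma exp_growth: "x \<ge> 1 \<Longrightarrow> \<bar>h x\<bar> \<le> 2 * K * exp (x / 4)"
proof -
  assume x: "x \<ge> 1"
  have "x powr (- (1/8)) \<le> 1 powr (- (1/8))" using x by (intro powr_mono2') auto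
  also have "\<dots> \<le> exp (x / 4)" using x by simp
  finally have "x powr (- (1/8)) + exp (x / 16) \<le> exp (x / 4) + exp (x / 4)" using x by (intro add_mono) auto
  then have "K * (x powr (- (1/8)) + exp (x / 16)) \<le> K * (exp (x / 4) + exp (x / 4))" using K_nonneg by (intro mult_left_mono)
  then show ?thesis using growth[of x] x by simp
qed

end

lemma integrable_mult_tame:
  assumes "tame u u' K" "tame v v' L" "k \<ge> 1"
  shows "integrable (gamma_law k) (\<lambda>x. u x * v x)"
proof (rule Bochner_Integration.integrable_bound)
  interpret u: tame u u' K by fact
  interpret v: tame v v' L by fact
  show "integrable (gamma_law k) (\<lambda>x. (u x)\<^sup>2 + (v x)\<^sup>2)" using u.integrable_h2 v.integrable_h2 assms by auto
  have "\<bar>u x * v x\<bar> \<le> (u x)\<^sup>2 + (v x)\<^sup>2" for x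
    using sum_squares_bound[of "\<bar>u x\<bar>" "\<bar>v x\<bar>"] by (auto simp: abs_mult mult.assoc intro: order_trans[rotated])
  then show "AE x in gamma_law k. norm (u x * v x) \<le> norm ((u x)\<^sup>2 + (v x)\<^sup>2)" by simp
qed (use assms in \<open>auto simp: tame_def\<close>)

abbreviation exp_law3 :: "(real \<times> real \<times> real) measure" where
  "exp_law3 \<equiv> exp_law \<Otimes>\<^sub>M (exp_law \<Otimes>\<^sub>M exp_law)"

text \<open>The covariance formula rewritten for three independent variables: e is shared, e1 and e2
  are private. On the right the derivatives are evaluated at e + e1 and e + e2, each a sum of one
  more variable than on the left; this is why windows grow from length m to m + 1.\<close>

lemma exp_law3_covariance:
  assumes "tame u u' K" "tame v v' L"
    and i: "integrable exp_law3 (\<lambda>(e, e1, e2). u' (e + e1) * v' (e + e2))"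
  shows "(\<integral>(e, e1, e2). u e * v e \<partial>exp_law3) - (\<integral>(e, e1, e2). u e1 * v e2 \<partial>exp_law3)
    = (\<integral>(e, e1, e2). u' (e + e1) * v' (e + e2) \<partial>exp_law3)"
proof -
  interpret u: tame u u' K by fact
  interpret v: tame v v' L by fact
  interpret X: prob_space exp_law by (rule prob_space_exp_law)
  interpret XX: pair_prob_space exp_law exp_law ..
  interpret XXX: pair_prob_space exp_law "exp_law \<Otimes>\<^sub>M exp_law" ..
  note iu = u.integrable_h[of "Suc 0", unfolded One_nat_def gamma_law_1] and iv = v.integrable_h[of "Suc 0", unfolded One_nat_def gamma_law_1]
    and iuv = integrable_mult_tame[OF assms(1,2), of "Suc 0", unfolded One_nat_def gamma_law_1]
  have 1: "(\<integral>(e, e1, e2). u e * v e \<partial>exp_law3) = (\<integral>e. u e * v e \<partial>exp_law)"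
  proof -
    have "(\<integral>(e, z). (u e * v e) * (\<lambda>_. 1) z \<partial>exp_law3) = (\<integral>e. u e * v e \<partial>exp_law) * (\<integral>z. 1 \<partial>(exp_law \<Otimes>\<^sub>M exp_law))"
      using iuv by (intro XXX.integral_product_mult) auto
    then show ?thesis using XX.prob_space by (simp add: split_beta')
  qed
  have 2: "(\<integral>(e, e1, e2). u e1 * v e2 \<partial>exp_law3) = (\<integral>x. u x \<partial>exp_law) * (\<integral>x. v x \<partial>exp_law)"
  proof -
    have "(\<integral>(e, z). (\<lambda>_. 1) e * (case z of (e1, e2) \<Rightarrow> u e1 * v e2) \<partial>exp_law3)
      = (\<integral>e. 1 \<partial>exp_law) * (\<integral>(e1, e2). u e1 * v e2 \<partial>(exp_law \<Otimes>\<^sub>M exp_law))"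
      using iu iv by (intro XXX.integral_product_mult XX.integral_product_mult) auto
    then show ?thesis using XX.integral_product_mult(2)[of u v] iu iv X.prob_space by (simp add: split_beta')
  qed
  let ?g = "\<lambda>x. (\<integral>e. u' (x + e) \<partial>exp_law) * (\<integral>e. v' (x + e) \<partial>exp_law)"
  have ae: "AE e in exp_law. (\<integral>z. (case z of (e1, e2) \<Rightarrow> u' (e + e1) * v' (e + e2)) \<partial>(exp_law \<Otimes>\<^sub>M exp_law)) = ?g e"
    using AE_exp_law_pos
  proof eventually_elim
    case (elim e)
    then show ?case
      using XX.integral_product_mult(2)[of "\<lambda>e1. u' (e + e1)" "\<lambda>e2. v' (e + e2)"]
        u.integrable_deriv_shift v.integrable_deriv_shift by simp
  qed
  have [measurable]: "?g \<in> borel_measurable exp_law" by measurable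
  have i': "integrable exp_law (\<lambda>e. \<integral>z. (case z of (e1, e2) \<Rightarrow> u' (e + e1) * v' (e + e2)) \<partial>(exp_law \<Otimes>\<^sub>M exp_law))"
    using XXX.integrable_fst'[OF i] by (simp add: split_beta')
  have ig: "integrable exp_law ?g"
    using i' ae by (subst (asm) integrable_cong_AE) auto
  have 3: "(\<integral>(e, e1, e2). u' (e + e1) * v' (e + e2) \<partial>exp_law3) = (\<integral>x. ?g x \<partial>exp_law)"
  proof -
    have "(\<integral>(e, e1, e2). u' (e + e1) * v' (e + e2) \<partial>exp_law3)
      = (\<integral>e. \<integral>z. (case z of (e1, e2) \<Rightarrow> u' (e + e1) * v' (e + e2)) \<partial>(exp_law \<Otimes>\<^sub>M exp_law) \<partial>exp_law)"
      using XXX.integral_fst'[OF i] by (simp add: split_beta')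
    also have "\<dots> = (\<integral>x. ?g x \<partial>exp_law)" using ae by (intro integral_cong_AE) auto
    finally show ?thesis .
  qed
  have g: "\<bar>u x\<bar> \<le> (2 * K + 2 * L) * exp (x / 4)" "\<bar>v x\<bar> \<le> (2 * K + 2 * L) * exp (x / 4)" if "x \<ge> 1" for x
    using u.exp_growth[OF that] v.exp_growth[OF that] u.K_nonneg v.K_nonneg
    by (auto intro!: order_trans[OF u.exp_growth[OF that]] order_trans[OF v.exp_growth[OF that]] mult_right_mono)
  show ?thesis
    unfolding 1 2 3
    using u.deriv u.cont v.deriv v.cont iu iv iuv u.integrable_deriv_shift v.integrable_deriv_shift g ig
    by (intro exp_law_covariance[where K = "2 * K + 2 * L"]) auto
qed

section \<open>Moments of overlapping windows\<close>

definition overlap_moment :: "(real \<Rightarrow> real) \<Rightarrow> (real \<Rightarrow> real) \<Rightarrow> nat \<Rightarrow> nat \<Rightarrow> real" where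
  "overlap_moment f g m d = (\<integral>\<omega>. f (sum \<omega> {..<m}) * g (sum \<omega> {d..<d+m}) \<partial>exp_seq)"

lemma integrable_exp_seq_gamma:
  fixes f :: "real \<Rightarrow> real"
  assumes "finite S" "f \<in> borel_measurable borel"
  shows "integrable exp_seq (\<lambda>\<omega>. f (sum \<omega> S)) \<longleftrightarrow> integrable (gamma_law (card S)) f"
    and "(\<integral>\<omega>. f (sum \<omega> S) \<partial>exp_seq) = integral\<^sup>L (gamma_law (card S)) f"
  using assms by (simp_all add: distr_sum_coord[OF assms(1), symmetric] integrable_distr_eq integral_distr)

lemma measurable_fun_sum:
  "f \<in> borel_measurable borel \<Longrightarrow> (\<lambda>\<omega>. f (sum \<omega> S)) \<in> borel_measurable exp_seq"
  by (rule measurable_compose[where N = borel]) measurable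

lemma overlap_integrable_tame:
  assumes "tame u u' K" "tame v v' L" "finite S" "finite T" "S \<noteq> {}" "T \<noteq> {}"
  shows "integrable exp_seq (\<lambda>\<omega>. u (sum \<omega> S) * v (sum \<omega> T))"
proof (rule Bochner_Integration.integrable_bound)
  interpret u: tame u u' K by fact
  interpret v: tame v v' L by fact
  have c: "card S \<ge> 1" "card T \<ge> 1" using assms by (auto simp: Suc_le_eq card_gt_0_iff)
  have "integrable exp_seq (\<lambda>\<omega>. (\<lambda>x. (u x)\<^sup>2) (sum \<omega> S))" "integrable exp_seq (\<lambda>\<omega>. (\<lambda>x. (v x)\<^sup>2) (sum \<omega> T))"
    using u.integrable_h2[OF c(1)] v.integrable_h2[OF c(2)] assms by (subst integrable_exp_seq_gamma; auto)+
  then show "integrable exp_seq (\<lambda>\<omega>. (u (sum \<omega> S))\<^sup>2 + (v (sum \<omega> T))\<^sup>2)" by simp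
  have "\<bar>x * y\<bar> \<le> x\<^sup>2 + y\<^sup>2" for x y :: real
    using sum_squares_bound[of "\<bar>x\<bar>" "\<bar>y\<bar>"] by (auto simp: abs_mult mult.assoc intro: order_trans[rotated])
  then show "AE \<omega> in exp_seq. norm (u (sum \<omega> S) * v (sum \<omega> T)) \<le> norm ((u (sum \<omega> S))\<^sup>2 + (v (sum \<omega> T))\<^sup>2)" by simp
  show "(\<lambda>\<omega>. u (sum \<omega> S) * v (sum \<omega> T)) \<in> borel_measurable exp_seq"
    by (intro borel_measurable_times measurable_fun_sum) auto
qed

lemma overlap_moment_eq:
  assumes [measurable]: "f \<in> borel_measurable borel" "g \<in> borel_measurable borel"
    and "finite I" "finite J" "finite K" "I \<inter> J = {}" "I \<inter> K = {}" "J \<inter> K = {}"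
    and "card I = d" "card J = m - d" "card K = d" "d \<le> m"
  shows "(\<integral>\<omega>. f (sum \<omega> (I \<union> J)) * g (sum \<omega> (J \<union> K)) \<partial>exp_seq) = overlap_moment f g m d"
proof -
  have *: "{..<m} = {..<d} \<union> {d..<m}" "{d..<d+m} = {d..<m} \<union> {m..<d+m}" using assms by auto
  have "distr exp_seq borel (\<lambda>\<omega>. f (sum \<omega> (I \<union> J)) * g (sum \<omega> (J \<union> K)))
     = distr exp_seq borel (\<lambda>\<omega>. f (sum \<omega> ({..<d} \<union> {d..<m})) * g (sum \<omega> ({d..<m} \<union> {m..<d+m})))"
    using assms by (intro distr_overlap_sums[where F = "\<lambda>x y. f x * g y"]) auto
  then have "(\<integral>x. x \<partial>distr exp_seq borel (\<lambda>\<omega>. f (sum \<omega> (I \<union> J)) * g (sum \<omega> (J \<union> K))))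
    = (\<integral>x. x \<partial>distr exp_seq borel (\<lambda>\<omega>. f (sum \<omega> {..<m}) * g (sum \<omega> {d..<d+m})))" by (simp add: *)
  then show ?thesis by (simp add: integral_distr overlap_moment_def)
qed

text \<open>Moving the two windows apart by one position replaces a shared coordinate by two independent ones.
  The difference is a covariance over that coordinate, which \<open>exp_law_covariance\<close> turns into derivatives.\<close>

lemma overlap_moment_step:
  assumes "tame u u' K" "tame v v' L" and d: "d < m"
    and i: "integrable exp_seq (\<lambda>\<omega>. u' (sum \<omega> {..<Suc m}) * v' (sum \<omega> {Suc d..<Suc d + Suc m}))"
  shows "overlap_moment u v m d - overlap_moment u v m (Suc d) = overlap_moment u' v' (Suc m) (Suc d)"
proof -
  interpret u: tame u u' K by fact
  interpret v: tame v v' L by fact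
  interpret X: prob_space exp_law by (rule prob_space_exp_law)
  interpret XX: pair_prob_space exp_law exp_law ..
  interpret XXX: pair_prob_space exp_law "exp_law \<Otimes>\<^sub>M exp_law" ..
  \<comment> \<open>The windows of length m + 1 at distance d + 1 are {0}, I, J, {m} and J, {m}, H,
    {m + d + 1}. Position m is the shared variable singled out, positions 0 and m + d + 1 are the
    private ones.\<close>
  define J where "J = {Suc d..<m}"
  define I where "I = {1..d}"
  define H where "H = {Suc m..<Suc m + d}"
  define N where "N = distr exp_seq (borel \<Otimes>\<^sub>M borel) (\<lambda>\<omega>. (sum \<omega> I + sum \<omega> J, sum \<omega> J + sum \<omega> H))"
  have mI [measurable]: "(\<lambda>\<omega>. sum \<omega> S) \<in> borel_measurable exp_seq" for S by measurable
  interpret N: prob_space N unfolding N_def by (intro exp_seq.prob_space_distr) measurable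
  interpret NX: pair_prob_space N exp_law3 ..
  have sN [measurable_cong]: "sets N = sets (borel \<Otimes>\<^sub>M borel)" by (simp add: N_def)
  have fin: "finite I" "finite J" "finite H" by (auto simp: I_def J_def H_def)
  have joint: "distr exp_seq ((borel \<Otimes>\<^sub>M borel) \<Otimes>\<^sub>M (borel \<Otimes>\<^sub>M (borel \<Otimes>\<^sub>M borel)))
     (\<lambda>\<omega>. ((sum \<omega> I + sum \<omega> J, sum \<omega> J + sum \<omega> H), (\<omega> m, \<omega> 0, \<omega> (Suc (m + d))))) = N \<Otimes>\<^sub>M exp_law3"
  proof -
    have r: "sum (restrict \<omega> A) B = sum \<omega> B" if "B \<subseteq> A" for \<omega> :: "nat \<Rightarrow> real" and A B
      using that by (intro sum.cong) auto
    have m: "(\<lambda>x. sum x B :: real) \<in> borel_measurable (Pi\<^sub>M A (\<lambda>_. borel))" if "B \<subseteq> A" for A B :: "nat set"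
      using that by (intro borel_measurable_sum measurable_component_singleton) auto
    let ?A = "I \<union> J \<union> H" and ?B = "{m, 0, Suc (m + d)}"
    have "distr exp_seq ((borel \<Otimes>\<^sub>M borel) \<Otimes>\<^sub>M (borel \<Otimes>\<^sub>M (borel \<Otimes>\<^sub>M borel)))
      (\<lambda>\<omega>. ((\<lambda>x. (sum x I + sum x J, sum x J + sum x H)) (restrict \<omega> ?A), (\<lambda>x. (x m, x 0, x (Suc (m + d)))) (restrict \<omega> ?B)))
      = distr exp_seq (borel \<Otimes>\<^sub>M borel) (\<lambda>\<omega>. (\<lambda>x. (sum x I + sum x J, sum x J + sum x H)) (restrict \<omega> ?A))
        \<Otimes>\<^sub>M distr exp_seq (borel \<Otimes>\<^sub>M (borel \<Otimes>\<^sub>M borel)) (\<lambda>\<omega>. (\<lambda>x. (x m, x 0, x (Suc (m + d)))) (restrict \<omega> ?B))"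
      using d by (intro distr_pair_disjoint measurable_Pair borel_measurable_add m measurable_component_singleton)
         (auto simp: I_def J_def H_def)
    moreover have "distr exp_seq (borel \<Otimes>\<^sub>M (borel \<Otimes>\<^sub>M borel)) (\<lambda>\<omega>. (\<omega> m, \<omega> 0, \<omega> (Suc (m + d)))) = exp_law3"
      using distr_three_sums[of "{m}" "{0}" "{Suc (m + d)}"] d by (simp add: gamma_law_1)
    ultimately show ?thesis by (simp add: r N_def)
  qed
  let ?X = "\<lambda>\<omega>::nat \<Rightarrow> real. ((sum \<omega> I + sum \<omega> J, sum \<omega> J + sum \<omega> H), (\<omega> m, \<omega> 0, \<omega> (Suc (m + d))))"
  let ?b = "(borel \<Otimes>\<^sub>M borel) \<Otimes>\<^sub>M (borel \<Otimes>\<^sub>M (borel \<Otimes>\<^sub>M borel)) :: ((real \<times> real) \<times> (real \<times> real \<times> real)) measure"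
  have [measurable]: "?X \<in> exp_seq \<rightarrow>\<^sub>M ?b" by measurable
  \<comment> \<open>In \<open>?f1\<close> both windows of length m contain position m, so they share
    m - d positions. In \<open>?f2\<close> the private positions replace it, so they share m - d -
    1. In \<open>?f3\<close> all three enter, giving length m + 1 with m - d shared
    positions.\<close>
  let ?f1 = "\<lambda>z. u (fst (fst z) + fst (snd z)) * v (snd (fst z) + fst (snd z))"
  let ?f2 = "\<lambda>z. u (fst (fst z) + fst (snd (snd z))) * v (snd (fst z) + snd (snd (snd z)))"
  let ?f3 = "\<lambda>z. u' (fst (fst z) + (fst (snd z) + fst (snd (snd z)))) * v' (snd (fst z) + (fst (snd z) + snd (snd (snd z))))"
  have mf: "?f1 \<in> borel_measurable ?b" "?f2 \<in> borel_measurable ?b" "?f3 \<in> borel_measurable ?b"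
    by measurable
  have tr: "integrable (N \<Otimes>\<^sub>M exp_law3) f \<longleftrightarrow> integrable exp_seq (\<lambda>\<omega>. f (?X \<omega>))"
      "integral\<^sup>L (N \<Otimes>\<^sub>M exp_law3) f = (\<integral>\<omega>. f (?X \<omega>) \<partial>exp_seq)"
    if "f \<in> borel_measurable ?b" for f :: "_ \<Rightarrow> real"
    unfolding joint[symmetric] using that by (auto simp: integrable_distr_eq integral_distr)
  have s1: "sum \<omega> I + sum \<omega> J + \<omega> m = sum \<omega> (I \<union> insert m J)" "sum \<omega> J + sum \<omega> H + \<omega> m = sum \<omega> (insert m J \<union> H)"
    "sum \<omega> I + sum \<omega> J + \<omega> 0 = sum \<omega> (insert 0 I \<union> J)"
    "sum \<omega> J + sum \<omega> H + \<omega> (Suc (m + d)) = sum \<omega> (J \<union> insert (Suc (m + d)) H)"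
    "sum \<omega> I + sum \<omega> J + (\<omega> m + \<omega> 0) = sum \<omega> {..<Suc m}"
    "sum \<omega> J + sum \<omega> H + (\<omega> m + \<omega> (Suc (m + d))) = sum \<omega> {Suc d..<Suc d + Suc m}" for \<omega> :: "nat \<Rightarrow> real"
  proof -
    show "sum \<omega> I + sum \<omega> J + \<omega> m = sum \<omega> (I \<union> insert m J)"
      using d by (subst sum.union_disjoint) (auto simp: I_def J_def)
    show "sum \<omega> J + sum \<omega> H + \<omega> m = sum \<omega> (insert m J \<union> H)"
      using d by (subst sum.union_disjoint) (auto simp: H_def J_def)
    show "sum \<omega> I + sum \<omega> J + \<omega> 0 = sum \<omega> (insert 0 I \<union> J)"
      using d by (subst sum.union_disjoint) (auto simp: I_def J_def)
    show "sum \<omega> J + sum \<omega> H + \<omega> (Suc (m + d)) = sum \<omega> (J \<union> insert (Suc (m + d)) H)"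
      using d by (subst sum.union_disjoint) (auto simp: H_def J_def)
    have e: "{..<Suc m} = insert 0 I \<union> insert m J" "{Suc d..<Suc d + Suc m} = insert m J \<union> insert (Suc (m + d)) H"
      using d by (auto simp: I_def J_def H_def)
    show "sum \<omega> I + sum \<omega> J + (\<omega> m + \<omega> 0) = sum \<omega> {..<Suc m}"
      unfolding e using d by (subst sum.union_disjoint) (auto simp: I_def J_def)
    show "sum \<omega> J + sum \<omega> H + (\<omega> m + \<omega> (Suc (m + d))) = sum \<omega> {Suc d..<Suc d + Suc m}"
      unfolding e using d by (subst sum.union_disjoint) (auto simp: H_def J_def)
  qed
  have i1: "integrable (N \<Otimes>\<^sub>M exp_law3) ?f1"
    using overlap_integrable_tame[OF assms(1,2), of "I \<union> insert m J" "insert m J \<union> H"] fin mf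
    by (subst tr) (auto simp: s1)
  have i2: "integrable (N \<Otimes>\<^sub>M exp_law3) ?f2"
    using overlap_integrable_tame[OF assms(1,2), of "insert 0 I \<union> J" "J \<union> insert (Suc (m + d)) H"] fin mf
    by (subst tr) (auto simp: s1)
  have i3: "integrable (N \<Otimes>\<^sub>M exp_law3) ?f3"
    using i mf by (subst tr) (auto simp: s1)
  have v1: "integral\<^sup>L (N \<Otimes>\<^sub>M exp_law3) ?f1 = overlap_moment u v m d"
  proof -
    have "(\<integral>\<omega>. u (sum \<omega> (I \<union> insert m J)) * v (sum \<omega> (insert m J \<union> H)) \<partial>exp_seq) = overlap_moment u v m d"
      using d by (intro overlap_moment_eq) (auto simp: I_def J_def H_def)
    then show ?thesis using mf by (subst tr) (auto simp: s1)
  qed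
  have v2: "integral\<^sup>L (N \<Otimes>\<^sub>M exp_law3) ?f2 = overlap_moment u v m (Suc d)"
  proof -
    have "(\<integral>\<omega>. u (sum \<omega> (insert 0 I \<union> J)) * v (sum \<omega> (J \<union> insert (Suc (m + d)) H)) \<partial>exp_seq) = overlap_moment u v m (Suc d)"
      using d by (intro overlap_moment_eq) (auto simp: I_def J_def H_def)
    then show ?thesis using mf by (subst tr) (auto simp: s1)
  qed
  have v3: "integral\<^sup>L (N \<Otimes>\<^sub>M exp_law3) ?f3 = overlap_moment u' v' (Suc m) (Suc d)"
    using mf by (subst tr) (auto simp: s1 overlap_moment_def)
  have nonneg: "AE z in N. 0 \<le> fst z \<and> 0 \<le> snd z"
    unfolding N_def
  proof (subst AE_distr_iff)
    show "AE \<omega> in exp_seq. 0 \<le> fst (sum \<omega> I + sum \<omega> J, sum \<omega> J + sum \<omega> H) \<and> 0 \<le> snd (sum \<omega> I + sum \<omega> J, sum \<omega> J + sum \<omega> H)"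
      using AE_exp_seq_pos by eventually_elim (simp add: add_nonneg_nonneg sum_nonneg less_imp_le)
  qed measurable
  \<comment> \<open>For fixed z = (a, b) this is the covariance formula for the translates by a and
    b, which are nonnegative almost surely.\<close>
  have "AE z in N. (\<integral>y. ?f1 (z, y) \<partial>exp_law3) - (\<integral>y. ?f2 (z, y) \<partial>exp_law3) = (\<integral>y. ?f3 (z, y) \<partial>exp_law3)"
    using nonneg NX.AE_integrable_fst'[OF i3]
  proof eventually_elim
    case (elim z)
    obtain a b where z: "z = (a, b)" by force
    then show ?case
      using exp_law3_covariance[OF u.tame_translate[of a] v.tame_translate[of b]] elim by (simp add: z split_beta')
  qed
  then have "(\<integral>z. (\<integral>y. ?f1 (z, y) \<partial>exp_law3) - (\<integral>y. ?f2 (z, y) \<partial>exp_law3) \<partial>N) = (\<integral>z. (\<integral>y. ?f3 (z, y) \<partial>exp_law3) \<partial>N)"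
    by (intro integral_cong_AE) (use NX.integrable_fst'[OF i1] NX.integrable_fst'[OF i2] NX.integrable_fst'[OF i3] in auto)
  then show ?thesis
    using NX.integrable_fst'[OF i1] NX.integrable_fst'[OF i2]
      NX.integral_fst'[OF i1, unfolded v1] NX.integral_fst'[OF i2, unfolded v2] NX.integral_fst'[OF i3, unfolded v3]
    by simp
qed

section \<open>Cyclic sums\<close>

definition cyc :: "nat \<Rightarrow> nat \<Rightarrow> nat \<Rightarrow> nat set" where
  "cyc n m k = (\<lambda>j. (k + j) mod n) ` {..<m}"

lemma inj_on_cyclic_shift: "inj_on (\<lambda>j. (k + j) mod n) {..<n::nat}"
proof (rule inj_onI)
  fix i j assume *: "i \<in> {..<n}" "j \<in> {..<n}" "(k + i) mod n = (k + j) mod n"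
  then have "int n dvd int i - int j"
    by (metis add_diff_cancel_left mod_eq_dvd_iff of_nat_add of_nat_mod)
  then have "int i mod int n = int j mod int n" by (simp add: mod_eq_dvd_iff)
  then show "i = j" using * by (simp flip: of_nat_mod)
qed

lemma cyc_no_wrap: "k + m \<le> n \<Longrightarrow> cyc n m k = {k..<k+m}"
proof -
  assume "k + m \<le> n"
  then have "(\<lambda>j. (k + j) mod n) ` {..<m} = (\<lambda>j. k + j) ` {..<m}" by (intro image_cong) auto
  also have "\<dots> = {k..<k+m}" by (auto simp: image_iff le_iff_add)
  finally show ?thesis by (simp add: cyc_def)
qed

lemma finite_cyc [simp]: "finite (cyc n m k)"
  by (simp add: cyc_def)

lemma card_cyc: "m \<le> n \<Longrightarrow> card (cyc n m k) = m"
  unfolding cyc_def by (subst card_image) (auto intro: inj_on_subset[OF inj_on_cyclic_shift])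

lemma sum_cyc: "m \<le> n \<Longrightarrow> sum f (cyc n m k) = (\<Sum>j<m. f ((k + j) mod n))"
  unfolding cyc_def by (subst sum.reindex) (auto intro: inj_on_subset[OF inj_on_cyclic_shift])

text \<open>Rotation by k is injective on the n residues, and for d + m <= n the two arcs do not
  meet again behind the wrap. Their overlap pattern is therefore that of two intervals. All
  distances from m on mean disjoint windows, hence the minimum.\<close>

lemma cyc_overlap:
  assumes [measurable]: "f \<in> borel_measurable borel" "g \<in> borel_measurable borel"
    and m: "2 * m \<le> n" and d: "d \<le> n - m"
  shows "(\<integral>\<omega>. f (sum \<omega> (cyc n m k)) * g (sum \<omega> (cyc n m ((k + d) mod n))) \<partial>exp_seq)
    = overlap_moment f g m (min d m)"
proof -
  let ?s = "\<lambda>j. (k + j) mod n"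
  have img: "inj_on ?s A" if "A \<subseteq> {..<n}" for A using that by (rule inj_on_subset[OF inj_on_cyclic_shift])
  have dis: "?s ` A \<inter> ?s ` B = {}" if "A \<inter> B = {}" "A \<subseteq> {..<n}" "B \<subseteq> {..<n}" for A B
    using inj_on_image_Int[OF inj_on_cyclic_shift, of A n B k] that by simp
  have 2: "cyc n m ((k + d) mod n) = ?s ` {d..<d+m}"
  proof -
    have "cyc n m ((k + d) mod n) = (\<lambda>j. ?s (d + j)) ` {..<m}"
      unfolding cyc_def by (intro image_cong) (auto simp: mod_simps add.assoc)
    also have "\<dots> = ?s ` ((\<lambda>j. d + j) ` {..<m})" by (simp add: image_image)
    also have "(\<lambda>j. d + j) ` {..<m} = {d..<d+m}" by (auto simp: image_iff le_iff_add)
    finally show ?thesis .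
  qed
  define e where "e = min d m"
  have A: "{..<m} = {..<e} \<union> {d..<m}" and B: "{d..<d+m} = {d..<m} \<union> {max d m..<d+m}"
    by (auto simp: e_def)
  have "(\<integral>\<omega>. f (sum \<omega> (?s ` {..<e} \<union> ?s ` {d..<m})) * g (sum \<omega> (?s ` {d..<m} \<union> ?s ` {max d m..<d+m})) \<partial>exp_seq)
    = overlap_moment f g m e"
  proof (rule overlap_moment_eq)
    show "card (?s ` {..<e}) = e" "card (?s ` {d..<m}) = m - e" "card (?s ` {max d m..<d+m}) = e"
      using m d by (subst card_image; auto intro!: img simp: e_def min_def max_def)+
    show "?s ` {..<e} \<inter> ?s ` {d..<m} = {}" "?s ` {..<e} \<inter> ?s ` {max d m..<d+m} = {}"
      "?s ` {d..<m} \<inter> ?s ` {max d m..<d+m} = {}"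
      using m d by (intro dis; auto simp: e_def)+
  qed (auto simp: e_def)
  then show ?thesis
    unfolding 2 cyc_def[of n m k] e_def[symmetric] by (simp only: image_Un[symmetric] A[symmetric] B[symmetric])
qed

lemma distr_shift_seq: "distr exp_seq exp_seq (\<lambda>\<omega> i. \<omega> (i + a)) = exp_seq"
proof -
  have "distr (Pi\<^sub>M UNIV (\<lambda>_. exp_law)) (Pi\<^sub>M UNIV (\<lambda>_. exp_law)) (\<lambda>\<omega>. \<lambda>n\<in>UNIV. \<omega> (n + a)) = Pi\<^sub>M UNIV (\<lambda>_. exp_law)"
    using distr_PiM_reindex[where M = "\<lambda>_. exp_law" and K = UNIV and I = UNIV and f = "\<lambda>n. n + a"]
    by (simp add: prob_space_exp_law)
  then show ?thesis by (simp add: exp_seq_def restrict_def)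
qed

lemma overlap_moment_full:
  assumes [measurable]: "f \<in> borel_measurable borel" "g \<in> borel_measurable borel"
    and i: "integrable (gamma_law m) f" "integrable (gamma_law m) g"
  shows "overlap_moment f g m m = integral\<^sup>L (gamma_law m) f * integral\<^sup>L (gamma_law m) g"
proof -
  interpret G: prob_space "gamma_law m" by (rule prob_space_gamma_law)
  interpret GG: pair_prob_space "gamma_law m" "gamma_law m" ..
  have r: "sum (restrict \<omega> A) A = sum \<omega> A" for \<omega> :: "nat \<Rightarrow> real" and A by (intro sum.cong) auto
  have m: "(\<lambda>x. sum x A :: real) \<in> borel_measurable (Pi\<^sub>M A (\<lambda>_. borel))" for A :: "nat set"
    by (intro borel_measurable_sum measurable_component_singleton) auto
  have "distr exp_seq (borel \<Otimes>\<^sub>M borel) (\<lambda>\<omega>. (sum (restrict \<omega> {..<m}) {..<m}, sum (restrict \<omega> {m..<m+m}) {m..<m+m}))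
     = distr exp_seq borel (\<lambda>\<omega>. sum (restrict \<omega> {..<m}) {..<m}) \<Otimes>\<^sub>M distr exp_seq borel (\<lambda>\<omega>. sum (restrict \<omega> {m..<m+m}) {m..<m+m})"
    by (intro distr_pair_disjoint m) auto
  then have *: "distr exp_seq (borel \<Otimes>\<^sub>M borel) (\<lambda>\<omega>. (sum \<omega> {..<m}, sum \<omega> {m..<m+m})) = gamma_law m \<Otimes>\<^sub>M gamma_law m"
    by (simp add: r distr_sum_coord)
  have "overlap_moment f g m m = integral\<^sup>L (distr exp_seq (borel \<Otimes>\<^sub>M borel) (\<lambda>\<omega>. (sum \<omega> {..<m}, sum \<omega> {m..<m+m}))) (\<lambda>z. f (fst z) * g (snd z))"
    by (subst integral_distr) (auto simp: overlap_moment_def)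
  also have "\<dots> = integral\<^sup>L (gamma_law m) f * integral\<^sup>L (gamma_law m) g"
    unfolding * using GG.integral_product_mult(2)[OF i] by (simp add: split_beta')
  finally show ?thesis .
qed

text \<open>The sum of the covariances over all lags d with |d| < m. It is the variance per window
  of the cyclic sum of a centred kernel as soon as 2 m <= n.\<close>

definition cyclic_variance :: "(real \<Rightarrow> real) \<Rightarrow> nat \<Rightarrow> real" where
  "cyclic_variance h m = overlap_moment h h m 0 + 2 * (\<Sum>d=1..<m. overlap_moment h h m d)"

definition cyclic_sum :: "(real \<Rightarrow> real) \<Rightarrow> nat \<Rightarrow> nat \<Rightarrow> (nat \<Rightarrow> real) \<Rightarrow> real" where
  "cyclic_sum h n m \<omega> = (\<Sum>k<n. h (sum \<omega> (cyc n m k)))"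

text \<open>What the central limit theorem asks of a kernel: mean zero and a fourth moment.
  Smoothness enters only when the variances are computed.\<close>

locale centred =
  fixes h :: "real \<Rightarrow> real" and m :: nat
  assumes m_pos: "m \<ge> 1"
    and h_meas [measurable]: "h \<in> borel_measurable borel"
    and int4: "integrable (gamma_law m) (\<lambda>x. h x ^ 4)"
    and mean0: "integral\<^sup>L (gamma_law m) h = 0"
begin

lemma integrable_kernel_square: "integrable (gamma_law m) (\<lambda>x. (h x)\<^sup>2)"
  by (rule prob_space.integrable_square_of_power4[OF prob_space_gamma_law _ int4]) measurable

lemma integrable_kernel: "integrable (gamma_law m) h"
proof -
  interpret prob_space "gamma_law m" by (rule prob_space_gamma_law)
  show ?thesis using integrable_kernel_square by (rule square_integrable_imp_integrable[rotated]) measurable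
qed

abbreviation V where "V \<equiv> integral\<^sup>L (gamma_law m) (\<lambda>x. (h x)\<^sup>2)"

lemma V_nonneg: "V \<ge> 0" by simp

lemma integrable_overlap_product:
  assumes "finite S" "finite T" "card S = m" "card T = m"
  shows "integrable exp_seq (\<lambda>\<omega>. h (sum \<omega> S) * h (sum \<omega> T))"
    and "\<bar>\<integral>\<omega>. h (sum \<omega> S) * h (sum \<omega> T) \<partial>exp_seq\<bar> \<le> V"
proof -
  have i: "integrable exp_seq (\<lambda>\<omega>. (h (sum \<omega> S))\<^sup>2)" "integrable exp_seq (\<lambda>\<omega>. (h (sum \<omega> T))\<^sup>2)"
    using integrable_kernel_square assms integrable_exp_seq_gamma(1)[of _ "\<lambda>x. (h x)\<^sup>2"] by auto
  have e: "(\<integral>\<omega>. (h (sum \<omega> S))\<^sup>2 \<partial>exp_seq) = V" "(\<integral>\<omega>. (h (sum \<omega> T))\<^sup>2 \<partial>exp_seq) = V"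
    using assms integrable_exp_seq_gamma(2)[of _ "\<lambda>x. (h x)\<^sup>2"] by auto
  have b: "\<bar>x * y\<bar> \<le> (x\<^sup>2 + y\<^sup>2) / 2" for x y :: real
    using sum_squares_bound[of "\<bar>x\<bar>" "\<bar>y\<bar>"] by (auto simp: abs_mult)
  show p: "integrable exp_seq (\<lambda>\<omega>. h (sum \<omega> S) * h (sum \<omega> T))"
  proof (rule Bochner_Integration.integrable_bound)
    show "integrable exp_seq (\<lambda>\<omega>. ((h (sum \<omega> S))\<^sup>2 + (h (sum \<omega> T))\<^sup>2) / 2)" using i by simp
    show "AE \<omega> in exp_seq. norm (h (sum \<omega> S) * h (sum \<omega> T)) \<le> norm (((h (sum \<omega> S))\<^sup>2 + (h (sum \<omega> T))\<^sup>2) / 2)"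
      using b by simp
    show "(\<lambda>\<omega>. h (sum \<omega> S) * h (sum \<omega> T)) \<in> borel_measurable exp_seq"
      by (intro borel_measurable_times measurable_fun_sum) auto
  qed
  have "\<bar>\<integral>\<omega>. h (sum \<omega> S) * h (sum \<omega> T) \<partial>exp_seq\<bar> \<le> (\<integral>\<omega>. \<bar>h (sum \<omega> S) * h (sum \<omega> T)\<bar> \<partial>exp_seq)"
    by (rule integral_abs_bound)
  also have "\<dots> \<le> (\<integral>\<omega>. ((h (sum \<omega> S))\<^sup>2 + (h (sum \<omega> T))\<^sup>2) / 2 \<partial>exp_seq)"
    using p i b by (intro integral_mono) auto
  also have "\<dots> = V" using i e by simp
  finally show "\<bar>\<integral>\<omega>. h (sum \<omega> S) * h (sum \<omega> T) \<partial>exp_seq\<bar> \<le> V" .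
qed

lemma overlap_zero: "overlap_moment h h m m = 0"
  using overlap_moment_full[OF h_meas h_meas integrable_kernel integrable_kernel] mean0 by simp

definition G :: "nat \<Rightarrow> nat \<Rightarrow> nat \<Rightarrow> real" where
  "G n k l = (\<integral>\<omega>. h (sum \<omega> (cyc n m k)) * h (sum \<omega> (cyc n m l)) \<partial>exp_seq)"

lemma G_eq_overlap_moment:
  assumes "2 * m \<le> n" "k < n" "d < n"
  shows "G n k ((k + d) mod n) = (if d < m then overlap_moment h h m d
    else if n - d < m then overlap_moment h h m (n - d) else 0)"
proof (cases "d \<le> n - m")
  case True
  then show ?thesis
    using cyc_overlap[OF h_meas h_meas assms(1) True, of k] overlap_zero assms by (auto simp: G_def min_def)
next
  \<comment> \<open>Here the second window reaches round the circle to the first one. Seen from its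
    own starting point the distance is n - d, and the roles of the windows are exchanged.\<close>
  case False
  let ?l = "(k + d) mod n"
  have "(?l + (n - d)) mod n = (k + d + (n - d)) mod n" by (rule mod_add_left_eq)
  then have l: "(?l + (n - d)) mod n = k" using assms by simp
  have "n - d \<le> n - m" using False assms by auto
  from cyc_overlap[OF h_meas h_meas assms(1) this, of ?l, unfolded l]
  have "G n k ?l = overlap_moment h h m (min (n - d) m)"
    unfolding G_def by (subst mult.commute)
  moreover have "\<not> d < m" "n - d < m" using False assms by auto
  ultimately show ?thesis by (simp add: min_def)
qed

lemma G_abs_le: "m \<le> n \<Longrightarrow> \<bar>G n k l\<bar> \<le> V"
  unfolding G_def by (intro integrable_overlap_product) (auto simp: card_cyc)

lemma sum_cyclic_reindex: "k < n \<Longrightarrow> (\<Sum>l<n. f l) = (\<Sum>d<n. f ((k + d) mod n))" for f :: "nat \<Rightarrow> real"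
proof -
  assume "k < n"
  have "(\<lambda>d. (k + d) mod n) ` {..<n} = {..<n}"
    using \<open>k < n\<close> by (intro endo_inj_surj inj_on_cyclic_shift) auto
  then show ?thesis by (metis (no_types, lifting) inj_on_cyclic_shift sum.reindex_cong)
qed

text \<open>The covariance matrix is circulant, so each row sums to the same value. The condition 2
  m <= n keeps the lags d and n - d from both being below m.\<close>

lemma sum_G: "2 * m \<le> n \<Longrightarrow> k < n \<Longrightarrow> (\<Sum>l<n. G n k l) = cyclic_variance h m"
proof -
  assume n: "2 * m \<le> n" "k < n"
  let ?g = "overlap_moment h h m"
  have "(\<Sum>l<n. G n k l) = (\<Sum>d<n. G n k ((k + d) mod n))"
    by (rule sum_cyclic_reindex[OF n(2)])
  also have "\<dots> = (\<Sum>d<n. if d < m then ?g d else if n - d < m then ?g (n - d) else 0)"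
    using n by (intro sum.cong) (auto simp: G_eq_overlap_moment)
  also have "\<dots> = (\<Sum>d<n. (if d < m then ?g d else 0) + (if n - d < m then ?g (n - d) else 0))"
    using n by (intro sum.cong) auto
  also have "\<dots> = (\<Sum>d<n. if d < m then ?g d else 0) + (\<Sum>d<n. if n - d < m then ?g (n - d) else 0)"
    by (rule sum.distrib)
  also have "(\<Sum>d<n. if d < m then ?g d else 0) = (\<Sum>d<m. ?g d)"
    using n by (intro sum.mono_neutral_cong_right) auto
  also have "\<dots> = ?g 0 + (\<Sum>d=1..<m. ?g d)"
    using m_pos by (simp add: lessThan_atLeast0 sum.atLeast_Suc_lessThan)
  also have "(\<Sum>d<n. if n - d < m then ?g (n - d) else 0) = (\<Sum>d=1..<m. ?g d)"
  proof -
    have "(\<Sum>d<n. if n - d < m then ?g (n - d) else 0) = (\<Sum>d\<in>{d. d < n \<and> n - d < m}. ?g (n - d))"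
      by (intro sum.mono_neutral_cong_right) auto
    also have "\<dots> = (\<Sum>d=1..<m. ?g d)"
      using n by (intro sum.reindex_bij_witness[where i = "\<lambda>d. n - d" and j = "\<lambda>d. n - d"]) auto
    finally show ?thesis .
  qed
  finally show ?thesis by (simp add: cyclic_variance_def)
qed

text \<open>At most 2 m windows overlap a given one, and each covariance is at most V. This bounds
  the second moment over any set of leftover windows without knowing its shape.\<close>

lemma sum_abs_G: "2 * m \<le> n \<Longrightarrow> k < n \<Longrightarrow> (\<Sum>l<n. \<bar>G n k l\<bar>) \<le> 2 * real m * V"
proof -
  assume n: "2 * m \<le> n" "k < n"
  have "(\<Sum>l<n. \<bar>G n k l\<bar>) = (\<Sum>d<n. \<bar>G n k ((k + d) mod n)\<bar>)"
    by (rule sum_cyclic_reindex[OF n(2)])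
  also have "\<dots> \<le> (\<Sum>d<n. if d < m \<or> n - m < d then V else 0)"
  proof (rule sum_mono)
    fix d assume "d \<in> {..<n}"
    then show "\<bar>G n k ((k + d) mod n)\<bar> \<le> (if d < m \<or> n - m < d then V else 0)"
      using n G_eq_overlap_moment[OF n, of d] G_abs_le[of n k "(k + d) mod n"] by auto
  qed
  also have "\<dots> = real (card {d. d < n \<and> (d < m \<or> n - m < d)}) * V"
    by (subst sum.inter_filter[symmetric]) (auto simp: conj_commute)
  also have "\<dots> \<le> real (2 * m) * V"
  proof (intro mult_right_mono V_nonneg of_nat_mono)
    have "card {d. d < n \<and> (d < m \<or> n - m < d)} \<le> card ({..<m} \<union> {n-m..<n})"
      by (intro card_mono) auto
    also have "\<dots> \<le> card {..<m} + card {n-m..<n}" by (rule card_Un_le)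
    also have "\<dots> \<le> 2 * m" by auto
    finally show "card {d. d < n \<and> (d < m \<or> n - m < d)} \<le> 2 * m" .
  qed
  finally show ?thesis by simp
qed

lemma second_moment_subset:
  assumes "m \<le> n" "finite A"
  shows "integrable exp_seq (\<lambda>\<omega>. (\<Sum>k\<in>A. h (sum \<omega> (cyc n m k)))\<^sup>2)"
    and "(\<integral>\<omega>. (\<Sum>k\<in>A. h (sum \<omega> (cyc n m k)))\<^sup>2 \<partial>exp_seq) = (\<Sum>k\<in>A. \<Sum>l\<in>A. G n k l)"
proof -
  have *: "(\<Sum>k\<in>A. h (sum \<omega> (cyc n m k)))\<^sup>2 = (\<Sum>k\<in>A. \<Sum>l\<in>A. h (sum \<omega> (cyc n m k)) * h (sum \<omega> (cyc n m l)))" for \<omega>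
    by (simp add: power2_eq_square sum_product)
  have i: "integrable exp_seq (\<lambda>\<omega>. h (sum \<omega> (cyc n m k)) * h (sum \<omega> (cyc n m l)))" for k l
    using assms by (intro integrable_overlap_product) (auto simp: card_cyc)
  show "integrable exp_seq (\<lambda>\<omega>. (\<Sum>k\<in>A. h (sum \<omega> (cyc n m k)))\<^sup>2)"
    unfolding * using i by auto
  show "(\<integral>\<omega>. (\<Sum>k\<in>A. h (sum \<omega> (cyc n m k)))\<^sup>2 \<partial>exp_seq) = (\<Sum>k\<in>A. \<Sum>l\<in>A. G n k l)"
    unfolding * G_def using i by simp
qed

lemma second_moment:
  assumes "2 * m \<le> n"
  shows "(\<integral>\<omega>. (cyclic_sum h n m \<omega>)\<^sup>2 \<partial>exp_seq) = real n * cyclic_variance h m"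
  using second_moment_subset(2)[of n "{..<n}"] assms by (simp add: cyclic_sum_def sum_G)

lemma second_moment_subset_le:
  assumes "2 * m \<le> n" "A \<subseteq> {..<n}"
  shows "(\<integral>\<omega>. (\<Sum>k\<in>A. h (sum \<omega> (cyc n m k)))\<^sup>2 \<partial>exp_seq) \<le> real (card A) * (2 * real m * V)"
proof -
  have fin: "finite A" using assms by (auto intro: finite_subset)
  have "(\<Sum>k\<in>A. \<Sum>l\<in>A. G n k l) \<le> (\<Sum>k\<in>A. 2 * real m * V)"
  proof (rule sum_mono)
    fix k assume k: "k \<in> A"
    have "(\<Sum>l\<in>A. G n k l) \<le> (\<Sum>l\<in>A. \<bar>G n k l\<bar>)" by (intro sum_mono) auto
    also have "\<dots> \<le> (\<Sum>l<n. \<bar>G n k l\<bar>)" using assms by (intro sum_mono2) auto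
    also have "\<dots> \<le> 2 * real m * V" using assms k by (intro sum_abs_G) auto
    finally show "(\<Sum>l\<in>A. G n k l) \<le> 2 * real m * V" .
  qed
  then show ?thesis using second_moment_subset(2)[of n A] assms fin by simp
qed

end

section \<open>Central limit theorem for cyclic sums\<close>

lemma expectation_shift_seq:
  fixes F :: "(nat \<Rightarrow> real) \<Rightarrow> real"
  assumes F: "F \<in> borel_measurable exp_seq"
  shows "(\<integral>\<omega>. F (\<lambda>i. \<omega> (i + a)) \<partial>exp_seq) = integral\<^sup>L exp_seq F"
    and "integrable exp_seq (\<lambda>\<omega>. F (\<lambda>i. \<omega> (i + a))) \<longleftrightarrow> integrable exp_seq F"
    and "distr exp_seq borel (\<lambda>\<omega>. F (\<lambda>i. \<omega> (i + a))) = distr exp_seq borel F"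
proof -
  have m: "(\<lambda>\<omega> i. \<omega> (i + a)) \<in> exp_seq \<rightarrow>\<^sub>M exp_seq"
    unfolding measurable_cong_sets[OF refl sets_exp_seq] by (rule measurable_abs_UNIV) (simp add: measurable_coord)
  show "(\<integral>\<omega>. F (\<lambda>i. \<omega> (i + a)) \<partial>exp_seq) = integral\<^sup>L exp_seq F"
    using integral_distr[OF m F] by (simp add: distr_shift_seq)
  show "integrable exp_seq (\<lambda>\<omega>. F (\<lambda>i. \<omega> (i + a))) \<longleftrightarrow> integrable exp_seq F"
    using integrable_distr_eq[OF m F] by (simp add: distr_shift_seq)
  show "distr exp_seq borel (\<lambda>\<omega>. F (\<lambda>i. \<omega> (i + a))) = distr exp_seq borel F"
    using distr_distr[OF F m] by (simp add: distr_shift_seq comp_def)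
qed

lemma power4_sum_le: "(\<Sum>i<L. x i) ^ 4 \<le> real L ^ 3 * (\<Sum>i<L. x i ^ 4)" for x :: "nat \<Rightarrow> real"
proof -
  have "(\<Sum>i<L. x i) ^ 4 = ((\<Sum>i<L. x i)\<^sup>2)\<^sup>2" by simp
  also have "\<dots> \<le> ((\<Sum>i<L. (x i)\<^sup>2) * card {..<L})\<^sup>2"
    by (intro power_mono sum_squared_le_sum_of_squares) auto
  also have "\<dots> = real L ^ 2 * (\<Sum>i<L. (x i)\<^sup>2)\<^sup>2" by (simp add: power_mult_distrib)
  also have "\<dots> \<le> real L ^ 2 * ((\<Sum>i<L. ((x i)\<^sup>2)\<^sup>2) * card {..<L})"
    by (intro mult_left_mono sum_squared_le_sum_of_squares) auto
  finally show ?thesis by (simp add: power3_eq_cube power2_eq_square power4_eq_xxxx ac_simps)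
qed

lemma one_minus_power_exp:
  fixes a :: real assumes "0 \<le> a" "a \<le> 1"
  shows "\<bar>(1 - a) ^ N - exp (- (real N * a))\<bar> \<le> real N * a\<^sup>2"
proof -
  have "1 - a \<le> exp (- a)" using exp_ge_add_one_self[of "- a"] by simp
  moreover have "exp (- a) \<le> 1 - a + a\<^sup>2"
  proof -
    \<comment> \<open>The product equals 1 + a^3.\<close>
    have "1 \<le> (1 - a + a\<^sup>2) * (1 + a)" using assms by (simp add: algebra_simps power2_eq_square power3_eq_cube)
    also have "\<dots> \<le> (1 - a + a\<^sup>2) * exp a" using assms by (intro mult_left_mono exp_ge_add_one_self) auto
    finally show ?thesis by (simp add: exp_minus field_simps)
  qed
  ultimately have *: "\<bar>(1 - a) - exp (- a)\<bar> \<le> a\<^sup>2" by simp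
  have "\<bar>(1 - a) ^ N - exp (- a) ^ N\<bar> \<le> real N * \<bar>(1 - a) - exp (- a)\<bar>"
    using norm_power_diff[of "1 - a" "exp (- a)" N] assms by simp
  also have "\<dots> \<le> real N * a\<^sup>2" using * by (intro mult_left_mono) auto
  also have "exp (- a) ^ N = exp (- (real N * a))" by (simp flip: exp_of_nat_mult)
  finally show ?thesis .
qed

context centred begin

text \<open>The windows starting at p, ..., p + L - 1. They use the coordinates from p to p + L + m
  - 2, so blocks started at multiples of L + m share no coordinate.\<close>

definition block :: "nat \<Rightarrow> nat \<Rightarrow> (nat \<Rightarrow> real) \<Rightarrow> real" where
  "block L p \<omega> = (\<Sum>i<L. h (sum \<omega> {p+i..<p+i+m}))"

lemma block_shift: "block L p \<omega> = block L 0 (\<lambda>i. \<omega> (i + p))"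
proof -
  have "sum \<omega> {p+i..<p+i+m} = sum (\<lambda>j. \<omega> (j + p)) {i..<i+m}" for i
    using sum.shift_bounds_nat_ivl[of \<omega> i p "i + m"] by (simp add: add_ac)
  then show ?thesis by (simp add: block_def)
qed

lemma block_measurable [measurable]: "block L p \<in> borel_measurable exp_seq"
  unfolding block_def by (intro borel_measurable_sum measurable_fun_sum) auto

lemma distr_block: "distr exp_seq borel (block L p) = distr exp_seq borel (block L 0)"
  unfolding block_shift[of L p] by (rule expectation_shift_seq) measurable

lemma indep_block: "exp_seq.indep_vars (\<lambda>_. borel) (\<lambda>j. block L (j * (L + m))) {..<N}"
proof -
  let ?K = "\<lambda>j. {j * (L + m)..<Suc j * (L + m)}"
  have "exp_seq.indep_vars (\<lambda>j. Pi\<^sub>M (?K j) (\<lambda>_. borel)) (\<lambda>j \<omega>. restrict (\<lambda>i. \<omega> i) (?K j)) {..<N}"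
  proof (rule exp_seq.indep_vars_restrict[OF indep_coord])
    show "disjoint_family_on ?K {..<N}"
    proof (unfold disjoint_family_on_def, intro ballI impI)
      fix i j :: nat assume "i \<noteq> j"
      have *: "?K i \<inter> ?K j = {}" if "i < j" for i j
      proof -
        have "Suc i * (L + m) \<le> j * (L + m)" using that by (intro mult_right_mono) auto
        then show ?thesis by auto
      qed
      show "?K i \<inter> ?K j = {}" using *[of i j] *[of j i] \<open>i \<noteq> j\<close> by (metis inf_commute linorder_neqE_nat)
    qed
  qed auto
  then have "exp_seq.indep_vars (\<lambda>_. borel) (\<lambda>j \<omega>. (\<lambda>x. block L (j * (L + m)) x) (restrict (\<lambda>i. \<omega> i) (?K j))) {..<N}"
  proof (rule exp_seq.indep_vars_compose2)
    fix j
    show "block L (j * (L + m)) \<in> borel_measurable (Pi\<^sub>M (?K j) (\<lambda>_. borel))"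
      unfolding block_def
      by (intro borel_measurable_sum measurable_compose[OF _ h_meas] measurable_component_singleton) auto
  qed
  also have "(\<lambda>j \<omega>. (\<lambda>x. block L (j * (L + m)) x) (restrict (\<lambda>i. \<omega> i) (?K j))) = (\<lambda>j. block L (j * (L + m)))"
    unfolding block_def by (intro ext sum.cong refl arg_cong[of _ _ h]) auto
  finally show ?thesis .
qed

abbreviation F where "F \<equiv> integral\<^sup>L (gamma_law m) (\<lambda>x. h x ^ 4)"

lemma block_fourth_moment:
  shows "integrable exp_seq (\<lambda>\<omega>. block L p \<omega> ^ 4)" and "(\<integral>\<omega>. block L p \<omega> ^ 4 \<partial>exp_seq) \<le> real L ^ 4 * F"
proof -
  let ?S = "\<lambda>\<omega>. real L ^ 3 * (\<Sum>i<L. h (sum \<omega> {p+i..<p+i+m}) ^ 4)"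
  have le: "block L p \<omega> ^ 4 \<le> ?S \<omega>" for \<omega> unfolding block_def by (rule power4_sum_le)
  have i: "integrable exp_seq (\<lambda>\<omega>. h (sum \<omega> {p+i..<p+i+m}) ^ 4)"
      "(\<integral>\<omega>. h (sum \<omega> {p+i..<p+i+m}) ^ 4 \<partial>exp_seq) = F" for i
    using int4 integrable_exp_seq_gamma[of "{p+i..<p+i+m}" "\<lambda>x. h x ^ 4"] by auto
  then have iS: "integrable exp_seq ?S" by auto
  show int: "integrable exp_seq (\<lambda>\<omega>. block L p \<omega> ^ 4)"
    by (rule Bochner_Integration.integrable_bound[OF iS]) (use le in \<open>auto intro: order_trans[OF _ abs_ge_self]\<close>)
  have "(\<integral>\<omega>. block L p \<omega> ^ 4 \<partial>exp_seq) \<le> (\<integral>\<omega>. ?S \<omega> \<partial>exp_seq)"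
    by (intro integral_mono int iS le)
  also have "\<dots> = real L ^ 4 * F" using i by (simp add: power3_eq_cube power4_eq_xxxx)
  finally show "(\<integral>\<omega>. block L p \<omega> ^ 4 \<partial>exp_seq) \<le> real L ^ 4 * F" .
qed

lemma integrable_block_square: "integrable exp_seq (\<lambda>\<omega>. (block L p \<omega>)\<^sup>2)"
  by (rule exp_seq.integrable_square_of_power4[OF _ block_fourth_moment(1)]) measurable

lemma integrable_block: "integrable exp_seq (block L p)"
  by (rule exp_seq.square_integrable_imp_integrable[OF _ integrable_block_square]) measurable

lemma block_mean: "integral\<^sup>L exp_seq (block L p) = 0"
proof -
  have i: "integrable exp_seq (\<lambda>\<omega>. h (sum \<omega> {p+i..<p+i+m}))"
      "(\<integral>\<omega>. h (sum \<omega> {p+i..<p+i+m}) \<partial>exp_seq) = 0" for i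
    using integrable_kernel mean0 integrable_exp_seq_gamma[of "{p+i..<p+i+m}" h] by auto
  then show ?thesis unfolding block_def by simp
qed

lemma block_sum_square:
  "(\<integral>\<omega>. (\<Sum>j<N. block L (j * (L + m)) \<omega>)\<^sup>2 \<partial>exp_seq) = real N * (\<integral>\<omega>. (block L 0 \<omega>)\<^sup>2 \<partial>exp_seq)"
proof -
  let ?B = "\<lambda>j. block L (j * (L + m))"
  have *: "integrable exp_seq (\<lambda>\<omega>. ?B i \<omega> * ?B j \<omega>) \<and> (\<integral>\<omega>. ?B i \<omega> * ?B j \<omega> \<partial>exp_seq)
     = (if i = j then (\<integral>\<omega>. (block L 0 \<omega>)\<^sup>2 \<partial>exp_seq) else 0)" if "i < N" "j < N" for i j
  proof (cases "i = j")
    case True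
    have "(\<integral>\<omega>. (block L p \<omega>)\<^sup>2 \<partial>exp_seq) = (\<integral>\<omega>. (block L 0 \<omega>)\<^sup>2 \<partial>exp_seq)" for p
      unfolding block_shift[of L p] by (rule expectation_shift_seq) measurable
    then show ?thesis using True integrable_block_square[of L "j * (L + m)"] by (simp add: power2_eq_square)
  next
    case False
    have ind: "exp_seq.indep_vars (\<lambda>_. borel) ?B {i, j}"
      using that by (intro exp_seq.indep_vars_subset[OF indep_block[of L N]]) auto
    show ?thesis
      using exp_seq.indep_vars_integrable[OF _ ind] exp_seq.indep_vars_lebesgue_integral[OF _ ind] False
      by (simp add: integrable_block block_mean)
  qed
  have "(\<integral>\<omega>. (\<Sum>j<N. ?B j \<omega>)\<^sup>2 \<partial>exp_seq) = (\<integral>\<omega>. (\<Sum>i<N. \<Sum>j<N. ?B i \<omega> * ?B j \<omega>) \<partial>exp_seq)"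
    by (simp add: power2_eq_square sum_product)
  also have "\<dots> = (\<Sum>i<N. \<integral>\<omega>. (\<Sum>j<N. ?B i \<omega> * ?B j \<omega>) \<partial>exp_seq)"
    by (intro Bochner_Integration.integral_sum Bochner_Integration.integrable_sum) (use * in auto)
  also have "\<dots> = (\<Sum>i<N. \<Sum>j<N. \<integral>\<omega>. ?B i \<omega> * ?B j \<omega> \<partial>exp_seq)"
    by (intro sum.cong refl Bochner_Integration.integral_sum) (use * in auto)
  also have "\<dots> = (\<Sum>i<N. \<Sum>j<N. (if i = j then (\<integral>\<omega>. (block L 0 \<omega>)\<^sup>2 \<partial>exp_seq) else 0))"
    using * by (intro sum.cong) auto
  finally show ?thesis by simp
qed

text \<open>The set A collects the starting points in the gaps, in the incomplete last stretch, and
  those whose windows wrap round the end.\<close>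

lemma cyclic_sum_split:
  assumes "m \<le> n" "N * (L + m) \<le> n"
  obtains A where "A \<subseteq> {..<n}" "card A = n - N * L"
    "\<And>\<omega>. cyclic_sum h n m \<omega> = (\<Sum>j<N. block L (j * (L + m)) \<omega>) + (\<Sum>k\<in>A. h (sum \<omega> (cyc n m k)))"
proof
  let ?f = "\<lambda>(j, i). j * (L + m) + i"
  let ?P = "{..<N} \<times> {..<L}"
  have lt: "j * (L + m) + i + m \<le> n" if "j < N" "i < L" for i j
  proof -
    have "j * (L + m) + i + m \<le> Suc j * (L + m)" using that by simp
    also have "\<dots> \<le> N * (L + m)" using that by (intro mult_right_mono) auto
    finally show ?thesis using assms by simp
  qed
  have inj: "inj_on ?f ?P"
  proof (rule inj_onI, clarify)
    fix j i j' i' assume *: "i < L" "i' < L" "j * (L + m) + i = j' * (L + m) + i'"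
    have d: "(j * (L + m) + i) div (L + m) = j" "(j * (L + m) + i) mod (L + m) = i" if "i < L" for i j
      using that by (simp_all only: div_mult_self3 mod_mult_self3) auto
    show "j = j' \<and> i = i'" using d[OF *(1), of j] d[OF *(2), of j'] unfolding *(3) by (metis (no_types))
  qed
  let ?A = "{..<n} - ?f ` ?P"
  have sub: "?f ` ?P \<subseteq> {..<n}" using lt m_pos by fastforce
  show "?A \<subseteq> {..<n}" by auto
  show "card ?A = n - N * L" using sub inj by (simp add: card_Diff_subset card_image)
  fix \<omega> :: "nat \<Rightarrow> real"
  have "cyclic_sum h n m \<omega> = (\<Sum>k\<in>?f ` ?P. h (sum \<omega> (cyc n m k))) + (\<Sum>k\<in>?A. h (sum \<omega> (cyc n m k)))"
    unfolding cyclic_sum_def using sub by (subst sum.subset_diff[of "?f ` ?P"]) auto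
  also have "(\<Sum>k\<in>?f ` ?P. h (sum \<omega> (cyc n m k))) = (\<Sum>(j, i)\<in>?P. h (sum \<omega> (cyc n m (j * (L + m) + i))))"
    by (subst sum.reindex[OF inj]) (simp add: split_beta' comp_def)
  also have "\<dots> = (\<Sum>j<N. \<Sum>i<L. h (sum \<omega> (cyc n m (j * (L + m) + i))))"
    by (simp add: sum.cartesian_product)
  also have "\<dots> = (\<Sum>j<N. block L (j * (L + m)) \<omega>)"
    unfolding block_def by (intro sum.cong refl) (simp add: cyc_no_wrap lt)
  finally show "cyclic_sum h n m \<omega> = (\<Sum>j<N. block L (j * (L + m)) \<omega>) + (\<Sum>k\<in>?A. h (sum \<omega> (cyc n m k)))" .
qed

end

lemma norm_iexp_diff_le: "cmod (iexp (t * x) - iexp (t * y)) \<le> \<bar>t\<bar> * \<bar>x - y\<bar>"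
proof -
  have "iexp (t * x) - iexp (t * y) = iexp (t * y) * (iexp (t * (x - y)) - 1)"
    by (simp add: algebra_simps flip: exp_add)
  then have "cmod (iexp (t * x) - iexp (t * y)) = cmod (iexp (t * (x - y)) - 1)"
    by (simp add: norm_mult)
  also have "\<dots> \<le> \<bar>t * (x - y)\<bar>" using iexp_approx1[of "t * (x - y)" 0] by simp
  finally show ?thesis by (simp add: abs_mult)
qed

text \<open>On the good event \<bar>e^(itx) - e^(ity)\<bar> <= \<bar>t\<bar> \<bar>x - y\<bar> is
  used, elsewhere the trivial bound 2. The variable Q dominates the indicator of the bad event, so
  its mean acts as a Chebyshev bound.\<close>

lemma (in prob_space) char_diff_le_truncated:
  assumes [measurable]: "random_variable borel X" "random_variable borel Y"
    and D: "integrable M D" "expectation D \<le> d" and Q: "integrable M Q" "expectation Q \<le> q"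
    and le: "AE \<omega> in M. 0 \<le> D \<omega> \<and> 0 \<le> Q \<omega> \<and> (\<bar>X \<omega> - Y \<omega>\<bar> \<le> D \<omega> \<or> 1 \<le> Q \<omega>)"
  shows "cmod (char (distr M borel X) t - char (distr M borel Y) t) \<le> \<bar>t\<bar> * d + 2 * q"
proof -
  have "char (distr M borel X) t - char (distr M borel Y) t = (CLINT \<omega>|M. iexp (t * X \<omega>) - iexp (t * Y \<omega>))"
    by (simp add: char_def integral_distr integrable_iexp)
  also have "cmod \<dots> \<le> (\<integral>\<omega>. cmod (iexp (t * X \<omega>) - iexp (t * Y \<omega>)) \<partial>M)"
    by (rule integral_norm_bound)
  also have "\<dots> \<le> (\<integral>\<omega>. \<bar>t\<bar> * D \<omega> + 2 * Q \<omega> \<partial>M)"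
  proof (rule integral_mono_AE)
    show "integrable M (\<lambda>\<omega>. cmod (iexp (t * X \<omega>) - iexp (t * Y \<omega>)))"
      by (intro integrable_norm Bochner_Integration.integrable_diff integrable_iexp) auto
    show "integrable M (\<lambda>\<omega>. \<bar>t\<bar> * D \<omega> + 2 * Q \<omega>)" using D Q by auto
    show "AE \<omega> in M. cmod (iexp (t * X \<omega>) - iexp (t * Y \<omega>)) \<le> \<bar>t\<bar> * D \<omega> + 2 * Q \<omega>"
      using le
    proof eventually_elim
      case (elim \<omega>)
      have "cmod (iexp (t * X \<omega>) - iexp (t * Y \<omega>)) \<le> cmod (iexp (t * X \<omega>)) + cmod (iexp (t * Y \<omega>))"
        by (rule norm_triangle_ineq4)
      then have "cmod (iexp (t * X \<omega>) - iexp (t * Y \<omega>)) \<le> 2" by simp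
      moreover have "cmod (iexp (t * X \<omega>) - iexp (t * Y \<omega>)) \<le> \<bar>t\<bar> * D \<omega>" if "\<bar>X \<omega> - Y \<omega>\<bar> \<le> D \<omega>"
        using norm_iexp_diff_le[of t "X \<omega>" "Y \<omega>"] mult_left_mono[OF that, of "\<bar>t\<bar>"] by linarith
      moreover have "0 \<le> \<bar>t\<bar> * D \<omega>" using elim by simp
      ultimately show ?case using elim by linarith
    qed
  qed
  also have "\<dots> = \<bar>t\<bar> * expectation D + 2 * expectation Q" using D Q by simp
  also have "\<dots> \<le> \<bar>t\<bar> * d + 2 * q" using D Q by (intro add_mono mult_left_mono) auto
  finally show ?thesis .
qed

lemma (in prob_space) char_diff_le:
  assumes X: "random_variable borel X" "random_variable borel Y" and i2: "integrable M (\<lambda>\<omega>. (X \<omega> - Y \<omega>)\<^sup>2)"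
    and e: "expectation (\<lambda>\<omega>. (X \<omega> - Y \<omega>)\<^sup>2) \<le> \<epsilon>"
  shows "cmod (char (distr M borel X) t - char (distr M borel Y) t) \<le> \<bar>t\<bar> * sqrt \<epsilon>"
proof -
  note [measurable] = X
  have i: "integrable M (\<lambda>\<omega>. X \<omega> - Y \<omega>)" by (rule square_integrable_imp_integrable[OF _ i2]) measurable
  have "(expectation (\<lambda>\<omega>. \<bar>X \<omega> - Y \<omega>\<bar>))\<^sup>2 \<le> expectation (\<lambda>\<omega>. \<bar>X \<omega> - Y \<omega>\<bar>\<^sup>2)"
    using variance_positive[of "\<lambda>\<omega>. \<bar>X \<omega> - Y \<omega>\<bar>"] variance_eq[of "\<lambda>\<omega>. \<bar>X \<omega> - Y \<omega>\<bar>"] i i2 by simp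
  also have "\<dots> \<le> \<epsilon>" using e by simp
  finally have "expectation (\<lambda>\<omega>. \<bar>X \<omega> - Y \<omega>\<bar>) \<le> sqrt \<epsilon>" by (rule real_le_rsqrt)
  from char_diff_le_truncated[OF X _ this, of "\<lambda>_. 0" 0 t] i show ?thesis by simp
qed

text \<open>The estimate for a single n. Here \<epsilon> bounds the variance of the leftover
  windows, \<eta> is the Lyapunov quotient of the blocks, and q is the variance of the block part,
  which differs from 1 only through the leftovers. The three error terms come from dropping the
  leftovers, from expanding the characteristic function of one block, and from passing from (1 -
  a)^N to an exponential.\<close>

lemma (in centred) cyclic_sum_char:
  assumes n: "2 * m \<le> n" "N * (L + m) \<le> n" "N \<ge> 1" and s2: "cyclic_variance h m > 0"
    and eps: "real (n - N * L) * (2 * real m * V) / (real n * cyclic_variance h m) \<le> \<epsilon>" "\<epsilon> > 0"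
    and eta: "real N * real L ^ 4 * F / (real n * cyclic_variance h m)\<^sup>2 \<le> \<eta>" "\<eta> > 0"
    and small: "t\<^sup>2 * (1 + 2 * sqrt \<epsilon> + \<epsilon>) \<le> 2 * real N"
  obtains q where "\<bar>q - 1\<bar> \<le> 2 * sqrt \<epsilon> + \<epsilon>"
    "cmod (char (distr exp_seq borel (\<lambda>\<omega>. cyclic_sum h n m \<omega> / sqrt (real n * cyclic_variance h m))) t - complex_of_real (exp (- (t\<^sup>2 * q / 2))))
      \<le> \<bar>t\<bar> * sqrt \<epsilon> + t\<^sup>2 / 12 * (sqrt \<eta> * (q + t\<^sup>2)) + (t\<^sup>2 * q)\<^sup>2 / (4 * real N)"
proof -
  define D where "D = real n * cyclic_variance h m"
  have D: "D > 0" using s2 n m_pos by (auto simp: D_def)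
  have sq [simp]: "(x / sqrt D)\<^sup>2 = x\<^sup>2 / D" "(x / sqrt D) ^ 4 = x ^ 4 / D\<^sup>2" for x
    using D by (simp_all add: power_divide) (simp add: power4_eq_xxxx power2_eq_square)
  obtain A where A: "A \<subseteq> {..<n}" "card A = n - N * L"
    "\<And>\<omega>. cyclic_sum h n m \<omega> = (\<Sum>j<N. block L (j * (L + m)) \<omega>) + (\<Sum>k\<in>A. h (sum \<omega> (cyc n m k)))"
    using cyclic_sum_split[of n N L] n by auto
  define X where "X = (\<lambda>\<omega>. cyclic_sum h n m \<omega> / sqrt D)"
  define Y where "Y = (\<lambda>\<omega>. (\<Sum>j<N. block L (j * (L + m)) \<omega>) / sqrt D)"
  define R where "R = (\<lambda>\<omega>. (\<Sum>k\<in>A. h (sum \<omega> (cyc n m k))) / sqrt D)"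
  have YXR: "Y \<omega> = X \<omega> - R \<omega>" for \<omega> using A(3) by (simp add: X_def Y_def R_def diff_divide_distrib[symmetric])
  have meas: "X \<in> borel_measurable exp_seq" "R \<in> borel_measurable exp_seq" "Y \<in> borel_measurable exp_seq"
    unfolding X_def R_def Y_def cyclic_sum_def
    by (intro borel_measurable_divide borel_measurable_sum measurable_fun_sum borel_measurable_const h_meas block_measurable)+
  note meas [measurable]
  have finA: "finite A" using A(1) by (rule finite_subset) auto
  have X2: "integrable exp_seq (\<lambda>\<omega>. (X \<omega>)\<^sup>2)" "(\<integral>\<omega>. (X \<omega>)\<^sup>2 \<partial>exp_seq) = 1"
    using second_moment_subset(1)[of n "{..<n}"] second_moment[of n, folded D_def] n D
    by (simp_all add: X_def cyclic_sum_def)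
  have R2: "integrable exp_seq (\<lambda>\<omega>. (R \<omega>)\<^sup>2)" "(\<integral>\<omega>. (R \<omega>)\<^sup>2 \<partial>exp_seq) \<le> \<epsilon>"
  proof -
    show "integrable exp_seq (\<lambda>\<omega>. (R \<omega>)\<^sup>2)"
      using second_moment_subset(1)[of n A] n finA by (simp add: R_def)
    have "(\<integral>\<omega>. (R \<omega>)\<^sup>2 \<partial>exp_seq) = (\<integral>\<omega>. (\<Sum>k\<in>A. h (sum \<omega> (cyc n m k)))\<^sup>2 \<partial>exp_seq) / D"
      by (simp add: R_def)
    also have "\<dots> \<le> real (card A) * (2 * real m * V) / D"
      using second_moment_subset_le[OF n(1) A(1)] D by (intro divide_right_mono) auto
    also have "\<dots> \<le> \<epsilon>" using eps A(2) by (simp add: D_def)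
    finally show "(\<integral>\<omega>. (R \<omega>)\<^sup>2 \<partial>exp_seq) \<le> \<epsilon>" .
  qed
  \<comment> \<open>Weighted arithmetic-geometric mean; the weight sqrt \<epsilon> balances E X^2 =
    1 against E R^2 <= \<epsilon>.\<close>
  have XR: "integrable exp_seq (\<lambda>\<omega>. X \<omega> * R \<omega>)" "\<bar>\<integral>\<omega>. X \<omega> * R \<omega> \<partial>exp_seq\<bar> \<le> sqrt \<epsilon>"
  proof -
    have b: "\<bar>x * y\<bar> \<le> (sqrt \<epsilon> * x\<^sup>2 + y\<^sup>2 / sqrt \<epsilon>) / 2" for x y
    proof -
      have "0 \<le> (sqrt \<epsilon> * \<bar>x\<bar> - \<bar>y\<bar>)\<^sup>2 / sqrt \<epsilon>" using eps by simp
      also have "\<dots> = sqrt \<epsilon> * x\<^sup>2 + y\<^sup>2 / sqrt \<epsilon> - 2 * \<bar>x * y\<bar>"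
        using eps by (simp add: power2_diff power_mult_distrib abs_mult field_simps real_sqrt_mult_self power2_eq_square)
      finally show ?thesis by simp
    qed
    have i: "integrable exp_seq (\<lambda>\<omega>. (sqrt \<epsilon> * (X \<omega>)\<^sup>2 + (R \<omega>)\<^sup>2 / sqrt \<epsilon>) / 2)"
      using X2 R2 by simp
    show p: "integrable exp_seq (\<lambda>\<omega>. X \<omega> * R \<omega>)"
      by (rule Bochner_Integration.integrable_bound[OF i]) (use b in \<open>auto intro: order_trans[OF _ abs_ge_self]\<close>)
    have "\<bar>\<integral>\<omega>. X \<omega> * R \<omega> \<partial>exp_seq\<bar> \<le> (\<integral>\<omega>. \<bar>X \<omega> * R \<omega>\<bar> \<partial>exp_seq)"
      by (rule integral_abs_bound)
    also have "\<dots> \<le> (\<integral>\<omega>. (sqrt \<epsilon> * (X \<omega>)\<^sup>2 + (R \<omega>)\<^sup>2 / sqrt \<epsilon>) / 2 \<partial>exp_seq)"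
      using p i b by (intro integral_mono) auto
    also have "\<dots> = (sqrt \<epsilon> + (\<integral>\<omega>. (R \<omega>)\<^sup>2 \<partial>exp_seq) / sqrt \<epsilon>) / 2"
      using X2 R2 by simp
    also have "\<dots> \<le> (sqrt \<epsilon> + \<epsilon> / sqrt \<epsilon>) / 2"
      using R2 eps by (intro divide_right_mono add_left_mono) auto
    also have "\<dots> = sqrt \<epsilon>" using eps by (simp add: real_div_sqrt)
    finally show "\<bar>\<integral>\<omega>. X \<omega> * R \<omega> \<partial>exp_seq\<bar> \<le> sqrt \<epsilon>" .
  qed
  define q where "q = (\<integral>\<omega>. (Y \<omega>)\<^sup>2 \<partial>exp_seq)"
  have q0: "q \<ge> 0" by (simp add: q_def)
  have Y2: "(Y \<omega>)\<^sup>2 = (X \<omega>)\<^sup>2 - 2 * (X \<omega> * R \<omega>) + (R \<omega>)\<^sup>2" for \<omega>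
    by (simp add: YXR power2_diff)
  have "q = 1 - 2 * (\<integral>\<omega>. X \<omega> * R \<omega> \<partial>exp_seq) + (\<integral>\<omega>. (R \<omega>)\<^sup>2 \<partial>exp_seq)"
    using X2 R2 XR by (simp add: q_def Y2)
  moreover have "0 \<le> (\<integral>\<omega>. (R \<omega>)\<^sup>2 \<partial>exp_seq)" by simp
  ultimately have q1: "\<bar>q - 1\<bar> \<le> 2 * sqrt \<epsilon> + \<epsilon>" using R2(2) XR(2) by linarith
  let ?b = "\<lambda>\<omega>. block L 0 \<omega> / sqrt D"
  have b2: "integrable exp_seq (\<lambda>\<omega>. (?b \<omega>)\<^sup>2)" "(\<integral>\<omega>. (?b \<omega>)\<^sup>2 \<partial>exp_seq) = q / N"
  proof -
    show "integrable exp_seq (\<lambda>\<omega>. (?b \<omega>)\<^sup>2)" using integrable_block_square[of L 0] by simp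
    have "q = real N * (\<integral>\<omega>. (?b \<omega>)\<^sup>2 \<partial>exp_seq)"
      unfolding q_def Y_def using block_sum_square[of L N] by simp
    then show "(\<integral>\<omega>. (?b \<omega>)\<^sup>2 \<partial>exp_seq) = q / N" using n by (simp add: field_simps)
  qed
  have b4: "integrable exp_seq (\<lambda>\<omega>. ?b \<omega> ^ 4)" "(\<integral>\<omega>. ?b \<omega> ^ 4 \<partial>exp_seq) \<le> \<eta> / N"
  proof -
    show "integrable exp_seq (\<lambda>\<omega>. ?b \<omega> ^ 4)" using block_fourth_moment(1)[of L 0] by simp
    have "(\<integral>\<omega>. ?b \<omega> ^ 4 \<partial>exp_seq) \<le> real L ^ 4 * F / D\<^sup>2"
      using block_fourth_moment(2)[of L 0] D by (simp add: divide_right_mono)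
    also have "\<dots> \<le> \<eta> / N" using eta n by (simp add: D_def field_simps)
    finally show "(\<integral>\<omega>. ?b \<omega> ^ 4 \<partial>exp_seq) \<le> \<eta> / N" .
  qed
  define \<phi> where "\<phi> = char (distr exp_seq borel ?b) t"
  have charY: "char (distr exp_seq borel Y) t = \<phi> ^ N"
  proof -
    have "char (distr exp_seq borel Y) t = char (distr exp_seq borel (\<lambda>\<omega>. \<Sum>j<N. block L (j * (L + m)) \<omega> / sqrt D)) t"
      by (simp add: Y_def sum_divide_distrib)
    also have "\<dots> = (\<Prod>j<N. char (distr exp_seq borel (\<lambda>\<omega>. block L (j * (L + m)) \<omega> / sqrt D)) t)"
      by (intro exp_seq.char_distr_sum exp_seq.indep_vars_compose2[OF indep_block]) auto
    also have "\<dots> = (\<Prod>j<N. \<phi>)"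
    proof (rule prod.cong)
      fix j
      have *: "distr exp_seq borel (\<lambda>\<omega>. block L p \<omega> / sqrt D) = distr (distr exp_seq borel (block L p)) borel (\<lambda>x. x / sqrt D)" for p
        by (subst distr_distr) (auto simp: comp_def)
      show "char (distr exp_seq borel (\<lambda>\<omega>. block L (j * (L + m)) \<omega> / sqrt D)) t = \<phi>"
        unfolding \<phi>_def *[of "j * (L + m)"] *[of 0] distr_block[of L "j * (L + m)"] ..
    qed simp
    finally show ?thesis by simp
  qed
  \<comment> \<open>The second-order expansion of the characteristic function of one block is 1 - a.
    The assumption \<open>small\<close> is what makes a <= 1.\<close>
  define a where "a = t\<^sup>2 * (q / N) / 2"
  have a: "0 \<le> a" "a \<le> 1"
  proof -
    show "0 \<le> a" using q0 by (simp add: a_def)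
    have "t\<^sup>2 * q \<le> t\<^sup>2 * (1 + 2 * sqrt \<epsilon> + \<epsilon>)" using q1 by (intro mult_left_mono) auto
    then show "a \<le> 1" using small n by (simp add: a_def field_simps)
  qed
  have phi: "cmod (\<phi> - (1 - a)) \<le> t\<^sup>2 / 12 * (sqrt \<eta> * (q + t\<^sup>2)) / N"
  proof -
    have "cmod (\<phi> - (1 - t\<^sup>2 * (q / N) / 2)) \<le> (t\<^sup>2 / 6) * (\<integral>\<omega>. min (6 * (?b \<omega>)\<^sup>2) (\<bar>t\<bar> * \<bar>?b \<omega>\<bar> ^ 3) \<partial>exp_seq)"
      unfolding \<phi>_def
    proof (rule exp_seq.char_approx3'[OF _ _ b2(1) _ _ refl])
      show "exp_seq.variance ?b = q / N"
        using b2 integrable_block[of L 0] block_mean[of L 0] by (simp only: exp_seq.variance_eq integrable_divide) simp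
    qed (use integrable_block[of L 0] block_mean[of L 0] in auto)
    also have "(\<integral>\<omega>. min (6 * (?b \<omega>)\<^sup>2) (\<bar>t\<bar> * \<bar>?b \<omega>\<bar> ^ 3) \<partial>exp_seq)
      \<le> (\<integral>\<omega>. (sqrt \<eta> * (?b \<omega>)\<^sup>2 + t\<^sup>2 * ?b \<omega> ^ 4 / sqrt \<eta>) / 2 \<partial>exp_seq)"
    proof (rule integral_mono)
      show "integrable exp_seq (\<lambda>\<omega>. min (6 * (?b \<omega>)\<^sup>2) (\<bar>t\<bar> * \<bar>?b \<omega>\<bar> ^ 3))"
      proof (rule Bochner_Integration.integrable_bound[OF integrable_mult_right[OF b2(1), of 6]])
        have "norm (min (6 * x\<^sup>2) (\<bar>t\<bar> * \<bar>x\<bar> ^ 3)) \<le> norm (6 * x\<^sup>2)" for x :: real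
          by (simp add: min_def)
        then show "AE \<omega> in exp_seq. norm (min (6 * (?b \<omega>)\<^sup>2) (\<bar>t\<bar> * \<bar>?b \<omega>\<bar> ^ 3)) \<le> norm (6 * (?b \<omega>)\<^sup>2)"
          by (simp del: sq)
      qed measurable
      show "integrable exp_seq (\<lambda>\<omega>. (sqrt \<eta> * (?b \<omega>)\<^sup>2 + t\<^sup>2 * ?b \<omega> ^ 4 / sqrt \<eta>) / 2)"
        by (intro integrable_divide Bochner_Integration.integrable_add integrable_mult_right b2(1) b4(1))
      fix \<omega>
      define x where "x = \<bar>?b \<omega>\<bar>"
      have x: "(?b \<omega>)\<^sup>2 = x\<^sup>2" "?b \<omega> ^ 4 = x ^ 4" unfolding x_def by (rule power2_abs[symmetric], rule power_even_abs[symmetric]) simp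
      \<comment> \<open>The third absolute moment in the Taylor remainder is traded for the second
        and fourth ones; with the weight sqrt \<eta> both contribute order sqrt \<eta> / N.\<close>
      have "0 \<le> (sqrt \<eta> * x - \<bar>t\<bar> * x\<^sup>2)\<^sup>2 / sqrt \<eta>" using eta by simp
      also have "\<dots> = sqrt \<eta> * x\<^sup>2 + t\<^sup>2 * x ^ 4 / sqrt \<eta> - 2 * (\<bar>t\<bar> * x ^ 3)"
        using eta by (simp add: power2_diff power_mult_distrib field_simps real_sqrt_mult_self power2_eq_square power3_eq_cube power4_eq_xxxx)
      finally have "\<bar>t\<bar> * x ^ 3 \<le> (sqrt \<eta> * x\<^sup>2 + t\<^sup>2 * x ^ 4 / sqrt \<eta>) / 2" by simp
      then show "min (6 * (?b \<omega>)\<^sup>2) (\<bar>t\<bar> * \<bar>?b \<omega>\<bar> ^ 3) \<le> (sqrt \<eta> * (?b \<omega>)\<^sup>2 + t\<^sup>2 * ?b \<omega> ^ 4 / sqrt \<eta>) / 2"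
        unfolding x unfolding x_def[symmetric] by (rule min.coboundedI2)
    qed
    also have "\<dots> = (sqrt \<eta> * (q / N) + t\<^sup>2 * (\<integral>\<omega>. ?b \<omega> ^ 4 \<partial>exp_seq) / sqrt \<eta>) / 2"
      using b2 b4(1) by (simp del: sq)
    also have "\<dots> \<le> (sqrt \<eta> * (q / N) + t\<^sup>2 * (\<eta> / N) / sqrt \<eta>) / 2"
      using b4(2) eta by (intro divide_right_mono add_left_mono mult_left_mono) auto
    also have "t\<^sup>2 * (\<eta> / N) / sqrt \<eta> = t\<^sup>2 * (\<eta> / sqrt \<eta>) / N" by simp
    also have "\<eta> / sqrt \<eta> = sqrt \<eta>" using eta by (simp add: real_div_sqrt)
    finally have *: "cmod (\<phi> - (1 - t\<^sup>2 * (q / N) / 2)) \<le> (t\<^sup>2 / 6) * ((sqrt \<eta> * (q / N) + t\<^sup>2 * sqrt \<eta> / N) / 2)"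
      by (simp add: mult_left_mono)
    also have "\<dots> = t\<^sup>2 / 12 * (sqrt \<eta> * (q + t\<^sup>2)) / N" using n by (simp add: field_simps)
    finally show ?thesis by (simp add: a_def)
  qed
  have "cmod (\<phi> ^ N - complex_of_real (1 - a) ^ N) \<le> real N * cmod (\<phi> - complex_of_real (1 - a))"
  proof (rule norm_power_diff)
    interpret d: real_distribution "distr exp_seq borel ?b" by (rule exp_seq.real_distribution_distr) auto
    show "norm \<phi> \<le> 1" unfolding \<phi>_def by (rule d.cmod_char_le_1)
    show "norm (complex_of_real (1 - a)) \<le> 1" using a by (simp del: of_real_diff)
  qed
  also have "\<dots> \<le> real N * (t\<^sup>2 / 12 * (sqrt \<eta> * (q + t\<^sup>2)) / N)" using phi by (intro mult_left_mono) auto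
  also have "\<dots> = t\<^sup>2 / 12 * (sqrt \<eta> * (q + t\<^sup>2))" using n by simp
  finally have s2: "cmod (char (distr exp_seq borel Y) t - complex_of_real ((1 - a) ^ N)) \<le> t\<^sup>2 / 12 * (sqrt \<eta> * (q + t\<^sup>2))"
    by (simp add: charY)
  have s3: "cmod (complex_of_real ((1 - a) ^ N) - complex_of_real (exp (- (t\<^sup>2 * q / 2)))) \<le> (t\<^sup>2 * q)\<^sup>2 / (4 * real N)"
  proof -
    have Na: "real N * a = t\<^sup>2 * q / 2" using n by (simp add: a_def)
    have "\<bar>(1 - a) ^ N - exp (- (t\<^sup>2 * q / 2))\<bar> \<le> real N * a\<^sup>2"
      using one_minus_power_exp[OF a, of N] unfolding Na .
    also have "real N * a\<^sup>2 = (t\<^sup>2 * q)\<^sup>2 / (4 * real N)" using n by (simp add: a_def power2_eq_square field_simps)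
    finally show ?thesis by (simp only: of_real_diff[symmetric] norm_of_real)
  qed
  have s1: "cmod (char (distr exp_seq borel X) t - char (distr exp_seq borel Y) t) \<le> \<bar>t\<bar> * sqrt \<epsilon>"
    by (rule exp_seq.char_diff_le) (use R2 in \<open>auto simp: YXR\<close>)
  have "cmod (char (distr exp_seq borel X) t - complex_of_real (exp (- (t\<^sup>2 * q / 2))))
    \<le> \<bar>t\<bar> * sqrt \<epsilon> + t\<^sup>2 / 12 * (sqrt \<eta> * (q + t\<^sup>2)) + (t\<^sup>2 * q)\<^sup>2 / (4 * real N)"
    by (rule order_trans[OF norm_diff_triangle_le[OF norm_diff_triangle_le[OF s1 s2] s3]]) simp
  with q1 show ?thesis by (intro that[of q]) (auto simp: X_def D_def)
qed

text \<open>Blocks of length \<open>L \<approx> m (n/m)\<^bsup>1/4\<^esup>\<close> are long compared with the range \<open>m\<close> of dependence, so the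
  gaps between them are negligible, and short enough for a Lyapunov condition with the crude bound
  \<open>E(block\<^sup>4) \<le> L\<^sup>4 E h\<^sup>4\<close>.\<close>

lemma block_length_exists:
  fixes m :: "nat \<Rightarrow> nat"
  assumes m: "eventually (\<lambda>n. m n \<ge> 1) sequentially" and lim: "(\<lambda>n. real (m n) / real n) \<longlonglongrightarrow> 0"
  obtains L :: "nat \<Rightarrow> nat" where
    "(\<lambda>n. real (m n) / real (L n)) \<longlonglongrightarrow> 0" "(\<lambda>n. real (L n) / real n) \<longlonglongrightarrow> 0"
    "(\<lambda>n. real (L n) ^ 3 / (real n * real (m n) ^ 2)) \<longlonglongrightarrow> 0" "eventually (\<lambda>n. L n \<ge> 1) sequentially"
proof
  \<comment> \<open>For m w <= L <= 2 m w and w^4 = n/m the three quotients are at most 1/w, 2/w^3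
    and 8/w, and w tends to infinity.\<close>
  define w where "w = (\<lambda>n. (real n / real (m n)) powr (1/4))"
  define L where "L = (\<lambda>n. nat \<lceil>real (m n) * w n\<rceil>)"
  have pos: "eventually (\<lambda>n. m n \<ge> 1 \<and> n \<ge> 1) sequentially" using m eventually_ge_at_top[of 1] by eventually_elim auto
  have "filterlim (\<lambda>n. inverse (real (m n) / real n)) at_top sequentially"
    using pos by (intro filterlim_inverse_at_top[OF lim]) (auto elim!: eventually_mono)
  then have ratio: "filterlim (\<lambda>n. real n / real (m n)) at_top sequentially" by (simp add: inverse_eq_divide)
  have w_top: "filterlim w at_top sequentially"
    unfolding w_def by (rule filterlim_compose[OF _ ratio]) real_asymp
  have w1: "eventually (\<lambda>n. w n \<ge> 1) sequentially" using w_top unfolding filterlim_at_top by blast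
  have w4: "eventually (\<lambda>n. w n ^ 4 = real n / real (m n)) sequentially"
    using pos by eventually_elim (auto simp: w_def powr_power)
  have Lb: "eventually (\<lambda>n. real (m n) * w n \<le> real (L n) \<and> real (L n) \<le> 2 * (real (m n) * w n)) sequentially"
    using pos w1
  proof eventually_elim
    case (elim n)
    then have "1 * 1 \<le> real (m n) * w n" by (intro mult_mono) auto
    then show ?case unfolding L_def by linarith
  qed
  have inv: "((\<lambda>n. C / w n) \<longlonglongrightarrow> 0)" for C :: real
    using tendsto_divide_0[OF tendsto_const filterlim_at_top_imp_at_infinity[OF w_top]] .
  show "(\<lambda>n. real (m n) / real (L n)) \<longlonglongrightarrow> 0"
  proof (rule Lim_null_comparison[OF _ inv[of 1]])
    show "\<forall>\<^sub>F n in sequentially. norm (real (m n) / real (L n)) \<le> 1 / w n"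
      using pos w1 Lb
    proof eventually_elim
      case (elim n)
      then have p: "0 < real (m n) * w n" by (intro mult_pos_pos) auto
      moreover from p elim have "0 < real (L n)" by linarith
      ultimately have "real (m n) / real (L n) \<le> real (m n) / (real (m n) * w n)"
        using elim by (intro divide_left_mono mult_pos_pos) auto
      then show ?case using elim by simp
    qed
  qed
  show "(\<lambda>n. real (L n) / real n) \<longlonglongrightarrow> 0"
  proof (rule Lim_null_comparison[OF _ inv[of 2]])
    show "\<forall>\<^sub>F n in sequentially. norm (real (L n) / real n) \<le> 2 / w n"
      using pos w1 Lb w4
    proof eventually_elim
      case (elim n)
      have "real (L n) / real n \<le> 2 * (real (m n) * w n) / real n" using elim by (intro divide_right_mono) auto
      also have "\<dots> = 2 * w n / (real n / real (m n))" using elim by simp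
      also have "\<dots> = 2 * w n / w n ^ 4" using elim by simp
      also have "\<dots> \<le> 2 / w n"
      proof -
        have "w n ^ 1 \<le> w n ^ 3" using elim by (intro power_increasing) auto
        then show ?thesis using elim by (simp add: field_simps power_numeral_reduce)
      qed
      finally show ?case by simp
    qed
  qed
  show "(\<lambda>n. real (L n) ^ 3 / (real n * real (m n) ^ 2)) \<longlonglongrightarrow> 0"
  proof (rule Lim_null_comparison[OF _ inv[of 8]])
    show "\<forall>\<^sub>F n in sequentially. norm (real (L n) ^ 3 / (real n * real (m n) ^ 2)) \<le> 8 / w n"
      using pos w1 Lb w4
    proof eventually_elim
      case (elim n)
      have "real (L n) ^ 3 / (real n * real (m n) ^ 2) \<le> (2 * (real (m n) * w n)) ^ 3 / (real n * real (m n) ^ 2)"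
        using elim by (intro divide_right_mono power_mono) auto
      also have "\<dots> = 8 * w n ^ 3 / (real n / real (m n))"
        using elim by (simp add: power_mult_distrib field_simps power_numeral_reduce)
      also have "\<dots> = 8 * w n ^ 3 / w n ^ 4" using elim by simp
      also have "\<dots> = 8 / w n" using elim by (simp add: field_simps power_numeral_reduce)
      finally show ?case by simp
    qed
  qed
  show "eventually (\<lambda>n. L n \<ge> 1) sequentially"
    using pos w1 Lb
  proof eventually_elim
    case (elim n)
    then have "1 * 1 \<le> real (m n) * w n" by (intro mult_mono) auto
    then show ?case using elim by linarith
  qed
qed

text \<open>The scale v carries the dependence on n: E h^4 is of order at most v^2, while
  overlapping windows have to reinforce each other so that the variance per window is of order at
  least m v.\<close>

lemma cyclic_clt:
  fixes h :: "nat \<Rightarrow> real \<Rightarrow> real" and m :: "nat \<Rightarrow> nat" and v :: "nat \<Rightarrow> real"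
  assumes centred: "\<And>n. n \<ge> 1 \<Longrightarrow> centred (h n) (m n)"
    and lim: "(\<lambda>n. real (m n) / real n) \<longlonglongrightarrow> 0"
    and v: "\<And>n. n \<ge> 1 \<Longrightarrow> v n > 0"
    and h4: "\<And>n. n \<ge> 1 \<Longrightarrow> (\<integral>x. h n x ^ 4 \<partial>gamma_law (m n)) \<le> C * (v n)\<^sup>2"
    and var: "\<And>n. n \<ge> 1 \<Longrightarrow> cyclic_variance (h n) (m n) \<ge> c * real (m n) * v n" and c: "c > 0"
  shows "(\<lambda>n. char (distr exp_seq borel
      (\<lambda>\<omega>. cyclic_sum (h n) n (m n) \<omega> / sqrt (real n * cyclic_variance (h n) (m n)))) t) \<longlonglongrightarrow> complex_of_real (exp (- (t\<^sup>2 / 2)))"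
proof -
  have m: "m n \<ge> 1" if "n \<ge> 1" for n using centred[OF that] by (simp add: centred_def)
  have C: "C \<ge> 0"
  proof -
    have "0 \<le> (\<integral>x. h 1 x ^ 4 \<partial>gamma_law (m 1))" by simp
    also have "\<dots> \<le> C * (v 1)\<^sup>2" using h4[of 1] by simp
    finally show ?thesis using v[of 1] by (simp add: zero_le_mult_iff)
  qed
  have "eventually (\<lambda>n. m n \<ge> 1) sequentially" using eventually_ge_at_top[of 1] by eventually_elim (rule m)
  then obtain L where L: "(\<lambda>n. real (m n) / real (L n)) \<longlonglongrightarrow> 0" "(\<lambda>n. real (L n) / real n) \<longlonglongrightarrow> 0"
    "(\<lambda>n. real (L n) ^ 3 / (real n * real (m n) ^ 2)) \<longlonglongrightarrow> 0" "eventually (\<lambda>n. L n \<ge> 1) sequentially"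
    using lim by (rule block_length_exists)
  define N where "N = (\<lambda>n. n div (L n + m n))"
  \<comment> \<open>At most L + m windows are lost at the end and N m <= n m / L in the gaps. The
    factor comes from V <= sqrt C v and the lower bound c m v for the variance. The summand 1/n only
    makes \<epsilon> positive.\<close>
  define \<epsilon> where "\<epsilon> = (\<lambda>n. 2 * sqrt C / c * (real (L n) / real n + real (m n) / real n + real (m n) / real (L n)) + 1 / real n)"
  \<comment> \<open>From N L <= n the Lyapunov quotient is at most n L^3 C v^2 / (n c m v)^2. Again
    1/n ensures positivity.\<close>
  define \<eta> where "\<eta> = (\<lambda>n. C / c\<^sup>2 * (real (L n) ^ 3 / (real n * real (m n) ^ 2)) + 1 / real n)"
  have eps0: "\<epsilon> \<longlonglongrightarrow> 0"
  proof -
    have "\<epsilon> \<longlonglongrightarrow> 2 * sqrt C / c * (0 + 0 + 0) + 0"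
      unfolding \<epsilon>_def by (intro tendsto_add tendsto_mult tendsto_const L lim lim_1_over_n)
    then show ?thesis by simp
  qed
  have eta0: "\<eta> \<longlonglongrightarrow> 0"
  proof -
    have "\<eta> \<longlonglongrightarrow> C / c\<^sup>2 * 0 + 0"
      unfolding \<eta>_def by (intro tendsto_add tendsto_mult tendsto_const L lim_1_over_n)
    then show ?thesis by simp
  qed
  have N_top: "filterlim (\<lambda>n. real (N n)) at_top sequentially"
  proof -
    have "(\<lambda>n. (real (L n) + real (m n)) / real n) \<longlonglongrightarrow> 0"
      using tendsto_add[OF L(2) lim] by (simp add: add_divide_distrib)
    moreover have "\<forall>\<^sub>F n in sequentially. 0 < (real (L n) + real (m n)) / real n"
      using eventually_ge_at_top[of 1] by eventually_elim (use m in \<open>auto intro!: divide_pos_pos add_nonneg_pos simp: Suc_le_eq\<close>)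
    ultimately have "filterlim (\<lambda>n. inverse ((real (L n) + real (m n)) / real n)) at_top sequentially"
      by (rule filterlim_inverse_at_top)
    then have "filterlim (\<lambda>n. - 1 + inverse ((real (L n) + real (m n)) / real n)) at_top sequentially"
      by (rule filterlim_tendsto_add_at_top[OF tendsto_const])
    then show ?thesis
    proof (rule filterlim_at_top_mono)
      show "\<forall>\<^sub>F n in sequentially. - 1 + inverse ((real (L n) + real (m n)) / real n) \<le> real (N n)"
      proof (intro always_eventually allI)
        fix n
        have "real n / real k \<le> real (n div k) + 1" for k
        proof (cases "k = 0")
          case False
          then have "n \<le> (n div k + 1) * k" using dividend_less_div_times[of k n] by (simp add: algebra_simps)
          then have "real n \<le> (real (n div k) + 1) * real k" by (metis of_nat_1 of_nat_add of_nat_le_iff of_nat_mult)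
          then show ?thesis using False by (simp add: divide_le_eq)
        qed simp
        from this[of "L n + m n"] have "real n / real (L n + m n) \<le> real (n div (L n + m n)) + 1" .
        then show "- 1 + inverse ((real (L n) + real (m n)) / real n) \<le> real (N n)"
          by (simp add: N_def inverse_eq_divide)
      qed
    qed
  qed
  have N1: "\<forall>\<^sub>F n in sequentially. N n \<ge> 1"
    using N_top unfolding filterlim_at_top by (auto elim: eventually_mono dest: spec[of _ 1])
  have mn: "\<forall>\<^sub>F n in sequentially. 2 * m n \<le> n"
  proof -
    have "\<forall>\<^sub>F n in sequentially. real (m n) / real n < 1 / 2"
      by (rule order_tendstoD(2)[OF lim]) simp
    then show ?thesis using eventually_ge_at_top[of 1] by eventually_elim (auto simp: field_simps)
  qed
  have small: "\<forall>\<^sub>F n in sequentially. t\<^sup>2 * (1 + 2 * sqrt (\<epsilon> n) + \<epsilon> n) \<le> 2 * real (N n)"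
  proof -
    have "(\<lambda>n. t\<^sup>2 * (1 + 2 * sqrt (\<epsilon> n) + \<epsilon> n)) \<longlonglongrightarrow> t\<^sup>2 * (1 + 2 * sqrt 0 + 0)"
      by (intro tendsto_intros eps0)
    then have "\<forall>\<^sub>F n in sequentially. t\<^sup>2 * (1 + 2 * sqrt (\<epsilon> n) + \<epsilon> n) < t\<^sup>2 + 1"
      by (rule order_tendstoD) simp
    moreover have "\<forall>\<^sub>F n in sequentially. t\<^sup>2 + 1 \<le> real (N n)" using N_top unfolding filterlim_at_top by blast
    ultimately show ?thesis by eventually_elim auto
  qed
  let ?char = "\<lambda>n. char (distr exp_seq borel
      (\<lambda>\<omega>. cyclic_sum (h n) n (m n) \<omega> / sqrt (real n * cyclic_variance (h n) (m n)))) t"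
  let ?P = "\<lambda>n q. \<bar>q - 1\<bar> \<le> 2 * sqrt (\<epsilon> n) + \<epsilon> n \<and>
    cmod (?char n - complex_of_real (exp (- (t\<^sup>2 * q / 2))))
      \<le> \<bar>t\<bar> * sqrt (\<epsilon> n) + t\<^sup>2 / 12 * (sqrt (\<eta> n) * (q + t\<^sup>2)) + (t\<^sup>2 * q)\<^sup>2 / (4 * real (N n))"
  have ex: "\<forall>\<^sub>F n in sequentially. \<exists>q. ?P n q"
    using N1 mn small L(4) eventually_ge_at_top[of 1]
  proof eventually_elim
    case (elim n)
    interpret centred "h n" "m n" using elim by (intro centred) auto
    have m1: "real (m n) \<ge> 1" and n1: "real n \<ge> 1" and L1: "real (L n) \<ge> 1" and N1: "real (N n) \<ge> 1"
      using m_pos elim by auto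
    have vn: "v n > 0" using elim by (intro v)
    have Vle: "V \<le> sqrt C * v n"
    proof -
      interpret prob_space "gamma_law (m n)" by (rule prob_space_gamma_law)
      have "V\<^sup>2 \<le> F"
        using variance_positive[of "\<lambda>x. (h n x)\<^sup>2"] variance_eq[of "\<lambda>x. (h n x)\<^sup>2"] integrable_kernel_square int4 by simp
      also have "\<dots> \<le> C * (v n)\<^sup>2" using elim by (intro h4)
      finally have "V \<le> sqrt (C * (v n)\<^sup>2)" by (rule real_le_rsqrt)
      then show ?thesis using vn by (simp add: real_sqrt_mult)
    qed
    have var_n: "c * real (m n) * v n \<le> cyclic_variance (h n) (m n)" using elim by (intro var)
    have base: "0 < c * real (m n) * v n" using c m1 vn by simp
    then have var_pos: "cyclic_variance (h n) (m n) > 0" using var_n by simp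
    have NL: "N n * (L n + m n) \<le> n" by (simp add: N_def)
    have nl: "real (n - N n * L n) \<le> real (L n) + real (m n) + real (N n) * real (m n)"
    proof -
      have "n < N n * (L n + m n) + (L n + m n)"
        using elim m_pos mod_less_divisor[of "L n + m n" n] div_mult_mod_eq[of n "L n + m n"] unfolding N_def by linarith
      then have "n - N n * L n \<le> L n + m n + N n * m n" by (simp add: algebra_simps)
      then show ?thesis by (metis of_nat_add of_nat_le_iff of_nat_mult)
    qed
    have NLn: "real (N n) * real (L n) \<le> real n"
    proof -
      have "N n * L n \<le> n" using NL by (simp add: algebra_simps)
      then show ?thesis by (metis of_nat_le_iff of_nat_mult)
    qed
    have 1: "real (n - N n * L n) * (2 * real (m n) * V) / (real n * cyclic_variance (h n) (m n)) \<le> \<epsilon> n"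
    proof -
      have "real (n - N n * L n) * (2 * real (m n) * V) / (real n * cyclic_variance (h n) (m n))
        \<le> (real (L n) + real (m n) + real (N n) * real (m n)) * (2 * real (m n) * (sqrt C * v n)) / (real n * (c * real (m n) * v n))"
        using nl Vle var_n base n1 m1 V_nonneg C vn c
        by (intro frac_le mult_mono mult_nonneg_nonneg mult_pos_pos add_nonneg_nonneg) auto
      also have "\<dots> = 2 * sqrt C / c * ((real (L n) + real (m n) + real (N n) * real (m n)) / real n)"
        using m1 vn c n1 by (simp add: field_simps)
      also have "\<dots> \<le> 2 * sqrt C / c * (real (L n) / real n + real (m n) / real n + real (m n) / real (L n))"
      proof (intro mult_left_mono)
        have "real (N n) * real (m n) / real n \<le> real (m n) / real (L n)"
          using NLn n1 L1 m1 by (simp add: field_simps mult_right_mono)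
        then show "(real (L n) + real (m n) + real (N n) * real (m n)) / real n \<le> real (L n) / real n + real (m n) / real n + real (m n) / real (L n)"
          by (simp add: add_divide_distrib)
      qed (use C c in auto)
      finally show ?thesis unfolding \<epsilon>_def by (rule order_trans) simp
    qed
    have e_pos: "\<epsilon> n > 0"
      unfolding \<epsilon>_def using C c n1 by (intro add_nonneg_pos mult_nonneg_nonneg add_nonneg_nonneg divide_nonneg_nonneg) auto
    have eta_pos: "\<eta> n > 0"
      unfolding \<eta>_def using C c n1 by (intro add_nonneg_pos mult_nonneg_nonneg divide_nonneg_nonneg) auto
    have 2: "real (N n) * real (L n) ^ 4 * F / (real n * cyclic_variance (h n) (m n))\<^sup>2 \<le> \<eta> n"
    proof -
      have "real (N n) * real (L n) ^ 4 * F / (real n * cyclic_variance (h n) (m n))\<^sup>2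
        \<le> (real n * real (L n) ^ 3) * (C * (v n)\<^sup>2) / (real n * (c * real (m n) * v n))\<^sup>2"
      proof (rule frac_le)
        have "real (N n) * real (L n) * real (L n) ^ 3 \<le> real n * real (L n) ^ 3"
          using NLn by (intro mult_right_mono) auto
        then have "real (N n) * real (L n) ^ 4 \<le> real n * real (L n) ^ 3" by (simp add: power_numeral_reduce mult.assoc)
        then show "real (N n) * real (L n) ^ 4 * F \<le> (real n * real (L n) ^ 3) * (C * (v n)\<^sup>2)"
          by (rule mult_mono) (use h4[of n] elim in auto)
        show "(real n * (c * real (m n) * v n))\<^sup>2 \<le> (real n * cyclic_variance (h n) (m n))\<^sup>2"
          using base n1 var_n by (intro power_mono mult_left_mono) auto
        show "0 < (real n * (c * real (m n) * v n))\<^sup>2" using base n1 by (intro zero_less_power mult_pos_pos[OF _ base]) linarith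
      qed (use C in auto)
      also have "\<dots> = C / c\<^sup>2 * (real (L n) ^ 3 / (real n * real (m n) ^ 2))"
        using n1 m1 vn c by (simp add: field_simps power2_eq_square)
      finally show ?thesis unfolding \<eta>_def by (rule order_trans) simp
    qed
    have 3: "2 * m n \<le> n" "N n \<ge> 1" "t\<^sup>2 * (1 + 2 * sqrt (\<epsilon> n) + \<epsilon> n) \<le> 2 * real (N n)" using elim by auto
    obtain q where "?P n q"
      using cyclic_sum_char[OF 3(1) NL 3(2) var_pos 1 e_pos 2 eta_pos 3(3)] by blast
    then show ?case by blast
  qed
  \<comment> \<open>The variances q are known only through existence for each large n; a choice
    turns them into a sequence, whose limit is 1.\<close>
  define q where "q = (\<lambda>n. SOME q. ?P n q)"
  have q: "\<forall>\<^sub>F n in sequentially. ?P n (q n)"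
    using ex by eventually_elim (unfold q_def, rule someI_ex)
  have q1: "q \<longlonglongrightarrow> 1"
  proof (rule LIM_zero_cancel, rule Lim_null_comparison)
    show "\<forall>\<^sub>F n in sequentially. norm (q n - 1) \<le> 2 * sqrt (\<epsilon> n) + \<epsilon> n" using q by eventually_elim auto
    have "(\<lambda>n. 2 * sqrt (\<epsilon> n) + \<epsilon> n) \<longlonglongrightarrow> 2 * sqrt 0 + 0" by (intro tendsto_intros eps0)
    then show "(\<lambda>n. 2 * sqrt (\<epsilon> n) + \<epsilon> n) \<longlonglongrightarrow> 0" by simp
  qed
  have "(\<lambda>n. ?char n - complex_of_real (exp (- (t\<^sup>2 * q n / 2)))) \<longlonglongrightarrow> 0"
  proof (rule Lim_null_comparison)
    show "\<forall>\<^sub>F n in sequentially. norm (?char n - complex_of_real (exp (- (t\<^sup>2 * q n / 2))))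
       \<le> \<bar>t\<bar> * sqrt (\<epsilon> n) + t\<^sup>2 / 12 * (sqrt (\<eta> n) * (q n + t\<^sup>2)) + (t\<^sup>2 * q n)\<^sup>2 / (4 * real (N n))"
      using q by eventually_elim auto
    have "(\<lambda>n. (t\<^sup>2 * q n)\<^sup>2 / (4 * real (N n))) \<longlonglongrightarrow> 0"
      by (intro tendsto_divide_0[where c = "(t\<^sup>2 * 1)\<^sup>2"] tendsto_intros q1 filterlim_at_top_imp_at_infinity
          filterlim_tendsto_pos_mult_at_top[OF tendsto_const _ N_top]) auto
    moreover have "(\<lambda>n. \<bar>t\<bar> * sqrt (\<epsilon> n) + t\<^sup>2 / 12 * (sqrt (\<eta> n) * (q n + t\<^sup>2))) \<longlonglongrightarrow> \<bar>t\<bar> * sqrt 0 + t\<^sup>2 / 12 * (sqrt 0 * (1 + t\<^sup>2))"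
      by (intro tendsto_intros eps0 eta0 q1)
    ultimately show "(\<lambda>n. \<bar>t\<bar> * sqrt (\<epsilon> n) + t\<^sup>2 / 12 * (sqrt (\<eta> n) * (q n + t\<^sup>2)) + (t\<^sup>2 * q n)\<^sup>2 / (4 * real (N n))) \<longlonglongrightarrow> 0"
      using tendsto_add by fastforce
  qed
  moreover have "(\<lambda>n. exp (- (t\<^sup>2 * q n / 2))) \<longlonglongrightarrow> exp (- (t\<^sup>2 * 1 / 2))"
    by (intro tendsto_intros q1) simp
  then have "(\<lambda>n. complex_of_real (exp (- (t\<^sup>2 * q n / 2)))) \<longlonglongrightarrow> complex_of_real (exp (- (t\<^sup>2 * 1 / 2)))"
    by (rule tendsto_of_real)
  ultimately show ?thesis using tendsto_add[of "\<lambda>n. ?char n - complex_of_real (exp (- (t\<^sup>2 * q n / 2)))" 0] by fastforce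
qed

section \<open>Closed forms of the variances\<close>

text \<open>At distance m the windows are independent and the moment is a product of zero means.
  Summing the one-position identity from r up to m therefore leaves only derivative moments.\<close>

lemma overlap_moment_telescope:
  assumes "tame u u' K" and m: "m \<ge> 1" and mean: "integral\<^sup>L (gamma_law m) u = 0" and "r \<le> m"
    and i: "\<And>q. r < q \<Longrightarrow> q \<le> m \<Longrightarrow> integrable exp_seq (\<lambda>\<omega>. u' (sum \<omega> {..<Suc m}) * u' (sum \<omega> {q..<q + Suc m}))"
  shows "overlap_moment u u m r = (\<Sum>q=Suc r..m. overlap_moment u' u' (Suc m) q)"
proof -
  interpret tame u u' K by fact
  have "overlap_moment u u m m = 0"
    using overlap_moment_full[of u u m] integrable_h[OF m] mean by simp
  have "overlap_moment u u m p - overlap_moment u u m m = (\<Sum>q=Suc p..m. overlap_moment u' u' (Suc m) q)" if "r \<le> p" "p \<le> m" for p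
    using that(2,1)
  proof (induction p rule: inc_induct)
    case (step p)
    have "overlap_moment u u m p - overlap_moment u u m (Suc p) = overlap_moment u' u' (Suc m) (Suc p)"
      using step.hyps step.prems by (intro overlap_moment_step[OF assms(1,1)] i) auto
    moreover have "(\<Sum>q=Suc p..m. overlap_moment u' u' (Suc m) q) = overlap_moment u' u' (Suc m) (Suc p) + (\<Sum>q=Suc (Suc p)..m. overlap_moment u' u' (Suc m) q)"
      using step.hyps by (simp add: sum.atLeast_Suc_atMost)
    ultimately show ?case using step by simp
  qed simp
  from this[of r] \<open>overlap_moment u u m m = 0\<close> \<open>r \<le> m\<close> show ?thesis by simp
qed

text \<open>Summation by parts: the lag weights 1, 2, 2, ... of \<open>cyclic_variance\<close> have
  the odd numbers as partial sums.\<close>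

lemma sum_by_parts_odd:
  fixes g :: "nat \<Rightarrow> real"
  shows "p \<ge> 1 \<Longrightarrow> (\<Sum>r=1..p. (2 * real r - 1) * (g (r - 1) - g r)) = g 0 + 2 * (\<Sum>d=1..<p. g d) - (2 * real p - 1) * g p"
proof (induction p rule: nat_induct_at_least)
  case (Suc p)
  then show ?case by (simp add: algebra_simps)
qed simp

lemma cyclic_variance_sum:
  assumes "tame u u' K" and m: "m \<ge> 1" and mean: "integral\<^sup>L (gamma_law m) u = 0"
    and i: "\<And>q. 1 \<le> q \<Longrightarrow> q \<le> m \<Longrightarrow> integrable exp_seq (\<lambda>\<omega>. u' (sum \<omega> {..<Suc m}) * u' (sum \<omega> {q..<q + Suc m}))"
  shows "cyclic_variance u m = (\<Sum>r=1..m. (2 * real r - 1) * overlap_moment u' u' (Suc m) r)"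
proof -
  interpret tame u u' K by fact
  have z: "overlap_moment u u m m = 0"
    using overlap_moment_full[of u u m] integrable_h[OF m] mean by simp
  have "(\<Sum>r=1..m. (2 * real r - 1) * overlap_moment u' u' (Suc m) r)
    = (\<Sum>r=1..m. (2 * real r - 1) * (overlap_moment u u m (r - 1) - overlap_moment u u m r))"
  proof (intro sum.cong refl)
    fix r assume r: "r \<in> {1..m}"
    then have "overlap_moment u u m (r - 1) - overlap_moment u u m (Suc (r - 1)) = overlap_moment u' u' (Suc m) (Suc (r - 1))"
      by (intro overlap_moment_step[OF assms(1,1)] i) auto
    then show "(2 * real r - 1) * overlap_moment u' u' (Suc m) r = (2 * real r - 1) * (overlap_moment u u m (r - 1) - overlap_moment u u m r)"
      using r by simp
  qed
  also have "\<dots> = cyclic_variance u m"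
    using sum_by_parts_odd[OF m, of "overlap_moment u u m"] z by (simp add: cyclic_variance_def)
  finally show ?thesis ..
qed

section \<open>Beta integrals and inverse moments of overlapping windows\<close>

text \<open>The beta function B(m, k + 1) for integer arguments.\<close>

definition beta_coeff :: "nat \<Rightarrow> nat \<Rightarrow> real" where
  "beta_coeff m k = 1 / (real m * real ((m + k) choose k))"

lemma beta_coeff_0 [simp]: "beta_coeff m 0 = 1 / real m"
  by (simp add: beta_coeff_def)

lemma beta_coeff_nonneg [simp]: "beta_coeff m k \<ge> 0"
  by (simp add: beta_coeff_def)

lemma beta_coeff_Suc: "m \<ge> 1 \<Longrightarrow> real (m + k + 1) * beta_coeff m (Suc k) = real (k + 1) * beta_coeff m k"
proof -
  assume m: "m \<ge> 1"
  have "Suc k * (Suc (m + k) choose Suc k) = Suc (m + k) * ((m + k) choose k)" by (rule Suc_times_binomial)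
  then have "real (k + 1) * real (Suc (m + k) choose Suc k) = real (m + k + 1) * real ((m + k) choose k)"
    by (metis Suc_eq_plus1 of_nat_mult)
  moreover have "real (Suc (m + k) choose Suc k) > 0" "real ((m + k) choose k) > 0"
    by (simp_all del: binomial_Suc_Suc)
  ultimately show ?thesis using m by (simp add: beta_coeff_def field_simps del: binomial_Suc_Suc of_nat_Suc of_nat_add)
qed

lemma choose_step: "real (m + 1) * real (Suc m + k choose k) = real (m + k + 1) * real (m + k choose k)"
proof -
  have "Suc m * (Suc (m + k) choose Suc m) = Suc (m + k) * ((m + k) choose m)" by (rule Suc_times_binomial)
  moreover have "(Suc (m + k) choose Suc m) = (Suc m + k choose k)" "((m + k) choose m) = (m + k choose k)"
    by (subst binomial_symmetric; simp)+
  ultimately show ?thesis by (metis Suc_eq_plus1 of_nat_mult)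
qed

text \<open>In integral form this is x^(m-1) - x^m = x^(m-1) (1 - x).\<close>

lemma beta_coeff_step: "m \<ge> 1 \<Longrightarrow> beta_coeff m k - beta_coeff (Suc m) k = beta_coeff m (Suc k)"
proof -
  assume m: "m \<ge> 1"
  have e: "real (Suc m) * real (Suc m + k choose k) = real (m + k + 1) * real (m + k choose k)"
    using choose_step[of m k] by simp
  have "real (m + k + 1) * beta_coeff (Suc m) k = real m * beta_coeff m k"
    unfolding beta_coeff_def e using m by (simp del: of_nat_add)
  with beta_coeff_Suc[OF m, of k] have "real (m + k + 1) * (beta_coeff m k - beta_coeff (Suc m) k) = real (m + k + 1) * beta_coeff m (Suc k)"
    by (simp add: algebra_simps)
  then show ?thesis by (simp del: of_nat_add)
qed

lemma beta_coeff_le: "m \<ge> 1 \<Longrightarrow> beta_coeff m k \<le> 1 / (real m * real (k + 1))"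
proof -
  assume m: "m \<ge> 1"
  have "(1 + k) choose k \<le> (m + k) choose k" using m by (intro binomial_right_mono) auto
  then have "real (k + 1) \<le> real ((m + k) choose k)" by simp
  then show ?thesis unfolding beta_coeff_def using m by (intro divide_left_mono mult_left_mono mult_pos_pos) auto
qed

text \<open>Writing s = (1 + s) - 1 in one factor of the numerator lowers k and expresses the
  integral through those for m and m + 1, matching \<open>beta_coeff_step\<close>. The induction on
  k must therefore leave m free.\<close>

lemma beta_integral:
  assumes "m \<ge> 1"
  shows "set_integrable lborel {0<..} (\<lambda>s::real. s ^ k / (1 + s) ^ (m + 1 + k))"
    and "(LBINT s:{0<..}. s ^ k / (1 + s) ^ (m + 1 + k)) = beta_coeff m k"
proof -
  have "set_integrable lborel {0<..} (\<lambda>s::real. s ^ k / (1 + s) ^ (m + 1 + k)) \<and> (LBINT s:{0<..}. s ^ k / (1 + s) ^ (m + 1 + k)) = beta_coeff m k"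
    if "m \<ge> 1" for m using that
  proof (induction k arbitrary: m)
    case 0
    have l: "((\<lambda>s::real. - 1 / (real m * (1 + s) ^ m)) \<longlongrightarrow> 0) at_top"
    proof (rule tendsto_divide_0[OF tendsto_const filterlim_at_top_imp_at_infinity])
      have "filterlim (\<lambda>s::real. (1 + s) ^ m) at_top at_top"
        using 0 by (intro filterlim_pow_at_top filterlim_tendsto_add_at_top[OF tendsto_const] filterlim_ident) auto
      then show "filterlim (\<lambda>s::real. real m * (1 + s) ^ m) at_top at_top"
        using 0 by (intro filterlim_tendsto_pos_mult_at_top[OF tendsto_const]) auto
    qed
    have d: "((\<lambda>s. - 1 / (real m * (1 + s) ^ m)) has_real_derivative 1 / (1 + s) ^ (m + 1)) (at s)" if "s \<ge> 0" for s :: real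
    proof -
      have "m * (m * x ^ (m - 1)) / ((m * x ^ m) * (m * x ^ m)) = 1 / x ^ (m + 1)" if "x > 0" for x :: real
      proof -
        have "x ^ m = x * x ^ (m - 1)" using 0 by (cases m) auto
        then show ?thesis using that 0 by (simp add: field_simps)
      qed
      from this[of "1 + s"] show ?thesis
        using that 0 by (auto intro!: derivative_eq_intros)
    qed
    have nn: "(\<integral>\<^sup>+ s. ennreal (1 / (1 + s) ^ (m + 1)) * indicator {0..} s \<partial>lborel) = ennreal (0 - (- 1 / (real m * (1 + 0) ^ m)))"
      by (rule nn_integral_FTC_atLeast[where F = "\<lambda>s. - 1 / (real m * (1 + s) ^ m)"]) (use l d in auto)
    have "(\<integral>\<^sup>+ s. ennreal (norm (indicat_real {0<..} (s::real) *\<^sub>R (1 / (1 + s) ^ (m + 1)))) \<partial>(lborel :: real measure))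
       \<le> (\<integral>\<^sup>+ s. ennreal (1 / (1 + s) ^ (m + 1)) * indicator {0..} s \<partial>lborel)"
      by (intro nn_integral_mono) (auto split: split_indicator)
    also have "\<dots> < \<infinity>" unfolding nn by simp
    finally have i: "set_integrable lborel {0<..} (\<lambda>s::real. 1 / (1 + s) ^ (m + 1))"
      unfolding set_integrable_def by (intro integrableI_bounded) auto
    have r: "((\<lambda>s::real. - 1 / (real m * (1 + s) ^ m)) \<longlongrightarrow> - 1 / (real m * (1 + 0) ^ m)) (at_right 0)"
      using 0 by (intro tendsto_intros) auto
    have "continuous_on {0<..} (\<lambda>s::real. 1 / (1 + s) ^ (m + 1))" by (intro continuous_intros) auto
    from set_integral_FTC_Ioi[OF d this i r l] i show ?case by simp
  next
    case (Suc k)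
    have eq: "s ^ Suc k / (1 + s) ^ (m + 1 + Suc k) = s ^ k / (1 + s) ^ (m + 1 + k) - s ^ k / (1 + s) ^ (Suc m + 1 + k)"
      if "s \<in> {0<..}" for s :: real
    proof -
      have "a / x ^ n - a / x ^ Suc n = a * (x - 1) / x ^ Suc n" if "x > 0" for a x :: real and n
        using that by (simp add: field_simps)
      from this[of "1 + s" "s ^ k" "m + 1 + k"] show ?thesis using that by (simp add: mult.commute)
    qed
    have "set_integrable lborel {0<..} (\<lambda>s::real. s ^ k / (1 + s) ^ (m + 1 + k) - s ^ k / (1 + s) ^ (Suc m + 1 + k))"
      "(LBINT s:{0<..}. s ^ k / (1 + s) ^ (m + 1 + k) - s ^ k / (1 + s) ^ (Suc m + 1 + k)) = beta_coeff m (Suc k)"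
      using Suc.IH[OF Suc.prems] Suc.IH[of "Suc m"] beta_coeff_step[OF Suc.prems, of k] by (simp_all only: set_integral_diff)
    moreover have "set_integrable lborel {0<..} (\<lambda>s::real. s ^ Suc k / (1 + s) ^ (m + 1 + Suc k))
      = set_integrable lborel {0<..} (\<lambda>s::real. s ^ k / (1 + s) ^ (m + 1 + k) - s ^ k / (1 + s) ^ (Suc m + 1 + k))"
      by (rule set_integrable_cong[OF refl refl eq])
    moreover have "(LBINT s:{0::real<..}. s ^ Suc k / (1 + s) ^ (m + 1 + Suc k))
      = (LBINT s:{0::real<..}. s ^ k / (1 + s) ^ (m + 1 + k) - s ^ k / (1 + s) ^ (Suc m + 1 + k))"
    proof (rule set_lebesgue_integral_cong)
      show "{0::real<..} \<in> sets lborel" by simp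
    qed (use eq in blast)
    ultimately show ?case by (simp only:)
  qed
  then show "set_integrable lborel {0<..} (\<lambda>s::real. s ^ k / (1 + s) ^ (m + 1 + k))"
    "(LBINT s:{0<..}. s ^ k / (1 + s) ^ (m + 1 + k)) = beta_coeff m k" using assms by auto
qed

text \<open>Each Cauchy product with the geometric series raises the exponent by one; the
  coefficients follow from the hockey-stick identity for binomials.\<close>

lemma negative_binomial_sums:
  fixes x :: real assumes "0 \<le> x" "x < 1"
  shows "(\<lambda>k. real ((j + k) choose k) * x ^ k) sums (1 / (1 - x) ^ Suc j)"
proof (induction j)
  case 0
  then show ?case using geometric_sums[of x] assms by simp
next
  case (Suc j)
  have g: "(\<lambda>k. x ^ k) sums (1 / (1 - x))" using geometric_sums[of x] assms by simp
  have "(\<lambda>k. \<Sum>i\<le>k. (real ((j + i) choose i) * x ^ i) * x ^ (k - i)) sums ((\<Sum>k. real ((j + k) choose k) * x ^ k) * (\<Sum>k. x ^ k))"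
    using Suc g assms by (intro Cauchy_product_sums) (auto simp: sums_iff)
  also have "(\<lambda>k. \<Sum>i\<le>k. (real ((j + i) choose i) * x ^ i) * x ^ (k - i)) = (\<lambda>k. real ((Suc j + k) choose k) * x ^ k)"
  proof
    fix k
    have "(\<Sum>i\<le>k. (real ((j + i) choose i) * x ^ i) * x ^ (k - i)) = (\<Sum>i\<le>k. real ((j + i) choose i)) * x ^ k"
      by (simp add: sum_distrib_right mult.assoc flip: power_add)
    also have "(\<Sum>i\<le>k. real ((j + i) choose i)) = real ((Suc j + k) choose k)"
      using sum_choose_lower[of j k] by (metis add_Suc of_nat_sum)
    finally show "(\<Sum>i\<le>k. (real ((j + i) choose i) * x ^ i) * x ^ (k - i)) = real ((Suc j + k) choose k) * x ^ k" .
  qed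
  also have "(\<Sum>k. real ((j + k) choose k) * x ^ k) * (\<Sum>k. x ^ k) = 1 / (1 - x) ^ Suc (Suc j)"
    using Suc g by (simp add: sums_iff)
  finally show ?case .
qed

text \<open>\<open>\<kappa> m r = E(1/(S T))\<close> for windows \<open>S\<close>, \<open>T\<close> of length \<open>m + 1\<close> at distance \<open>r\<close>. The series comes from
  \<open>1/(S T) = \<integral>\<integral> e\<^sup>-\<^sup>s\<^sup>S\<^sup>-\<^sup>t\<^sup>T ds dt\<close> and a negative binomial expansion of the joint Laplace transform.\<close>

definition kappa :: "nat \<Rightarrow> nat \<Rightarrow> real" where
  "kappa m r = (\<Sum>k. real ((m - r + k) choose k) * (beta_coeff m k)\<^sup>2)"

text \<open>For r >= 1 the binomial is at most binom(m - 1 + k, k) = m / (m + k) binom(m + k, k).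
  This cancels one of the two beta coefficients and leaves terms of order 1 / (k + 1)^2.\<close>

lemma kappa_summable:
  assumes "1 \<le> r" "r \<le> m"
  shows "summable (\<lambda>k. real ((m - r + k) choose k) * (beta_coeff m k)\<^sup>2)"
proof (rule summable_comparison_test)
  have "real ((m - r + k) choose k) * (beta_coeff m k)\<^sup>2 \<le> 1 / real (k + 1) ^ 2" for k
  proof -
    obtain p where p: "m = Suc p" using assms by (cases m) auto
    have "(m - r + k) choose k \<le> (p + k) choose k" using assms p by (intro binomial_right_mono) auto
    then have "real ((m - r + k) choose k) * (beta_coeff m k)\<^sup>2 \<le> real ((p + k) choose k) * (beta_coeff m k)\<^sup>2"
      by (intro mult_right_mono) auto
    also have "real ((p + k) choose k) = real m * real ((m + k) choose k) / real (m + k)"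
      using choose_step[of p k] p by (simp add: field_simps)
    also have "real m * real ((m + k) choose k) / real (m + k) * (beta_coeff m k)\<^sup>2 = 1 / real (m + k) * beta_coeff m k"
      using assms by (simp add: beta_coeff_def power2_eq_square)
    also have "\<dots> \<le> 1 / real (k + 1) * (1 / real (k + 1))"
    proof (intro mult_mono)
      show "1 / real (m + k) \<le> 1 / real (k + 1)" using assms by (intro divide_left_mono) auto
      have "beta_coeff m k \<le> 1 / (real m * real (k + 1))" using assms by (intro beta_coeff_le) auto
      also have "\<dots> \<le> 1 / (1 * real (k + 1))" using assms by (intro divide_left_mono mult_right_mono) auto
      finally show "beta_coeff m k \<le> 1 / real (k + 1)" by simp
    qed auto
    finally show ?thesis by (simp add: power2_eq_square)
  qed
  then show "\<exists>N. \<forall>n\<ge>N. norm (real ((m - r + n) choose n) * (beta_coeff m n)\<^sup>2) \<le> 1 / real (n + 1) ^ 2"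
    by auto
  show "summable (\<lambda>n. 1 / real (n + 1) ^ 2)"
    using inverse_squares_sums by (simp add: sums_iff add.commute)
qed

lemma nn_integral_exp_decay:
  assumes "x > (0::real)"
  shows "(\<integral>\<^sup>+ s. ennreal (exp (- s * x)) * indicator {0<..} s \<partial>lborel) = ennreal (1 / x)"
proof -
  note e = has_integral_exp_tail[OF assms, of 0]
  have "(\<integral>\<^sup>+ s. ennreal (exp (- s * x)) * indicator {0<..} s \<partial>lborel) = (\<integral>\<^sup>+ s. ennreal (indicat_real {0<..} s *\<^sub>R exp (- x * s)) \<partial>lborel)"
    by (intro nn_integral_cong) (auto split: split_indicator simp: mult.commute)
  also have "\<dots> = ennreal (LBINT s:{0<..}. exp (- x * s))"
    unfolding set_lebesgue_integral_def using e(1) unfolding set_integrable_def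
    by (intro nn_integral_eq_integral) auto
  finally show ?thesis using e(2) by simp
qed

lemma nn_integral_coord_exp:
  assumes "c \<ge> 0"
  shows "(\<integral>\<^sup>+ \<omega>. ennreal (exp (- c * \<omega> i)) \<partial>exp_seq) = ennreal (1 / (1 + c))"
proof -
  have "(\<integral>\<^sup>+ \<omega>. ennreal (exp (- c * \<omega> i)) \<partial>exp_seq) = (\<integral>\<^sup>+ x. ennreal (exp (- c * x)) \<partial>exp_law)"
    unfolding distr_coord[of i, symmetric] by (subst nn_integral_distr) (auto intro: measurable_coord)
  also have "\<dots> = (\<integral>\<^sup>+ x. ennreal (exponential_density 1 x) * ennreal (exp (- c * x)) \<partial>lborel)"
    unfolding exp_law_def by (subst nn_integral_density) auto
  also have "\<dots> = (\<integral>\<^sup>+ x. ennreal (exp (- x * (1 + c))) * indicator {0<..} x \<partial>lborel)"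
  proof (rule nn_integral_cong_AE)
    show "AE x in lborel. ennreal (exponential_density 1 x) * ennreal (exp (- c * x)) = ennreal (exp (- x * (1 + c))) * indicator {0<..} x"
      using AE_lborel_singleton[of 0]
      by eventually_elim (auto simp: exponential_density_def ennreal_mult[symmetric] algebra_simps simp flip: exp_add split: split_indicator)
  qed
  also have "\<dots> = ennreal (1 / (1 + c))" using assms by (intro nn_integral_exp_decay) auto
  finally show ?thesis .
qed

lemma overlap_laplace:
  assumes "r \<le> M" and s: "s \<ge> 0" and t: "t \<ge> 0"
  shows "(\<integral>\<^sup>+ \<omega>. ennreal (exp (- s * sum \<omega> {..<M})) * ennreal (exp (- t * sum \<omega> {r..<r+M})) \<partial>exp_seq)
    = ennreal (1 / ((1 + s) ^ r * (1 + s + t) ^ (M - r) * (1 + t) ^ r))"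
proof -
  \<comment> \<open>The total exponent at coordinate i: s from the first window and t from the
    second. The condition r <= i suffices for the second because only i < r + M occur.\<close>
  define c where "c = (\<lambda>i. (if i < M then s else 0) + (if r \<le> i then t else 0))"
  have c0: "c i \<ge> 0" for i using s t by (simp add: c_def)
  have un: "{..<r+M} = {..<r} \<union> {r..<M} \<union> {M..<r+M}" using assms by auto
  have "ennreal (exp (- s * sum \<omega> {..<M})) * ennreal (exp (- t * sum \<omega> {r..<r+M})) = (\<Prod>i\<in>{..<r+M}. ennreal (exp (- c i * \<omega> i)))" for \<omega> :: "nat \<Rightarrow> real"
  proof -
    have "(\<Sum>i<r+M. c i * \<omega> i) = (\<Sum>i<r+M. (if i < M then s * \<omega> i else 0)) + (\<Sum>i<r+M. (if r \<le> i then t * \<omega> i else 0))"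
      unfolding sum.distrib[symmetric] by (intro sum.cong) (auto simp: c_def algebra_simps)
    also have "(\<Sum>i<r+M. (if i < M then s * \<omega> i else 0)) = (\<Sum>i<M. s * \<omega> i)"
      by (intro sum.mono_neutral_cong_right) auto
    also have "(\<Sum>i<r+M. (if r \<le> i then t * \<omega> i else 0)) = (\<Sum>i=r..<r+M. t * \<omega> i)"
      by (intro sum.mono_neutral_cong_right) auto
    finally have "(\<Sum>i<r+M. c i * \<omega> i) = s * sum \<omega> {..<M} + t * sum \<omega> {r..<r+M}" by (simp add: sum_distrib_left)
    then have "exp (- s * sum \<omega> {..<M}) * exp (- t * sum \<omega> {r..<r+M}) = (\<Prod>i<r+M. exp (- c i * \<omega> i))"
      by (simp add: exp_sum[symmetric] sum_negf flip: exp_add)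
    then show ?thesis by (simp add: ennreal_mult[symmetric] prod_ennreal)
  qed
  then have "(\<integral>\<^sup>+ \<omega>. ennreal (exp (- s * sum \<omega> {..<M})) * ennreal (exp (- t * sum \<omega> {r..<r+M})) \<partial>exp_seq)
    = (\<integral>\<^sup>+ \<omega>. (\<Prod>i\<in>{..<r+M}. ennreal (exp (- c i * \<omega> i))) \<partial>exp_seq)" by simp
  also have "\<dots> = (\<Prod>i\<in>{..<r+M}. \<integral>\<^sup>+ \<omega>. ennreal (exp (- c i * \<omega> i)) \<partial>exp_seq)"
    by (intro exp_seq.indep_vars_nn_integral exp_seq.indep_vars_compose2[OF exp_seq.indep_vars_subset[OF indep_coord]]) auto
  also have "\<dots> = (\<Prod>i\<in>{..<r+M}. ennreal (1 / (1 + c i)))"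
    using c0 by (intro prod.cong refl nn_integral_coord_exp)
  also have "\<dots> = ennreal (\<Prod>i\<in>{..<r+M}. 1 / (1 + c i))" using c0 by (intro prod_ennreal) auto
  also have "(\<Prod>i\<in>{..<r+M}. 1 / (1 + c i)) = (\<Prod>i\<in>{..<r}. 1 / (1 + c i)) * (\<Prod>i\<in>{r..<M}. 1 / (1 + c i)) * (\<Prod>i\<in>{M..<r+M}. 1 / (1 + c i))"
  proof -
    have dis: "({..<r} \<union> {r..<M}) \<inter> {M..<r+M} = {}" "{..<r} \<inter> {r..<M} = {}" using assms by auto
    show ?thesis
      unfolding un by (simp only: prod.union_disjoint[OF _ _ dis(1)] prod.union_disjoint[OF _ _ dis(2)]
          finite_Un finite_lessThan finite_atLeastLessThan)
  qed
  also have "(\<Prod>i\<in>{..<r}. 1 / (1 + c i)) = (\<Prod>i\<in>{..<r}. 1 / (1 + s))"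
    using assms by (intro prod.cong) (auto simp: c_def)
  also have "(\<Prod>i\<in>{r..<M}. 1 / (1 + c i)) = (\<Prod>i\<in>{r..<M}. 1 / (1 + s + t))"
    using assms by (intro prod.cong) (auto simp: c_def)
  also have "(\<Prod>i\<in>{M..<r+M}. 1 / (1 + c i)) = (\<Prod>i\<in>{M..<r+M}. 1 / (1 + t))"
    using assms by (intro prod.cong) (auto simp: c_def)
  finally show ?thesis by (simp add: power_one_over)
qed

text \<open>Because 1 + s + t = (1 + s)(1 + t) - s t, expanding in x = s t / ((1 + s)(1 + t)) splits
  every term into a function of s times a function of t. As 0 <= x < 1 for all positive s and t, the
  series converges everywhere.\<close>

lemma laplace_expansion:
  fixes s t :: real
  assumes "1 \<le> r" "r \<le> m" "s > 0" "t > 0"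
  shows "(\<lambda>k. real ((m - r + k) choose k) * (s ^ k / (1 + s) ^ (m + 1 + k) * (t ^ k / (1 + t) ^ (m + 1 + k))))
    sums (1 / ((1 + s) ^ r * (1 + s + t) ^ (Suc m - r) * (1 + t) ^ r))"
proof -
  define A where "A = (1 + s) * (1 + t)"
  define x where "x = s * t / A"
  have A: "A > 0" using assms by (simp add: A_def)
  have d: "1 - x = (1 + s + t) / A" using A by (simp add: x_def A_def field_simps)
  have pos: "1 + s + t > 0" using assms by simp
  have x: "0 \<le> x" "x < 1"
  proof -
    have "1 - x > 0" unfolding d using A pos by simp
    then show "x < 1" by simp
    show "0 \<le> x" using assms A by (simp add: x_def)
  qed
  have j: "Suc (m - r) = Suc m - r" "r + (Suc m - r) = m + 1" using assms by auto
  have "(\<lambda>k. 1 / A ^ (m + 1) * (real ((m - r + k) choose k) * x ^ k)) sums (1 / A ^ (m + 1) * (1 / (1 - x) ^ Suc (m - r)))"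
    by (intro sums_mult negative_binomial_sums x)
  also have "(\<lambda>k. 1 / A ^ (m + 1) * (real ((m - r + k) choose k) * x ^ k))
    = (\<lambda>k. real ((m - r + k) choose k) * (s ^ k / (1 + s) ^ (m + 1 + k) * (t ^ k / (1 + t) ^ (m + 1 + k))))"
    by (simp add: x_def A_def power_divide power_mult_distrib power_add fun_eq_iff)
  also have "1 / A ^ (m + 1) * (1 / (1 - x) ^ Suc (m - r)) = 1 / (A ^ r * (1 + s + t) ^ (Suc m - r))"
  proof -
    have "A ^ (m + 1) = A ^ r * A ^ (Suc m - r)" by (simp only: j(2)[symmetric] power_add)
    then show ?thesis using A pos unfolding d j(1) by (simp add: power_divide)
  qed
  finally show ?thesis by (simp add: A_def power_mult_distrib mult_ac)
qed

text \<open>Everything is nonnegative, so the expectation, both Laplace integrals and the series may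
  be interchanged before finiteness is known. Integrating term by term gives two beta
  integrals.\<close>

lemma nn_overlap_inverse:
  assumes r: "1 \<le> r" "r \<le> m"
  shows "(\<integral>\<^sup>+ \<omega>. ennreal (1 / sum \<omega> {..<Suc m} * (1 / sum \<omega> {r..<r + Suc m})) \<partial>exp_seq) = ennreal (kappa m r)"
proof -
  interpret P: pair_sigma_finite exp_seq "lborel :: real measure" ..
  let ?X = "\<lambda>\<omega>::nat \<Rightarrow> real. sum \<omega> {..<Suc m}" and ?Y = "\<lambda>\<omega>::nat \<Rightarrow> real. sum \<omega> {r..<r + Suc m}"
  let ?i = "\<lambda>s::real. indicator {0<..} s :: ennreal"
  let ?g = "\<lambda>\<omega> s t. ennreal (exp (- s * ?X \<omega>)) * ?i s * (ennreal (exp (- t * ?Y \<omega>)) * ?i t)"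
  let ?a = "\<lambda>k s. s ^ k / (1 + s) ^ (m + 1 + k) :: real"
  have mX: "(\<lambda>\<omega>. sum \<omega> S) \<in> borel_measurable exp_seq" for S :: "nat set" by measurable
  have "(\<integral>\<^sup>+ \<omega>. ennreal (1 / ?X \<omega> * (1 / ?Y \<omega>)) \<partial>exp_seq) = (\<integral>\<^sup>+ \<omega>. (\<integral>\<^sup>+ s. (\<integral>\<^sup>+ t. ?g \<omega> s t \<partial>lborel) \<partial>lborel) \<partial>exp_seq)"
  proof (rule nn_integral_cong_AE)
    show "AE \<omega> in exp_seq. ennreal (1 / ?X \<omega> * (1 / ?Y \<omega>)) = (\<integral>\<^sup>+ s. (\<integral>\<^sup>+ t. ?g \<omega> s t \<partial>lborel) \<partial>lborel)"
      using AE_exp_seq_pos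
    proof eventually_elim
      case (elim \<omega>)
      have X: "?X \<omega> > 0" and Y: "?Y \<omega> > 0" by (rule sum_pos; use elim in auto)+
      have "ennreal (1 / ?X \<omega> * (1 / ?Y \<omega>)) = ennreal (1 / ?X \<omega>) * ennreal (1 / ?Y \<omega>)"
        using X Y by (intro ennreal_mult) auto
      also have "\<dots> = (\<integral>\<^sup>+ s. (\<integral>\<^sup>+ t. ?g \<omega> s t \<partial>lborel) \<partial>lborel)"
      proof -
        have "(\<integral>\<^sup>+ t. ?g \<omega> s t \<partial>lborel) = ennreal (exp (- s * ?X \<omega>)) * ?i s * ennreal (1 / ?Y \<omega>)" for s
          by (rule trans[OF nn_integral_cmult]) (measurable, simp only: nn_integral_exp_decay[OF Y])
        moreover have "(\<integral>\<^sup>+ s. ennreal (exp (- s * ?X \<omega>)) * ?i s * ennreal (1 / ?Y \<omega>) \<partial>lborel) = ennreal (1 / ?X \<omega>) * ennreal (1 / ?Y \<omega>)"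
          by (rule trans[OF nn_integral_multc]) (measurable, simp only: nn_integral_exp_decay[OF X])
        ultimately show ?thesis by (simp only:)
      qed
      finally show ?case .
    qed
  qed
  also have "\<dots> = (\<integral>\<^sup>+ s. (\<integral>\<^sup>+ \<omega>. (\<integral>\<^sup>+ t. ?g \<omega> s t \<partial>lborel) \<partial>exp_seq) \<partial>lborel)"
    by (rule P.Fubini'[symmetric]) (use mX in measurable)
  also have "\<dots> = (\<integral>\<^sup>+ s. (\<integral>\<^sup>+ t. (\<integral>\<^sup>+ \<omega>. ?g \<omega> s t \<partial>exp_seq) \<partial>lborel) \<partial>lborel)"
    by (intro nn_integral_cong P.Fubini'[symmetric]) (use mX in measurable)
  also have "\<dots> = (\<integral>\<^sup>+ s. (\<integral>\<^sup>+ t. (\<Sum>k. ennreal (real ((m - r + k) choose k)) * (ennreal (?a k s) * ?i s) * (ennreal (?a k t) * ?i t)) \<partial>lborel) \<partial>lborel)"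
  proof (intro nn_integral_cong)
    fix s t :: real
    show "(\<integral>\<^sup>+ \<omega>. ?g \<omega> s t \<partial>exp_seq) = (\<Sum>k. ennreal (real ((m - r + k) choose k)) * (ennreal (?a k s) * ?i s) * (ennreal (?a k t) * ?i t))"
    proof (cases "s > 0 \<and> t > 0")
      case True
      then have "(\<integral>\<^sup>+ \<omega>. ?g \<omega> s t \<partial>exp_seq) = ennreal (1 / ((1 + s) ^ r * (1 + s + t) ^ (Suc m - r) * (1 + t) ^ r))"
        using overlap_laplace[of r "Suc m" s t] r by (simp add: mult_ac)
      also have "\<dots> = ennreal (\<Sum>k. real ((m - r + k) choose k) * (?a k s * ?a k t))"
        using laplace_expansion[OF r, of s t] True by (simp add: sums_iff)
      also have "\<dots> = (\<Sum>k. ennreal (real ((m - r + k) choose k) * (?a k s * ?a k t)))"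
        using laplace_expansion[OF r, of s t] True by (intro suminf_ennreal2[symmetric]) (auto simp: sums_iff)
      also have "\<dots> = (\<Sum>k. ennreal (real ((m - r + k) choose k)) * (ennreal (?a k s) * ?i s) * (ennreal (?a k t) * ?i t))"
      proof (rule suminf_cong)
        fix k
        have a: "?a k s \<ge> 0" "?a k t \<ge> 0" using True by auto
        show "ennreal (real ((m - r + k) choose k) * (?a k s * ?a k t))
          = ennreal (real ((m - r + k) choose k)) * (ennreal (?a k s) * ?i s) * (ennreal (?a k t) * ?i t)"
          unfolding ennreal_mult[OF of_nat_0_le_iff mult_nonneg_nonneg[OF a]] ennreal_mult[OF a]
          using True by (simp add: mult.assoc)
      qed
      finally show ?thesis .
    next
      case False
      then show ?thesis by (cases "s > 0") auto
    qed
  qed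
  also have "\<dots> = (\<integral>\<^sup>+ s. (\<Sum>k. (\<integral>\<^sup>+ t. ennreal (real ((m - r + k) choose k)) * (ennreal (?a k s) * ?i s) * (ennreal (?a k t) * ?i t) \<partial>lborel)) \<partial>lborel)"
    by (intro nn_integral_cong nn_integral_suminf) measurable
  also have "\<dots> = (\<Sum>k. (\<integral>\<^sup>+ s. (\<integral>\<^sup>+ t. ennreal (real ((m - r + k) choose k)) * (ennreal (?a k s) * ?i s) * (ennreal (?a k t) * ?i t) \<partial>lborel) \<partial>lborel))"
    by (rule nn_integral_suminf) measurable
  also have "\<dots> = (\<Sum>k. ennreal (real ((m - r + k) choose k) * (beta_coeff m k)\<^sup>2))"
  proof (rule suminf_cong)
    fix k
    have b: "(\<integral>\<^sup>+ s. ennreal (?a k s) * ?i s \<partial>lborel) = ennreal (beta_coeff m k)"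
    proof -
      have "(\<integral>\<^sup>+ s. ennreal (?a k s) * ?i s \<partial>lborel) = (\<integral>\<^sup>+ s. ennreal (indicat_real {0<..} s *\<^sub>R ?a k s) \<partial>lborel)"
        by (intro nn_integral_cong) (auto split: split_indicator)
      also have "\<dots> = ennreal (LBINT s:{0<..}. ?a k s)"
        unfolding set_lebesgue_integral_def using beta_integral(1)[of m k] r unfolding set_integrable_def
        by (intro nn_integral_eq_integral) (auto split: split_indicator)
      finally show ?thesis using beta_integral(2)[of m k] r by simp
    qed
    show "(\<integral>\<^sup>+ s. (\<integral>\<^sup>+ t. ennreal (real ((m - r + k) choose k)) * (ennreal (?a k s) * ?i s) * (ennreal (?a k t) * ?i t) \<partial>lborel) \<partial>lborel)
      = ennreal (real ((m - r + k) choose k) * (beta_coeff m k)\<^sup>2)"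
    proof -
      let ?C = "ennreal (real ((m - r + k) choose k))"
      have "(\<integral>\<^sup>+ t. ?C * (ennreal (?a k s) * ?i s) * (ennreal (?a k t) * ?i t) \<partial>lborel) = ?C * (ennreal (?a k s) * ?i s) * ennreal (beta_coeff m k)" for s
        by (rule trans[OF nn_integral_cmult]) (measurable, simp only: b)
      moreover have "(\<integral>\<^sup>+ s. ?C * (ennreal (?a k s) * ?i s) * ennreal (beta_coeff m k) \<partial>lborel) = ?C * ennreal (beta_coeff m k) * ennreal (beta_coeff m k)"
        by (rule trans[OF nn_integral_multc], measurable, rule arg_cong[where f = "\<lambda>x. x * _"], rule trans[OF nn_integral_cmult], measurable, simp only: b)
      ultimately show ?thesis by (simp only: mult.assoc) (simp add: ennreal_mult power2_eq_square)
    qed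
  qed
  also have "\<dots> = ennreal (kappa m r)"
    unfolding kappa_def by (intro suminf_ennreal2 kappa_summable r) auto
  finally show ?thesis .
qed

lemma kappa_nonneg: "1 \<le> r \<Longrightarrow> r \<le> m \<Longrightarrow> kappa m r \<ge> 0"
  unfolding kappa_def by (intro suminf_nonneg kappa_summable) auto

lemma overlap_inverse:
  assumes r: "1 \<le> r" "r \<le> m"
  shows "integrable exp_seq (\<lambda>\<omega>. 1 / sum \<omega> {..<Suc m} * (1 / sum \<omega> {r..<r + Suc m}))"
    and "overlap_moment (\<lambda>x. 1 / x) (\<lambda>x. 1 / x) (Suc m) r = kappa m r"
proof -
  have ae: "AE \<omega> in exp_seq. 0 \<le> 1 / sum \<omega> {..<Suc m} * (1 / sum \<omega> {r..<r + Suc m})"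
    using AE_exp_seq_pos by eventually_elim (intro mult_nonneg_nonneg divide_nonneg_nonneg sum_nonneg, auto intro: less_imp_le)
  have m: "(\<lambda>\<omega>. 1 / sum \<omega> {..<Suc m} * (1 / sum \<omega> {r..<r + Suc m})) \<in> borel_measurable exp_seq"
    by (intro borel_measurable_times measurable_fun_sum[where f = "\<lambda>x. 1 / x"]) auto
  have "has_bochner_integral exp_seq (\<lambda>\<omega>. 1 / sum \<omega> {..<Suc m} * (1 / sum \<omega> {r..<r + Suc m})) (kappa m r)"
    using m ae kappa_nonneg[OF r] nn_overlap_inverse[OF r] by (intro has_bochner_integral_nn_integral) auto
  then show "integrable exp_seq (\<lambda>\<omega>. 1 / sum \<omega> {..<Suc m} * (1 / sum \<omega> {r..<r + Suc m}))"
    and "overlap_moment (\<lambda>x. 1 / x) (\<lambda>x. 1 / x) (Suc m) r = kappa m r"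
    by (auto simp: has_bochner_integral_iff overlap_moment_def)
qed

text \<open>Passing from m to m + 1 moves r to r + 1, and 2 (r + 1) - 1 = (2 r - 1) + 2 brings in
  the unweighted sum. Hence the joint induction.\<close>

lemma sum_odd_choose:
  "(\<Sum>r=1..m. (2 * real r - 1) * real ((m - r + k) choose k)) * (real (k + 1) * real (k + 2))
    = real m * real (2 * m + k) * real ((m + k) choose k)"
  "(\<Sum>r=1..m. real ((m - r + k) choose k)) * real (k + 1) = real m * real ((m + k) choose k)"
proof (induction m)
  case (Suc m)
  let ?c = "real ((m + k) choose k)" and ?d = "real ((Suc m + k) choose k)"
  have e: "real (m + 1) * ?d = real (m + k + 1) * ?c" by (rule choose_step)
  have split: "(\<Sum>r=1..Suc m. f (Suc m - r) (real r)) = f m 1 + (\<Sum>r=1..m. f (m - r) (real r + 1))" for f :: "nat \<Rightarrow> real \<Rightarrow> real"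
  proof -
    have "(\<Sum>r=1..Suc m. f (Suc m - r) (real r)) = f m 1 + (\<Sum>r=Suc 1..Suc m. f (Suc m - r) (real r))"
      by (subst sum.atLeast_Suc_atMost) auto
    also have "(\<Sum>r=Suc 1..Suc m. f (Suc m - r) (real r)) = (\<Sum>r=1..m. f (m - r) (real r + 1))"
      by (subst sum.shift_bounds_cl_Suc_ivl) (simp add: add.commute)
    finally show ?thesis .
  qed
  have 2: "(\<Sum>r=1..Suc m. real ((Suc m - r + k) choose k)) = ?c + (\<Sum>r=1..m. real ((m - r + k) choose k))"
    using split[of "\<lambda>j x. real ((j + k) choose k)"] by simp
  show "(\<Sum>r=1..Suc m. real ((Suc m - r + k) choose k)) * real (k + 1) = real (Suc m) * ?d"
    unfolding 2 using Suc(2) e by (simp add: algebra_simps)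
  have 1: "(\<Sum>r=1..Suc m. (2 * real r - 1) * real ((Suc m - r + k) choose k))
    = ?c + (\<Sum>r=1..m. (2 * real r - 1) * real ((m - r + k) choose k)) + 2 * (\<Sum>r=1..m. real ((m - r + k) choose k))"
    using split[of "\<lambda>j x. (2 * x - 1) * real ((j + k) choose k)"]
    by (simp add: sum_distrib_left sum.distrib[symmetric] algebra_simps)
  have "(\<Sum>r=1..Suc m. (2 * real r - 1) * real ((Suc m - r + k) choose k)) * (real (k + 1) * real (k + 2))
    = ?c * (real (k + 1) * real (k + 2)) + real m * real (2 * m + k) * ?c + 2 * real (k + 2) * (real m * ?c)"
  proof -
    have "(c + A + 2 * B) * (real (k + 1) * real (k + 2)) = c * (real (k + 1) * real (k + 2)) + A * (real (k + 1) * real (k + 2)) + 2 * real (k + 2) * (B * real (k + 1))"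
      for A B c :: real by (simp add: algebra_simps)
    then show ?thesis unfolding 1 by (simp only: Suc)
  qed
  also have "\<dots> = real (2 * m + 2 + k) * (real (m + k + 1) * ?c)" by (simp add: algebra_simps)
  also have "\<dots> = real (Suc m) * real (2 * Suc m + k) * ?d" unfolding e[symmetric] by simp
  finally show "(\<Sum>r=1..Suc m. (2 * real r - 1) * real ((Suc m - r + k) choose k)) * (real (k + 1) * real (k + 2))
    = real (Suc m) * real (2 * Suc m + k) * ?d" .
qed simp_all

text \<open>In the induction step r^2 = (r - 1)^2 + (2 r - 1) reduces the new terms to the sums with
  odd weights.\<close>

lemma sum_square_choose:
  "(\<Sum>r=1..m. (real r - 1)\<^sup>2 * real ((m - r + k) choose k)) * (real (k + 1) * real (k + 2) * real (k + 3))
    = real m * (real m - 1) * (2 * real m + real k - 1) * real ((m + k) choose k)"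
proof (induction m)
  case (Suc m)
  let ?c = "real ((m + k) choose k)" and ?d = "real ((Suc m + k) choose k)"
  have e: "real (m + 1) * ?d = real (m + k + 1) * ?c" by (rule choose_step)
  have "(\<Sum>r=1..Suc m. (real r - 1)\<^sup>2 * real ((Suc m - r + k) choose k)) = (\<Sum>r=Suc 1..Suc m. (real r - 1)\<^sup>2 * real ((Suc m - r + k) choose k))"
    by (subst sum.atLeast_Suc_atMost) auto
  also have "\<dots> = (\<Sum>r=1..m. (real r)\<^sup>2 * real ((m - r + k) choose k))"
    by (subst sum.shift_bounds_cl_Suc_ivl) simp
  also have "\<dots> = (\<Sum>r=1..m. (real r - 1)\<^sup>2 * real ((m - r + k) choose k)) + (\<Sum>r=1..m. (2 * real r - 1) * real ((m - r + k) choose k))"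
    by (simp add: sum.distrib[symmetric] algebra_simps power2_eq_square)
  finally have "(\<Sum>r=1..Suc m. (real r - 1)\<^sup>2 * real ((Suc m - r + k) choose k)) * (real (k + 1) * real (k + 2) * real (k + 3))
    = real m * (real m - 1) * (2 * real m + real k - 1) * ?c + real m * real (2 * m + k) * ?c * real (k + 3)"
  proof -
    assume *: "(\<Sum>r=1..Suc m. (real r - 1)\<^sup>2 * real ((Suc m - r + k) choose k))
      = (\<Sum>r=1..m. (real r - 1)\<^sup>2 * real ((m - r + k) choose k)) + (\<Sum>r=1..m. (2 * real r - 1) * real ((m - r + k) choose k))"
    have "(A + B) * (real (k + 1) * real (k + 2) * real (k + 3)) = A * (real (k + 1) * real (k + 2) * real (k + 3)) + B * (real (k + 1) * real (k + 2)) * real (k + 3)"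
      for A B :: real by (simp add: algebra_simps)
    then show ?thesis unfolding * by (simp only: Suc sum_odd_choose(1))
  qed
  also have "\<dots> = real m * (2 * real m + real k + 1) * (real (m + k + 1) * ?c)" by (simp add: algebra_simps)
  also have "\<dots> = real (Suc m) * (real (Suc m) - 1) * (2 * real (Suc m) + real k - 1) * ?d"
    unfolding e[symmetric] by (simp add: algebra_simps)
  finally show ?case .
qed simp

lemma kappa_weighted_sums:
  assumes m: "m \<ge> 1"
  shows "(\<lambda>k. (\<Sum>r=1..m. w r * real ((m - r + k) choose k)) * (beta_coeff m k)\<^sup>2) sums (\<Sum>r=1..m. w r * kappa m r)"
proof -
  have "(\<lambda>k. \<Sum>r=1..m. w r * (real ((m - r + k) choose k) * (beta_coeff m k)\<^sup>2)) sums (\<Sum>r=1..m. w r * kappa m r)"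
    unfolding kappa_def by (intro sums_sum sums_mult summable_sums kappa_summable) auto
  then show ?thesis by (simp add: sum_distrib_right mult.assoc)
qed

lemma kappa_odd_sums:
  assumes m: "m \<ge> 1"
  shows "(\<lambda>k. beta_coeff m k * real (2 * m + k) / (real (k + 1) * real (k + 2))) sums (\<Sum>r=1..m. (2 * real r - 1) * kappa m r)"
proof -
  have "(\<Sum>r=1..m. (2 * real r - 1) * real ((m - r + k) choose k)) * (beta_coeff m k)\<^sup>2 = beta_coeff m k * real (2 * m + k) / (real (k + 1) * real (k + 2))" for k
  proof -
    have pos: "real ((m + k) choose k) > 0" by simp
    have "(\<Sum>r=1..m. (2 * real r - 1) * real ((m - r + k) choose k)) = real m * real (2 * m + k) * real ((m + k) choose k) / (real (k + 1) * real (k + 2))"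
      by (subst nonzero_eq_divide_eq) (simp, rule sum_odd_choose(1))
    then show ?thesis using m pos by (simp add: beta_coeff_def power2_eq_square del: of_nat_add)
  qed
  with kappa_weighted_sums[OF m, of "\<lambda>r. 2 * real r - 1"] show ?thesis by simp
qed

lemma kappa_square_sums:
  assumes m: "m \<ge> 1"
  shows "(\<lambda>k. beta_coeff m k * (real m - 1) * (2 * real m + real k - 1) / (real (k + 1) * real (k + 2) * real (k + 3)))
    sums (\<Sum>r=1..m. (real r - 1)\<^sup>2 * kappa m r)"
proof -
  have "(\<Sum>r=1..m. (real r - 1)\<^sup>2 * real ((m - r + k) choose k)) * (beta_coeff m k)\<^sup>2
    = beta_coeff m k * (real m - 1) * (2 * real m + real k - 1) / (real (k + 1) * real (k + 2) * real (k + 3))" for k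
  proof -
    have pos: "real ((m + k) choose k) > 0" by simp
    have "real (k + 1) * real (k + 2) * real (k + 3) \<noteq> 0" by simp
    then have "(\<Sum>r=1..m. (real r - 1)\<^sup>2 * real ((m - r + k) choose k))
      = real m * (real m - 1) * (2 * real m + real k - 1) * real ((m + k) choose k) / (real (k + 1) * real (k + 2) * real (k + 3))"
      using sum_square_choose[of m k] by (subst nonzero_eq_divide_eq) assumption+
    then show ?thesis using m pos by (simp add: beta_coeff_def power2_eq_square del: of_nat_add)
  qed
  with kappa_weighted_sums[OF m, of "\<lambda>r. (real r - 1)\<^sup>2"] show ?thesis by simp
qed

section \<open>Summation of the series by Hurwitz zeta values\<close>

text \<open>The series left over when partial fractions in k are applied to the weighted sums of
  \<open>kappa\<close>.\<close>

definition beta_sum :: "nat \<Rightarrow> nat \<Rightarrow> real" where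
  "beta_sum j m = (\<Sum>k. beta_coeff m k / real (k + j))"

lemma summable_inverse_square: "summable (\<lambda>n. 1 / real (n + 1) ^ 2)"
  using inverse_squares_sums by (simp add: sums_iff add.commute)

lemma beta_sum_summable:
  assumes "m \<ge> 1" "j \<ge> 1"
  shows "summable (\<lambda>k. beta_coeff m k / real (k + j))"
    and "j = 1 \<Longrightarrow> beta_sum j m \<le> 1 / real m * (\<Sum>n. 1 / real (n + 1) ^ 2)"
proof -
  have le: "beta_coeff m k / real (k + j) \<le> 1 / real m * (1 / real (k + 1) ^ 2)" for k
  proof -
    have "beta_coeff m k / real (k + j) \<le> (1 / (real m * real (k + 1))) / real (k + 1)"
      using assms beta_coeff_le[OF assms(1), of k] by (intro frac_le) auto
    then show ?thesis by (simp add: power2_eq_square mult.assoc)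
  qed
  show s: "summable (\<lambda>k. beta_coeff m k / real (k + j))"
    by (rule summable_comparison_test'[OF summable_mult[OF summable_inverse_square, of "1 / real m"]]) (use le in simp)
  show "beta_sum j m \<le> 1 / real m * (\<Sum>n. 1 / real (n + 1) ^ 2)"
    unfolding beta_sum_def suminf_mult[OF summable_inverse_square, symmetric]
    by (intro suminf_le le s summable_mult summable_inverse_square)
qed

lemma beta_coeff_tendsto_0: "m \<ge> 1 \<Longrightarrow> beta_coeff m \<longlonglongrightarrow> 0"
proof -
  assume m: "m \<ge> 1"
  have "(\<lambda>k. 1 / real (Suc k)) \<longlonglongrightarrow> 0" by (rule LIMSEQ_Suc) (rule lim_1_over_n)
  then have l: "(\<lambda>k. 1 / real m * (1 / real (Suc k))) \<longlonglongrightarrow> 0" by (rule tendsto_mult_right_zero)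
  show ?thesis
    by (rule Lim_null_comparison[OF _ l]) (use beta_coeff_le[OF m] in \<open>auto intro!: always_eventually simp: mult.commute\<close>)
qed

text \<open>The recursion for the beta coefficients writes the terms of the next series through b(k)
  - b(k + 1), which telescopes, and a shift of the present series. All indices thus reduce to j =
  1.\<close>

lemma beta_sum_rec:
  assumes "m \<ge> 1" "j \<ge> 1"
  shows "real j * beta_sum (Suc j) m = 1 / real j - (real m - real j) * beta_sum j m"
proof -
  let ?b = "beta_coeff m"
  have s: "(\<lambda>k. ?b k / real (k + j)) sums beta_sum j m" "(\<lambda>k. ?b k / real (k + Suc j)) sums beta_sum (Suc j) m"
    unfolding beta_sum_def using beta_sum_summable(1)[OF assms] beta_sum_summable(1)[OF assms(1), of "Suc j"] by (auto intro: summable_sums)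
  have t: "(\<lambda>k. ?b k - ?b (Suc k)) sums (?b 0 - 0)"
    by (rule telescope_sums'[OF beta_coeff_tendsto_0[OF assms(1)]])
  have s': "(\<lambda>k. ?b (Suc k) / real (Suc k + j)) sums (beta_sum j m - ?b 0 / real j)"
    using s(1) by (subst sums_Suc_iff) simp
  have "real j * (?b k / real (k + Suc j)) = (?b k - ?b (Suc k)) - (real m - real j) * (?b (Suc k) / real (Suc k + j))" for k
  proof -
    have "real (m + k + 1) * ?b (Suc k) = real (k + 1) * ?b k" by (rule beta_coeff_Suc[OF assms(1)])
    then have "real (m + k + 1) * ?b (Suc k) / real (k + Suc j) = real (k + 1) * ?b k / real (k + Suc j)" by simp
    then show ?thesis by (simp add: field_simps)
  qed
  moreover have "(\<lambda>k. (?b k - ?b (Suc k)) - (real m - real j) * (?b (Suc k) / real (Suc k + j)))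
    sums ((?b 0 - 0) - (real m - real j) * (beta_sum j m - ?b 0 / real j))"
    by (intro sums_diff sums_mult t s')
  ultimately have "(\<lambda>k. real j * (?b k / real (k + Suc j))) sums ((?b 0 - 0) - (real m - real j) * (beta_sum j m - ?b 0 / real j))"
    by simp
  moreover have "(\<lambda>k. real j * (?b k / real (k + Suc j))) sums (real j * beta_sum (Suc j) m)"
    by (intro sums_mult s)
  ultimately have "real j * beta_sum (Suc j) m = (?b 0 - 0) - (real m - real j) * (beta_sum j m - ?b 0 / real j)"
    by (rule sums_unique2[rotated])
  moreover have "(real m - real j) * (?b 0 / real j) = 1 / real j - ?b 0" using assms by (simp add: field_simps)
  ultimately show ?thesis by (simp add: right_diff_distrib)
qed

lemma beta_sum_1_step:
  assumes m: "m \<ge> 1"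
  shows "beta_sum 1 m - beta_sum 1 (Suc m) = 1 / real m ^ 2"
proof -
  let ?b = "beta_coeff m"
  have s: "(\<lambda>k. ?b k / real (k + 1)) sums beta_sum 1 m" "(\<lambda>k. beta_coeff (Suc m) k / real (k + 1)) sums beta_sum 1 (Suc m)"
    unfolding beta_sum_def using beta_sum_summable(1)[OF m, of 1] beta_sum_summable(1)[of "Suc m" 1] by (auto intro: summable_sums)
  have "(\<lambda>k. ?b k / real (k + 1) - beta_coeff (Suc m) k / real (k + 1)) sums (beta_sum 1 m - beta_sum 1 (Suc m))"
    by (intro sums_diff s)
  moreover have "?b k / real (k + 1) - beta_coeff (Suc m) k / real (k + 1) = (?b k - ?b (Suc k)) / real m" for k
  proof -
    have "real (m + k + 1) * ?b (Suc k) = real (k + 1) * ?b k" by (rule beta_coeff_Suc[OF m])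
    then have "?b k = real (m + k + 1) * ?b (Suc k) / real (k + 1)" by (simp add: field_simps)
    then have "?b k - ?b (Suc k) = real m * ?b (Suc k) / real (k + 1)" by (simp add: field_simps)
    then show ?thesis using m beta_coeff_step[OF m, of k] by (simp add: diff_divide_distrib[symmetric] del: of_nat_add)
  qed
  moreover have "(\<lambda>k. (?b k - ?b (Suc k)) / real m) sums ((?b 0 - 0) / real m)"
    by (intro sums_divide telescope_sums' beta_coeff_tendsto_0 m)
  ultimately show ?thesis by (simp add: sums_iff power2_eq_square)
qed

text \<open>The series drops by 1/m^2 from m to m + 1 and tends to 0 as m grows, so it is the sum of
  all these drops.\<close>

lemma beta_sum_1_eq:
  assumes m: "m \<ge> 1"
  shows "beta_sum 1 m = hurwitz_zeta_nat 2 m"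
proof -
  have eq: "(\<Sum>j<J. 1 / real (m + j) ^ 2) = beta_sum 1 m - beta_sum 1 (m + J)" for J
  proof (induction J)
    case (Suc J)
    have "1 / real (m + J) ^ 2 = beta_sum 1 (m + J) - beta_sum 1 (Suc (m + J))" using m by (subst beta_sum_1_step) auto
    with Suc show ?case by simp
  qed simp
  have "(\<lambda>J. beta_sum 1 (m + J)) \<longlonglongrightarrow> 0"
  proof (rule Lim_null_comparison)
    show "\<forall>\<^sub>F J in sequentially. norm (beta_sum 1 (m + J)) \<le> 1 / real (m + J) * (\<Sum>n. 1 / real (n + 1) ^ 2)"
    proof (intro always_eventually allI)
      fix J
      have "0 \<le> beta_sum 1 (m + J)" unfolding beta_sum_def using m beta_sum_summable(1)[of "m + J" 1] by (intro suminf_nonneg) auto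
      then show "norm (beta_sum 1 (m + J)) \<le> 1 / real (m + J) * (\<Sum>n. 1 / real (n + 1) ^ 2)"
        using beta_sum_summable(2)[of "m + J" 1] m by simp
    qed
    have "(\<lambda>J. 1 / real (J + m)) \<longlonglongrightarrow> 0" by (rule LIMSEQ_ignore_initial_segment) (rule lim_1_over_n)
    then show "(\<lambda>J. 1 / real (m + J) * (\<Sum>n. 1 / real (n + 1) ^ 2)) \<longlonglongrightarrow> 0"
      by (intro tendsto_mult_left_zero) (simp add: add.commute)
  qed
  then have "(\<lambda>J. beta_sum 1 m - beta_sum 1 (m + J)) \<longlonglongrightarrow> beta_sum 1 m - 0" by (intro tendsto_intros)
  then have "(\<lambda>j. 1 / real (m + j) ^ 2) sums beta_sum 1 m" unfolding sums_def eq by simp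
  then show ?thesis by (simp add: hurwitz_zeta_nat_def sums_iff)
qed

lemma kappa_odd_closed_form:
  assumes m: "m \<ge> 1"
  shows "(\<Sum>r=1..m. (2 * real r - 1) * kappa m r) = (2 * real m ^ 2 - 2 * real m + 1) * hurwitz_zeta_nat 2 m - 2 * real m + 2"
    and "(\<Sum>r=1..m. (2 * real r - 1) * kappa m r) \<ge> 1 + 1 / (6 * real m)"
proof -
  let ?b = "beta_coeff m"
  let ?t = "\<lambda>k. ?b k * real (2 * m + k) / (real (k + 1) * real (k + 2))"
  \<comment> \<open>Partial fractions: (2 m + k) / ((k + 1)(k + 2)) = (2 m - 1) / (k + 1) - (2 m -
    2) / (k + 2).\<close>
  have t: "?t k = (2 * real m - 1) * (?b k / real (k + 1)) - (2 * real m - 2) * (?b k / real (k + 2))" for k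
    by (simp add: field_simps)
  have "(\<lambda>k. (2 * real m - 1) * (?b k / real (k + 1)) - (2 * real m - 2) * (?b k / real (k + 2)))
    sums ((2 * real m - 1) * beta_sum 1 m - (2 * real m - 2) * beta_sum 2 m)"
    unfolding beta_sum_def using beta_sum_summable(1)[OF m, of 1] beta_sum_summable(1)[OF m, of 2]
    by (intro sums_diff sums_mult summable_sums) auto
  then have 1: "(\<Sum>r=1..m. (2 * real r - 1) * kappa m r) = (2 * real m - 1) * beta_sum 1 m - (2 * real m - 2) * beta_sum 2 m"
    using kappa_odd_sums[OF m] unfolding t by (rule sums_unique2[rotated])
  have 2: "beta_sum 2 m = 1 - (real m - 1) * beta_sum 1 m"
    using beta_sum_rec[OF m, of 1] by (simp add: numeral_2_eq_2)
  show "(\<Sum>r=1..m. (2 * real r - 1) * kappa m r) = (2 * real m ^ 2 - 2 * real m + 1) * hurwitz_zeta_nat 2 m - 2 * real m + 2"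
    unfolding 1 2 beta_sum_1_eq[OF m, symmetric] by (simp add: algebra_simps power2_eq_square)
  \<comment> \<open>Two terms are kept because the first equals 1, and exactly 1 will be subtracted
    when the logarithmic kernel is centred. The second one supplies the lower bound for the
    variance.\<close>
  have "sum ?t {..<2} \<le> (\<Sum>r=1..m. (2 * real r - 1) * kappa m r)"
  proof -
    have "summable ?t" "suminf ?t = (\<Sum>r=1..m. (2 * real r - 1) * kappa m r)"
      using kappa_odd_sums[OF m] by (auto simp only: sums_iff)
    moreover have "sum ?t {..<2} \<le> suminf ?t" by (rule sum_le_suminf[OF \<open>summable ?t\<close>]) auto
    ultimately show ?thesis by simp
  qed
  moreover have "?t 0 = 1" using m by simp
  moreover have "?t 1 \<ge> 1 / (6 * real m)"
  proof -
    have "?b 1 = 1 / (real m * real (m + 1))" by (simp add: beta_coeff_def)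
    then have "?t 1 = (2 * real m + 1) / (real m + 1) / (6 * real m)" by (simp add: field_simps)
    also have "\<dots> \<ge> 1 / (6 * real m)" using m by (intro divide_right_mono) auto
    finally show ?thesis .
  qed
  ultimately show "(\<Sum>r=1..m. (2 * real r - 1) * kappa m r) \<ge> 1 + 1 / (6 * real m)"
  proof -
    assume *: "sum ?t {..<2} \<le> (\<Sum>r=1..m. (2 * real r - 1) * kappa m r)" "?t 0 = 1" "?t 1 \<ge> 1 / (6 * real m)"
    have "sum ?t {..<2} = ?t 0 + ?t 1" by (simp add: numeral_2_eq_2)
    with * show ?thesis by linarith
  qed
qed

lemma kappa_square_closed_form:
  assumes m: "m \<ge> 1"
  shows "(\<Sum>r=1..Suc m. (real r - 1)\<^sup>2 * kappa (Suc m) r)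
      = (2 * (real m * (real m + 1)) ^ 2 * hurwitz_zeta_nat 2 (m + 2) - real m * (real m + 1) * (2 * real m - 1)) / 4"
    and "(\<Sum>r=1..Suc m. (real r - 1)\<^sup>2 * kappa (Suc m) r) \<ge> real m / 6"
proof -
  let ?M = "Suc m"
  have M: "?M \<ge> 1" by simp
  let ?b = "beta_coeff ?M"
  let ?t = "\<lambda>k. ?b k * (real ?M - 1) * (2 * real ?M + real k - 1) / (real (k + 1) * real (k + 2) * real (k + 3))"
  \<comment> \<open>Partial fractions with residues 2 m / 2, -(2 m - 1) and (2 m - 2) / 2 at k = -1,
    -2, -3.\<close>
  have t: "?t k = real m * (real m * (?b k / real (k + 1)) - (2 * real m - 1) * (?b k / real (k + 2)) + (real m - 1) * (?b k / real (k + 3)))" for k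
    by (simp add: divide_simps) (simp add: algebra_simps)
  have "(\<lambda>k. real m * (real m * (?b k / real (k + 1)) - (2 * real m - 1) * (?b k / real (k + 2)) + (real m - 1) * (?b k / real (k + 3))))
    sums (real m * (real m * beta_sum 1 ?M - (2 * real m - 1) * beta_sum 2 ?M + (real m - 1) * beta_sum 3 ?M))"
    unfolding beta_sum_def using beta_sum_summable(1)[OF M, of 1] beta_sum_summable(1)[OF M, of 2] beta_sum_summable(1)[OF M, of 3]
    by (intro sums_diff sums_add sums_mult summable_sums) auto
  then have 1: "(\<Sum>r=1..Suc m. (real r - 1)\<^sup>2 * kappa (Suc m) r)
    = real m * (real m * beta_sum 1 ?M - (2 * real m - 1) * beta_sum 2 ?M + (real m - 1) * beta_sum 3 ?M)"
    using kappa_square_sums[OF M] unfolding t by (rule sums_unique2[rotated])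
  have 2: "beta_sum 2 ?M = 1 - real m * beta_sum 1 ?M"
    using beta_sum_rec[OF M, of 1] by (simp add: numeral_2_eq_2)
  have 3: "beta_sum 3 ?M = 1 / 4 - (real m - 1) / 2 * beta_sum 2 ?M"
    using beta_sum_rec[OF M, of 2] by (simp add: numeral_3_eq_3 numeral_2_eq_2 field_simps)
  \<comment> \<open>The closed form starts the zeta series at m + 2, one term after
    \<open>beta_sum 1 (Suc m)\<close>.\<close>
  have 4: "beta_sum 1 ?M = hurwitz_zeta_nat 2 (m + 2) + 1 / (real m + 1) ^ 2"
    using beta_sum_1_step[OF M] beta_sum_1_eq[of "Suc ?M"] by (simp add: add.commute)
  show "(\<Sum>r=1..Suc m. (real r - 1)\<^sup>2 * kappa (Suc m) r)
      = (2 * (real m * (real m + 1)) ^ 2 * hurwitz_zeta_nat 2 (m + 2) - real m * (real m + 1) * (2 * real m - 1)) / 4"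
  proof -
    have "(\<Sum>r=1..Suc m. (real r - 1)\<^sup>2 * kappa (Suc m) r)
      = real m ^ 2 * (real m + 1) ^ 2 / 2 * beta_sum 1 ?M - real m * (2 * real m ^ 2 + 3 * real m - 1) / 4"
      unfolding 1 3 2 by (simp add: field_simps power2_eq_square)
    also have "\<dots> = real m ^ 2 * (real m + 1) ^ 2 / 2 * hurwitz_zeta_nat 2 (m + 2) + real m ^ 2 / 2 - real m * (2 * real m ^ 2 + 3 * real m - 1) / 4"
      unfolding 4 by (simp add: distrib_left add_nonneg_eq_0_iff)
    also have "\<dots> = (2 * (real m * (real m + 1)) ^ 2 * hurwitz_zeta_nat 2 (m + 2) - real m * (real m + 1) * (2 * real m - 1)) / 4"
      by (simp add: field_simps power2_eq_square)
    finally show ?thesis .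
  qed
  have "sum ?t {..<1} \<le> (\<Sum>r=1..Suc m. (real r - 1)\<^sup>2 * kappa (Suc m) r)"
  proof -
    have "summable ?t" "suminf ?t = (\<Sum>r=1..Suc m. (real r - 1)\<^sup>2 * kappa (Suc m) r)"
      using kappa_square_sums[OF M] by (auto simp only: sums_iff)
    moreover have "sum ?t {..<1} \<le> suminf ?t" by (rule sum_le_suminf[OF \<open>summable ?t\<close>]) auto
    ultimately show ?thesis by (simp only:)
  qed
  moreover have "?t 0 \<ge> real m / 6"
  proof -
    have "?t 0 = (2 * real m + 1) / (real m + 1) * (real m / 6)" by (simp add: field_simps)
    also have "\<dots> \<ge> 1 * (real m / 6)" by (intro mult_right_mono) auto
    finally show ?thesis by simp
  qed
  moreover have "sum ?t {..<1} = ?t 0" by simp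
  ultimately show "(\<Sum>r=1..Suc m. (real r - 1)\<^sup>2 * kappa (Suc m) r) \<ge> real m / 6" by linarith
qed

section \<open>Gamma moments\<close>

lemma gamma_law_lborel:
  fixes f :: "real \<Rightarrow> real"
  assumes [measurable]: "f \<in> borel_measurable borel"
  shows "integrable (gamma_law (Suc k)) f \<longleftrightarrow> set_integrable lborel {0<..} (\<lambda>x. f x * (x ^ k * exp (- x) / fact k))"
    and "integral\<^sup>L (gamma_law (Suc k)) f = (LBINT x:{0<..}. f x * (x ^ k * exp (- x) / fact k))"
proof -
  have ae: "AE x in lborel. erlang_density k 1 x *\<^sub>R f x = indicat_real {0<..} x *\<^sub>R (f x * (x ^ k * exp (- x) / fact k))"
    using AE_lborel_singleton[of 0] by eventually_elim (auto simp: erlang_density_def split: split_indicator)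
  have "integrable (gamma_law (Suc k)) f \<longleftrightarrow> integrable lborel (\<lambda>x. erlang_density k 1 x *\<^sub>R f x)"
    unfolding gamma_law_Suc by (rule integrable_density) auto
  also have "\<dots> \<longleftrightarrow> set_integrable lborel {0<..} (\<lambda>x. f x * (x ^ k * exp (- x) / fact k))"
    unfolding set_integrable_def by (rule integrable_cong_AE[OF _ _ ae]) measurable
  finally show "integrable (gamma_law (Suc k)) f \<longleftrightarrow> set_integrable lborel {0<..} (\<lambda>x. f x * (x ^ k * exp (- x) / fact k))" .
  have "integral\<^sup>L (gamma_law (Suc k)) f = (LBINT x. erlang_density k 1 x *\<^sub>R f x)"
    unfolding gamma_law_Suc by (rule integral_density) auto
  also have "\<dots> = (LBINT x:{0<..}. f x * (x ^ k * exp (- x) / fact k))"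
    unfolding set_lebesgue_integral_def by (rule integral_cong_AE[OF _ _ ae]) measurable
  finally show "integral\<^sup>L (gamma_law (Suc k)) f = (LBINT x:{0<..}. f x * (x ^ k * exp (- x) / fact k))" .
qed

text \<open>x x^(k-1) / (k-1)! = k x^k / k!. This trades factors x against the gamma parameter; it
  gives the moments, the mean of x ln x, and bounds for inverse powers.\<close>

lemma gamma_law_size_bias:
  fixes f :: "real \<Rightarrow> real"
  assumes [measurable]: "f \<in> borel_measurable borel" and k: "k \<ge> 1"
  shows "integrable (gamma_law k) (\<lambda>x. x * f x) \<longleftrightarrow> integrable (gamma_law (Suc k)) f"
    and "(\<integral>x. x * f x \<partial>gamma_law k) = real k * (\<integral>x. f x \<partial>gamma_law (Suc k))"
proof -
  obtain p where p: "k = Suc p" using k by (cases k) auto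
  have eq: "real k * (f x * (x ^ k * exp (- x) / fact k)) = x * f x * (x ^ p * exp (- x) / fact p)" for x
    unfolding p by (simp only: fact_Suc power_Suc of_nat_mult) (simp del: of_nat_Suc)
  have m: "(\<lambda>x. x * f x) \<in> borel_measurable borel" by measurable
  have 1: "integrable (gamma_law (Suc p)) (\<lambda>x. x * f x) \<longleftrightarrow> set_integrable lborel {0<..} (\<lambda>x. real k * (f x * (x ^ k * exp (- x) / fact k)))"
    "integral\<^sup>L (gamma_law (Suc p)) (\<lambda>x. x * f x) = (LBINT x:{0<..}. real k * (f x * (x ^ k * exp (- x) / fact k)))"
    unfolding eq by (rule gamma_law_lborel[OF m])+
  have 3: "set_integrable lborel {0<..} (\<lambda>x. real k * (f x * (x ^ k * exp (- x) / fact k)))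
    = set_integrable lborel {0<..} (\<lambda>x. f x * (x ^ k * exp (- x) / fact k))"
    using k by (intro set_integrable_mult_right_iff) auto
  show "integrable (gamma_law k) (\<lambda>x. x * f x) \<longleftrightarrow> integrable (gamma_law (Suc k)) f"
    by (simp only: 1[folded p] 3 gamma_law_lborel[OF assms(1)])
  show "(\<integral>x. x * f x \<partial>gamma_law k) = real k * (\<integral>x. f x \<partial>gamma_law (Suc k))"
    by (simp only: 1[folded p] set_integral_mult_right gamma_law_lborel[OF assms(1)])
qed

lemma gamma_law_moment:
  assumes "m \<ge> 1"
  shows "has_bochner_integral (gamma_law m) (\<lambda>x. x ^ i) (pochhammer (real m) i)"
  using assms
proof (induction i arbitrary: m)
  case 0
  interpret prob_space "gamma_law m" by (rule prob_space_gamma_law)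
  show ?case by (simp add: has_bochner_integral_iff prob_space[simplified])
next
  case (Suc i)
  have "has_bochner_integral (gamma_law (Suc m)) (\<lambda>x. x ^ i) (pochhammer (real (Suc m)) i)" by (rule Suc.IH) simp
  then show ?case
    using gamma_law_size_bias[of "\<lambda>x. x ^ i" m] Suc.prems
    by (simp add: has_bochner_integral_iff pochhammer_rec add.commute)
qed

text \<open>The kernels are controlled by quadratic expressions in x - m, and their fourth moments
  are needed; this is why the eighth central moment appears.\<close>

lemma gamma_law_central_moments:
  assumes m: "m \<ge> 1"
  shows "has_bochner_integral (gamma_law m) (\<lambda>x. x - real m) 0"
    and "has_bochner_integral (gamma_law m) (\<lambda>x. (x - real m)\<^sup>2) (real m)"
    and "has_bochner_integral (gamma_law m) (\<lambda>x. (x - real m) ^ 4) (3 * real m ^ 2 + 6 * real m)"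
    and "has_bochner_integral (gamma_law m) (\<lambda>x. (x - real m) ^ 8) (105 * real m ^ 4 + 2380 * real m ^ 3 + 7308 * real m ^ 2 + 5040 * real m)"
proof -
  have gen: "has_bochner_integral (gamma_law m) (\<lambda>x. (x - real m) ^ n) (\<Sum>i\<le>n. real (n choose i) * pochhammer (real m) i * (- real m) ^ (n - i))" for n
  proof -
    have "(\<lambda>x. (x - real m) ^ n) = (\<lambda>x. \<Sum>i\<le>n. real (n choose i) * x ^ i * (- real m) ^ (n - i))"
      using binomial_ring[of _ "- real m" n] by simp
    then show ?thesis
      using gamma_law_moment[OF m]
      by (auto intro!: has_bochner_integral_sum has_bochner_integral_mult_left has_bochner_integral_mult_right)
  qed
  have e: "(\<Sum>i\<le>1. real (1 choose i) * pochhammer x i * (- x) ^ (1 - i)) = 0"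
    "(\<Sum>i\<le>2. real (2 choose i) * pochhammer x i * (- x) ^ (2 - i)) = x"
    "(\<Sum>i\<le>4. real (4 choose i) * pochhammer x i * (- x) ^ (4 - i)) = 3 * x ^ 2 + 6 * x"
    "(\<Sum>i\<le>8. real (8 choose i) * pochhammer x i * (- x) ^ (8 - i)) = 105 * x ^ 4 + 2380 * x ^ 3 + 7308 * x ^ 2 + 5040 * x" for x :: real
    by (simp_all add: eval_nat_numeral pochhammer_Suc algebra_simps)
  show "has_bochner_integral (gamma_law m) (\<lambda>x. x - real m) 0"
    "has_bochner_integral (gamma_law m) (\<lambda>x. (x - real m)\<^sup>2) (real m)"
    "has_bochner_integral (gamma_law m) (\<lambda>x. (x - real m) ^ 4) (3 * real m ^ 2 + 6 * real m)"
    "has_bochner_integral (gamma_law m) (\<lambda>x. (x - real m) ^ 8) (105 * real m ^ 4 + 2380 * real m ^ 3 + 7308 * real m ^ 2 + 5040 * real m)"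
    using gen[of 1] gen[of 2] gen[of 4] gen[of 8] unfolding e by simp_all
qed

text \<open>The constants are the sums of the coefficients, lower powers of m being estimated by the
  highest one.\<close>

lemma gamma_law_central_moment_bounds:
  assumes m: "m \<ge> 1"
  shows "(\<integral>x. (x - real m) ^ 4 \<partial>gamma_law m) \<le> 9 * real m ^ 2"
    and "(\<integral>x. (x - real m) ^ 8 \<partial>gamma_law m) \<le> 14833 * real m ^ 4"
proof -
  have p: "real m ^ i \<le> real m ^ j" if "i \<le> j" for i j using m that by (intro power_increasing) auto
  show "(\<integral>x. (x - real m) ^ 4 \<partial>gamma_law m) \<le> 9 * real m ^ 2"
    using gamma_law_central_moments(3)[OF m] p[of 1 2] by (simp add: has_bochner_integral_iff)
  show "(\<integral>x. (x - real m) ^ 8 \<partial>gamma_law m) \<le> 14833 * real m ^ 4"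
  proof -
    have "real m \<le> real m ^ 4" using p[of 1 4] by simp
    moreover have "(\<integral>x. (x - real m) ^ 8 \<partial>gamma_law m) = 105 * real m ^ 4 + 2380 * real m ^ 3 + 7308 * real m ^ 2 + 5040 * real m"
      using gamma_law_central_moments(4)[OF m] by (simp add: has_bochner_integral_iff)
    ultimately show ?thesis using p[of 2 4] p[of 3 4] by linarith
  qed
qed

section \<open>Growth of the elementary functions and the mean of the logarithm\<close>

lemma exp_ge_sq: "x \<ge> 0 \<Longrightarrow> x\<^sup>2 \<le> 1024 * exp (x / 16)" for x :: real
proof -
  assume x: "x \<ge> 0"
  have "x / 32 \<le> exp (x / 32)" using exp_ge_add_one_self[of "x / 32"] by linarith
  then have "(x / 32)\<^sup>2 \<le> (exp (x / 32))\<^sup>2" using x by (intro power_mono) auto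
  also have "(exp (x / 32))\<^sup>2 = exp (x / 16)" by (simp add: power2_eq_square flip: exp_add)
  finally show ?thesis by (simp add: power2_eq_square)
qed

lemma exp_ge_lin: "x \<le> 16 * exp (x / 16)" for x :: real
  using exp_ge_add_one_self[of "x / 16"] by linarith

text \<open>The inequality ln y <= y is applied to y = x and to y = x^(-1/8); the latter gives -ln x
  <= 8 x^(-1/8).\<close>

lemma abs_ln_le: "x > 0 \<Longrightarrow> \<bar>ln x\<bar> \<le> 8 * x powr (- (1/8)) + x" for x :: real
proof -
  assume x: "x > 0"
  define P where "P = x powr (- (1/8))"
  have "P > 0" using x by (simp add: P_def)
  have "ln P \<le> P" using ln_le_minus_one[OF \<open>P > 0\<close>] by simp
  moreover have "ln P = - (1/8) * ln x" using x by (simp add: P_def ln_powr)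
  moreover have "ln x \<le> x" using ln_le_minus_one[OF x] by simp
  ultimately have "\<bar>ln x\<bar> \<le> 8 * P + x" using x \<open>P > 0\<close> unfolding distrib_left by linarith
  then show ?thesis by (simp add: P_def)
qed

lemma tame_const: "tame (\<lambda>_. 1) (\<lambda>_. 0) 1"
proof
  fix x :: real assume x: "x > 0"
  have "1 \<le> exp (x / 16)" using x by simp
  then show "\<bar>1\<bar> \<le> 1 * (x powr (- (1/8)) + exp (x / 16))" by (simp add: add_increasing)
  show "\<bar>0\<bar> \<le> 1 * (1 / x + exp (x / 16))" using x by simp
qed auto

lemma tame_id: "tame (\<lambda>x. x) (\<lambda>_. 1) 16"
proof
  fix x :: real assume x: "x > 0"
  show "\<bar>x\<bar> \<le> 16 * (x powr (- (1/8)) + exp (x / 16))" using x exp_ge_lin[of x] by (simp add: distrib_left add_increasing)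
  show "\<bar>1\<bar> \<le> 16 * (1 / x + exp (x / 16))" using x exp_ge_add_one_self[of "x / 16"] divide_pos_pos[OF zero_less_one x] unfolding distrib_left by linarith
qed auto

lemma tame_square: "tame (\<lambda>x. x\<^sup>2) (\<lambda>x. 2 * x) 1024"
proof
  fix x :: real assume x: "x > 0"
  show "\<bar>x\<^sup>2\<bar> \<le> 1024 * (x powr (- (1/8)) + exp (x / 16))" using x exp_ge_sq[of x] by (simp add: distrib_left add_increasing)
  show "\<bar>2 * x\<bar> \<le> 1024 * (1 / x + exp (x / 16))" using x exp_ge_lin[of x] divide_pos_pos[OF zero_less_one x] unfolding distrib_left by linarith
qed (auto intro!: derivative_eq_intros continuous_intros)

lemma tame_ln: "tame ln (\<lambda>x. 1 / x) 16"
proof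
  fix x :: real assume x: "x > 0"
  define P where "P = x powr (- (1/8))"
  have "P > 0" using x by (simp add: P_def)
  have "\<bar>ln x\<bar> \<le> 8 * P + x" using abs_ln_le[OF x] by (simp add: P_def)
  then have "\<bar>ln x\<bar> \<le> 16 * (P + exp (x / 16))" using exp_ge_lin[of x] \<open>P > 0\<close> unfolding distrib_left by linarith
  then show "\<bar>ln x\<bar> \<le> 16 * (x powr (- (1/8)) + exp (x / 16))" by (simp add: P_def)
  show "\<bar>1 / x\<bar> \<le> 16 * (1 / x + exp (x / 16))" using x exp_gt_zero[of "x / 16"] divide_pos_pos[OF zero_less_one x] unfolding distrib_left by linarith
qed (auto intro!: derivative_eq_intros continuous_intros simp: field_simps)

lemma tame_xlnx: "tame (\<lambda>x. x * ln x) (\<lambda>x. ln x + 1) 1024"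
proof
  fix x :: real assume x: "x > 0"
  have l: "ln x \<le> x" using ln_le_minus_one[OF x] by simp
  have l': "- ln x \<le> 1 / x - 1" using ln_le_minus_one[of "1 / x"] x by (simp add: ln_div)
  have "x * ln x \<le> x\<^sup>2" using x l by (simp add: power2_eq_square)
  moreover have "- (x * ln x) \<le> 1"
  proof -
    have "x * (- ln x) \<le> x * (1 / x - 1)" using l' x by (intro mult_left_mono) auto
    also have "\<dots> = 1 - x" using x by (simp add: field_simps)
    finally show ?thesis using x by simp
  qed
  moreover have "1 \<le> exp (x / 16)" using x by simp
  ultimately have "\<bar>x * ln x\<bar> \<le> 1024 * exp (x / 16)"
    using x exp_ge_sq[of x] by linarith
  then show "\<bar>x * ln x\<bar> \<le> 1024 * (x powr (- (1/8)) + exp (x / 16))" by (simp add: distrib_left add_increasing)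
  show "\<bar>ln x + 1\<bar> \<le> 1024 * (1 / x + exp (x / 16))"
    using x l l' exp_ge_lin[of x] exp_ge_add_one_self[of "x / 16"] divide_pos_pos[OF zero_less_one x] unfolding distrib_left by linarith
qed (auto intro!: derivative_eq_intros continuous_intros simp: field_simps)

lemma tame_lincomb:
  assumes "tame u u' K" "tame v v' L"
  shows "tame (\<lambda>x. a * u x + b * v x) (\<lambda>x. a * u' x + b * v' x) (\<bar>a\<bar> * K + \<bar>b\<bar> * L)"
proof -
  interpret u: tame u u' K by fact
  interpret v: tame v v' L by fact
  show ?thesis
  proof
    fix x :: real assume x: "x > 0"
    show "((\<lambda>x. a * u x + b * v x) has_real_derivative a * u' x + b * v' x) (at x)"
      using u.deriv[OF x] v.deriv[OF x] by (auto intro!: derivative_eq_intros)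
    have "\<bar>a * u x + b * v x\<bar> \<le> \<bar>a\<bar> * \<bar>u x\<bar> + \<bar>b\<bar> * \<bar>v x\<bar>" by (metis abs_mult abs_triangle_ineq)
    also have "\<dots> \<le> \<bar>a\<bar> * (K * (x powr (- (1/8)) + exp (x / 16))) + \<bar>b\<bar> * (L * (x powr (- (1/8)) + exp (x / 16)))"
      using u.growth[OF x] v.growth[OF x] by (intro add_mono mult_left_mono) auto
    finally show "\<bar>a * u x + b * v x\<bar> \<le> (\<bar>a\<bar> * K + \<bar>b\<bar> * L) * (x powr (- (1/8)) + exp (x / 16))" by (simp add: algebra_simps)
    have "\<bar>a * u' x + b * v' x\<bar> \<le> \<bar>a\<bar> * \<bar>u' x\<bar> + \<bar>b\<bar> * \<bar>v' x\<bar>" by (metis abs_mult abs_triangle_ineq)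
    also have "\<dots> \<le> \<bar>a\<bar> * (K * (1 / x + exp (x / 16))) + \<bar>b\<bar> * (L * (1 / x + exp (x / 16)))"
      using u.growth'[OF x] v.growth'[OF x] by (intro add_mono mult_left_mono) auto
    finally show "\<bar>a * u' x + b * v' x\<bar> \<le> (\<bar>a\<bar> * K + \<bar>b\<bar> * L) * (1 / x + exp (x / 16))" by (simp add: algebra_simps)
  qed (use u.cont v.cont in \<open>auto intro!: continuous_intros\<close>)
qed

lemma gamma_law_inverse:
  assumes "m \<ge> 1"
  shows "has_bochner_integral (gamma_law (Suc m)) (\<lambda>x. 1 / x) (1 / real m)"
proof -
  interpret prob_space "gamma_law m" by (rule prob_space_gamma_law)
  have ae: "AE x in gamma_law m. x * (1 / x) = 1" using AE_gamma_law_pos[OF assms] by eventually_elim auto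
  have mm: "(\<lambda>x. x * (1 / x)) \<in> borel_measurable (gamma_law m)" by measurable
  have "integrable (gamma_law m) (\<lambda>x. x * (1 / x))" "(\<integral>x. x * (1 / x) \<partial>gamma_law m) = 1"
    using integrable_cong_AE[OF mm _ ae] integral_cong_AE[OF mm _ ae] prob_space by auto
  then show ?thesis
    using gamma_law_size_bias[of "\<lambda>x. 1 / x" m] assms by (simp add: has_bochner_integral_iff field_simps)
qed

text \<open>Let d(k) be the density with parameter k + 1. From d(m)' = d(m - 1) - d(m), integrating
  the derivative of ln x times d(m) over the half line gives the difference of the two means, with
  zero boundary terms, and the remaining term is the mean of 1/x.\<close>

lemma gamma_law_ln_step:
  assumes "m \<ge> 1"
  shows "integral\<^sup>L (gamma_law (Suc m)) ln - integral\<^sup>L (gamma_law m) ln = 1 / real m"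
proof -
  obtain p where p: "m = Suc p" using assms by (cases m) auto
  interpret L: tame ln "\<lambda>x. 1 / x" 16 by (rule tame_ln)
  let ?d = "\<lambda>k x. x ^ k * exp (- x) / fact k :: real"
  have i: "set_integrable lborel {0<..} (\<lambda>x. ln x * ?d k x)" for k
    using L.integrable_h[of "Suc k"] gamma_law_lborel(1)[of ln k] by simp
  have i': "set_integrable lborel {0<..} (\<lambda>x. 1 / x * ?d m x)"
    using gamma_law_inverse[OF assms] gamma_law_lborel(1)[of "\<lambda>x. 1 / x" m] by (simp add: has_bochner_integral_iff)
  have "(LBINT x:{0<..}. 1 / x * ?d m x + ln x * ?d p x - ln x * ?d m x) = 0 - 0"
  proof (rule set_integral_FTC_Ioi[where F = "\<lambda>x. ln x * ?d m x"])
    show "((\<lambda>x. ln x * ?d m x) has_real_derivative 1 / x * ?d m x + ln x * ?d p x - ln x * ?d m x) (at x)" if "x > 0" for x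
    proof -
      have "((\<lambda>x. x ^ Suc p * exp (- x) / fact (Suc p)) has_real_derivative
          (real (Suc p) * x ^ p * exp (- x) - x ^ Suc p * exp (- x)) / fact (Suc p)) (at x)"
      proof (rule DERIV_cong[OF DERIV_cdivide[OF DERIV_mult]])
        show "((\<lambda>x. x ^ Suc p) has_real_derivative real (Suc p) * x ^ p) (at x)" using DERIV_pow[of "Suc p" x] by simp
        show "((\<lambda>x. exp (- x)) has_real_derivative - exp (- x)) (at x)" by (auto intro!: derivative_eq_intros)
      qed (simp only: mult_minus_left mult.commute[of "exp (- x)"] diff_conv_add_uminus)
      also have "(real (Suc p) * x ^ p * exp (- x) - x ^ Suc p * exp (- x)) / fact (Suc p) = ?d p x - ?d m x"
        unfolding p diff_divide_distrib by (simp only: fact_Suc of_nat_mult) (simp del: of_nat_Suc)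
      finally have "((\<lambda>x. ?d m x) has_real_derivative ?d p x - ?d m x) (at x)" unfolding p .
      from DERIV_mult[OF DERIV_ln[OF that] this] show ?thesis
        by (simp add: inverse_eq_divide algebra_simps)
    qed
    show "continuous_on {0<..} (\<lambda>x. 1 / x * ?d m x + ln x * ?d p x - ln x * ?d m x)"
      by (intro continuous_intros) auto
    show "set_integrable lborel {0<..} (\<lambda>x. 1 / x * ?d m x + ln x * ?d p x - ln x * ?d m x)"
      by (intro set_integral_diff(1) set_integral_add(1) i i')
    have f1: "((\<lambda>x::real. x * ln x) \<longlongrightarrow> 0) (at_right 0)" by real_asymp
    have f2: "((\<lambda>x. x ^ p * exp (- x) / fact m) \<longlongrightarrow> 0 ^ p * exp (- 0) / fact m) (at_right (0::real))"
      by (intro tendsto_intros) auto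
    from tendsto_mult[OF f1 f2]
    show "((\<lambda>x. ln x * ?d m x) \<longlongrightarrow> 0) (at_right 0)" by (simp add: p mult_ac)
    have g: "((\<lambda>x::real. ln x / x) \<longlongrightarrow> 0) at_top" by real_asymp
    from tendsto_mult[OF tendsto_mult[OF g tendsto_power_div_exp_0[of "Suc m"]] tendsto_const[of "1 / fact m"]]
    have "((\<lambda>x::real. (ln x / x) * (x ^ Suc m / exp x) * (1 / fact m)) \<longlongrightarrow> 0) at_top" by (simp only: mult_zero_left)
    then show "((\<lambda>x. ln x * ?d m x) \<longlongrightarrow> 0) at_top"
    proof (rule Lim_transform_eventually)
      show "\<forall>\<^sub>F x in at_top. (ln x / x) * (x ^ Suc m / exp x) * (1 / fact m) = ln x * ?d m x"
        using eventually_gt_at_top[of 0] by eventually_elim (simp add: exp_minus field_simps)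
    qed
  qed
  then have "(LBINT x:{0<..}. 1 / x * ?d m x) + (LBINT x:{0<..}. ln x * ?d p x) - (LBINT x:{0<..}. ln x * ?d m x) = 0"
    by (simp only: set_integral_diff(2)[OF set_integral_add(1)[OF i' i] i] set_integral_add(2)[OF i' i])
  moreover have "(LBINT x:{0<..}. 1 / x * ?d m x) = 1 / real m"
    using gamma_law_inverse[OF assms] gamma_law_lborel(2)[of "\<lambda>x. 1 / x" m] by (simp add: has_bochner_integral_iff)
  moreover have "integral\<^sup>L (gamma_law (Suc m)) ln = (LBINT x:{0<..}. ln x * ?d m x)" "integral\<^sup>L (gamma_law m) ln = (LBINT x:{0<..}. ln x * ?d p x)"
    unfolding p by (simp_all add: gamma_law_lborel)
  ultimately show ?thesis by simp
qed

text \<open>The lower bound is ln y <= y - 1, the upper one the same inequality at 1/y. The quotient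
  keeps control near y = 0, where the logarithm is unbounded.\<close>

lemma ln_deviation_bound:
  fixes y :: real assumes "y > 0"
  shows "0 \<le> y - 1 - ln y" "y - 1 - ln y \<le> (y - 1)\<^sup>2 / y"
proof -
  show "0 \<le> y - 1 - ln y" using ln_le_minus_one[OF assms] by simp
  have "- ln y \<le> 1 / y - 1" using ln_le_minus_one[of "1 / y"] assms by (simp add: ln_div)
  then have "y - 1 - ln y \<le> y - 2 + 1 / y" by simp
  also have "\<dots> = (y - 1)\<^sup>2 / y" using assms by (simp add: field_simps power2_eq_square)
  finally show "y - 1 - ln y \<le> (y - 1)\<^sup>2 / y" .
qed

text \<open>Both sides satisfy the recursion \<open>\<psi>(m + 1) = \<psi>(m) + 1/m\<close> and are asymptotic to \<open>ln m\<close>.\<close>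

lemma gamma_law_ln:
  assumes "m \<ge> 1"
  shows "integral\<^sup>L (gamma_law m) ln = Digamma (real m)"
proof -
  interpret L: tame ln "\<lambda>x. 1 / x" 16 by (rule tame_ln)
  define D where "D = (\<lambda>n. integral\<^sup>L (gamma_law (Suc n)) ln - Digamma (real (Suc n)))"
  have "D (Suc n) = D n" for n
    using gamma_law_ln_step[of "Suc n"] Digamma_plus1[of "real (Suc n)"] by (simp add: D_def add.commute)
  then have const: "D n = D 0" for n by (induction n) auto
  have "D \<longlonglongrightarrow> 0"
  proof -
    have 1: "(\<lambda>n. Digamma (real (Suc n)) - ln (real n)) \<longlonglongrightarrow> 0"
    proof -
      have "(\<lambda>n. harm n - ln (real n) - euler_mascheroni) \<longlonglongrightarrow> euler_mascheroni - euler_mascheroni"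
        by (intro tendsto_diff tendsto_const euler_mascheroni_LIMSEQ)
      moreover have "Digamma (real (Suc n)) - ln (real n) = harm n - ln (real n) - euler_mascheroni" for n
        using Digamma_of_nat[of n, where 'a = real] by simp
      ultimately show ?thesis by (simp only: diff_self)
    qed
    have 2: "(\<lambda>n. ln (real (Suc n)) - ln (real n)) \<longlonglongrightarrow> 0" by real_asymp
    have 3: "(\<lambda>n. integral\<^sup>L (gamma_law (Suc n)) ln - ln (real (Suc n))) \<longlonglongrightarrow> 0"
    proof (rule Lim_null_comparison)
      show "\<forall>\<^sub>F n in sequentially. norm (integral\<^sup>L (gamma_law (Suc n)) ln - ln (real (Suc n))) \<le> 1 / real n"
        using eventually_ge_at_top[of 1]
      proof eventually_elim
        case (elim n)
        let ?m = "real (Suc n)"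
        interpret prob_space "gamma_law (Suc n)" by (rule prob_space_gamma_law)
        have b1: "has_bochner_integral (gamma_law (Suc n)) (\<lambda>x. 1 / x) (1 / real n)" by (rule gamma_law_inverse[OF elim])
        have b2: "has_bochner_integral (gamma_law (Suc n)) (\<lambda>x. x) ?m" using gamma_law_moment[of "Suc n" 1] by simp
        have il: "integrable (gamma_law (Suc n)) ln" by (rule L.integrable_h) simp
        have m: "?m > 0" by simp
        \<comment> \<open>The deviation bound at y = x / (n + 1). Since E x = n + 1 and E (1/x) =
          1/n, the upper bound y - 2 + 1/y has mean 1/n.\<close>
        have e: "AE x in gamma_law (Suc n). 0 \<le> x / ?m - 1 - (ln x - ln ?m) \<and> x / ?m - 1 - (ln x - ln ?m) \<le> x / ?m - 2 + ?m * (1 / x)"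
          using AE_gamma_law_pos[of "Suc n", simplified]
        proof eventually_elim
          case (elim x)
          have "(x / M - 1)\<^sup>2 / (x / M) = x / M - 2 + M * (1 / x)" if "M > 0" for M :: real
            using elim that by (simp add: field_simps power2_eq_square)
          note this[OF m]
          moreover have "ln (x / ?m) = ln x - ln ?m" using elim m by (simp add: ln_div)
          ultimately show ?case using ln_deviation_bound[of "x / ?m"] divide_pos_pos[OF elim m] by (simp only:)
        qed
        have i1: "integrable (gamma_law (Suc n)) (\<lambda>x. x / ?m - 1 - (ln x - ln ?m))" "integrable (gamma_law (Suc n)) (\<lambda>x. x / ?m - 2 + ?m * (1 / x))"
          using b1 b2 il unfolding has_bochner_integral_iff
          by (intro Bochner_Integration.integrable_add Bochner_Integration.integrable_diff integrable_divide integrable_mult_right integrable_const; simp)+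
        have "0 \<le> (\<integral>x. x / ?m - 1 - (ln x - ln ?m) \<partial>gamma_law (Suc n))" using e by (intro integral_nonneg_AE) (auto elim!: eventually_mono)
        moreover have "(\<integral>x. x / ?m - 1 - (ln x - ln ?m) \<partial>gamma_law (Suc n)) \<le> (\<integral>x. x / ?m - 2 + ?m * (1 / x) \<partial>gamma_law (Suc n))"
          using e by (intro integral_mono_AE i1) (auto elim!: eventually_mono)
        moreover have "(\<integral>x. x / ?m - 1 - (ln x - ln ?m) \<partial>gamma_law (Suc n)) = ln ?m - integral\<^sup>L (gamma_law (Suc n)) ln"
          using b2 il prob_space unfolding has_bochner_integral_iff by simp
        moreover have "(\<integral>x. x / ?m - 2 + ?m * (1 / x) \<partial>gamma_law (Suc n)) = 1 - 2 + ?m * (1 / real n)"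
        proof -
          have "(\<integral>x. x / ?m - 2 + ?m * (1 / x) \<partial>gamma_law (Suc n)) = (\<integral>x. x / ?m - 2 \<partial>gamma_law (Suc n)) + (\<integral>x. ?m * (1 / x) \<partial>gamma_law (Suc n))"
            using b1 b2 unfolding has_bochner_integral_iff
            by (intro Bochner_Integration.integral_add Bochner_Integration.integrable_diff integrable_divide integrable_mult_right integrable_const) auto
          also have "(\<integral>x. ?m * (1 / x) \<partial>gamma_law (Suc n)) = ?m * (1 / real n)"
            using b1 unfolding has_bochner_integral_iff by (simp only: integral_mult_right_zero)
          also have "(\<integral>x. x / ?m - 2 \<partial>gamma_law (Suc n)) = 1 - 2"
            using b2 prob_space unfolding has_bochner_integral_iff by simp
          finally show ?thesis .
        qed
        moreover have "1 - 2 + ?m * (1 / real n) = 1 / real n" using elim by (simp add: field_simps)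
        ultimately show ?case by simp
      qed
      show "(\<lambda>n. 1 / real n) \<longlonglongrightarrow> 0" by (rule lim_1_over_n)
    qed
    have "(\<lambda>n. (integral\<^sup>L (gamma_law (Suc n)) ln - ln (real (Suc n))) + (ln (real (Suc n)) - ln (real n)) - (Digamma (real (Suc n)) - ln (real n))) \<longlonglongrightarrow> 0 + 0 - 0"
      by (intro tendsto_intros 1 2 3)
    then show ?thesis by (simp add: D_def)
  qed
  moreover have "D = (\<lambda>_. D 0)" by (rule ext) (rule const)
  ultimately have "(\<lambda>_::nat. D 0) \<longlonglongrightarrow> 0" by argo
  then have "D 0 = 0" by (simp only: LIMSEQ_const_iff)
  obtain p where p: "m = Suc p" using assms by (cases m) auto
  from const[of p] \<open>D 0 = 0\<close> show ?thesis by (simp add: D_def p)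
qed

section \<open>The three kernels\<close>

text \<open>The linear terms are chosen so that dividing all coordinates by their mean changes the sums of the
  kernels only by terms of second order.\<close>

definition greenwood_kernel :: "nat \<Rightarrow> real \<Rightarrow> real" where
  "greenwood_kernel m x = x\<^sup>2 - 2 * (real m + 1) * x + real m * (real m + 1)"

definition log_kernel :: "nat \<Rightarrow> real \<Rightarrow> real" where
  "log_kernel m x = ln x - Digamma (real m) - (x - real m) / real m"

definition entropy_kernel :: "nat \<Rightarrow> real \<Rightarrow> real" where
  "entropy_kernel m x = x * ln x - (Digamma (real m + 1) + 1) * x + real m"

lemma power4_sum3_le: "(a + b + c) ^ 4 \<le> 27 * (a ^ 4 + b ^ 4 + c ^ 4)" for a b c :: real
proof -
  have sq: "(a + b + c)\<^sup>2 \<le> 3 * (a\<^sup>2 + b\<^sup>2 + c\<^sup>2)" for a b c :: real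
  proof -
    have "0 \<le> (a - b)\<^sup>2 + (b - c)\<^sup>2 + (a - c)\<^sup>2" by simp
    then show ?thesis by (simp add: power2_eq_square algebra_simps)
  qed
  have "(a + b + c) ^ 4 = ((a + b + c)\<^sup>2)\<^sup>2" by simp
  also have "\<dots> \<le> (3 * (a\<^sup>2 + b\<^sup>2 + c\<^sup>2))\<^sup>2" using sq by (intro power_mono) auto
  also have "\<dots> = 9 * (a\<^sup>2 + b\<^sup>2 + c\<^sup>2)\<^sup>2" by (simp add: power_mult_distrib del: distrib_left_numeral)
  also have "\<dots> \<le> 9 * (3 * ((a\<^sup>2)\<^sup>2 + (b\<^sup>2)\<^sup>2 + (c\<^sup>2)\<^sup>2))" by (rule mult_left_mono[OF sq]) simp
  finally show ?thesis by simp
qed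

lemma sum_odd: "(\<Sum>r=1..m. 2 * real r - 1) = real m ^ 2"
  by (induction m) (simp_all add: power2_eq_square algebra_simps)

text \<open>Exchanging the order of summation, the weight of g(q) is the sum of the first q - 1 odd
  numbers.\<close>

lemma sum_odd_tail:
  "(\<Sum>r=1..m. (2 * real r - 1) * (\<Sum>q=Suc r..Suc m. g q)) = (\<Sum>q=1..Suc m. (real q - 1)\<^sup>2 * g q)" for g :: "nat \<Rightarrow> real"
proof (induction m)
  case (Suc m)
  have "(\<Sum>r=1..Suc m. (2 * real r - 1) * (\<Sum>q=Suc r..Suc (Suc m). g q))
    = (\<Sum>r=1..Suc m. (2 * real r - 1) * (\<Sum>q=Suc r..Suc m. g q) + (2 * real r - 1) * g (Suc (Suc m)))"
    by (intro sum.cong) (auto simp: algebra_simps)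
  also have "\<dots> = (\<Sum>r=1..Suc m. (2 * real r - 1) * (\<Sum>q=Suc r..Suc m. g q)) + (\<Sum>r=1..Suc m. 2 * real r - 1) * g (Suc (Suc m))"
    by (simp only: sum.distrib sum_distrib_right)
  also have "(\<Sum>r=1..Suc m. (2 * real r - 1) * (\<Sum>q=Suc r..Suc m. g q)) = (\<Sum>r=1..m. (2 * real r - 1) * (\<Sum>q=Suc r..Suc m. g q))"
    by simp
  finally show ?case unfolding Suc sum_odd by simp
qed simp

lemma centred_tame:
  assumes "tame u u' K" "m \<ge> 1" "integral\<^sup>L (gamma_law m) u = 0"
  shows "centred u m"
proof -
  interpret tame u u' K by fact
  show ?thesis using assms integrable_h4[of m] by unfold_locales auto
qed

lemma tame_quadratic: "\<exists>K. tame (\<lambda>x. a * x\<^sup>2 + b * x + c) (\<lambda>x. 2 * a * x + b) K"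
  using tame_lincomb[OF tame_square tame_lincomb[OF tame_id tame_const, of b c], of a 1] by (auto simp: mult.assoc mult.left_commute add.assoc)

lemma tame_ln_affine: "\<exists>K. tame (\<lambda>x. ln x + b * x + c) (\<lambda>x. 1 / x + b) K"
  using tame_lincomb[OF tame_ln tame_lincomb[OF tame_id tame_const, of b c], of 1 1] by (auto simp: add.assoc)

lemma tame_xlnx_affine: "\<exists>K. tame (\<lambda>x. x * ln x + b * x + c) (\<lambda>x. ln x + 1 + b) K"
  using tame_lincomb[OF tame_xlnx tame_lincomb[OF tame_id tame_const, of b c], of 1 1] by (auto simp: add.assoc)

lemma tame_kernels:
  shows "\<exists>K. tame (greenwood_kernel m) (\<lambda>x. 2 * (x - (real m + 1))) K"
    and "\<exists>K. tame (log_kernel m) (\<lambda>x. 1 / x - 1 / real m) K"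
    and "\<exists>K. tame (entropy_kernel m) (\<lambda>x. ln x - Digamma (real m + 1)) K"
proof -
  have "greenwood_kernel m = (\<lambda>x. 1 * x\<^sup>2 + (- 2 * (real m + 1)) * x + real m * (real m + 1))"
    "(\<lambda>x. 2 * (x - (real m + 1))) = (\<lambda>x. 2 * 1 * x + (- 2 * (real m + 1)))"
    by (auto simp: greenwood_kernel_def fun_eq_iff algebra_simps)
  then show "\<exists>K. tame (greenwood_kernel m) (\<lambda>x. 2 * (x - (real m + 1))) K"
    using tame_quadratic[of 1] by (simp only:)
  have "log_kernel m = (\<lambda>x. ln x + (- 1 / real m) * x + (real m / real m - Digamma (real m)))"
    "(\<lambda>x. 1 / x - 1 / real m) = (\<lambda>x. 1 / x + (- 1 / real m))"
    by (auto simp: log_kernel_def fun_eq_iff diff_divide_distrib)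
  then show "\<exists>K. tame (log_kernel m) (\<lambda>x. 1 / x - 1 / real m) K"
    using tame_ln_affine by (simp only:)
  have "entropy_kernel m = (\<lambda>x. x * ln x + (- (Digamma (real m + 1) + 1)) * x + real m)"
    "(\<lambda>x. ln x - Digamma (real m + 1)) = (\<lambda>x. ln x + 1 + (- (Digamma (real m + 1) + 1)))"
    by (auto simp: entropy_kernel_def fun_eq_iff algebra_simps)
  then show "\<exists>K. tame (entropy_kernel m) (\<lambda>x. ln x - Digamma (real m + 1)) K"
    using tame_xlnx_affine by (simp only:)
qed

lemma gamma_law_affine:
  assumes "m \<ge> 1"
  shows "has_bochner_integral (gamma_law m) (\<lambda>x. b * x + c) (b * real m + c)"
proof -
  interpret prob_space "gamma_law m" by (rule prob_space_gamma_law)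
  show ?thesis
    using gamma_law_moment[OF assms, of 1] prob_space by (simp add: has_bochner_integral_iff)
qed

lemma mean_kernels:
  assumes m: "m \<ge> 1"
  shows "integral\<^sup>L (gamma_law m) (greenwood_kernel m) = 0"
    and "integral\<^sup>L (gamma_law m) (log_kernel m) = 0"
    and "integral\<^sup>L (gamma_law m) (entropy_kernel m) = 0"
proof -
  interpret L: tame ln "\<lambda>x. 1 / x" 16 by (rule tame_ln)
  interpret X: tame "\<lambda>x. x * ln x" "\<lambda>x. ln x + 1" 1024 by (rule tame_xlnx)
  note a = gamma_law_affine[OF m, unfolded has_bochner_integral_iff]
  have "greenwood_kernel m = (\<lambda>x. x\<^sup>2 + ((- 2 * (real m + 1)) * x + real m * (real m + 1)))"
    by (auto simp: greenwood_kernel_def fun_eq_iff algebra_simps)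
  moreover have "(\<integral>x. x\<^sup>2 + ((- 2 * (real m + 1)) * x + real m * (real m + 1)) \<partial>gamma_law m)
    = pochhammer (real m) 2 + ((- 2 * (real m + 1)) * real m + real m * (real m + 1))"
    using gamma_law_moment[OF m, of 2] a by (subst Bochner_Integration.integral_add) (auto simp only: has_bochner_integral_iff)
  ultimately show "integral\<^sup>L (gamma_law m) (greenwood_kernel m) = 0"
    by (simp add: eval_nat_numeral pochhammer_Suc algebra_simps)
  have "log_kernel m = (\<lambda>x. ln x + ((- 1 / real m) * x + (1 - Digamma (real m))))"
    using m by (auto simp: log_kernel_def fun_eq_iff diff_divide_distrib)
  moreover have "(\<integral>x. ln x + ((- 1 / real m) * x + (1 - Digamma (real m))) \<partial>gamma_law m)
    = Digamma (real m) + ((- 1 / real m) * real m + (1 - Digamma (real m)))"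
    using gamma_law_ln[OF m] a L.integrable_h[OF m] by (subst Bochner_Integration.integral_add) (auto simp only:)
  ultimately show "integral\<^sup>L (gamma_law m) (log_kernel m) = 0" using m by simp
  have "entropy_kernel m = (\<lambda>x. x * ln x + ((- (Digamma (real m + 1) + 1)) * x + real m))"
    by (auto simp: entropy_kernel_def fun_eq_iff algebra_simps)
  moreover have "(\<integral>x. x * ln x + ((- (Digamma (real m + 1) + 1)) * x + real m) \<partial>gamma_law m)
    = real m * Digamma (real (Suc m)) + ((- (Digamma (real m + 1) + 1)) * real m + real m)"
  proof -
    have "1 \<le> Suc m" by simp
    from gamma_law_ln[OF this] gamma_law_size_bias(2)[OF L.h_measurable(1) m] a X.integrable_h[OF m] show ?thesis
      by (subst Bochner_Integration.integral_add) (auto simp only:)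
  qed
  ultimately show "integral\<^sup>L (gamma_law m) (entropy_kernel m) = 0" by (simp add: algebra_simps)
qed

text \<open>The derivative of the kernel is centred at length m + 1 and its second derivative is the
  constant 2, so two applications of the covariance identity leave a sum of squares.\<close>

lemma variance_greenwood_kernel:
  assumes m: "m \<ge> 1"
  shows "cyclic_variance (greenwood_kernel m) m = 2 * real m * (real m + 1) * (2 * real m + 1) / 3"
proof -
  let ?h' = "\<lambda>x. 2 * (x - (real m + 1))"
  obtain K where K: "tame (greenwood_kernel m) ?h' K" using tame_kernels(1) by blast
  obtain L where L: "tame ?h' (\<lambda>_. 2) L"
    using tame_quadratic[of 0 2 "- 2 * (real m + 1)"] by (auto simp: algebra_simps)
  have mean: "integral\<^sup>L (gamma_law (Suc m)) ?h' = 0"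
    using gamma_law_affine[of "Suc m" 2 "- 2 * (real m + 1)"] by (simp add: has_bochner_integral_iff algebra_simps)
  have om: "overlap_moment ?h' ?h' (Suc m) r = 4 * (real m + 1 - real r)" if "1 \<le> r" "r \<le> m" for r
  proof -
    have "overlap_moment ?h' ?h' (Suc m) r = (\<Sum>q=Suc r..Suc m. overlap_moment (\<lambda>_. 2) (\<lambda>_. 2) (Suc (Suc m)) q)"
      using that by (intro overlap_moment_telescope[OF L _ mean]) auto
    also have "\<dots> = 4 * (real m + 1 - real r)"
      using that exp_seq.prob_space by (simp add: overlap_moment_def of_nat_diff)
    finally show ?thesis .
  qed
  have "cyclic_variance (greenwood_kernel m) m = (\<Sum>r=1..m. (2 * real r - 1) * overlap_moment ?h' ?h' (Suc m) r)"
    by (intro cyclic_variance_sum[OF K m mean_kernels(1)[OF m]] overlap_integrable_tame[OF L L]) auto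
  also have "\<dots> = (\<Sum>r=1..m. (2 * real r - 1) * (\<Sum>q=Suc r..Suc m. 4))"
    by (intro sum.cong refl) (subst om, auto simp: of_nat_diff)
  also have "\<dots> = (\<Sum>q=1..Suc m. (real q - 1)\<^sup>2 * 4)" by (rule sum_odd_tail)
  also have "\<dots> = 2 * real m * (real m + 1) * (2 * real m + 1) / 3"
    by (induction m) (simp_all add: field_simps power2_eq_square)
  finally show ?thesis .
qed

text \<open>The derivative is 1/x minus its mean 1/m at length m + 1, so its overlap moments are
  \<kappa> - 1/m^2. The odd numbers up to 2 m - 1 add up to m^2, which makes the total correction
  exactly 1.\<close>

lemma variance_log_kernel:
  assumes m: "m \<ge> 1"
  shows "cyclic_variance (log_kernel m) m = (2 * real m ^ 2 - 2 * real m + 1) * hurwitz_zeta_nat 2 m - 2 * real m + 1"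
    and "cyclic_variance (log_kernel m) m \<ge> 1 / 6 * real m * (1 / real m ^ 2)"
proof -
  let ?h' = "\<lambda>x. 1 / x - 1 / real m"
  obtain K where K: "tame (log_kernel m) ?h' K" using tame_kernels(2) by blast
  have om: "integrable exp_seq (\<lambda>\<omega>. ?h' (sum \<omega> {..<Suc m}) * ?h' (sum \<omega> {r..<r + Suc m}))"
    "overlap_moment ?h' ?h' (Suc m) r = kappa m r - 1 / real m ^ 2" if r: "1 \<le> r" "r \<le> m" for r
  proof -
    have i: "has_bochner_integral exp_seq (\<lambda>\<omega>. 1 / sum \<omega> S) (1 / real m)" if "finite S" "card S = Suc m" for S
      using integrable_exp_seq_gamma[OF that(1), of "\<lambda>x. 1 / x"] gamma_law_inverse[OF m] that by (simp add: has_bochner_integral_iff)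
    have X: "has_bochner_integral exp_seq (\<lambda>\<omega>. 1 / sum \<omega> {..<Suc m}) (1 / real m)"
      and Y: "has_bochner_integral exp_seq (\<lambda>\<omega>. 1 / sum \<omega> {r..<r + Suc m}) (1 / real m)" by (intro i; simp)+
    have XY: "has_bochner_integral exp_seq (\<lambda>\<omega>. 1 / sum \<omega> {..<Suc m} * (1 / sum \<omega> {r..<r + Suc m})) (kappa m r)"
      using overlap_inverse[OF r] by (simp add: has_bochner_integral_iff overlap_moment_def)
    have c: "has_bochner_integral exp_seq (\<lambda>\<omega>. 1 / real m ^ 2) (1 / real m ^ 2)"
      using exp_seq.prob_space by (simp add: has_bochner_integral_iff)
    have "has_bochner_integral exp_seq (\<lambda>\<omega>. 1 / sum \<omega> {..<Suc m} * (1 / sum \<omega> {r..<r + Suc m})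
        - 1 / real m * (1 / sum \<omega> {..<Suc m}) - 1 / real m * (1 / sum \<omega> {r..<r + Suc m}) + 1 / real m ^ 2)
      (kappa m r - 1 / real m * (1 / real m) - 1 / real m * (1 / real m) + 1 / real m ^ 2)"
      by (intro has_bochner_integral_add has_bochner_integral_diff has_bochner_integral_mult_right XY X Y c)
    moreover have "1 / sum \<omega> {..<Suc m} * (1 / sum \<omega> {r..<r + Suc m})
        - 1 / real m * (1 / sum \<omega> {..<Suc m}) - 1 / real m * (1 / sum \<omega> {r..<r + Suc m}) + 1 / real m ^ 2
      = ?h' (sum \<omega> {..<Suc m}) * ?h' (sum \<omega> {r..<r + Suc m})" for \<omega> :: "nat \<Rightarrow> real"
      by (simp only: power2_eq_square right_diff_distrib left_diff_distrib) (simp add: mult.commute)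
    moreover have "kappa m r - 1 / real m * (1 / real m) - 1 / real m * (1 / real m) + 1 / real m ^ 2 = kappa m r - 1 / real m ^ 2"
      by (simp add: power2_eq_square)
    ultimately have "has_bochner_integral exp_seq (\<lambda>\<omega>. ?h' (sum \<omega> {..<Suc m}) * ?h' (sum \<omega> {r..<r + Suc m})) (kappa m r - 1 / real m ^ 2)"
      by (simp only:)
    then show "integrable exp_seq (\<lambda>\<omega>. ?h' (sum \<omega> {..<Suc m}) * ?h' (sum \<omega> {r..<r + Suc m}))"
      "overlap_moment ?h' ?h' (Suc m) r = kappa m r - 1 / real m ^ 2"
      unfolding overlap_moment_def has_bochner_integral_iff by blast+
  qed
  have "cyclic_variance (log_kernel m) m = (\<Sum>r=1..m. (2 * real r - 1) * overlap_moment ?h' ?h' (Suc m) r)"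
    by (intro cyclic_variance_sum[OF K m mean_kernels(2)[OF m]] om) auto
  also have "\<dots> = (\<Sum>r=1..m. (2 * real r - 1) * kappa m r - (2 * real r - 1) * (1 / real m ^ 2))"
    by (intro sum.cong refl) (subst om(2), auto simp: right_diff_distrib)
  also have "\<dots> = (\<Sum>r=1..m. (2 * real r - 1) * kappa m r) - (\<Sum>r=1..m. 2 * real r - 1) * (1 / real m ^ 2)"
    unfolding sum_distrib_right by (rule sum_subtractf)
  also have "\<dots> = (\<Sum>r=1..m. (2 * real r - 1) * kappa m r) - 1" unfolding sum_odd using m by simp
  finally have *: "cyclic_variance (log_kernel m) m = (\<Sum>r=1..m. (2 * real r - 1) * kappa m r) - 1" .
  show "cyclic_variance (log_kernel m) m = (2 * real m ^ 2 - 2 * real m + 1) * hurwitz_zeta_nat 2 m - 2 * real m + 1"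
    unfolding * kappa_odd_closed_form(1)[OF m] by simp
  show "cyclic_variance (log_kernel m) m \<ge> 1 / 6 * real m * (1 / real m ^ 2)"
    unfolding * using kappa_odd_closed_form(2)[OF m] m by (simp add: power2_eq_square)
qed

text \<open>The second derivative is 1/x. After two applications of the identity the windows have
  length m + 2, so \<open>kappa\<close> enters with parameter m + 1 and the double sum turns into
  square weights.\<close>

lemma variance_entropy_kernel:
  assumes m: "m \<ge> 1"
  shows "cyclic_variance (entropy_kernel m) m
      = (2 * (real m * (real m + 1)) ^ 2 * hurwitz_zeta_nat 2 (m + 2) - real m * (real m + 1) * (2 * real m - 1)) / 4"
    and "cyclic_variance (entropy_kernel m) m \<ge> 1 / 6 * real m * 1"
proof -
  let ?h' = "\<lambda>x. ln x - Digamma (real m + 1)"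
  obtain K where K: "tame (entropy_kernel m) ?h' K" using tame_kernels(3) by blast
  obtain L where L: "tame ?h' (\<lambda>x. 1 / x) L"
    using tame_ln_affine[of 0 "- Digamma (real m + 1)"] by auto
  interpret T: tame ln "\<lambda>x. 1 / x" 16 by (rule tame_ln)
  have mean: "integral\<^sup>L (gamma_law (Suc m)) ?h' = 0"
  proof -
    interpret prob_space "gamma_law (Suc m)" by (rule prob_space_gamma_law)
    show ?thesis using gamma_law_ln[of "Suc m"] T.integrable_h[of "Suc m"] prob_space by (simp add: add.commute)
  qed
  have om: "overlap_moment ?h' ?h' (Suc m) r = (\<Sum>q=Suc r..Suc m. kappa (Suc m) q)" if "1 \<le> r" "r \<le> m" for r
  proof -
    have "overlap_moment ?h' ?h' (Suc m) r = (\<Sum>q=Suc r..Suc m. overlap_moment (\<lambda>x. 1 / x) (\<lambda>x. 1 / x) (Suc (Suc m)) q)"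
      using that by (intro overlap_moment_telescope[OF L _ mean] overlap_inverse) auto
    also have "\<dots> = (\<Sum>q=Suc r..Suc m. kappa (Suc m) q)"
      using that by (intro sum.cong refl overlap_inverse) auto
    finally show ?thesis .
  qed
  have "cyclic_variance (entropy_kernel m) m = (\<Sum>r=1..m. (2 * real r - 1) * overlap_moment ?h' ?h' (Suc m) r)"
    by (intro cyclic_variance_sum[OF K m mean_kernels(3)[OF m]] overlap_integrable_tame[OF L L]) auto
  also have "\<dots> = (\<Sum>r=1..m. (2 * real r - 1) * (\<Sum>q=Suc r..Suc m. kappa (Suc m) q))"
    by (intro sum.cong refl) (subst om, auto)
  also have "\<dots> = (\<Sum>q=1..Suc m. (real q - 1)\<^sup>2 * kappa (Suc m) q)" by (rule sum_odd_tail)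
  finally have *: "cyclic_variance (entropy_kernel m) m = (\<Sum>q=1..Suc m. (real q - 1)\<^sup>2 * kappa (Suc m) q)" .
  show "cyclic_variance (entropy_kernel m) m
      = (2 * (real m * (real m + 1)) ^ 2 * hurwitz_zeta_nat 2 (m + 2) - real m * (real m + 1) * (2 * real m - 1)) / 4"
    unfolding * by (rule kappa_square_closed_form(1)[OF m])
  show "cyclic_variance (entropy_kernel m) m \<ge> 1 / 6 * real m * 1"
    unfolding * using kappa_square_closed_form(2)[OF m] by simp
qed

section \<open>Fourth moments of the kernels\<close>

text \<open>With y = x - m the kernel is y^2 - 2 y - m, so each term has size at most of order m.
  The constant is 27 (14833 + 16 * 9 + 1).\<close>

lemma fourth_moment_greenwood_kernel:
  assumes m: "m \<ge> 1"
  shows "(\<integral>x. greenwood_kernel m x ^ 4 \<partial>gamma_law m) \<le> 404406 * (real m ^ 2)\<^sup>2"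
proof -
  interpret prob_space "gamma_law m" by (rule prob_space_gamma_law)
  obtain K where "tame (greenwood_kernel m) (\<lambda>x. 2 * (x - (real m + 1))) K" using tame_kernels(1) by blast
  then interpret tame "greenwood_kernel m" "\<lambda>x. 2 * (x - (real m + 1))" K .
  note M4 = gamma_law_central_moments(3)[OF m] and M8 = gamma_law_central_moments(4)[OF m]
  note i4 = M4[THEN integrable.intros] and i8 = M8[THEN integrable.intros]
  have le: "greenwood_kernel m x ^ 4 \<le> 27 * ((x - real m) ^ 8 + 16 * (x - real m) ^ 4 + real m ^ 4)" for x
  proof -
    define y where "y = x - real m"
    have e: "greenwood_kernel m x = y\<^sup>2 + - 2 * y + - real m"
      by (simp add: greenwood_kernel_def y_def power2_eq_square algebra_simps)
    have "(y\<^sup>2 + - 2 * y + - real m) ^ 4 \<le> 27 * ((y\<^sup>2) ^ 4 + (- 2 * y) ^ 4 + (- real m) ^ 4)" by (rule power4_sum3_le)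
    also have "\<dots> = 27 * (y ^ 8 + 16 * y ^ 4 + real m ^ 4)" by (simp add: power_mult_distrib)
    finally show ?thesis unfolding e y_def .
  qed
  have "(\<integral>x. greenwood_kernel m x ^ 4 \<partial>gamma_law m) \<le> (\<integral>x. 27 * ((x - real m) ^ 8 + 16 * (x - real m) ^ 4 + real m ^ 4) \<partial>gamma_law m)"
    by (intro integral_mono integrable_h4 m le integrable_mult_right Bochner_Integration.integrable_add i4 i8 integrable_const)
  also have "\<dots> = 27 * ((\<integral>x. (x - real m) ^ 8 \<partial>gamma_law m) + 16 * (\<integral>x. (x - real m) ^ 4 \<partial>gamma_law m) + real m ^ 4)"
    using i4 i8 prob_space by simp
  also have "\<dots> \<le> 27 * (14833 * real m ^ 4 + 16 * (9 * real m ^ 2) + real m ^ 4)"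
    using gamma_law_central_moment_bounds[OF m] by (intro mult_left_mono add_mono) auto
  also have "\<dots> \<le> 27 * (14833 * real m ^ 4 + 16 * (9 * real m ^ 4) + real m ^ 4)"
    using m by (intro mult_left_mono add_mono power_increasing) auto
  finally show ?thesis by simp
qed

text \<open>The kernel splits into a part with a double zero at x = m, of size (x - m)^2 / m, and a
  linear part whose slope d is shown to be at most 1/m in absolute value. The constant is 27 (14833
  + 9 + 1).\<close>

lemma fourth_moment_entropy_kernel:
  assumes m: "m \<ge> 1"
  shows "(\<integral>x. entropy_kernel m x ^ 4 \<partial>gamma_law m) \<le> 400761 * 1\<^sup>2"
proof -
  interpret prob_space "gamma_law m" by (rule prob_space_gamma_law)
  obtain K where "tame (entropy_kernel m) (\<lambda>x. ln x - Digamma (real m + 1)) K" using tame_kernels(3) by blast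
  then interpret tame "entropy_kernel m" "\<lambda>x. ln x - Digamma (real m + 1)" K .
  note M1 = gamma_law_central_moments(1)[OF m] and M2 = gamma_law_central_moments(2)[OF m]
    and M4 = gamma_law_central_moments(3)[OF m] and M8 = gamma_law_central_moments(4)[OF m]
  note i1 = M1[THEN integrable.intros] and i2 = M2[THEN integrable.intros]
    and i4 = M4[THEN integrable.intros] and i8 = M8[THEN integrable.intros]
  have rm: "real m > 0" "real m \<ge> 1" using m by auto
  \<comment> \<open>The derivative of the kernel at x = m. Subtracting d x leaves g(x) = x ln (x/m)
    - x + m, which vanishes to second order at m.\<close>
  define d where "d = ln (real m) - Digamma (real m + 1)"
  define g where "g = (\<lambda>x. entropy_kernel m x - d * (x - real m) - d * real m)"
  have g: "0 \<le> g x \<and> g x \<le> (x - real m)\<^sup>2 / real m" if "x > 0" for x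
  proof -
    define y where "y = x / real m"
    have y: "y > 0" "x = real m * y" using that rm by (auto simp: y_def)
    have "ln x = ln (real m) + ln y" using y rm by (simp add: ln_mult)
    then have "g x = real m * (y * ln y - y + 1)"
      unfolding g_def entropy_kernel_def d_def y(2) by (simp add: algebra_simps)
    moreover have "0 \<le> y * ln y - y + 1"
    proof -
      have "- ln y \<le> 1 / y - 1" using ln_le_minus_one[of "1 / y"] y by (simp add: ln_div)
      then have "y * (- ln y) \<le> y * (1 / y - 1)" using y by (intro mult_left_mono) auto
      then show ?thesis using y by (simp add: right_diff_distrib)
    qed
    moreover have "y * ln y - y + 1 \<le> (y - 1)\<^sup>2"
    proof -
      have "y * ln y \<le> y * (y - 1)" using y ln_le_minus_one[of y] by (intro mult_left_mono) auto
      then show ?thesis by (simp add: power2_eq_square algebra_simps)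
    qed
    moreover have "real m * (y - 1)\<^sup>2 = (x - real m)\<^sup>2 / real m" using rm unfolding y(2) by (simp add: power2_eq_square field_simps)
    ultimately show ?thesis using rm by (metis mult_left_mono mult_nonneg_nonneg less_imp_le)
  qed
  have E0: "has_bochner_integral (gamma_law m) (entropy_kernel m) 0" and Ec: "has_bochner_integral (gamma_law m) (\<lambda>_. d * real m) (d * real m)"
    using integrable_h[OF m] mean_kernels(3)[OF m] prob_space by (simp_all add: has_bochner_integral_iff)
  have hg: "has_bochner_integral (gamma_law m) g (0 - d * 0 - d * real m)"
    unfolding g_def by (intro has_bochner_integral_diff has_bochner_integral_mult_right E0 M1 Ec)
  then have ig: "integrable (gamma_law m) g" and "(\<integral>x. g x \<partial>gamma_law m) = - d * real m"
    by (simp_all add: has_bochner_integral_iff)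
  note \<open>(\<integral>x. g x \<partial>gamma_law m) = - d * real m\<close>
  moreover have "0 \<le> (\<integral>x. g x \<partial>gamma_law m)"
    using AE_gamma_law_pos[OF m] g by (intro integral_nonneg_AE) (auto elim!: eventually_mono)
  moreover have "(\<integral>x. g x \<partial>gamma_law m) \<le> (\<integral>x. (x - real m)\<^sup>2 / real m \<partial>gamma_law m)"
    using AE_gamma_law_pos[OF m] g i2 ig by (intro integral_mono_AE) (auto elim!: eventually_mono)
  moreover have "(\<integral>x. (x - real m)\<^sup>2 / real m \<partial>gamma_law m) = 1"
    using M2 rm by (simp add: has_bochner_integral_iff)
  \<comment> \<open>The kernel is centred, so E g = -d m; on the other hand g lies between 0 and (x
    - m)^2 / m, whose mean is 1.\<close>
  ultimately have dm: "\<bar>d * real m\<bar> \<le> 1" by auto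
  have ae: "AE x in gamma_law m. entropy_kernel m x ^ 4 \<le> 27 * ((x - real m) ^ 8 / real m ^ 4 + (x - real m) ^ 4 / real m ^ 4 + 1)"
    using AE_gamma_law_pos[OF m]
  proof eventually_elim
    case (elim x)
    have "entropy_kernel m x = g x + d * (x - real m) + d * real m" by (simp add: g_def)
    then have "entropy_kernel m x ^ 4 \<le> 27 * (g x ^ 4 + (d * (x - real m)) ^ 4 + (d * real m) ^ 4)"
      using power4_sum3_le by simp
    also have "\<dots> \<le> 27 * ((x - real m) ^ 8 / real m ^ 4 + (x - real m) ^ 4 / real m ^ 4 + 1)"
    proof (intro mult_left_mono add_mono)
      have "g x ^ 4 \<le> ((x - real m)\<^sup>2 / real m) ^ 4" using g[OF elim] by (intro power_mono) auto
      then show "g x ^ 4 \<le> (x - real m) ^ 8 / real m ^ 4" by (simp add: power_divide)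
      have dm4: "(d * real m) ^ 4 \<le> 1"
        using power_mono[OF dm, of 4] by (simp add: power_even_abs)
      then show "(d * real m) ^ 4 \<le> 1" .
      have "(d * (x - real m)) ^ 4 = (d * real m) ^ 4 * ((x - real m) ^ 4 / real m ^ 4)" using rm by (simp add: power_mult_distrib)
      also have "\<dots> \<le> 1 * ((x - real m) ^ 4 / real m ^ 4)" using dm4 by (intro mult_right_mono) auto
      finally show "(d * (x - real m)) ^ 4 \<le> (x - real m) ^ 4 / real m ^ 4" by simp
    qed auto
    finally show ?case .
  qed
  have "(\<integral>x. entropy_kernel m x ^ 4 \<partial>gamma_law m) \<le> (\<integral>x. 27 * ((x - real m) ^ 8 / real m ^ 4 + (x - real m) ^ 4 / real m ^ 4 + 1) \<partial>gamma_law m)"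
    by (intro integral_mono_AE integrable_h4 m ae integrable_mult_right Bochner_Integration.integrable_add integrable_divide i4 i8 integrable_const)
  also have "\<dots> = 27 * ((\<integral>x. (x - real m) ^ 8 \<partial>gamma_law m) / real m ^ 4 + (\<integral>x. (x - real m) ^ 4 \<partial>gamma_law m) / real m ^ 4 + 1)"
    using i4 i8 prob_space by simp
  also have "\<dots> \<le> 27 * (14833 * real m ^ 4 / real m ^ 4 + 9 * real m ^ 4 / real m ^ 4 + 1)"
  proof (intro mult_left_mono add_mono divide_right_mono)
    have "real m ^ 2 \<le> real m ^ 4" using rm by (intro power_increasing) auto
    then show "(\<integral>x. (x - real m) ^ 4 \<partial>gamma_law m) \<le> 9 * real m ^ 4" using gamma_law_central_moment_bounds(1)[OF m] by linarith
  qed (use gamma_law_central_moment_bounds(2)[OF m] in auto)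
  finally show ?thesis using rm by simp
qed

text \<open>The logarithm forces a factor x^(-4) in the estimate. Four size-bias steps move it to
  the gamma law with parameter m - 4, which must be at least 1, hence m >= 5. The constant is 2 * 27
  * 10287232.\<close>

lemma fourth_moment_log_kernel_large:
  assumes m: "m \<ge> 5"
  shows "(\<integral>x. log_kernel m x ^ 4 \<partial>gamma_law m) \<le> 555510528 * (1 / real m ^ 2)\<^sup>2"
proof -
  interpret prob_space "gamma_law m" by (rule prob_space_gamma_law)
  have m1: "m \<ge> 1" using m by simp
  obtain K where "tame (log_kernel m) (\<lambda>x. 1 / x - 1 / real m) K" using tame_kernels(2) by blast
  then interpret tame "log_kernel m" "\<lambda>x. 1 / x - 1 / real m" K .
  obtain k where k: "m = Suc (Suc (Suc (Suc k)))" "k \<ge> 1" using m by (intro that[of "m - 4"]) auto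
  have rm: "real m > 0" using m by simp
  define f where "f = (\<lambda>x. (x - real m) ^ 8 / x ^ 4)"
  have [measurable]: "f \<in> borel_measurable borel" unfolding f_def by measurable
  have pow8: "(a + b) ^ 8 \<le> 128 * (a ^ 8 + b ^ 8)" for a b :: real
  proof -
    have sq: "(a + b)\<^sup>2 \<le> 2 * (a\<^sup>2 + b\<^sup>2)" for a b :: real
      using sum_squares_bound[of a b] by (simp add: power2_sum)
    have "(a + b) ^ 8 = (((a + b)\<^sup>2)\<^sup>2)\<^sup>2" by simp
    also have "\<dots> \<le> ((2 * (a\<^sup>2 + b\<^sup>2))\<^sup>2)\<^sup>2" by (intro power_mono sq) auto
    also have "\<dots> = 16 * ((a\<^sup>2 + b\<^sup>2)\<^sup>2)\<^sup>2" by (simp add: power_mult_distrib del: distrib_left_numeral)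
    also have "\<dots> \<le> 16 * (2 * ((a\<^sup>2)\<^sup>2 + (b\<^sup>2)\<^sup>2))\<^sup>2" by (intro mult_left_mono power_mono sq) auto
    also have "\<dots> = 64 * ((a\<^sup>2)\<^sup>2 + (b\<^sup>2)\<^sup>2)\<^sup>2" by (simp add: power_mult_distrib del: distrib_left_numeral)
    also have "\<dots> \<le> 64 * (2 * (((a\<^sup>2)\<^sup>2)\<^sup>2 + ((b\<^sup>2)\<^sup>2)\<^sup>2))" by (intro mult_left_mono sq) auto
    finally show ?thesis by simp
  qed
  have ifk: "integrable (gamma_law m) f" and "(\<integral>x. f x \<partial>gamma_law m) \<le> 10287232"
  proof -
    interpret G: prob_space "gamma_law k" by (rule prob_space_gamma_law)
    have i8: "integrable (gamma_law k) (\<lambda>x. (x - real k) ^ 8)" using gamma_law_central_moments(4)[OF k(2)] by (rule integrable.intros)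
    \<comment> \<open>The centre moves from m to k = m - 4, and the shift contributes 4^8 =
      65536.\<close>
    have le: "(x - real m) ^ 8 \<le> 128 * ((x - real k) ^ 8 + 65536)" for x
    proof -
      have "x - real m = x - real k + - 4" using k(1) by simp
      show ?thesis using pow8[of "x - real k" "- 4"] unfolding \<open>x - real m = x - real k + - 4\<close>[symmetric] by simp
    qed
    have ae: "AE x in gamma_law k. (x - real m) ^ 8 = x * (x * (x * (x * f x)))"
      using AE_gamma_law_pos[OF k(2)] by eventually_elim (simp add: f_def power4_eq_xxxx)
    have mm: "(\<lambda>x. (x - real m) ^ 8) \<in> borel_measurable (gamma_law k)" "(\<lambda>x. x * (x * (x * (x * f x)))) \<in> borel_measurable (gamma_law k)"
      by measurable
    have i: "integrable (gamma_law k) (\<lambda>x. (x - real m) ^ 8)"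
      by (rule Bochner_Integration.integrable_bound[where f = "\<lambda>x. 128 * ((x - real k) ^ 8 + 65536)"])
        (use i8 le in \<open>auto intro: order_trans[OF _ abs_ge_self]\<close>)
    have ints: "integrable (gamma_law k) (\<lambda>x. x * (x * (x * (x * f x))))"
      "(\<integral>x. x * (x * (x * (x * f x))) \<partial>gamma_law k) = (\<integral>x. (x - real m) ^ 8 \<partial>gamma_law k)"
      using integrable_cong_AE[OF mm ae] integral_cong_AE[OF mm ae] i by auto
    show "integrable (gamma_law m) f"
      using ints(1) k by (simp add: gamma_law_size_bias(1))
    have "real k * (real (Suc k) * (real (Suc (Suc k)) * (real (Suc (Suc (Suc k))) * (\<integral>x. f x \<partial>gamma_law m)))) = (\<integral>x. (x - real m) ^ 8 \<partial>gamma_law k)"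
      using ints(2) k by (simp add: gamma_law_size_bias(2))
    also have "\<dots> \<le> (\<integral>x. 128 * ((x - real k) ^ 8 + 65536) \<partial>gamma_law k)"
      using i i8 le by (intro integral_mono) auto
    also have "\<dots> = 128 * ((\<integral>x. (x - real k) ^ 8 \<partial>gamma_law k) + 65536)" using i8 G.prob_space by simp
    also have "\<dots> \<le> 128 * (14833 * real k ^ 4 + 65536 * real k ^ 4)"
      using gamma_law_central_moment_bounds(2)[OF k(2)] k(2) by (intro mult_left_mono add_mono) (auto intro: one_le_power)
    also have "\<dots> = 10287232 * (real k * (real k * (real k * real k)))" by (simp add: power4_eq_xxxx)
    also have "\<dots> \<le> 10287232 * (real k * (real (Suc k) * (real (Suc (Suc k)) * real (Suc (Suc (Suc k))))))"
      by (intro mult_left_mono mult_mono) auto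
    finally have "(real k * (real (Suc k) * (real (Suc (Suc k)) * real (Suc (Suc (Suc k)))))) * (\<integral>x. f x \<partial>gamma_law m)
      \<le> (real k * (real (Suc k) * (real (Suc (Suc k)) * real (Suc (Suc (Suc k)))))) * 10287232"
      by (simp only: mult.assoc mult.commute[of 10287232])
    then show "(\<integral>x. f x \<partial>gamma_law m) \<le> 10287232"
      by (rule mult_left_le_imp_le) (use k(2) in \<open>intro mult_pos_pos; simp\<close>)
  qed
  \<comment> \<open>With y = x/m the difference D of d and the kernel is y - 1 - ln y, which is
    nonnegative and at most (y - 1)^2 / y. Its mean is d.\<close>
  define d where "d = ln (real m) - Digamma (real m)"
  define D where "D = (\<lambda>x. d - log_kernel m x)"
  have D: "0 \<le> D x \<and> D x ^ 4 \<le> f x / real m ^ 4" if "x > 0" for x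
  proof -
    define y where "y = x / real m"
    have y: "y > 0" "x = real m * y" using that rm by (auto simp: y_def)
    have "ln x = ln (real m) + ln y" using y rm by (simp add: ln_mult)
    then have Dy: "D x = y - 1 - ln y" using rm
      unfolding D_def d_def log_kernel_def y(2) by (simp add: diff_divide_distrib)
    have "D x \<le> (y - 1)\<^sup>2 / y" "0 \<le> D x" unfolding Dy using ln_deviation_bound[OF y(1)] by auto
    then have "D x ^ 4 \<le> ((y - 1)\<^sup>2 / y) ^ 4" by (intro power_mono)
    also have "(y - 1)\<^sup>2 / y = (x - real m)\<^sup>2 / (x * real m)" using rm y(1) unfolding y(2) by (simp add: power2_eq_square field_simps)
    also have "((x - real m)\<^sup>2 / (x * real m)) ^ 4 = f x / real m ^ 4" by (simp add: f_def power_divide power_mult_distrib)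
    finally show ?thesis using \<open>0 \<le> D x\<close> by simp
  qed
  have [measurable]: "D \<in> borel_measurable borel" unfolding D_def by measurable
  have iD4: "integrable (gamma_law m) (\<lambda>x. D x ^ 4)"
  proof (rule Bochner_Integration.integrable_bound[where f = "\<lambda>x. f x / real m ^ 4"])
    show "AE x in gamma_law m. norm (D x ^ 4) \<le> norm (f x / real m ^ 4)"
      using AE_gamma_law_pos[OF m1] proof eventually_elim
        case (elim x)
        have "f x \<ge> 0" by (simp add: f_def)
        then show ?case using D[OF elim] by simp
      qed
  qed (use ifk in auto)
  have D4: "(\<integral>x. D x ^ 4 \<partial>gamma_law m) \<le> 10287232 / real m ^ 4"
  proof -
    have "(\<integral>x. D x ^ 4 \<partial>gamma_law m) \<le> (\<integral>x. f x / real m ^ 4 \<partial>gamma_law m)"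
      using AE_gamma_law_pos[OF m1] D ifk iD4 by (intro integral_mono_AE) (auto elim!: eventually_mono)
    also have "\<dots> = (\<integral>x. f x \<partial>gamma_law m) / real m ^ 4" by simp
    also have "\<dots> \<le> 10287232 / real m ^ 4" using \<open>(\<integral>x. f x \<partial>gamma_law m) \<le> 10287232\<close> by (intro divide_right_mono) auto
    finally show ?thesis .
  qed
  have iD: "integrable (gamma_law m) D" "(\<integral>x. D x \<partial>gamma_law m) = d"
    unfolding D_def using integrable_h[OF m1] mean_kernels(2)[OF m1] prob_space by simp_all
  have iD2: "integrable (gamma_law m) (\<lambda>x. (D x)\<^sup>2)"
    unfolding D_def power2_diff using integrable_h[OF m1] integrable_h2[OF m1] by (simp add: mult.assoc)
  \<comment> \<open>Nonnegativity of the variance, used for D here and for D^2 below, gives d^4 = (E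
    D)^4 <= E D^4.\<close>
  have "0 \<le> (\<integral>x. (D x)\<^sup>2 \<partial>gamma_law m) - (\<integral>x. D x \<partial>gamma_law m)\<^sup>2"
    by (subst variance_eq[OF iD(1) iD2, symmetric], rule variance_positive)
  then have d2: "d\<^sup>2 \<le> (\<integral>x. (D x)\<^sup>2 \<partial>gamma_law m)" using iD(2) by simp
  have iD22: "integrable (gamma_law m) (\<lambda>x. ((D x)\<^sup>2)\<^sup>2)" using iD4 by simp
  have "0 \<le> (\<integral>x. ((D x)\<^sup>2)\<^sup>2 \<partial>gamma_law m) - (\<integral>x. (D x)\<^sup>2 \<partial>gamma_law m)\<^sup>2"
    by (subst variance_eq[OF iD2 iD22, symmetric], rule variance_positive)
  then have "(\<integral>x. (D x)\<^sup>2 \<partial>gamma_law m)\<^sup>2 \<le> (\<integral>x. ((D x)\<^sup>2)\<^sup>2 \<partial>gamma_law m)" by simp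
  moreover have "(d\<^sup>2)\<^sup>2 \<le> (\<integral>x. (D x)\<^sup>2 \<partial>gamma_law m)\<^sup>2" by (intro power_mono d2) auto
  ultimately have d4: "d ^ 4 \<le> (\<integral>x. D x ^ 4 \<partial>gamma_law m)" by simp
  have "(\<integral>x. log_kernel m x ^ 4 \<partial>gamma_law m) \<le> (\<integral>x. 27 * (D x ^ 4 + d ^ 4) \<partial>gamma_law m)"
  proof (rule integral_mono)
    show "log_kernel m x ^ 4 \<le> 27 * (D x ^ 4 + d ^ 4)" for x
    proof -
      have "log_kernel m x = - D x + d + 0" by (simp add: D_def)
      then show ?thesis using power4_sum3_le[of "- D x" d 0] by simp
    qed
  qed (use integrable_h4[OF m1] iD4 in auto)
  also have "\<dots> = 27 * ((\<integral>x. D x ^ 4 \<partial>gamma_law m) + d ^ 4)" using iD4 prob_space by simp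
  also have "\<dots> \<le> 27 * (10287232 / real m ^ 4 + 10287232 / real m ^ 4)"
    using D4 d4 by (intro mult_left_mono add_mono) auto
  finally show ?thesis by (simp add: power_divide)
qed

text \<open>The values m = 1, ..., 4 contribute finitely many finite moments, whose sum is absorbed
  into the constant.\<close>

lemma fourth_moment_log_kernel:
  obtains C where "\<And>m. m \<ge> 1 \<Longrightarrow> (\<integral>x. log_kernel m x ^ 4 \<partial>gamma_law m) \<le> C * (1 / real m ^ 2)\<^sup>2"
proof
  let ?F = "\<lambda>m. \<integral>x. log_kernel m x ^ 4 \<partial>gamma_law m"
  let ?S = "\<Sum>j=1..4. ?F j * real j ^ 4"
  fix m :: nat assume m: "m \<ge> 1"
  have S: "?S \<ge> 0" by (intro sum_nonneg mult_nonneg_nonneg) auto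
  show "?F m \<le> (555510528 + ?S) * (1 / real m ^ 2)\<^sup>2"
  proof (cases "m \<ge> 5")
    case True
    have "?F m \<le> 555510528 * (1 / real m ^ 2)\<^sup>2" by (rule fourth_moment_log_kernel_large[OF True])
    also have "\<dots> \<le> (555510528 + ?S) * (1 / real m ^ 2)\<^sup>2" using S by (intro mult_right_mono) auto
    finally show ?thesis .
  next
    case False
    then have "?F m * real m ^ 4 \<le> ?S" using m by (intro member_le_sum[of m "{1..4}" "\<lambda>j. ?F j * real j ^ 4"]) auto
    then have "?F m * real m ^ 4 * (1 / real m ^ 2)\<^sup>2 \<le> (555510528 + ?S) * (1 / real m ^ 2)\<^sup>2" by (intro mult_right_mono) auto
    then show ?thesis using m by (simp add: power_divide)
  qed
qed

section \<open>Uniform spacings as normalised exponential variables\<close>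

text \<open>If u lists the ordered points U_1, U_2, ... from index 0 on,
  \<open>left_neighbour u j\<close> is U_j, with U_0 = 0 included.\<close>

definition left_neighbour :: "(nat \<Rightarrow> real) \<Rightarrow> nat \<Rightarrow> real" where
  "left_neighbour t i = (if i = 0 then 0 else t (i - 1))"

definition increasing_vectors :: "nat \<Rightarrow> (nat \<Rightarrow> real) set" where
  "increasing_vectors n = {t. \<forall>i<n. left_neighbour t i \<le> t i}"

interpretation lborel_power: product_sigma_finite "\<lambda>_::nat. lborel :: real measure"
  by (simp add: product_sigma_finite_def lborel.sigma_finite_measure_axioms)

interpretation exp_power: product_sigma_finite "\<lambda>_::nat. exp_law"
  by (simp add: product_sigma_finite_def prob_space_exp_law prob_space_imp_sigma_finite)

lemma sets_PiM_exp_law [measurable_cong]: "sets (Pi\<^sub>M I (\<lambda>_::nat. exp_law)) = sets (Pi\<^sub>M I (\<lambda>_. borel))"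
  and sets_PiM_lborel [measurable_cong]: "sets (Pi\<^sub>M I (\<lambda>_::nat. lborel :: real measure)) = sets (Pi\<^sub>M I (\<lambda>_. borel))"
  by (intro sets_PiM_cong; simp)+

lemma measurable_left_neighbour:
  "i \<le> n \<Longrightarrow> (\<lambda>t. left_neighbour t i) \<in> borel_measurable (Pi\<^sub>M {..<n} (\<lambda>_. borel))"
  unfolding left_neighbour_def by (cases "i = 0") (auto intro!: measurable_component_singleton)

lemma increasing_sets: "increasing_vectors n \<inter> space (Pi\<^sub>M {..<n} (\<lambda>_. borel)) \<in> sets (Pi\<^sub>M {..<n} (\<lambda>_. borel))"
proof -
  have "Measurable.pred (Pi\<^sub>M {..<n} (\<lambda>_. borel)) (\<lambda>t. \<forall>i\<in>{..<n}. left_neighbour t i \<le> t i)"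
  proof (rule pred_intros_finite)
    fix i assume "i \<in> {..<n}"
    then have "(\<lambda>t. left_neighbour t i) \<in> borel_measurable (Pi\<^sub>M {..<n} (\<lambda>_. borel))"
      "(\<lambda>t. t i) \<in> borel_measurable (Pi\<^sub>M {..<n} (\<lambda>_. borel :: real measure))"
      by (auto intro: measurable_left_neighbour measurable_component_singleton)
    show "Measurable.pred (Pi\<^sub>M {..<n} (\<lambda>_. borel)) (\<lambda>t. left_neighbour t i \<le> t i)"
      unfolding pred_def by (rule borel_measurable_le) fact+
  qed simp
  moreover have "increasing_vectors n \<inter> space (Pi\<^sub>M {..<n} (\<lambda>_. borel)) = {t \<in> space (Pi\<^sub>M {..<n} (\<lambda>_. borel)). \<forall>i\<in>{..<n}. left_neighbour t i \<le> t i}"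
    by (auto simp: increasing_vectors_def)
  ultimately show ?thesis unfolding pred_def by (simp only:)
qed

lemma measurable_indicator_increasing:
  "(\<lambda>t. indicator (increasing_vectors n) t :: ennreal) \<in> borel_measurable (Pi\<^sub>M {..<n} (\<lambda>_. borel))"
  using increasing_sets by (subst borel_measurable_indicator_iff)

lemma increasing_Suc: "t(n := y) \<in> increasing_vectors (Suc n) \<longleftrightarrow> t \<in> increasing_vectors n \<and> left_neighbour t n \<le> y"
proof -
  have "left_neighbour (t(n := y)) i = left_neighbour t i" if "i \<le> n" for i
    using that by (cases i) (simp_all add: left_neighbour_def)
  then show ?thesis by (auto simp: increasing_vectors_def less_Suc_eq)
qed

lemma measurable_append_coord:
  assumes "f \<in> N \<rightarrow>\<^sub>M Pi\<^sub>M {..<n} (\<lambda>_. borel)" "g \<in> borel_measurable N"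
  shows "(\<lambda>x. (f x)(n := g x)) \<in> N \<rightarrow>\<^sub>M Pi\<^sub>M {..<Suc n} (\<lambda>_. borel)"
  by (rule measurable_fun_upd[OF _ assms]) auto

text \<open>The change of variables to partial sums has Jacobian 1 and turns the product of the
  e^(-w) into e to the minus last point, which is \<open>left_neighbour t n\<close>. It is carried
  out one coordinate at a time by a translation, and the ordering of the points records the
  positivity of the increments.\<close>

lemma nn_integral_partial_sums:
  fixes G :: "(nat \<Rightarrow> real) \<Rightarrow> ennreal"
  assumes "G \<in> borel_measurable (Pi\<^sub>M {..<n} (\<lambda>_. borel))"
  shows "(\<integral>\<^sup>+\<omega>. G (\<lambda>i\<in>{..<n}. \<Sum>j\<le>i. \<omega> j) \<partial>Pi\<^sub>M {..<n} (\<lambda>_. exp_law))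
    = (\<integral>\<^sup>+t. G t * (ennreal (exp (- left_neighbour t n)) * indicator (increasing_vectors n) t) \<partial>Pi\<^sub>M {..<n} (\<lambda>_. lborel))"
  using assms
proof (induction n arbitrary: G)
  case 0
  show ?case
    by (simp add: PiM_empty nn_integral_count_space_finite left_neighbour_def increasing_vectors_def restrict_def)
next
  case (Suc n)
  note [measurable] = Suc.prems measurable_left_neighbour[OF order_refl, of n]
    measurable_left_neighbour[OF order_refl, of "Suc n"]
    measurable_indicator_increasing measurable_append_coord
  define S where "S = (\<lambda>(n :: nat) (w :: nat \<Rightarrow> real). \<lambda>i\<in>{..<n}. \<Sum>j\<le>i. w j)"
  define H where "H = (\<lambda>t. \<integral>\<^sup>+y. G (t(n := left_neighbour t n + y)) \<partial>exp_law)"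
  interpret E: sigma_finite_measure exp_law by (rule prob_space_imp_sigma_finite[OF prob_space_exp_law])
  have [measurable]: "H \<in> borel_measurable (Pi\<^sub>M {..<n} (\<lambda>_. borel))"
    unfolding H_def by measurable
  have S: "S n \<in> Pi\<^sub>M {..<n} (\<lambda>_. borel) \<rightarrow>\<^sub>M Pi\<^sub>M {..<n} (\<lambda>_. borel)" for n
    unfolding S_def by (intro measurable_restrict borel_measurable_sum measurable_component_singleton) auto
  have upd: "S (Suc n) (w(n := y)) = (S n w)(n := left_neighbour (S n w) n + y)" for w y
  proof
    fix i show "S (Suc n) (w(n := y)) i = ((S n w)(n := left_neighbour (S n w) n + y)) i"
      by (cases "i = n"; cases n) (auto simp: left_neighbour_def S_def)
  qed
  have "(\<integral>\<^sup>+w. G (S (Suc n) w) \<partial>Pi\<^sub>M {..<Suc n} (\<lambda>_. exp_law))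
    = (\<integral>\<^sup>+w. \<integral>\<^sup>+y. G (S (Suc n) (w(n := y))) \<partial>exp_law \<partial>Pi\<^sub>M {..<n} (\<lambda>_. exp_law))"
    unfolding lessThan_Suc
    by (rule exp_power.product_nn_integral_insert)
      (use measurable_compose[OF S Suc.prems] in \<open>auto simp: lessThan_Suc cong: measurable_cong_sets sets_PiM_exp_law\<close>)
  also have "\<dots> = (\<integral>\<^sup>+w. H (S n w) \<partial>Pi\<^sub>M {..<n} (\<lambda>_. exp_law))"
    unfolding upd H_def ..
  also have "\<dots> = (\<integral>\<^sup>+t. H t * (ennreal (exp (- left_neighbour t n)) * indicator (increasing_vectors n) t) \<partial>Pi\<^sub>M {..<n} (\<lambda>_. lborel))"
    unfolding S_def by (rule Suc.IH) measurable
  also have "\<dots> = (\<integral>\<^sup>+t. \<integral>\<^sup>+z. G (t(n := z)) * (ennreal (exp (- left_neighbour (t(n := z)) (Suc n))) * indicator (increasing_vectors (Suc n)) (t(n := z))) \<partial>lborel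
      \<partial>Pi\<^sub>M {..<n} (\<lambda>_. lborel))"
  proof (rule nn_integral_cong)
    fix t assume "t \<in> space (Pi\<^sub>M {..<n} (\<lambda>_. lborel :: real measure))"
    then have t: "t \<in> space (Pi\<^sub>M {..<n} (\<lambda>_. borel))" by (simp add: space_PiM)
    define a where "a = left_neighbour t n"
    have [measurable]: "(\<lambda>z. G (t(n := z))) \<in> borel_measurable borel"
      by (rule measurable_compose[OF measurable_append_coord[OF measurable_const[OF t]] Suc.prems]) simp
    have "H t = (\<integral>\<^sup>+y. ennreal (exponential_density 1 y) * G (t(n := a + y)) \<partial>lborel)"
      unfolding H_def exp_law_def a_def by (subst nn_integral_density) auto
    then have "H t * ennreal (exp (- a)) = (\<integral>\<^sup>+y. ennreal (exponential_density 1 y) * G (t(n := a + y)) * ennreal (exp (- a)) \<partial>lborel)"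
      by (simp add: nn_integral_multc)
    also have "\<dots> = (\<integral>\<^sup>+y. (\<lambda>z. G (t(n := z)) * (ennreal (exp (- z)) * indicator {a..} z)) (a + 1 * y) \<partial>lborel)"
    proof (rule nn_integral_cong)
      fix y :: real
      show "ennreal (exponential_density 1 y) * G (t(n := a + y)) * ennreal (exp (- a))
        = G (t(n := a + 1 * y)) * (ennreal (exp (- (a + 1 * y))) * indicator {a..} (a + 1 * y))"
        by (auto simp: exponential_density_def ennreal_mult'[symmetric] exp_add[symmetric] mult_ac split: split_indicator)
          (auto simp: mult.assoc[symmetric] ennreal_mult'[symmetric] exp_add[symmetric] algebra_simps exp_diff)
    qed
    also have "\<dots> = (\<integral>\<^sup>+z. G (t(n := z)) * (ennreal (exp (- z)) * indicator {a..} z) \<partial>lborel)"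
      by (subst nn_integral_real_affine[where c = 1 and t = a]) auto
    finally have "H t * (ennreal (exp (- a)) * indicator (increasing_vectors n) t)
      = (\<integral>\<^sup>+z. G (t(n := z)) * (ennreal (exp (- z)) * indicator {a..} z) \<partial>lborel) * indicator (increasing_vectors n) t"
      by (simp add: mult.assoc[symmetric])
    also have "\<dots> = (\<integral>\<^sup>+z. G (t(n := z)) * (ennreal (exp (- z)) * indicator {a..} z) * indicator (increasing_vectors n) t \<partial>lborel)"
      by (rule nn_integral_multc[symmetric]) measurable
    finally show "H t * (ennreal (exp (- left_neighbour t n)) * indicator (increasing_vectors n) t)
      = (\<integral>\<^sup>+z. G (t(n := z)) * (ennreal (exp (- left_neighbour (t(n := z)) (Suc n))) * indicator (increasing_vectors (Suc n)) (t(n := z))) \<partial>lborel)"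
      by (simp add: a_def left_neighbour_def increasing_Suc mult.assoc indicator_def if_distrib cong: if_cong)
  qed
  also have "\<dots> = (\<integral>\<^sup>+t. G t * (ennreal (exp (- left_neighbour t (Suc n))) * indicator (increasing_vectors (Suc n)) t) \<partial>Pi\<^sub>M {..<Suc n} (\<lambda>_. lborel))"
  proof -
    have "(\<lambda>t. G t * (ennreal (exp (- left_neighbour t (Suc n))) * indicator (increasing_vectors (Suc n)) t)) \<in> borel_measurable (Pi\<^sub>M {..<Suc n} (\<lambda>_. lborel))"
      by measurable
    then show ?thesis
      unfolding lessThan_Suc by (subst lborel_power.product_nn_integral_insert) auto
  qed
  finally show ?case unfolding S_def .
qed

text \<open>Change of variables for a dilation, again one coordinate at a time.\<close>

lemma nn_integral_scale:
  fixes G :: "(nat \<Rightarrow> real) \<Rightarrow> ennreal"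
  assumes "G \<in> borel_measurable (Pi\<^sub>M {..<n} (\<lambda>_. borel))" and s: "s > 0"
  shows "(\<integral>\<^sup>+t. G t \<partial>Pi\<^sub>M {..<n} (\<lambda>_. lborel))
    = ennreal (s ^ n) * (\<integral>\<^sup>+t. G (\<lambda>i\<in>{..<n}. s * t i) \<partial>Pi\<^sub>M {..<n} (\<lambda>_. lborel))"
  using assms(1)
proof (induction n arbitrary: G)
  case 0
  show ?case by (simp add: PiM_empty nn_integral_count_space_finite restrict_def)
next
  case (Suc n)
  note [measurable] = Suc.prems measurable_append_coord
  have sc: "(\<lambda>t. \<lambda>i\<in>{..<n}. s * t i) \<in> Pi\<^sub>M {..<n} (\<lambda>_. borel) \<rightarrow>\<^sub>M Pi\<^sub>M {..<n} (\<lambda>_. borel)" for n :: nat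
    by (intro measurable_restrict borel_measurable_times measurable_component_singleton) auto
  have upd: "(\<lambda>i\<in>{..<Suc n}. s * (t(n := y)) i) = (\<lambda>i\<in>{..<n}. s * t i)(n := s * y)" for t y
    by auto
  have "(\<integral>\<^sup>+t. G t \<partial>Pi\<^sub>M {..<Suc n} (\<lambda>_. lborel)) = (\<integral>\<^sup>+t. \<integral>\<^sup>+y. G (t(n := y)) \<partial>lborel \<partial>Pi\<^sub>M {..<n} (\<lambda>_. lborel))"
    unfolding lessThan_Suc by (rule lborel_power.product_nn_integral_insert) (auto simp flip: lessThan_Suc)
  also have "\<dots> = ennreal (s ^ n) * (\<integral>\<^sup>+t. \<integral>\<^sup>+y. G ((\<lambda>i\<in>{..<n}. s * t i)(n := y)) \<partial>lborel \<partial>Pi\<^sub>M {..<n} (\<lambda>_. lborel))"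
    by (rule Suc.IH) measurable
  also have "(\<integral>\<^sup>+t. \<integral>\<^sup>+y. G ((\<lambda>i\<in>{..<n}. s * t i)(n := y)) \<partial>lborel \<partial>Pi\<^sub>M {..<n} (\<lambda>_. lborel))
    = (\<integral>\<^sup>+t. ennreal s * (\<integral>\<^sup>+y. G ((\<lambda>i\<in>{..<n}. s * t i)(n := s * y)) \<partial>lborel) \<partial>Pi\<^sub>M {..<n} (\<lambda>_. lborel))"
  proof (rule nn_integral_cong)
    fix t
    have t: "(\<lambda>i\<in>{..<n}. s * t i) \<in> space (Pi\<^sub>M {..<n} (\<lambda>_. borel))" by (auto simp: space_PiM)
    have "(\<lambda>y. G ((\<lambda>i\<in>{..<n}. s * t i)(n := y))) \<in> borel_measurable borel"
      by (rule measurable_compose[OF measurable_append_coord[OF measurable_const[OF t]] Suc.prems]) simp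
    from nn_integral_real_affine[OF this, of s 0] s
    show "(\<integral>\<^sup>+y. G ((\<lambda>i\<in>{..<n}. s * t i)(n := y)) \<partial>lborel) = ennreal s * (\<integral>\<^sup>+y. G ((\<lambda>i\<in>{..<n}. s * t i)(n := s * y)) \<partial>lborel)"
      by simp
  qed
  also have "\<dots> = ennreal s * (\<integral>\<^sup>+t. \<integral>\<^sup>+y. G ((\<lambda>i\<in>{..<n}. s * t i)(n := s * y)) \<partial>lborel \<partial>Pi\<^sub>M {..<n} (\<lambda>_. lborel))"
    using sc[of n] by (intro nn_integral_cmult) measurable
  also have "(\<integral>\<^sup>+t. \<integral>\<^sup>+y. G ((\<lambda>i\<in>{..<n}. s * t i)(n := s * y)) \<partial>lborel \<partial>Pi\<^sub>M {..<n} (\<lambda>_. lborel))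
    = (\<integral>\<^sup>+t. G (\<lambda>i\<in>{..<Suc n}. s * t i) \<partial>Pi\<^sub>M {..<Suc n} (\<lambda>_. lborel))"
    unfolding upd[symmetric] lessThan_Suc
    by (rule lborel_power.product_nn_integral_insert[symmetric])
      (use measurable_compose[OF sc Suc.prems] in \<open>auto simp flip: lessThan_Suc cong: measurable_cong_sets sets_PiM_lborel\<close>)
  finally have "(\<integral>\<^sup>+t. G t \<partial>Pi\<^sub>M {..<Suc n} (\<lambda>_. lborel))
    = ennreal (s ^ n) * (ennreal s * (\<integral>\<^sup>+t. G (\<lambda>i\<in>{..<Suc n}. s * t i) \<partial>Pi\<^sub>M {..<Suc n} (\<lambda>_. lborel)))" .
  moreover have "ennreal (s ^ Suc n) = ennreal (s ^ n) * ennreal s" using s by (simp add: ennreal_mult[symmetric] mult.commute)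
  ultimately show ?case by (simp only: mult.assoc)
qed

lemma increasing_left_neighbour_nonneg: "t \<in> increasing_vectors n \<Longrightarrow> i \<le> n \<Longrightarrow> left_neighbour t i \<ge> 0"
proof (induction i)
  case 0
  then show ?case by (simp add: left_neighbour_def)
next
  case (Suc i)
  then have "left_neighbour t i \<le> t i" by (auto simp: increasing_vectors_def)
  then show ?case using Suc by (simp add: left_neighbour_def)
qed

lemma left_neighbour_scale: "i \<le> n \<Longrightarrow> left_neighbour (\<lambda>j\<in>{..<n}. s * t j) i = s * left_neighbour t i"
  by (cases i) (simp_all add: left_neighbour_def)

lemma increasing_scale:
  assumes "s > 0"
  shows "(\<lambda>j\<in>{..<n}. s * t j) \<in> increasing_vectors n \<longleftrightarrow> t \<in> increasing_vectors n"
  using assms by (simp add: increasing_vectors_def left_neighbour_scale)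

text \<open>With the last point z held fixed, dividing the others by z gives a factor z^N and an
  integral over ordered points in [0, 1] that does not involve z. The integral of z^N e^(-z) over
  the half line is N!.\<close>

lemma nn_integral_normalized_partial_sums:
  fixes F :: "(nat \<Rightarrow> real) \<Rightarrow> ennreal"
  assumes F: "F \<in> borel_measurable (Pi\<^sub>M {..<N} (\<lambda>_. borel))"
  shows "(\<integral>\<^sup>+w. F (\<lambda>i\<in>{..<N}. (\<Sum>j\<le>i. w j) / (\<Sum>j\<le>N. w j)) \<partial>Pi\<^sub>M {..<Suc N} (\<lambda>_. exp_law))
    = fact N * (\<integral>\<^sup>+u. F u * indicator {u \<in> increasing_vectors N. left_neighbour u N \<le> 1} u \<partial>Pi\<^sub>M {..<N} (\<lambda>_. lborel))"
proof -
  define G where "G = (\<lambda>t. F (\<lambda>i\<in>{..<N}. t i / t N))"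
  note [measurable] = F measurable_left_neighbour[OF order_refl, of N]
    measurable_left_neighbour[OF order_refl, of "Suc N"]
    measurable_indicator_increasing measurable_append_coord
  have [measurable]: "G \<in> borel_measurable (Pi\<^sub>M {..<Suc N} (\<lambda>_. borel))"
    unfolding G_def
    by (rule measurable_compose[OF _ F], intro measurable_restrict borel_measurable_divide measurable_component_singleton) auto
  let ?I = "\<integral>\<^sup>+u. F u * indicator {u \<in> increasing_vectors N. left_neighbour u N \<le> 1} u \<partial>Pi\<^sub>M {..<N} (\<lambda>_. lborel)"
  have "(\<integral>\<^sup>+w. F (\<lambda>i\<in>{..<N}. (\<Sum>j\<le>i. w j) / (\<Sum>j\<le>N. w j)) \<partial>Pi\<^sub>M {..<Suc N} (\<lambda>_. exp_law))
    = (\<integral>\<^sup>+w. G (\<lambda>i\<in>{..<Suc N}. \<Sum>j\<le>i. w j) \<partial>Pi\<^sub>M {..<Suc N} (\<lambda>_. exp_law))"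
    unfolding G_def by (intro nn_integral_cong arg_cong[where f = F]) auto
  also have "\<dots> = (\<integral>\<^sup>+t. G t * (ennreal (exp (- left_neighbour t (Suc N))) * indicator (increasing_vectors (Suc N)) t) \<partial>Pi\<^sub>M {..<Suc N} (\<lambda>_. lborel))"
    by (rule nn_integral_partial_sums) measurable
  also have "\<dots> = (\<integral>\<^sup>+z. \<integral>\<^sup>+t. G (t(N := z)) * (ennreal (exp (- left_neighbour (t(N := z)) (Suc N))) * indicator (increasing_vectors (Suc N)) (t(N := z)))
      \<partial>Pi\<^sub>M {..<N} (\<lambda>_. lborel) \<partial>lborel)"
  proof -
    have "(\<lambda>t. G t * (ennreal (exp (- left_neighbour t (Suc N))) * indicator (increasing_vectors (Suc N)) t)) \<in> borel_measurable (Pi\<^sub>M {..<Suc N} (\<lambda>_. lborel))"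
      by measurable
    then show ?thesis
      unfolding lessThan_Suc by (subst lborel_power.product_nn_integral_insert_rev) auto
  qed
  also have "\<dots> = (\<integral>\<^sup>+z. ennreal (z ^ N * exp (- z)) * indicator {0..} z * ?I \<partial>lborel)"
  proof (rule nn_integral_cong_AE)
    have "(\<integral>\<^sup>+t. G (t(N := z)) * (ennreal (exp (- left_neighbour (t(N := z)) (Suc N))) * indicator (increasing_vectors (Suc N)) (t(N := z))) \<partial>Pi\<^sub>M {..<N} (\<lambda>_. lborel))
      = ennreal (z ^ N * exp (- z)) * indicator {0..} z * ?I" if z: "z \<noteq> 0" for z
    proof (cases "z > 0")
      \<comment> \<open>For negative z no ordered nonnegative vector ends in z; the null set z = 0
        has been set aside.\<close>
      case False
      then have "t(N := z) \<notin> increasing_vectors (Suc N)" for t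
        using z increasing_left_neighbour_nonneg[of t N N] by (auto simp: increasing_Suc)
      then show ?thesis using False z by simp
    next
      case True
      define K where "K = (\<lambda>t. G (t(N := z)) * (ennreal (exp (- left_neighbour (t(N := z)) (Suc N))) * indicator (increasing_vectors (Suc N)) (t(N := z))))"
      have 1: "(\<lambda>t. t(N := z)) \<in> Pi\<^sub>M {..<N} (\<lambda>_. borel) \<rightarrow>\<^sub>M Pi\<^sub>M {..<Suc N} (\<lambda>_. borel)"
        by (rule measurable_append_coord) auto
      have "K \<in> borel_measurable (Pi\<^sub>M {..<N} (\<lambda>_. borel))"
        unfolding K_def by (rule measurable_compose[OF 1]) measurable
      then have "(\<integral>\<^sup>+t. K t \<partial>Pi\<^sub>M {..<N} (\<lambda>_. lborel)) = ennreal (z ^ N) * (\<integral>\<^sup>+u. K (\<lambda>i\<in>{..<N}. z * u i) \<partial>Pi\<^sub>M {..<N} (\<lambda>_. lborel))"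
        using True by (rule nn_integral_scale)
      also have "(\<integral>\<^sup>+u. K (\<lambda>i\<in>{..<N}. z * u i) \<partial>Pi\<^sub>M {..<N} (\<lambda>_. lborel))
        = (\<integral>\<^sup>+u. ennreal (exp (- z)) * (F u * indicator {u \<in> increasing_vectors N. left_neighbour u N \<le> 1} u) \<partial>Pi\<^sub>M {..<N} (\<lambda>_. lborel))"
      proof (rule nn_integral_cong)
        fix u assume "u \<in> space (Pi\<^sub>M {..<N} (\<lambda>_. lborel :: real measure))"
        then have "restrict u {..<N} = u" by (simp add: space_PiM PiE_restrict)
        moreover have "(\<lambda>i\<in>{..<N}. ((\<lambda>j\<in>{..<N}. z * u j)(N := z)) i / ((\<lambda>j\<in>{..<N}. z * u j)(N := z)) N) = restrict u {..<N}"
          using True by auto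
        ultimately have "G ((\<lambda>j\<in>{..<N}. z * u j)(N := z)) = F u" by (simp only: G_def)
        moreover have "left_neighbour ((\<lambda>j\<in>{..<N}. z * u j)(N := z)) (Suc N) = z" by (simp add: left_neighbour_def)
        moreover have "(\<lambda>j\<in>{..<N}. z * u j)(N := z) \<in> increasing_vectors (Suc N) \<longleftrightarrow> u \<in> increasing_vectors N \<and> left_neighbour u N \<le> 1"
          unfolding increasing_Suc using True by (simp add: increasing_scale left_neighbour_scale)
        ultimately show "K (\<lambda>i\<in>{..<N}. z * u i) = ennreal (exp (- z)) * (F u * indicator {u \<in> increasing_vectors N. left_neighbour u N \<le> 1} u)"
          unfolding K_def by (auto simp: indicator_def mult_ac)
      qed
      also have "\<dots> = ennreal (exp (- z)) * ?I"
      proof (rule nn_integral_cmult)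
        have "(\<lambda>u. F u * (indicator (increasing_vectors N) u * indicator {..1} (left_neighbour u N))) \<in> borel_measurable (Pi\<^sub>M {..<N} (\<lambda>_. lborel))"
          by measurable
        then show "(\<lambda>u. F u * indicator {u \<in> increasing_vectors N. left_neighbour u N \<le> 1} u) \<in> borel_measurable (Pi\<^sub>M {..<N} (\<lambda>_. lborel))"
          by (rule measurable_cong[THEN iffD1, rotated]) (auto simp: indicator_def)
      qed
      finally show ?thesis using True unfolding K_def by (simp add: ennreal_mult mult.assoc)
    qed
    then show "AE z in lborel. (\<integral>\<^sup>+t. G (t(N := z)) * (ennreal (exp (- left_neighbour (t(N := z)) (Suc N))) * indicator (increasing_vectors (Suc N)) (t(N := z))) \<partial>Pi\<^sub>M {..<N} (\<lambda>_. lborel))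
      = ennreal (z ^ N * exp (- z)) * indicator {0..} z * ?I"
      using AE_lborel_singleton[of "0::real"] by (auto elim!: eventually_mono)
  qed
  also have "\<dots> = (\<integral>\<^sup>+z. ennreal (z ^ N * exp (- z)) * indicator {0..} z \<partial>lborel) * ?I"
    by (rule nn_integral_multc) measurable
  also have "(\<integral>\<^sup>+z. ennreal (z ^ N * exp (- z)) * indicator {0..} z \<partial>lborel) = fact N"
  proof -
    have "ennreal (real (fact N)) = fact N" by (metis ennreal_of_nat_eq_real_of_nat of_nat_fact)
    then show ?thesis using nn_intergal_power_times_exp_Ici[of N] by (simp only:)
  qed
  finally show ?thesis .
qed

section \<open>Order statistics of a uniform sample\<close>

definition uniform_law :: "real measure" where
  "uniform_law = uniform_measure lborel {0..1}"

lemma prob_space_uniform_law: "prob_space uniform_law"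
  unfolding uniform_law_def by (rule prob_space_uniform_measure) auto

interpretation uniform_power: product_sigma_finite "\<lambda>_::nat. uniform_law"
  by (simp add: product_sigma_finite_def prob_space_uniform_law prob_space_imp_sigma_finite)

lemma sets_uniform_law [measurable_cong, simp]: "sets uniform_law = sets borel"
  and space_uniform_law [simp]: "space uniform_law = UNIV"
  by (simp_all add: uniform_law_def)

lemma sets_PiM_uniform_law [measurable_cong]: "sets (Pi\<^sub>M I (\<lambda>_::nat. uniform_law)) = sets (Pi\<^sub>M I (\<lambda>_. borel))"
  by (intro sets_PiM_cong; simp)

lemma nn_integral_uniform_power:
  fixes G :: "(nat \<Rightarrow> real) \<Rightarrow> ennreal"
  assumes "G \<in> borel_measurable (Pi\<^sub>M {..<n} (\<lambda>_. borel))"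
  shows "(\<integral>\<^sup>+t. G t \<partial>Pi\<^sub>M {..<n} (\<lambda>_. uniform_law)) = (\<integral>\<^sup>+t. G t * (\<Prod>i<n. indicator {0..1} (t i)) \<partial>Pi\<^sub>M {..<n} (\<lambda>_. lborel))"
  using assms
proof (induction n arbitrary: G)
  case 0
  show ?case by (simp add: PiM_empty nn_integral_count_space_finite)
next
  case (Suc n)
  note [measurable] = Suc.prems measurable_append_coord
  interpret U: sigma_finite_measure uniform_law by (rule prob_space_imp_sigma_finite[OF prob_space_uniform_law])
  have P: "(\<lambda>t. \<Prod>i<n. indicator {0..1::real} (t i) :: ennreal) \<in> borel_measurable (Pi\<^sub>M {..<n} (\<lambda>_. borel))" for n :: nat
    by (intro borel_measurable_prod_ennreal measurable_compose[OF measurable_component_singleton]) auto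
  have "(\<integral>\<^sup>+t. G t \<partial>Pi\<^sub>M {..<Suc n} (\<lambda>_. uniform_law)) = (\<integral>\<^sup>+t. \<integral>\<^sup>+y. G (t(n := y)) \<partial>uniform_law \<partial>Pi\<^sub>M {..<n} (\<lambda>_. uniform_law))"
    unfolding lessThan_Suc by (rule uniform_power.product_nn_integral_insert) (auto simp flip: lessThan_Suc)
  also have "\<dots> = (\<integral>\<^sup>+t. (\<integral>\<^sup>+y. G (t(n := y)) \<partial>uniform_law) * (\<Prod>i<n. indicator {0..1} (t i)) \<partial>Pi\<^sub>M {..<n} (\<lambda>_. lborel))"
    by (rule Suc.IH) measurable
  also have "\<dots> = (\<integral>\<^sup>+t. \<integral>\<^sup>+y. G (t(n := y)) * (\<Prod>i<Suc n. indicator {0..1} ((t(n := y)) i)) \<partial>lborel \<partial>Pi\<^sub>M {..<n} (\<lambda>_. lborel))"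
  proof (rule nn_integral_cong)
    fix t assume "t \<in> space (Pi\<^sub>M {..<n} (\<lambda>_. lborel :: real measure))"
    then have t: "t \<in> space (Pi\<^sub>M {..<n} (\<lambda>_. borel))" by (simp add: space_PiM)
    have [measurable]: "(\<lambda>y. G (t(n := y))) \<in> borel_measurable borel"
      by (rule measurable_compose[OF measurable_append_coord[OF measurable_const[OF t]] Suc.prems]) simp
    have "(\<integral>\<^sup>+y. G (t(n := y)) \<partial>uniform_law) = (\<integral>\<^sup>+y. G (t(n := y)) * indicator {0..1} y \<partial>lborel)"
      unfolding uniform_law_def by (subst nn_integral_uniform_measure) (auto simp: divide_ennreal_def)
    then have "(\<integral>\<^sup>+y. G (t(n := y)) \<partial>uniform_law) * (\<Prod>i<n. indicator {0..1} (t i))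
      = (\<integral>\<^sup>+y. G (t(n := y)) * indicator {0..1} y * (\<Prod>i<n. indicator {0..1} (t i)) \<partial>lborel)"
      by (simp add: nn_integral_multc)
    also have "\<dots> = (\<integral>\<^sup>+y. G (t(n := y)) * (\<Prod>i<Suc n. indicator {0..1} ((t(n := y)) i)) \<partial>lborel)"
      by (intro nn_integral_cong) (simp add: mult_ac)
    finally show "(\<integral>\<^sup>+y. G (t(n := y)) \<partial>uniform_law) * (\<Prod>i<n. indicator {0..1} (t i)) = \<dots>" .
  qed
  also have "\<dots> = (\<integral>\<^sup>+t. G t * (\<Prod>i<Suc n. indicator {0..1} (t i)) \<partial>Pi\<^sub>M {..<Suc n} (\<lambda>_. lborel))"
    unfolding lessThan_Suc
    by (rule lborel_power.product_nn_integral_insert[symmetric])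
      (use P[of "Suc n"] in \<open>auto intro!: borel_measurable_times_ennreal simp flip: lessThan_Suc cong: measurable_cong_sets sets_PiM_lborel\<close>)
  finally show ?case .
qed

definition sorted_sample :: "nat \<Rightarrow> (nat \<Rightarrow> real) \<Rightarrow> nat \<Rightarrow> real" where
  "sorted_sample N x = (\<lambda>i\<in>{..<N}. order_stat N x (Suc i))"

lemma sorted_sample_permutation:
  obtains p where "p permutes {..<N}" "sorted_sample N x = (\<lambda>i\<in>{..<N}. x (p i))"
    "\<And>i. Suc i < N \<Longrightarrow> x (p i) \<le> x (p (Suc i))"
proof -
  obtain p where p: "p permutes {..<length (map x [0..<N])}" "permute_list p (map x [0..<N]) = sort (map x [0..<N])"
    by (rule mset_eq_permutation[of "sort (map x [0..<N])" "map x [0..<N]"]) auto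
  have pN: "p permutes {..<N}" using p(1) by simp
  have nth: "sort (map x [0..<N]) ! i = x (p i)" if "i < N" for i
  proof -
    have "p i < N" using permutes_in_image[OF pN, of i] that by simp
    then show ?thesis unfolding p(2)[symmetric] using permute_list_nth[OF p(1), of i] that by simp
  qed
  show ?thesis
  proof (rule that[OF pN])
    show "sorted_sample N x = (\<lambda>i\<in>{..<N}. x (p i))"
      by (auto simp: sorted_sample_def order_stat_def nth)
    fix i assume i: "Suc i < N"
    have "sort (map x [0..<N]) ! i \<le> sort (map x [0..<N]) ! Suc i"
      using i by (intro sorted_nth_mono) auto
    then show "x (p i) \<le> x (p (Suc i))" using i by (simp add: nth)
  qed
qed

text \<open>With ties several permutations sort x, but all of them produce the same vector, since a
  sorted list is determined by its multiset.\<close>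

lemma sorted_sample_eqI:
  assumes p: "p permutes {..<N}" and le: "\<And>i. Suc i < N \<Longrightarrow> x (p i) \<le> x (p (Suc i))"
  shows "sorted_sample N x = (\<lambda>i\<in>{..<N}. x (p i))"
proof -
  let ?l = "permute_list p (map x [0..<N])"
  have p': "p permutes {..<length (map x [0..<N])}" using p by simp
  have nth: "?l ! i = x (p i)" if "i < N" for i
    using permute_list_nth[OF p', of i] permutes_in_image[OF p, of i] that by simp
  have "sorted ?l" unfolding sorted_iff_nth_Suc using le by (simp add: nth)
  then have "sort (map x [0..<N]) = ?l"
    using p' by (intro properties_for_sort) simp_all
  then show ?thesis by (auto simp: sorted_sample_def order_stat_def nth)
qed

lemma measurable_permuted: "p permutes {..<N} \<Longrightarrow>
    (\<lambda>x. \<lambda>i\<in>{..<N}. x (p i) :: real) \<in> Pi\<^sub>M {..<N} (\<lambda>_. borel) \<rightarrow>\<^sub>M Pi\<^sub>M {..<N} (\<lambda>_. borel)"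
  by (intro measurable_restrict measurable_component_singleton) (auto simp: permutes_in_image[of p "{..<N}"] simp del: lessThan_iff)

definition monotone_vectors :: "nat \<Rightarrow> (nat \<Rightarrow> real) set" where
  "monotone_vectors N = {x. \<forall>i. Suc i < N \<longrightarrow> x i \<le> x (Suc i)}"

lemma monotone_vectors_sets: "monotone_vectors N \<inter> space (Pi\<^sub>M {..<N} (\<lambda>_. borel)) \<in> sets (Pi\<^sub>M {..<N} (\<lambda>_. borel))"
proof -
  have "Measurable.pred (Pi\<^sub>M {..<N} (\<lambda>_. borel)) (\<lambda>x. \<forall>i\<in>{i. Suc i < N}. x i \<le> (x (Suc i) :: real))"
  proof (rule pred_intros_finite)
    show "finite {i. Suc i < N}" by (rule finite_subset[of _ "{..<N}"]) auto
  qed (unfold pred_def, rule borel_measurable_le; rule measurable_component_singleton; simp)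
  moreover have "monotone_vectors N \<inter> space (Pi\<^sub>M {..<N} (\<lambda>_. borel))
      = {x \<in> space (Pi\<^sub>M {..<N} (\<lambda>_. borel)). \<forall>i\<in>{i. Suc i < N}. x i \<le> x (Suc i)}"
    by (auto simp: monotone_vectors_def)
  ultimately show ?thesis unfolding pred_def by (simp only:)
qed

text \<open>The preimage is a finite union over permutations: on the set where a given permutation
  puts the sample in order, sorting is that permutation of the coordinates.\<close>

lemma measurable_sorted_sample: "sorted_sample N \<in> Pi\<^sub>M {..<N} (\<lambda>_. borel) \<rightarrow>\<^sub>M Pi\<^sub>M {..<N} (\<lambda>_. borel)"
proof (rule measurableI)
  let ?M = "Pi\<^sub>M {..<N} (\<lambda>_. borel :: real measure)"
  show "sorted_sample N x \<in> space ?M" for x by (auto simp: space_PiM sorted_sample_def)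
  fix B assume B: "B \<in> sets ?M"
  have "sorted_sample N -` B \<inter> space ?M = (\<Union>p\<in>{p. p permutes {..<N}}. (\<lambda>x. \<lambda>i\<in>{..<N}. x (p i)) -` (B \<inter> (monotone_vectors N \<inter> space ?M)) \<inter> space ?M)"
  proof (intro set_eqI iffI)
    fix x assume x: "x \<in> sorted_sample N -` B \<inter> space ?M"
    obtain p where p: "p permutes {..<N}" "sorted_sample N x = (\<lambda>i\<in>{..<N}. x (p i))"
      "\<And>i. Suc i < N \<Longrightarrow> x (p i) \<le> x (p (Suc i))" by (rule sorted_sample_permutation[of N x]) blast
    have "(\<lambda>i\<in>{..<N}. x (p i)) \<in> monotone_vectors N \<inter> space ?M"
      using p(3) by (auto simp: monotone_vectors_def space_PiM)
    then show "x \<in> (\<Union>p\<in>{p. p permutes {..<N}}. (\<lambda>x. \<lambda>i\<in>{..<N}. x (p i)) -` (B \<inter> (monotone_vectors N \<inter> space ?M)) \<inter> space ?M)"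
      using x p(1,2) by auto
  next
    fix x assume "x \<in> (\<Union>p\<in>{p. p permutes {..<N}}. (\<lambda>x. \<lambda>i\<in>{..<N}. x (p i)) -` (B \<inter> (monotone_vectors N \<inter> space ?M)) \<inter> space ?M)"
    then obtain p where p: "p permutes {..<N}" and x: "x \<in> space ?M" "(\<lambda>i\<in>{..<N}. x (p i)) \<in> B" "(\<lambda>i\<in>{..<N}. x (p i)) \<in> monotone_vectors N"
      by blast
    have "x (p i) \<le> x (p (Suc i))" if "Suc i < N" for i
      using x(3) that by (auto simp: monotone_vectors_def)
    then show "x \<in> sorted_sample N -` B \<inter> space ?M"
      using sorted_sample_eqI[OF p, of x] x by simp
  qed
  also have "\<dots> \<in> sets ?M"
    using B monotone_vectors_sets by (intro sets.finite_UN finite_permutations measurable_sets[OF measurable_permuted]) auto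
  finally show "sorted_sample N -` B \<inter> space ?M \<in> sets ?M" .
qed

text \<open>The inequality for the complement of B is the reverse inequality for B, as both total
  masses are 1.\<close>

lemma prob_space_eqI_le:
  assumes "prob_space M" "prob_space M'" "sets M = sets M'"
    and le: "\<And>B. B \<in> sets M \<Longrightarrow> emeasure M B \<le> emeasure M' B"
  shows "M = M'"
proof (rule measure_eqI[OF assms(3)])
  interpret M: prob_space M by fact
  interpret M': prob_space M' by fact
  fix B assume B: "B \<in> sets M"
  then have "M.prob (space M - B) \<le> M'.prob (space M - B)" "M.prob B \<le> M'.prob B"
    using le by (auto simp: M.emeasure_eq_measure M'.emeasure_eq_measure)
  moreover have "space M = space M'" using assms(3) by (rule sets_eq_imp_space_eq)
  moreover have "M.prob (space M - B) = 1 - M.prob B" "M'.prob (space M' - B) = 1 - M'.prob B"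
    using B assms(3) by (auto intro: M.prob_compl M'.prob_compl)
  ultimately have "M.prob B = M'.prob B" by simp
  then show "emeasure M B = emeasure M' B" by (simp add: M.emeasure_eq_measure M'.emeasure_eq_measure)
qed

text \<open>Both sides are probability measures, so it suffices to bound the left-hand side by the right-hand
  side. This makes ties among the sample points harmless.\<close>

lemma distr_sorted_sample:
  "distr (Pi\<^sub>M {..<N} (\<lambda>_. uniform_law)) (Pi\<^sub>M {..<N} (\<lambda>_. borel)) (sorted_sample N)
    = distr (Pi\<^sub>M {..<Suc N} (\<lambda>_. exp_law)) (Pi\<^sub>M {..<N} (\<lambda>_. borel)) (\<lambda>w. \<lambda>i\<in>{..<N}. (\<Sum>j\<le>i. w j) / (\<Sum>j\<le>N. w j))"
    (is "?L = ?R")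
proof -
  let ?M = "Pi\<^sub>M {..<N} (\<lambda>_. borel :: real measure)"
  let ?U = "Pi\<^sub>M {..<N} (\<lambda>_. uniform_law)"
  interpret U: prob_space ?U by (intro prob_space_PiM prob_space_uniform_law)
  interpret E: prob_space "Pi\<^sub>M {..<Suc N} (\<lambda>_. exp_law)" by (intro prob_space_PiM prob_space_exp_law)
  have mS: "sorted_sample N \<in> ?U \<rightarrow>\<^sub>M ?M"
    using measurable_sorted_sample by (simp cong: measurable_cong_sets sets_PiM_uniform_law)
  have "(\<lambda>w. \<lambda>i\<in>{..<N}. (\<Sum>j\<le>i. w j) / (\<Sum>j\<le>N. w j) :: real) \<in> Pi\<^sub>M {..<Suc N} (\<lambda>_. borel) \<rightarrow>\<^sub>M ?M"
    by (intro measurable_restrict borel_measurable_divide borel_measurable_sum measurable_component_singleton) auto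
  then have mR: "(\<lambda>w. \<lambda>i\<in>{..<N}. (\<Sum>j\<le>i. w j) / (\<Sum>j\<le>N. w j) :: real) \<in> Pi\<^sub>M {..<Suc N} (\<lambda>_. exp_law) \<rightarrow>\<^sub>M ?M"
    by (simp cong: measurable_cong_sets sets_PiM_exp_law)
  show ?thesis
  proof (rule prob_space_eqI_le)
    show "prob_space ?L" "prob_space ?R" using mS mR by (auto intro: U.prob_space_distr E.prob_space_distr)
    fix B assume "B \<in> sets ?L"
    then have B: "B \<in> sets ?M" by simp
    define C where "C = B \<inter> (monotone_vectors N \<inter> space ?M)"
    have C: "C \<in> sets ?M" unfolding C_def using B monotone_vectors_sets by auto
    have reindex: "(\<integral>\<^sup>+x. indicator C (\<lambda>i\<in>{..<N}. x (p i)) \<partial>?U) = emeasure ?U C" if p: "p permutes {..<N}" for p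
    proof -
      have mp: "(\<lambda>x. \<lambda>i\<in>{..<N}. x (p i)) \<in> ?U \<rightarrow>\<^sub>M ?U"
        using measurable_permuted[OF p] by (simp cong: measurable_cong_sets sets_PiM_uniform_law)
      have "distr ?U ?U (\<lambda>x. \<lambda>i\<in>{..<N}. x (p i)) = ?U"
        using p by (intro distr_PiM_reindex prob_space_uniform_law) (auto simp: permutes_in_image[of p "{..<N}"] permutes_inj_on simp del: lessThan_iff)
      then have "emeasure ?U C = (\<integral>\<^sup>+x. indicator C x \<partial>distr ?U ?U (\<lambda>x. \<lambda>i\<in>{..<N}. x (p i)))"
        using C by (simp cong: sets_PiM_uniform_law)
      also have "\<dots> = (\<integral>\<^sup>+x. indicator C (\<lambda>i\<in>{..<N}. x (p i)) \<partial>?U)"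
        using C by (intro nn_integral_distr mp) (auto cong: sets_PiM_uniform_law measurable_cong_sets)
      finally show ?thesis by simp
    qed
    have "emeasure ?L B = (\<integral>\<^sup>+x. indicator B (sorted_sample N x) \<partial>?U)"
      using B mS by (simp add: nn_integral_distr flip: nn_integral_indicator)
    \<comment> \<open>Some permutation sorts x and its term alone equals the left side; ties make
      further terms positive, so only an inequality holds pointwise.\<close>
    also have "\<dots> \<le> (\<integral>\<^sup>+x. (\<Sum>p | p permutes {..<N}. indicator C (\<lambda>i\<in>{..<N}. x (p i))) \<partial>?U)"
    proof (rule nn_integral_mono)
      fix x
      obtain p where p: "p permutes {..<N}" "sorted_sample N x = (\<lambda>i\<in>{..<N}. x (p i))"
        "\<And>i. Suc i < N \<Longrightarrow> x (p i) \<le> x (p (Suc i))" by (rule sorted_sample_permutation[of N x]) blast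
      have "(\<lambda>i\<in>{..<N}. x (p i)) \<in> monotone_vectors N \<inter> space ?M"
        using p(3) by (auto simp: monotone_vectors_def space_PiM)
      then have "indicator B (sorted_sample N x) = (indicator C (\<lambda>i\<in>{..<N}. x (p i)) :: ennreal)"
        using p(2) by (simp add: C_def indicator_def)
      also have "\<dots> \<le> (\<Sum>p | p permutes {..<N}. indicator C (\<lambda>i\<in>{..<N}. x (p i)))"
        using p(1) by (intro member_le_sum) (auto intro: finite_permutations)
      finally show "indicator B (sorted_sample N x) \<le> \<dots>" .
    qed
    also have "\<dots> = (\<Sum>p | p permutes {..<N}. \<integral>\<^sup>+x. indicator C (\<lambda>i\<in>{..<N}. x (p i)) \<partial>?U)"
    proof (rule nn_integral_sum)
      fix p assume "p \<in> {p. p permutes {..<N}}"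
      then have "(\<lambda>x. indicator C (\<lambda>i\<in>{..<N}. x (p i)) :: ennreal) \<in> borel_measurable ?M"
        using measurable_compose[OF measurable_permuted[of p N] borel_measurable_indicator[OF C]] by simp
      then show "(\<lambda>x. indicator C (\<lambda>i\<in>{..<N}. x (p i)) :: ennreal) \<in> borel_measurable ?U"
        by (simp cong: measurable_cong_sets sets_PiM_uniform_law)
    qed
    \<comment> \<open>The uniform product law is invariant under all N! permutations of the
      coordinates.\<close>
    also have "\<dots> = fact N * emeasure ?U C"
    proof -
      have "(\<Sum>p | p permutes {..<N}. \<integral>\<^sup>+x. indicator C (\<lambda>i\<in>{..<N}. x (p i)) \<partial>?U) = (\<Sum>p | p permutes {..<N}. emeasure ?U C)"
        by (rule sum.cong) (use reindex in auto)
      then show ?thesis using card_permutations[of "{..<N}" N] by simp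
    qed
    also have "\<dots> = fact N * (\<integral>\<^sup>+u. indicator C u * (\<Prod>i<N. indicator {0..1} (u i)) \<partial>Pi\<^sub>M {..<N} (\<lambda>_. lborel))"
      using nn_integral_uniform_power[OF borel_measurable_indicator[OF C]] C
      by (simp cong: sets_PiM_uniform_law)
    also have "\<dots> \<le> fact N * (\<integral>\<^sup>+u. indicator B u * indicator {u \<in> increasing_vectors N. left_neighbour u N \<le> 1} u \<partial>Pi\<^sub>M {..<N} (\<lambda>_. lborel))"
    proof (intro mult_left_mono nn_integral_mono)
      fix u
      show "indicator C u * (\<Prod>i<N. indicator {0..1} (u i))
        \<le> (indicator B u * indicator {u \<in> increasing_vectors N. left_neighbour u N \<le> 1} u :: ennreal)"
      proof (cases "u \<in> C \<and> (\<forall>i<N. u i \<in> {0..1})")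
        case True
        have "left_neighbour u i \<le> u i" if "i < N" for i
          using True that by (cases i) (auto simp: C_def left_neighbour_def monotone_vectors_def)
        moreover have "left_neighbour u N \<le> 1"
          using True by (cases N) (auto simp: left_neighbour_def)
        ultimately show ?thesis using True by (simp add: increasing_vectors_def C_def)
      next
        case False
        then have "indicator C u * (\<Prod>i<N. indicator {0..1} (u i)) = (0 :: ennreal)"
          by (auto simp: indicator_def prod_zero_iff)
        then show ?thesis by (rule ord_eq_le_trans) simp
      qed
    qed simp
    also have "\<dots> = (\<integral>\<^sup>+w. indicator B (\<lambda>i\<in>{..<N}. (\<Sum>j\<le>i. w j) / (\<Sum>j\<le>N. w j)) \<partial>Pi\<^sub>M {..<Suc N} (\<lambda>_. exp_law))"
      using B by (intro nn_integral_normalized_partial_sums[symmetric]) auto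
    also have "\<dots> = emeasure ?R B"
      using B mR by (simp add: nn_integral_distr flip: nn_integral_indicator)
    finally show "emeasure ?L B \<le> emeasure ?R B" .
  qed simp
qed

section \<open>Spacings on the circle\<close>

text \<open>The spacing as a function of the ordered points alone, with the periodic continuation
  resolved for at most one turn.\<close>

definition cyclic_spacing :: "nat \<Rightarrow> nat \<Rightarrow> (nat \<Rightarrow> real) \<Rightarrow> nat \<Rightarrow> real" where
  "cyclic_spacing n m u k =
     (if k + m < n then left_neighbour u (k + m) else 1 + left_neighbour u (k + m - n)) - left_neighbour u k"

lemma spacing_eq_cyclic_spacing:
  assumes "k < n" "m \<le> n"
  shows "spacing n m x k = cyclic_spacing n m (sorted_sample (n - 1) x) k"
proof -
  have *: "spacing_point n x j = left_neighbour (sorted_sample (n - 1) x) j" if "j < n" for j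
    using that by (cases j) (auto simp: spacing_point.simps left_neighbour_def sorted_sample_def)
  show ?thesis
  proof (cases "k + m < n")
    case True
    then show ?thesis using assms by (simp add: spacing_def cyclic_spacing_def *)
  next
    case False
    then have "spacing_point n x (k + m) = 1 + spacing_point n x (k + m - n)"
      using assms by (subst spacing_point.simps) auto
    then show ?thesis using False assms by (simp add: spacing_def cyclic_spacing_def *)
  qed
qed

text \<open>The j-th point is the sum of the first j variables over their total T. When k + m passes
  n, the extra 1 of the continuation is one full turn T/T, so the spacing is again a cyclic window
  sum over T.\<close>

lemma cyclic_spacing_normalized:
  fixes w :: "nat \<Rightarrow> real"
  assumes k: "k < n" and m: "m \<le> n" and T: "(\<Sum>i<n. w i) \<noteq> 0"
  shows "cyclic_spacing n m (\<lambda>i\<in>{..<n - 1}. (\<Sum>j\<le>i. w j) / (\<Sum>j\<le>n - 1. w j)) k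
    = (\<Sum>j<m. w ((k + j) mod n)) / (\<Sum>i<n. w i)"
proof -
  define u where "u = (\<lambda>i\<in>{..<n - 1}. (\<Sum>j\<le>i. w j) / (\<Sum>j\<le>n - 1. w j))"
  let ?f = "\<lambda>i. w (i mod n)"
  have total: "(\<Sum>j\<le>n - 1. w j) = (\<Sum>i<n. w i)"
    using k by (intro sum.cong) auto
  have u: "left_neighbour u j = (\<Sum>i<j. ?f i) / (\<Sum>i<n. w i)" if "j < n" for j
  proof (cases j)
    case (Suc i)
    have "(\<Sum>i\<le>i. w i) = (\<Sum>i<j. ?f i)"
      using that Suc by (intro sum.cong) auto
    moreover have "i < n - 1" using that Suc by simp
    ultimately show ?thesis using Suc total by (simp add: left_neighbour_def u_def)
  qed (simp add: left_neighbour_def)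
  have split: "(\<Sum>i<a + b. ?f i) = (\<Sum>i<a. ?f i) + (\<Sum>j<b. ?f (a + j))" for a b
    by (induction b) (simp_all add: add.assoc)
  have "cyclic_spacing n m u k = (\<Sum>j<m. ?f (k + j)) / (\<Sum>i<n. w i)"
  proof (cases "k + m < n")
    case True
    then show ?thesis using k split[of k m] by (simp add: cyclic_spacing_def u diff_divide_distrib[symmetric])
  next
    case False
    define l where "l = k + m - n"
    have l: "l < n" "k + m = n + l" using False m k by (auto simp: l_def)
    have "(\<Sum>i<n. ?f i) = (\<Sum>i<n. w i)" by (intro sum.cong) auto
    moreover have "(\<Sum>j<l. ?f (n + j)) = (\<Sum>j<l. ?f j)" by (intro sum.cong) auto
    ultimately have "(\<Sum>i<k. ?f i) + (\<Sum>j<m. ?f (k + j)) = (\<Sum>i<n. w i) + (\<Sum>j<l. ?f j)"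
      using split[of k m] split[of n l] unfolding l(2) by simp
    then have "(\<Sum>j<m. ?f (k + j)) / (\<Sum>i<n. w i) = ((\<Sum>i<n. w i) + (\<Sum>j<l. ?f j) - (\<Sum>i<k. ?f i)) / (\<Sum>i<n. w i)"
      by (simp add: algebra_simps)
    then show ?thesis using False k l T
      by (simp add: cyclic_spacing_def u add_divide_distrib diff_divide_distrib l_def[symmetric])
  qed
  then show ?thesis unfolding u_def .
qed

lemma measurable_cyclic_spacing:
  assumes "k < n" "m \<le> n"
  shows "(\<lambda>u. cyclic_spacing n m u k) \<in> borel_measurable (Pi\<^sub>M {..<n - 1} (\<lambda>_. borel))"
proof -
  have [measurable]: "(\<lambda>u. left_neighbour u j) \<in> borel_measurable (Pi\<^sub>M {..<n - 1} (\<lambda>_. borel))" if "j < n" for j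
    using that by (intro measurable_left_neighbour) auto
  show ?thesis using assms
    unfolding cyclic_spacing_def by (cases "k + m < n") (auto intro!: borel_measurable_diff borel_measurable_add measurable_left_neighbour)
qed

text \<open>The statistic \<Psi> is arbitrary, so one transfer covers all three. The condition n >=
  2 makes the sample nonempty, and m <= n limits the continuation to one turn.\<close>

lemma distr_spacings:
  fixes \<Psi> :: "(nat \<Rightarrow> real) \<Rightarrow> real"
  assumes sample: "uniform_sample P (n - 1) X" and n: "n \<ge> 2" "m \<le> n"
    and \<Psi>: "\<Psi> \<in> borel_measurable (Pi\<^sub>M {..<n} (\<lambda>_. borel))"
  shows "distr P borel (\<lambda>\<omega>. \<Psi> (\<lambda>k\<in>{..<n}. spacing n m (\<lambda>i. X i \<omega>) k))
    = distr exp_seq borel (\<lambda>\<omega>. \<Psi> (\<lambda>k\<in>{..<n}. (\<Sum>j<m. \<omega> ((k + j) mod n)) / (\<Sum>i<n. \<omega> i)))"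
proof -
  define N where "N = n - 1"
  have N: "N \<ge> 1" "Suc N = n" "n - 1 = N" using n by (auto simp: N_def)
  let ?M = "Pi\<^sub>M {..<N} (\<lambda>_. borel :: real measure)"
  interpret P: prob_space P using sample by (simp add: uniform_sample_def)
  have indep: "P.indep_vars (\<lambda>_. borel) X {..<N}" using sample unfolding N(3) by (simp add: uniform_sample_def)
  then have X: "X i \<in> borel_measurable P" if "i < N" for i using that by (auto simp: P.indep_vars_def)
  have mX: "(\<lambda>\<omega>. \<lambda>i\<in>{..<N}. X i \<omega>) \<in> P \<rightarrow>\<^sub>M ?M" using X by (intro measurable_restrict) auto
  have "distr P ?M (\<lambda>\<omega>. \<lambda>i\<in>{..<N}. X i \<omega>) = Pi\<^sub>M {..<N} (\<lambda>i. distr P borel (X i))"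
    using P.indep_vars_iff_distr_eq_PiM'[where I = "{..<N}" and M' = "\<lambda>_. borel" and X = X] N(1) X indep by (auto simp: lessThan_empty_iff)
  also have "\<dots> = Pi\<^sub>M {..<N} (\<lambda>_. uniform_law)"
    using sample unfolding N(3) by (intro PiM_cong) (auto simp: uniform_sample_def uniform_law_def)
  finally have dX: "distr P ?M (\<lambda>\<omega>. \<lambda>i\<in>{..<N}. X i \<omega>) = Pi\<^sub>M {..<N} (\<lambda>_. uniform_law)" .
  define \<Phi> where "\<Phi> = (\<lambda>u. \<Psi> (\<lambda>k\<in>{..<n}. cyclic_spacing n m u k))"
  have \<Phi>: "\<Phi> \<in> borel_measurable ?M"
    unfolding \<Phi>_def using n measurable_cyclic_spacing[of _ n m] N
    by (intro measurable_compose[OF measurable_restrict \<Psi>]) auto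
  have ss: "sorted_sample N (\<lambda>i\<in>{..<N}. x i) = sorted_sample N x" for x :: "nat \<Rightarrow> real"
    unfolding sorted_sample_def order_stat_def
    by (intro restrict_ext arg_cong2[where f = "(!)"] arg_cong[where f = sort] map_cong refl) auto
  have spacings: "\<Psi> (\<lambda>k\<in>{..<n}. spacing n m x k) = \<Phi> (sorted_sample N (\<lambda>i\<in>{..<N}. x i))" for x
    using spacing_eq_cyclic_spacing[of _ n m x] n(2) unfolding \<Phi>_def ss N(3)
    by (intro arg_cong[where f = \<Psi>] restrict_ext) auto
  let ?E = "Pi\<^sub>M {..<n} (\<lambda>_. exp_law)"
  define R where "R = (\<lambda>w. \<lambda>i\<in>{..<N}. (\<Sum>j\<le>i. w j) / (\<Sum>j\<le>N. w j) :: real)"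
  have R0: "R \<in> Pi\<^sub>M {..<n} (\<lambda>_. borel) \<rightarrow>\<^sub>M ?M"
    unfolding R_def N(2)[symmetric]
    by (intro measurable_restrict borel_measurable_divide borel_measurable_sum measurable_component_singleton) auto
  then have R: "R \<in> ?E \<rightarrow>\<^sub>M ?M" by (simp cong: measurable_cong_sets sets_PiM_exp_law)
  have res: "(\<lambda>\<omega>. \<lambda>i\<in>{..<n}. \<omega> i) \<in> exp_seq \<rightarrow>\<^sub>M ?E"
    unfolding exp_seq_def by (intro measurable_restrict) auto
  have "distr exp_seq ?E (\<lambda>\<omega>. \<lambda>i\<in>{..<n}. \<omega> i) = ?E"
    unfolding exp_seq_def using distr_PiM_reindex[of UNIV "\<lambda>_. exp_law" "\<lambda>i. i" "{..<n}"] prob_space_exp_law by auto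
  then have dE: "?E = distr exp_seq ?E (\<lambda>\<omega>. \<lambda>i\<in>{..<n}. \<omega> i)" ..
  have "distr P borel (\<lambda>\<omega>. \<Psi> (\<lambda>k\<in>{..<n}. spacing n m (\<lambda>i. X i \<omega>) k))
    = distr P borel (\<lambda>\<omega>. \<Phi> (sorted_sample N (\<lambda>i\<in>{..<N}. X i \<omega>)))"
    unfolding spacings ..
  also have "\<dots> = distr (distr (distr P ?M (\<lambda>\<omega>. \<lambda>i\<in>{..<N}. X i \<omega>)) ?M (sorted_sample N)) borel \<Phi>"
    unfolding distr_distr[OF measurable_sorted_sample mX] distr_distr[OF \<Phi> measurable_comp[OF mX measurable_sorted_sample]]
    by (simp add: comp_def)
  also have "\<dots> = distr (distr ?E ?M R) borel \<Phi>"
    unfolding dX distr_sorted_sample R_def N(2) ..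
  also have "\<dots> = distr ?E borel (\<Phi> \<circ> R)"
    by (rule distr_distr[OF \<Phi> R])
  also have "\<dots> = distr exp_seq borel ((\<Phi> \<circ> R) \<circ> (\<lambda>\<omega>. \<lambda>i\<in>{..<n}. \<omega> i))"
    by (subst dE, rule distr_distr[OF measurable_comp[OF R \<Phi>] res])
  also have "\<dots> = distr exp_seq borel (\<lambda>\<omega>. \<Psi> (\<lambda>k\<in>{..<n}. (\<Sum>j<m. \<omega> ((k + j) mod n)) / (\<Sum>i<n. \<omega> i)))"
  \<comment> \<open>The identity of the spacings with normalised windows needs a nonzero total,
    which holds only almost surely.\<close>
  proof (rule distr_cong_AE)
    show "AE \<omega> in exp_seq. ((\<Phi> \<circ> R) \<circ> (\<lambda>\<omega>. \<lambda>i\<in>{..<n}. \<omega> i)) \<omega> = \<Psi> (\<lambda>k\<in>{..<n}. (\<Sum>j<m. \<omega> ((k + j) mod n)) / (\<Sum>i<n. \<omega> i))"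
      using AE_exp_seq_pos
    proof eventually_elim
      case (elim \<omega>)
      have "(\<Sum>i<n. \<omega> i) > 0" using elim n by (intro sum_pos) (auto simp: lessThan_empty_iff)
      then have T: "(\<Sum>i<n. \<omega> i) \<noteq> 0" by simp
      have "R (\<lambda>i\<in>{..<n}. \<omega> i) = (\<lambda>i\<in>{..<n - 1}. (\<Sum>j\<le>i. \<omega> j) / (\<Sum>j\<le>n - 1. \<omega> j))"
        unfolding R_def N(3) using N by (intro restrict_ext arg_cong2[where f = "(/)"] sum.cong) auto
      moreover have "(\<lambda>k\<in>{..<n}. cyclic_spacing n m (\<lambda>i\<in>{..<n - 1}. (\<Sum>j\<le>i. \<omega> j) / (\<Sum>j\<le>n - 1. \<omega> j)) k)
        = (\<lambda>k\<in>{..<n}. (\<Sum>j<m. \<omega> ((k + j) mod n)) / (\<Sum>i<n. \<omega> i))"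
        using n T by (intro restrict_ext cyclic_spacing_normalized) auto
      ultimately show ?case by (simp only: \<Phi>_def comp_def)
    qed
    show "(\<Phi> \<circ> R) \<circ> (\<lambda>\<omega>. \<lambda>i\<in>{..<n}. \<omega> i) \<in> borel_measurable exp_seq"
      by (rule measurable_comp[OF res measurable_comp[OF R \<Phi>]])
    show "(\<lambda>\<omega>. \<Psi> (\<lambda>k\<in>{..<n}. (\<Sum>j<m. \<omega> ((k + j) mod n)) / (\<Sum>i<n. \<omega> i))) \<in> borel_measurable exp_seq"
      by (intro measurable_compose[OF measurable_restrict \<Psi>] borel_measurable_divide borel_measurable_sum measurable_coord)
  qed simp_all
  finally show ?thesis .
qed

section \<open>Transfer to the spacings\<close>

definition coord_mean :: "nat \<Rightarrow> (nat \<Rightarrow> real) \<Rightarrow> real" where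
  "coord_mean n \<omega> = (\<Sum>i<n. \<omega> i) / real n"

lemma coord_mean_variance:
  assumes n: "n \<ge> 1"
  shows "integrable exp_seq (\<lambda>\<omega>. (coord_mean n \<omega> - 1)\<^sup>2)" "(\<integral>\<omega>. (coord_mean n \<omega> - 1)\<^sup>2 \<partial>exp_seq) = 1 / real n"
proof -
  have m: "(\<lambda>\<omega>. \<Sum>i<n. \<omega> i) \<in> borel_measurable exp_seq" by (intro borel_measurable_sum measurable_coord)
  have G: "has_bochner_integral (gamma_law n) (\<lambda>x. (x - real n)\<^sup>2 / (real n)\<^sup>2) (real n / (real n)\<^sup>2)"
    using gamma_law_central_moments(2)[OF n] by (rule has_bochner_integral_divide_zero)
  have "coord_mean n \<omega> - 1 = ((\<Sum>i<n. \<omega> i) - real n) / real n" for \<omega>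
    using n by (simp add: coord_mean_def diff_divide_distrib)
  then have *: "(\<lambda>\<omega>. (coord_mean n \<omega> - 1)\<^sup>2) = (\<lambda>\<omega>. ((\<Sum>i<n. \<omega> i) - real n)\<^sup>2 / (real n)\<^sup>2)"
    by (simp add: power_divide)
  have d: "distr exp_seq borel (\<lambda>\<omega>. \<Sum>i<n. \<omega> i) = gamma_law n"
    using distr_sum_coord[of "{..<n}"] by simp
  have f: "(\<lambda>x. (x - real n)\<^sup>2 / (real n)\<^sup>2) \<in> borel_measurable borel" by measurable
  show "integrable exp_seq (\<lambda>\<omega>. (coord_mean n \<omega> - 1)\<^sup>2)"
    unfolding * using integrable_distr_eq[OF m f] d G by (simp add: has_bochner_integral_iff)
  show "(\<integral>\<omega>. (coord_mean n \<omega> - 1)\<^sup>2 \<partial>exp_seq) = 1 / real n"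
    unfolding * using integral_distr[OF m f] d G n by (simp add: has_bochner_integral_iff power2_eq_square)
qed

text \<open>Away from an event of probability at most 4/n, by Chebyshev for the mean r of the
  coordinates, the assumed pathwise bound applies. Its first term is small because S/\<sigma> has
  variance 1 and r - 1 has variance 1/n; its second term has expectation B/n.\<close>

lemma (in centred) char_normalised_statistic:
  assumes n: "n \<ge> 1" "2 * m \<le> n" and V: "cyclic_variance h m > 0"
    and Z: "Z \<in> borel_measurable exp_seq" and B: "B \<ge> 0"
    and le: "AE \<omega> in exp_seq. \<bar>coord_mean n \<omega> - 1\<bar> \<le> 1 / 2 \<longrightarrow>
      \<bar>Z \<omega> - cyclic_sum h n m \<omega>\<bar> \<le> 6 * \<bar>cyclic_sum h n m \<omega>\<bar> * \<bar>coord_mean n \<omega> - 1\<bar> + B * (coord_mean n \<omega> - 1)\<^sup>2"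
  defines "\<sigma> \<equiv> sqrt (real n * cyclic_variance h m)"
  shows "cmod (char (distr exp_seq borel (\<lambda>\<omega>. Z \<omega> / \<sigma>)) t - char (distr exp_seq borel (\<lambda>\<omega>. cyclic_sum h n m \<omega> / \<sigma>)) t)
    \<le> \<bar>t\<bar> * (6 / sqrt (real n) + B / (\<sigma> * real n)) + 2 * (4 / real n)"
proof -
  let ?S = "cyclic_sum h n m"
  let ?R = "\<lambda>\<omega>. coord_mean n \<omega> - 1"
  have \<sigma>: "\<sigma> > 0" "\<sigma>\<^sup>2 = real n * cyclic_variance h m" using n V by (auto simp: \<sigma>_def)
  have Sm: "?S \<in> borel_measurable exp_seq"
    unfolding cyclic_sum_def by (intro borel_measurable_sum measurable_fun_sum h_meas)
  have S2: "integrable exp_seq (\<lambda>\<omega>. (?S \<omega>)\<^sup>2)" "(\<integral>\<omega>. (?S \<omega>)\<^sup>2 \<partial>exp_seq) = \<sigma>\<^sup>2"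
    using second_moment_subset(1)[of n "{..<n}"] second_moment[of n] n \<sigma> by (simp_all add: cyclic_sum_def)
  define q where "q = sqrt (real n)"
  have q: "q > 0" "real n = q\<^sup>2" using n by (auto simp: q_def)
  note R2 = coord_mean_variance[OF n(1)]
  \<comment> \<open>The product \<bar>S\<bar> \<bar>r - 1\<bar> / \<sigma> is split by the
    arithmetic-geometric mean with weight q = sqrt n, so that both squares have expectation
    1/q.\<close>
  define D where "D = (\<lambda>\<omega>. 3 * ((?S \<omega>)\<^sup>2 / (\<sigma>\<^sup>2 * q) + q * (?R \<omega>)\<^sup>2) + B / \<sigma> * (?R \<omega>)\<^sup>2)"
  have "cmod (char (distr exp_seq borel (\<lambda>\<omega>. Z \<omega> / \<sigma>)) t - char (distr exp_seq borel (\<lambda>\<omega>. ?S \<omega> / \<sigma>)) t)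
    \<le> \<bar>t\<bar> * (6 / q + B / (\<sigma> * real n)) + 2 * (4 / real n)"
  proof (rule exp_seq.char_diff_le_truncated)
    show "(\<lambda>\<omega>. Z \<omega> / \<sigma>) \<in> borel_measurable exp_seq" "(\<lambda>\<omega>. ?S \<omega> / \<sigma>) \<in> borel_measurable exp_seq"
      using Z Sm by auto
    show "integrable exp_seq D" unfolding D_def using S2(1) R2(1) by auto
    have "(\<integral>\<omega>. D \<omega> \<partial>exp_seq) = 3 * (\<sigma>\<^sup>2 / (\<sigma>\<^sup>2 * q) + q * (1 / real n)) + B / \<sigma> * (1 / real n)"
      unfolding D_def using S2 R2 by simp
    also have "\<dots> = 6 / q + B / (\<sigma> * real n)"
      using \<sigma>(1) q by (simp add: power2_eq_square)
    finally show "(\<integral>\<omega>. D \<omega> \<partial>exp_seq) \<le> 6 / q + B / (\<sigma> * real n)" by simp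
    show "integrable exp_seq (\<lambda>\<omega>. 4 * (?R \<omega>)\<^sup>2)" using R2 by auto
    show "(\<integral>\<omega>. 4 * (?R \<omega>)\<^sup>2 \<partial>exp_seq) \<le> 4 / real n" using R2 by simp
    show "AE \<omega> in exp_seq. 0 \<le> D \<omega> \<and> 0 \<le> 4 * (?R \<omega>)\<^sup>2 \<and> (\<bar>Z \<omega> / \<sigma> - ?S \<omega> / \<sigma>\<bar> \<le> D \<omega> \<or> 1 \<le> 4 * (?R \<omega>)\<^sup>2)"
      using le
    proof eventually_elim
      case (elim \<omega>)
      have "0 \<le> D \<omega>"
        unfolding D_def using \<sigma>(1) q(1) B by (intro add_nonneg_nonneg mult_nonneg_nonneg divide_nonneg_nonneg) auto
      moreover have "\<bar>Z \<omega> / \<sigma> - ?S \<omega> / \<sigma>\<bar> \<le> D \<omega>" if R: "\<bar>?R \<omega>\<bar> \<le> 1 / 2"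
      proof -
        define a where "a = \<bar>?S \<omega>\<bar> / \<sigma>"
        have "2 * (a * \<bar>?R \<omega>\<bar>) \<le> a\<^sup>2 / q + q * (?R \<omega>)\<^sup>2"
        proof -
          have "0 \<le> (a - q * \<bar>?R \<omega>\<bar>)\<^sup>2 / q" using q by simp
          also have "\<dots> = a\<^sup>2 / q + q * (?R \<omega>)\<^sup>2 - 2 * (a * \<bar>?R \<omega>\<bar>)"
            using q by (simp add: power2_diff power_mult_distrib add_divide_distrib diff_divide_distrib) (simp add: power2_eq_square)
          finally show ?thesis by simp
        qed
        moreover have "\<bar>Z \<omega> / \<sigma> - ?S \<omega> / \<sigma>\<bar> = \<bar>Z \<omega> - ?S \<omega>\<bar> / \<sigma>"
          using \<sigma> by (simp add: diff_divide_distrib[symmetric])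
        moreover have "\<bar>Z \<omega> - ?S \<omega>\<bar> / \<sigma> \<le> (6 * \<bar>?S \<omega>\<bar> * \<bar>?R \<omega>\<bar> + B * (?R \<omega>)\<^sup>2) / \<sigma>"
          using elim R \<sigma> by (intro divide_right_mono) auto
        moreover have "(6 * \<bar>?S \<omega>\<bar> * \<bar>?R \<omega>\<bar> + B * (?R \<omega>)\<^sup>2) / \<sigma> = 6 * (a * \<bar>?R \<omega>\<bar>) + B / \<sigma> * (?R \<omega>)\<^sup>2"
          by (simp add: a_def add_divide_distrib)
        moreover have "a\<^sup>2 / q = (?S \<omega>)\<^sup>2 / (\<sigma>\<^sup>2 * q)" by (simp add: a_def power_divide)
        ultimately show ?thesis unfolding D_def distrib_left by linarith
      qed
      moreover have "1 \<le> 4 * (?R \<omega>)\<^sup>2" if "\<not> \<bar>?R \<omega>\<bar> \<le> 1 / 2"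
      proof -
        have "(1 / 2)\<^sup>2 \<le> \<bar>?R \<omega>\<bar>\<^sup>2" using that by (intro power_mono) auto
        then show ?thesis by (simp add: power2_eq_square)
      qed
      ultimately show ?case by auto
    qed
  qed
  then show ?thesis by (simp only: q_def)
qed

text \<open>The quadratic error has expectation B m sqrt v, while the standard deviation is at least
  sqrt (c n m v). The quotient is of order sqrt (m/n), so m/n \<rightarrow> 0 makes Z and the kernel
  sum share their limit law.\<close>

lemma cyclic_statistic_clt:
  fixes h :: "nat \<Rightarrow> real \<Rightarrow> real" and m :: "nat \<Rightarrow> nat" and v :: "nat \<Rightarrow> real"
  assumes centred: "\<And>n. n \<ge> 1 \<Longrightarrow> centred (h n) (m n)"
    and lim: "(\<lambda>n. real (m n) / real n) \<longlonglongrightarrow> 0"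
    and v: "\<And>n. n \<ge> 1 \<Longrightarrow> v n > 0"
    and h4: "\<And>n. n \<ge> 1 \<Longrightarrow> (\<integral>x. h n x ^ 4 \<partial>gamma_law (m n)) \<le> C * (v n)\<^sup>2"
    and var: "\<And>n. n \<ge> 1 \<Longrightarrow> cyclic_variance (h n) (m n) \<ge> c * real (m n) * v n" and c: "c > 0"
    and Z: "\<And>n. Z n \<in> borel_measurable exp_seq" and B: "B \<ge> 0"
    and le: "\<And>n. n \<ge> 1 \<Longrightarrow> m n \<le> n \<Longrightarrow> AE \<omega> in exp_seq. \<bar>coord_mean n \<omega> - 1\<bar> \<le> 1 / 2 \<longrightarrow>
      \<bar>Z n \<omega> - cyclic_sum (h n) n (m n) \<omega>\<bar> \<le> 6 * \<bar>cyclic_sum (h n) n (m n) \<omega>\<bar> * \<bar>coord_mean n \<omega> - 1\<bar>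
        + B * real n * real (m n) * sqrt (v n) * (coord_mean n \<omega> - 1)\<^sup>2"
  shows "(\<lambda>n. char (distr exp_seq borel (\<lambda>\<omega>. Z n \<omega> / sqrt (real n * cyclic_variance (h n) (m n)))) t)
    \<longlonglongrightarrow> complex_of_real (exp (- (t\<^sup>2 / 2)))"
proof -
  define \<sigma> where "\<sigma> = (\<lambda>n. sqrt (real n * cyclic_variance (h n) (m n)))"
  define \<phi> where "\<phi> = (\<lambda>n. char (distr exp_seq borel (\<lambda>\<omega>. Z n \<omega> / \<sigma> n)) t)"
  define \<psi> where "\<psi> = (\<lambda>n. char (distr exp_seq borel (\<lambda>\<omega>. cyclic_sum (h n) n (m n) \<omega> / \<sigma> n)) t)"
  have \<psi>: "\<psi> \<longlonglongrightarrow> complex_of_real (exp (- (t\<^sup>2 / 2)))"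
    unfolding \<psi>_def \<sigma>_def by (rule cyclic_clt[OF centred lim v h4 var c])
  have ev: "\<forall>\<^sub>F n in sequentially. n \<ge> 1 \<and> 2 * m n \<le> n"
  proof -
    have "\<forall>\<^sub>F n in sequentially. real (m n) / real n < 1 / 2" by (rule order_tendstoD(2)[OF lim]) simp
    then show ?thesis using eventually_ge_at_top[of 1]
    proof eventually_elim
      case (elim n)
      then have "2 * real (m n) < real n" by (simp add: field_simps)
      then show ?case using elim by linarith
    qed
  qed
  define e where "e = (\<lambda>n. \<bar>t\<bar> * (6 / sqrt (real n) + B / sqrt c * sqrt (real (m n) / real n)) + 2 * (4 / real n))"
  have "(\<lambda>n. \<phi> n - \<psi> n) \<longlonglongrightarrow> 0"
  proof (rule Lim_null_comparison)
    show "\<forall>\<^sub>F n in sequentially. norm (\<phi> n - \<psi> n) \<le> e n"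
      using ev
    proof eventually_elim
      case (elim n)
      interpret centred "h n" "m n" using centred elim by simp
      have pos: "real n > 0" "real (m n) > 0" "v n > 0" using elim m_pos v by auto
      then have "0 < c * real (m n) * v n" using c by simp
      then have V: "cyclic_variance (h n) (m n) > 0" using var[of n] elim by linarith
      define b where "b = B * real n * real (m n) * sqrt (v n)"
      have b: "b \<ge> 0" unfolding b_def using B pos by simp
      have "norm (\<phi> n - \<psi> n) \<le> \<bar>t\<bar> * (6 / sqrt (real n) + b / (\<sigma> n * real n)) + 2 * (4 / real n)"
        unfolding \<phi>_def \<psi>_def \<sigma>_def
        by (rule char_normalised_statistic) (use elim V Z b le in \<open>auto simp: b_def\<close>)
      moreover have "b / (\<sigma> n * real n) \<le> B / sqrt c * sqrt (real (m n) / real n)"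
      proof -
        have "sqrt (real n * (c * real (m n) * v n)) \<le> \<sigma> n"
          unfolding \<sigma>_def using var[of n] elim by (intro real_sqrt_le_mono mult_left_mono) auto
        then have "b / (\<sigma> n * real n) \<le> b / (sqrt (real n * (c * real (m n) * v n)) * real n)"
          using b pos c V by (intro divide_left_mono mult_right_mono mult_pos_pos) (auto simp: \<sigma>_def)
        also have "\<dots> = B * (real (m n) / sqrt (real (m n))) / (sqrt c * sqrt (real n))"
          using pos by (simp add: b_def real_sqrt_mult)
        also have "\<dots> = B / sqrt c * sqrt (real (m n) / real n)"
          using pos by (simp add: real_div_sqrt real_sqrt_divide)
        finally show ?thesis .
      qed
      ultimately show ?case unfolding e_def
        by (smt (verit) mult_left_mono abs_ge_zero)
    qed
    have "(\<lambda>n. sqrt (real (m n) / real n)) \<longlonglongrightarrow> 0" using tendsto_real_sqrt[OF lim] by simp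
    moreover have "(\<lambda>n. 6 / sqrt (real n)) \<longlonglongrightarrow> 0" "(\<lambda>n. 4 / real n) \<longlonglongrightarrow> 0" by real_asymp+
    ultimately have "e \<longlonglongrightarrow> \<bar>t\<bar> * (0 + B / sqrt c * 0) + 2 * 0"
      unfolding e_def by (intro tendsto_intros)
    then show "e \<longlonglongrightarrow> 0" by simp
  qed
  from tendsto_add[OF this \<psi>] show ?thesis unfolding \<phi>_def \<sigma>_def by simp
qed

text \<open>Levy's theorem wants a probability law for every index. Finitely many laws may be
  arbitrary here, so they are replaced by the normal law itself.\<close>

lemma weak_conv_std_normalI:
  assumes "eventually (\<lambda>n. real_distribution (M n)) sequentially"
    and ch: "\<And>t. (\<lambda>n. char (M n) t) \<longlonglongrightarrow> complex_of_real (exp (- (t\<^sup>2 / 2)))"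
  shows "weak_conv_m M std_normal_distribution"
proof -
  define M' where "M' = (\<lambda>n. if real_distribution (M n) then M n else std_normal_distribution)"
  have ev: "eventually (\<lambda>n. M n = M' n) sequentially"
    using assms(1) by eventually_elim (simp add: M'_def)
  have N: "real_distribution std_normal_distribution" by (rule real_dist_normal_dist)
  have "weak_conv_m M' std_normal_distribution"
  proof (rule levy_continuity)
    show "real_distribution (M' n)" for n using N by (simp add: M'_def)
    fix t
    have "(\<lambda>n. char (M' n) t) \<longlonglongrightarrow> complex_of_real (exp (- (t\<^sup>2 / 2)))"
      by (rule Lim_transform_eventually[OF ch]) (use ev in \<open>auto elim: eventually_mono\<close>)
    then show "(\<lambda>n. char (M' n) t) \<longlonglongrightarrow> char std_normal_distribution t"
      by (simp add: char_std_normal_distribution)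
  qed (rule N)
  then have *: "isCont (cdf std_normal_distribution) x \<Longrightarrow> (\<lambda>n. cdf (M' n) x) \<longlonglongrightarrow> cdf std_normal_distribution x" for x
    by (simp add: weak_conv_m_def weak_conv_def)
  have ev': "eventually (\<lambda>n. cdf (M' n) x = cdf (M n) x) sequentially" for x
    using ev by eventually_elim simp
  show ?thesis
    unfolding weak_conv_m_def weak_conv_def using Lim_transform_eventually[OF * ev'] by blast
qed

lemma sum_over_cyc:
  assumes "m \<le> n"
  shows "(\<Sum>k<n. sum \<omega> (cyc n m k)) = real m * (\<Sum>i<n. \<omega> i :: real)"
proof -
  have "bij_betw (\<lambda>k. (j + k) mod n) {..<n} {..<n}" for j
    unfolding bij_betw_def using inj_on_cyclic_shift[of j n]
    by (intro conjI endo_inj_surj) auto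
  then have "(\<Sum>k<n. \<omega> ((j + k) mod n)) = (\<Sum>i<n. \<omega> i)" for j
    by (rule sum.reindex_bij_betw)
  then have "(\<Sum>j<m. \<Sum>k<n. \<omega> ((k + j) mod n)) = real m * (\<Sum>i<n. \<omega> i)"
    by (simp add: add.commute)
  then show ?thesis using assms by (simp add: sum_cyc sum.swap[of _ "{..<n}"])
qed

text \<open>The assumption \<open>le\<close> is a deterministic inequality for positive numbers with
  prescribed total n m r. It is the only place where the shape of g is compared with that of the
  kernel, so each statistic needs just one calculus estimate besides its moments.\<close>

lemma spacing_statistic_clt:
  fixes P :: "nat \<Rightarrow> 'a measure" and X :: "nat \<Rightarrow> nat \<Rightarrow> 'a \<Rightarrow> real" and m :: "nat \<Rightarrow> nat"
    and h :: "nat \<Rightarrow> real \<Rightarrow> real" and g :: "real \<Rightarrow> real" and v a V :: "nat \<Rightarrow> real"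
  assumes sample: "\<And>n. n \<ge> 1 \<Longrightarrow> uniform_sample (P n) (n - 1) (X n)"
    and g [measurable]: "g \<in> borel_measurable borel"
    and centred: "\<And>n. n \<ge> 1 \<Longrightarrow> centred (h n) (m n)"
    and lim: "(\<lambda>n. real (m n) / real n) \<longlonglongrightarrow> 0"
    and v: "\<And>n. n \<ge> 1 \<Longrightarrow> v n > 0"
    and h4: "\<And>n. n \<ge> 1 \<Longrightarrow> (\<integral>x. h n x ^ 4 \<partial>gamma_law (m n)) \<le> C * (v n)\<^sup>2"
    and V: "\<And>n. n \<ge> 1 \<Longrightarrow> cyclic_variance (h n) (m n) = V n"
    and var: "\<And>n. n \<ge> 1 \<Longrightarrow> cyclic_variance (h n) (m n) \<ge> c * real (m n) * v n" and c: "c > 0" and B: "B \<ge> 0"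
    and le: "\<And>n S r. n \<ge> 1 \<Longrightarrow> (\<And>k. k < n \<Longrightarrow> S k > 0) \<Longrightarrow> (\<Sum>k<n. S k) = real n * real (m n) * r \<Longrightarrow> r > 0 \<Longrightarrow> \<bar>r - 1\<bar> \<le> 1 / 2 \<Longrightarrow>
      \<bar>(\<Sum>k<n. g (S k / r)) - a n - (\<Sum>k<n. h n (S k))\<bar>
        \<le> 6 * \<bar>\<Sum>k<n. h n (S k)\<bar> * \<bar>r - 1\<bar> + B * real n * real (m n) * sqrt (v n) * (r - 1)\<^sup>2"
  shows "weak_conv_m (\<lambda>n. distr (P n) borel (\<lambda>\<omega>.
      ((\<Sum>k<n. g (real n * spacing n (m n) (\<lambda>i. X n i \<omega>) k)) - a n) / sqrt (real n * V n))) std_normal_distribution"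
    (is "weak_conv_m ?M _")
proof (rule weak_conv_std_normalI)
  define Z where "Z = (\<lambda>n \<omega>. (\<Sum>k<n. g (real n * ((\<Sum>j<m n. \<omega> ((k + j) mod n)) / (\<Sum>i<n. \<omega> i)))) - a n)"
  have Zm: "Z n \<in> borel_measurable exp_seq" for n
    unfolding Z_def
    by (intro borel_measurable_diff borel_measurable_sum measurable_compose[OF _ g] borel_measurable_times
        borel_measurable_divide measurable_coord) auto
  have ev: "\<forall>\<^sub>F n in sequentially. n \<ge> 2 \<and> m n \<le> n"
  proof -
    have "\<forall>\<^sub>F n in sequentially. real (m n) / real n < 1" by (rule order_tendstoD(2)[OF lim]) simp
    then show ?thesis using eventually_ge_at_top[of 2] by eventually_elim (auto simp: field_simps)
  qed
  have eq: "\<forall>\<^sub>F n in sequentially. distr exp_seq borel (\<lambda>\<omega>. Z n \<omega> / sqrt (real n * cyclic_variance (h n) (m n))) = ?M n"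
    using ev
  proof eventually_elim
    case (elim n)
    define \<Psi> where "\<Psi> = (\<lambda>u. ((\<Sum>k<n. g (real n * u k)) - a n) / sqrt (real n * V n))"
    have \<Psi>: "\<Psi> \<in> borel_measurable (Pi\<^sub>M {..<n} (\<lambda>_. borel))"
      unfolding \<Psi>_def by (intro borel_measurable_divide borel_measurable_diff borel_measurable_sum
          measurable_compose[OF _ g] borel_measurable_times measurable_component_singleton) auto
    have "n \<ge> 1" using elim by simp
    from distr_spacings[OF sample[OF this] _ _ \<Psi>, of "m n"] elim V[OF this]
    show ?case by (simp add: \<Psi>_def Z_def cong: sum.cong_simp)
  qed
  show "\<forall>\<^sub>F n in sequentially. real_distribution (?M n)"
    using eq
  proof eventually_elim
    case (elim n)
    have "real_distribution (distr exp_seq borel (\<lambda>\<omega>. Z n \<omega> / sqrt (real n * cyclic_variance (h n) (m n))))"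
      using Zm by (intro exp_seq.real_distribution_distr) auto
    then show ?case unfolding elim .
  qed
  fix t
  have "(\<lambda>n. char (distr exp_seq borel (\<lambda>\<omega>. Z n \<omega> / sqrt (real n * cyclic_variance (h n) (m n)))) t)
    \<longlonglongrightarrow> complex_of_real (exp (- (t\<^sup>2 / 2)))"
  proof (rule cyclic_statistic_clt[OF centred lim v h4 var c Zm B])
    fix n :: nat assume n: "n \<ge> 1" "m n \<le> n"
    show "AE \<omega> in exp_seq. \<bar>coord_mean n \<omega> - 1\<bar> \<le> 1 / 2 \<longrightarrow>
      \<bar>Z n \<omega> - cyclic_sum (h n) n (m n) \<omega>\<bar> \<le> 6 * \<bar>cyclic_sum (h n) n (m n) \<omega>\<bar> * \<bar>coord_mean n \<omega> - 1\<bar>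
        + B * real n * real (m n) * sqrt (v n) * (coord_mean n \<omega> - 1)\<^sup>2"
      using AE_exp_seq_pos
    proof eventually_elim
      case (elim \<omega>)
      define S where "S = (\<lambda>k. sum \<omega> (cyc n (m n) k))"
      define r where "r = coord_mean n \<omega>"
      have T: "(\<Sum>i<n. \<omega> i) > 0" using elim n by (intro sum_pos) (auto simp: lessThan_empty_iff)
      have r: "r > 0" "(\<Sum>i<n. \<omega> i) = real n * r" using T n by (auto simp: r_def coord_mean_def)
      have m1: "m n \<ge> 1" using centred[OF n(1)] by (rule centred.m_pos)
      have S: "S k > 0" for k
      proof -
        have "cyc n (m n) k \<noteq> {}" using m1 by (auto simp: cyc_def lessThan_empty_iff)
        then show ?thesis unfolding S_def using elim by (intro sum_pos) auto
      qed
      have sumS: "(\<Sum>k<n. S k) = real n * real (m n) * r"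
        unfolding S_def sum_over_cyc[OF n(2)] r(2) by simp
      have "real n * ((\<Sum>j<m n. \<omega> ((k + j) mod n)) / (\<Sum>i<n. \<omega> i)) = S k / r" for k
        using n r by (simp add: S_def sum_cyc)
      then have Z: "Z n \<omega> = (\<Sum>k<n. g (S k / r)) - a n" by (simp only: Z_def)
      have "cyclic_sum (h n) n (m n) \<omega> = (\<Sum>k<n. h n (S k))" by (simp add: cyclic_sum_def S_def)
      then show ?case using le[OF n(1) S sumS r(1)] unfolding Z r_def[symmetric] by simp
    qed
  qed
  then show "(\<lambda>n. char (?M n) t) \<longlonglongrightarrow> complex_of_real (exp (- (t\<^sup>2 / 2)))"
    by (rule Lim_transform_eventually) (use eq in \<open>auto elim: eventually_mono\<close>)
qed

section \<open>Effect of the normalising mean on a single path\<close>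

lemma greenwood_pathwise:
  fixes S :: "nat \<Rightarrow> real"
  assumes sum: "(\<Sum>k<n. S k) = real n * real m * r" and r: "r > 0" "\<bar>r - 1\<bar> \<le> 1 / 2" and m: "m \<ge> 1"
  shows "\<bar>(\<Sum>k<n. (S k / r)\<^sup>2) - real n * real m * (real m + 1) - (\<Sum>k<n. greenwood_kernel m (S k))\<bar>
    \<le> 6 * \<bar>\<Sum>k<n. greenwood_kernel m (S k)\<bar> * \<bar>r - 1\<bar> + 8 * real n * real m * sqrt (real m ^ 2) * (r - 1)\<^sup>2"
proof -
  define W where "W = (\<Sum>k<n. greenwood_kernel m (S k))"
  define c where "c = real n * real m * (real m + 1)"
  have r2: "r \<ge> 1 / 2" "r \<le> 3 / 2" using r by linarith+
  have "W = (\<Sum>k<n. (S k)\<^sup>2) - 2 * (real m + 1) * (\<Sum>k<n. S k) + real n * (real m * (real m + 1))"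
    by (simp add: W_def greenwood_kernel_def sum.distrib sum_subtractf sum_distrib_left)
  then have "(\<Sum>k<n. (S k)\<^sup>2) = W + 2 * c * r - c" unfolding sum c_def by (simp add: algebra_simps)
  then have eq: "(\<Sum>k<n. (S k / r)\<^sup>2) = (W + 2 * c * r - c) / r\<^sup>2" by (simp add: power_divide flip: sum_divide_distrib)
  \<comment> \<open>The linear term of the kernel turns the first-order effect of r into c (2 r - 1
    - r^2) / r^2 = -c (r - 1)^2 / r^2; what remains is proportional to the kernel sum W.\<close>
  have *: "(\<Sum>k<n. (S k / r)\<^sup>2) - c - W = W * ((1 - r\<^sup>2) / r\<^sup>2) - c * ((r - 1)\<^sup>2 / r\<^sup>2)"
    unfolding eq using r by (simp add: field_simps power2_eq_square)
  have inv: "1 / r\<^sup>2 \<le> 4"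
  proof -
    have "(1 / 2)\<^sup>2 \<le> r\<^sup>2" using r2 by (intro power_mono) auto
    then show ?thesis using r by (simp add: field_simps power2_eq_square)
  qed
  have "\<bar>(1 - r\<^sup>2) / r\<^sup>2\<bar> \<le> 6 * \<bar>r - 1\<bar>"
  proof -
    \<comment> \<open>The constant 6 is attained at r = 1/2: 6 r^2 - r - 1 = (2 r - 1)(3 r +
      1).\<close>
    have "(1 + r) / r\<^sup>2 \<le> 6"
    proof -
      have "0 \<le> (2 * r - 1) * (3 * r + 1)" using r2 by (intro mult_nonneg_nonneg) auto
      then have "1 + r \<le> 6 * r\<^sup>2" by (simp add: algebra_simps power2_eq_square)
      then show ?thesis using r by (simp add: divide_le_eq)
    qed
    then have "\<bar>r - 1\<bar> * ((1 + r) / r\<^sup>2) \<le> \<bar>r - 1\<bar> * 6" by (intro mult_left_mono) auto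
    moreover have "\<bar>(1 - r\<^sup>2) / r\<^sup>2\<bar> = \<bar>r - 1\<bar> * ((1 + r) / r\<^sup>2)"
    proof -
      have "(1 - r\<^sup>2) / r\<^sup>2 = - ((r - 1) * ((1 + r) / r\<^sup>2))" using r by (simp add: power2_eq_square field_simps)
      then show ?thesis using r by (simp add: abs_mult)
    qed
    ultimately show ?thesis by linarith
  qed
  then have "\<bar>W * ((1 - r\<^sup>2) / r\<^sup>2)\<bar> \<le> \<bar>W\<bar> * (6 * \<bar>r - 1\<bar>)"
    unfolding abs_mult[of W] by (intro mult_left_mono) auto
  moreover have "\<bar>W\<bar> * (6 * \<bar>r - 1\<bar>) = 6 * \<bar>W\<bar> * \<bar>r - 1\<bar>" by simp
  moreover have "\<bar>c * ((r - 1)\<^sup>2 / r\<^sup>2)\<bar> \<le> 8 * real n * real m * sqrt (real m ^ 2) * (r - 1)\<^sup>2"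
  proof -
    \<comment> \<open>From m + 1 <= 2 m; with 1/r^2 <= 4 this gives the constant 8.\<close>
    have c: "0 \<le> c" "c \<le> real n * real m * (2 * real m)" using m unfolding c_def by (auto intro!: mult_left_mono)
    have "\<bar>c * ((r - 1)\<^sup>2 / r\<^sup>2)\<bar> = c * (r - 1)\<^sup>2 * (1 / r\<^sup>2)" using c by (simp add: abs_mult)
    also have "\<dots> \<le> real n * real m * (2 * real m) * (r - 1)\<^sup>2 * 4"
      using inv c by (intro mult_mono) auto
    finally show ?thesis by simp
  qed
  ultimately show ?thesis unfolding W_def[symmetric] c_def[symmetric] * by linarith
qed

text \<open>Dividing by r subtracts ln r from every term, and the linear part of the kernel sums to
  n (r - 1). The whole discrepancy is n (r - 1 - ln r), which is quadratic in r - 1.\<close>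

lemma log_pathwise:
  fixes S :: "nat \<Rightarrow> real"
  assumes sum: "(\<Sum>k<n. S k) = real n * real m * r" and r: "r > 0" "\<bar>r - 1\<bar> \<le> 1 / 2" and m: "m \<ge> 1"
    and S: "\<And>k. k < n \<Longrightarrow> S k > 0"
  shows "\<bar>(\<Sum>k<n. ln (S k / r)) - real n * Digamma (real m) - (\<Sum>k<n. log_kernel m (S k))\<bar>
    \<le> 6 * \<bar>\<Sum>k<n. log_kernel m (S k)\<bar> * \<bar>r - 1\<bar> + 2 * real n * real m * sqrt (1 / real m ^ 2) * (r - 1)\<^sup>2"
proof -
  have r2: "r \<ge> 1 / 2" using r by linarith
  have "(\<Sum>k<n. ln (S k / r)) = (\<Sum>k<n. ln (S k) - ln r)"
  proof (rule sum.cong)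
    fix k assume "k \<in> {..<n}"
    then have "S k > 0" using S by simp
    then show "ln (S k / r) = ln (S k) - ln r" using r(1) by (simp add: ln_div)
  qed simp
  then have "(\<Sum>k<n. ln (S k / r)) - real n * Digamma (real m) - (\<Sum>k<n. log_kernel m (S k))
    = ((\<Sum>k<n. S k) - real n * real m) / real m - real n * ln r"
    by (simp add: log_kernel_def sum_subtractf flip: sum_divide_distrib)
  also have "\<dots> = real n * (r - 1 - ln r)" unfolding sum using m by (simp add: field_simps)
  finally have *: "(\<Sum>k<n. ln (S k / r)) - real n * Digamma (real m) - (\<Sum>k<n. log_kernel m (S k)) = real n * (r - 1 - ln r)" .
  have "r - 1 - ln r \<le> (r - 1)\<^sup>2 / r" by (rule ln_deviation_bound(2)[OF r(1)])
  also have "\<dots> \<le> (r - 1)\<^sup>2 / (1 / 2)" using r2 by (intro divide_left_mono) auto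
  finally have "\<bar>real n * (r - 1 - ln r)\<bar> \<le> real n * (2 * (r - 1)\<^sup>2)"
    using ln_deviation_bound(1)[OF r(1)] unfolding abs_mult by (intro mult_mono) auto
  moreover have "real m * sqrt (1 / real m ^ 2) = 1" using m by (simp add: real_sqrt_divide)
  then have "2 * real n * real m * sqrt (1 / real m ^ 2) * (r - 1)\<^sup>2 = real n * (2 * (r - 1)\<^sup>2)" by (simp add: mult.assoc)
  moreover have "0 \<le> 6 * \<bar>\<Sum>k<n. log_kernel m (S k)\<bar> * \<bar>r - 1\<bar>" by simp
  ultimately show ?thesis unfolding * by linarith
qed

text \<open>Homogeneity of x ln x up to a multiple of x makes the discrepancy W (1/r - 1) minus n m
  times the logarithmic deviation y - 1 - ln y at y = 1/r, with W the kernel sum.\<close>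

lemma entropy_pathwise:
  fixes S :: "nat \<Rightarrow> real"
  assumes sum: "(\<Sum>k<n. S k) = real n * real m * r" and r: "r > 0" "\<bar>r - 1\<bar> \<le> 1 / 2"
    and S: "\<And>k. k < n \<Longrightarrow> S k > 0"
  shows "\<bar>(\<Sum>k<n. S k / r * ln (S k / r)) - real n * real m * Digamma (real m + 1) - (\<Sum>k<n. entropy_kernel m (S k))\<bar>
    \<le> 6 * \<bar>\<Sum>k<n. entropy_kernel m (S k)\<bar> * \<bar>r - 1\<bar> + 2 * real n * real m * sqrt 1 * (r - 1)\<^sup>2"
proof -
  define W where "W = (\<Sum>k<n. entropy_kernel m (S k))"
  define L where "L = (\<Sum>k<n. S k * ln (S k))"
  define c where "c = real n * real m"
  define d where "d = Digamma (real m + 1)"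
  have r2: "r \<ge> 1 / 2" using r by linarith
  have "W = L - (d + 1) * (\<Sum>k<n. S k) + real n * real m"
    by (simp add: W_def L_def d_def entropy_kernel_def sum.distrib sum_subtractf sum_distrib_left)
  then have L: "L = W + (d + 1) * (c * r) - c" unfolding sum c_def by simp
  have "(\<Sum>k<n. S k / r * ln (S k / r)) = (\<Sum>k<n. (S k * ln (S k) - ln r * S k) / r)"
    using S r by (intro sum.cong) (auto simp: ln_div field_simps)
  also have "\<dots> = (L - ln r * (c * r)) / r"
    unfolding c_def L_def sum[symmetric] by (simp add: sum_subtractf sum_distrib_left flip: sum_divide_distrib)
  finally have eq: "(\<Sum>k<n. S k / r * ln (S k / r)) = (L - ln r * (c * r)) / r" .
  have "(\<Sum>k<n. S k / r * ln (S k / r)) - c * d - W = W * (1 / r - 1) - c * (1 / r - 1 - ln (1 / r))"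
    unfolding eq L using r by (simp add: field_simps ln_div)
  moreover have "\<bar>W * (1 / r - 1)\<bar> \<le> 6 * \<bar>W\<bar> * \<bar>r - 1\<bar>"
  proof -
    have "1 / r - 1 = - ((r - 1) * (1 / r))" using r by (simp add: field_simps)
    then have "\<bar>1 / r - 1\<bar> = \<bar>r - 1\<bar> * (1 / r)" using r by (simp add: abs_mult)
    also have "\<dots> \<le> \<bar>r - 1\<bar> * 6" using r r2 by (intro mult_left_mono) (auto simp: divide_le_eq)
    finally show ?thesis unfolding abs_mult using mult_left_mono[of "\<bar>1 / r - 1\<bar>" "\<bar>r - 1\<bar> * 6" "\<bar>W\<bar>"] by (simp add: mult_ac)
  qed
  moreover have "\<bar>c * (1 / r - 1 - ln (1 / r))\<bar> \<le> 2 * c * (r - 1)\<^sup>2"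
  proof -
    have "1 / r > 0" using r by simp
    note b = ln_deviation_bound[OF this]
    have "(1 / r - 1)\<^sup>2 / (1 / r) = (r - 1)\<^sup>2 / r" using r by (simp add: field_simps power2_eq_square)
    also have "\<dots> \<le> (r - 1)\<^sup>2 / (1 / 2)" using r2 by (intro divide_left_mono) auto
    finally have "1 / r - 1 - ln (1 / r) \<le> 2 * (r - 1)\<^sup>2" using b(2) by simp
    moreover have "c \<ge> 0" by (simp add: c_def)
    ultimately have "c * (1 / r - 1 - ln (1 / r)) \<le> c * (2 * (r - 1)\<^sup>2)" "0 \<le> c * (1 / r - 1 - ln (1 / r))"
      using b(1) by (auto intro!: mult_left_mono mult_nonneg_nonneg)
    then show ?thesis by simp
  qed
  ultimately show ?thesis unfolding W_def[symmetric] c_def[symmetric] d_def[symmetric]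
    by (simp add: c_def mult.assoc)
qed

theorem corollary2p5:
  fixes P :: "nat \<Rightarrow> 'a measure"
    and X :: "nat \<Rightarrow> nat \<Rightarrow> 'a \<Rightarrow> real"
    and m :: "nat \<Rightarrow> nat"
  assumes sample: "\<And>n. n \<ge> 1 \<Longrightarrow> uniform_sample (P n) (n - 1) (X n)"
    and m_pos: "\<And>n. n \<ge> 1 \<Longrightarrow> m n \<ge> 1"
  shows
    "((\<lambda>n. real (m n)) \<in> o(\<lambda>n. real n) \<longrightarrow>
        weak_conv_m
          (\<lambda>n. distr (P n) borel (\<lambda>\<omega>.
             sqrt 3 * (greenwood_stat n (m n) (\<lambda>i. X n i \<omega>)
                        - real n * real (m n) * (real (m n) + 1))
             / sqrt (2 * real (m n) * (real (m n) + 1) * (2 * real (m n) + 1) * real n)))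
          std_normal_distribution)
     \<and>
     ((\<lambda>n. real (m n)) \<in> o(\<lambda>n. real n powr (1 / 3)) \<longrightarrow>
        weak_conv_m
          (\<lambda>n. distr (P n) borel (\<lambda>\<omega>.
             (log_stat n (m n) (\<lambda>i. X n i \<omega>) - real n * Digamma (real (m n)))
             / sqrt (real n *
                 ((2 * real (m n) ^ 2 - 2 * real (m n) + 1) * hurwitz_zeta_nat 2 (m n)
                   - 2 * real (m n) + 1))))
          std_normal_distribution
        \<and>
        weak_conv_m
          (\<lambda>n. distr (P n) borel (\<lambda>\<omega>.
             (entropy_stat n (m n) (\<lambda>i. X n i \<omega>)
                - real n * real (m n) * Digamma (real (m n) + 1))
             / sqrt (real n *
                 (2 * (real (m n) * (real (m n) + 1)) ^ 2 * hurwitz_zeta_nat 2 (m n + 2)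
                   - real (m n) * (real (m n) + 1) * (2 * real (m n) - 1)) / 4)))
          std_normal_distribution)"
proof (intro conjI impI)
  assume "(\<lambda>n. real (m n)) \<in> o(\<lambda>n. real n)"
  then have lim: "(\<lambda>n. real (m n) / real n) \<longlonglongrightarrow> 0" by (rule smalloD_tendsto)
  have "weak_conv_m (\<lambda>n. distr (P n) borel (\<lambda>\<omega>.
      ((\<Sum>k<n. (real n * spacing n (m n) (\<lambda>i. X n i \<omega>) k)\<^sup>2) - real n * real (m n) * (real (m n) + 1))
        / sqrt (real n * (2 * real (m n) * (real (m n) + 1) * (2 * real (m n) + 1) / 3)))) std_normal_distribution"
  proof (rule spacing_statistic_clt[where g = "\<lambda>x. x\<^sup>2" and h = "\<lambda>n. greenwood_kernel (m n)" and v = "\<lambda>n. real (m n) ^ 2"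
        and c = 1 and B = 8, OF sample _ _ lim])
    fix n :: nat assume n: "n \<ge> 1"
    note m = m_pos[OF n]
    show "centred (greenwood_kernel (m n)) (m n)"
      using tame_kernels(1)[of "m n"] mean_kernels(1)[OF m] m by (auto intro: centred_tame)
    show "0 < real (m n) ^ 2" using m by simp
    show "(\<integral>x. greenwood_kernel (m n) x ^ 4 \<partial>gamma_law (m n)) \<le> 404406 * (real (m n) ^ 2)\<^sup>2"
      by (rule fourth_moment_greenwood_kernel[OF m])
    show "cyclic_variance (greenwood_kernel (m n)) (m n) = 2 * real (m n) * (real (m n) + 1) * (2 * real (m n) + 1) / 3"
      by (rule variance_greenwood_kernel[OF m])
    \<comment> \<open>The right side is 4 m^3 + 6 m^2 + 2 m, so the variance is at least m times the
      scale m^2 and c = 1 works.\<close>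
    have "3 * (real (m n) * real (m n) * real (m n)) \<le> 2 * real (m n) * (real (m n) + 1) * (2 * real (m n) + 1)"
      by (simp add: algebra_simps)
    then show "1 * real (m n) * real (m n) ^ 2 \<le> cyclic_variance (greenwood_kernel (m n)) (m n)"
      unfolding variance_greenwood_kernel[OF m] by (simp add: power2_eq_square)
    show "\<bar>(\<Sum>k<n. (S k / r)\<^sup>2) - real n * real (m n) * (real (m n) + 1) - (\<Sum>k<n. greenwood_kernel (m n) (S k))\<bar>
      \<le> 6 * \<bar>\<Sum>k<n. greenwood_kernel (m n) (S k)\<bar> * \<bar>r - 1\<bar> + 8 * real n * real (m n) * sqrt (real (m n) ^ 2) * (r - 1)\<^sup>2"
      if "(\<Sum>k<n. S k) = real n * real (m n) * r" "r > 0" "\<bar>r - 1\<bar> \<le> 1 / 2" for S r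
      by (rule greenwood_pathwise[OF that m])
  qed auto
  \<comment> \<open>The factor sqrt 3 of the stated normalisation is moved under the root as the
    denominator 3 of the variance.\<close>
  moreover have "sqrt 3 * y / sqrt (a * b) = y / sqrt (b * (a / 3))" for y a b :: real
    by (simp add: real_sqrt_divide real_sqrt_mult mult_ac)
  ultimately show "weak_conv_m
          (\<lambda>n. distr (P n) borel (\<lambda>\<omega>.
             sqrt 3 * (greenwood_stat n (m n) (\<lambda>i. X n i \<omega>)
                        - real n * real (m n) * (real (m n) + 1))
             / sqrt (2 * real (m n) * (real (m n) + 1) * (2 * real (m n) + 1) * real n)))
          std_normal_distribution"
    by (simp only: greenwood_stat_def)
next
  assume *: "(\<lambda>n. real (m n)) \<in> o(\<lambda>n. real n powr (1 / 3))"
  have "(\<lambda>n. real n powr (1 / 3)) \<in> O(\<lambda>n. real n)" by real_asymp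
  with * have "(\<lambda>n. real (m n)) \<in> o(\<lambda>n. real n)" by (rule landau_o.small_big_trans)
  then have lim: "(\<lambda>n. real (m n) / real n) \<longlonglongrightarrow> 0" by (rule smalloD_tendsto)
  obtain C where C: "\<And>m. m \<ge> 1 \<Longrightarrow> (\<integral>x. log_kernel m x ^ 4 \<partial>gamma_law m) \<le> C * (1 / real m ^ 2)\<^sup>2"
    by (rule fourth_moment_log_kernel) blast
  show "weak_conv_m
          (\<lambda>n. distr (P n) borel (\<lambda>\<omega>.
             (log_stat n (m n) (\<lambda>i. X n i \<omega>) - real n * Digamma (real (m n)))
             / sqrt (real n *
                 ((2 * real (m n) ^ 2 - 2 * real (m n) + 1) * hurwitz_zeta_nat 2 (m n)
                   - 2 * real (m n) + 1))))
          std_normal_distribution"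
    unfolding log_stat_def
  proof (rule spacing_statistic_clt[where g = ln and h = "\<lambda>n. log_kernel (m n)" and v = "\<lambda>n. 1 / real (m n) ^ 2"
        and c = "1 / 6" and B = 2, OF sample _ _ lim])
    fix n :: nat assume n: "n \<ge> 1"
    note m = m_pos[OF n]
    show "centred (log_kernel (m n)) (m n)"
      using tame_kernels(2)[of "m n"] mean_kernels(2)[OF m] m by (auto intro: centred_tame)
    show "0 < 1 / real (m n) ^ 2" using m by simp
    show "(\<integral>x. log_kernel (m n) x ^ 4 \<partial>gamma_law (m n)) \<le> C * (1 / real (m n) ^ 2)\<^sup>2" by (rule C[OF m])
    show "cyclic_variance (log_kernel (m n)) (m n)
      = (2 * real (m n) ^ 2 - 2 * real (m n) + 1) * hurwitz_zeta_nat 2 (m n) - 2 * real (m n) + 1"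
      by (rule variance_log_kernel(1)[OF m])
    show "1 / 6 * real (m n) * (1 / real (m n) ^ 2) \<le> cyclic_variance (log_kernel (m n)) (m n)"
      by (rule variance_log_kernel(2)[OF m])
    show "\<bar>(\<Sum>k<n. ln (S k / r)) - real n * Digamma (real (m n)) - (\<Sum>k<n. log_kernel (m n) (S k))\<bar>
      \<le> 6 * \<bar>\<Sum>k<n. log_kernel (m n) (S k)\<bar> * \<bar>r - 1\<bar> + 2 * real n * real (m n) * sqrt (1 / real (m n) ^ 2) * (r - 1)\<^sup>2"
      if "\<And>k. k < n \<Longrightarrow> S k > 0" "(\<Sum>k<n. S k) = real n * real (m n) * r" "r > 0" "\<bar>r - 1\<bar> \<le> 1 / 2" for S r
      by (rule log_pathwise[OF that(2-4) m that(1)])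
  qed auto
  have "weak_conv_m (\<lambda>n. distr (P n) borel (\<lambda>\<omega>.
      ((\<Sum>k<n. real n * spacing n (m n) (\<lambda>i. X n i \<omega>) k * ln (real n * spacing n (m n) (\<lambda>i. X n i \<omega>) k))
        - real n * real (m n) * Digamma (real (m n) + 1))
        / sqrt (real n * ((2 * (real (m n) * (real (m n) + 1)) ^ 2 * hurwitz_zeta_nat 2 (m n + 2)
            - real (m n) * (real (m n) + 1) * (2 * real (m n) - 1)) / 4)))) std_normal_distribution"
  proof (rule spacing_statistic_clt[where g = "\<lambda>x. x * ln x" and h = "\<lambda>n. entropy_kernel (m n)" and v = "\<lambda>n. 1"
        and c = "1 / 6" and B = 2, OF sample _ _ lim])
    fix n :: nat assume n: "n \<ge> 1"
    note m = m_pos[OF n]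
    show "centred (entropy_kernel (m n)) (m n)"
      using tame_kernels(3)[of "m n"] mean_kernels(3)[OF m] m by (auto intro: centred_tame)
    show "(\<integral>x. entropy_kernel (m n) x ^ 4 \<partial>gamma_law (m n)) \<le> 400761 * 1\<^sup>2"
      by (rule fourth_moment_entropy_kernel[OF m])
    show "cyclic_variance (entropy_kernel (m n)) (m n)
      = (2 * (real (m n) * (real (m n) + 1)) ^ 2 * hurwitz_zeta_nat 2 (m n + 2)
          - real (m n) * (real (m n) + 1) * (2 * real (m n) - 1)) / 4"
      by (rule variance_entropy_kernel(1)[OF m])
    show "1 / 6 * real (m n) * 1 \<le> cyclic_variance (entropy_kernel (m n)) (m n)"
      by (rule variance_entropy_kernel(2)[OF m])
    show "\<bar>(\<Sum>k<n. S k / r * ln (S k / r)) - real n * real (m n) * Digamma (real (m n) + 1) - (\<Sum>k<n. entropy_kernel (m n) (S k))\<bar>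
      \<le> 6 * \<bar>\<Sum>k<n. entropy_kernel (m n) (S k)\<bar> * \<bar>r - 1\<bar> + 2 * real n * real (m n) * sqrt 1 * (r - 1)\<^sup>2"
      if "\<And>k. k < n \<Longrightarrow> S k > 0" "(\<Sum>k<n. S k) = real n * real (m n) * r" "r > 0" "\<bar>r - 1\<bar> \<le> 1 / 2" for S r
      by (rule entropy_pathwise[OF that(2-4) that(1)])
  qed auto
  then show "weak_conv_m
          (\<lambda>n. distr (P n) borel (\<lambda>\<omega>.
             (entropy_stat n (m n) (\<lambda>i. X n i \<omega>)
                - real n * real (m n) * Digamma (real (m n) + 1))
             / sqrt (real n *
                 (2 * (real (m n) * (real (m n) + 1)) ^ 2 * hurwitz_zeta_nat 2 (m n + 2)
                   - real (m n) * (real (m n) + 1) * (2 * real (m n) - 1)) / 4)))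
          std_normal_distribution"
    by (simp only: entropy_stat_def times_divide_eq_right)
qed

end
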